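(* Let $\mathcal{E}\xrightarrow{\gamma}\mathrm{Set}$ be a Grothendieck topos and let $X\sim(R\to I,\sigma)$ be a covering projection in $\mathcal{E}$ trivialized by a cover $U\to\gamma^*I$. Then there exist a self-dual simplicial hypercover refinement $H_\bullet\to\gamma^*(S_\bullet)$ of the Čech simplicial family $U_\bullet\to\gamma^*(N_\bullet)$ of the cover, satisfying condition G, and a consistent $S_\bullet$-descent datum $\{s_\ell\}_{\ell\in S_1}$ on the family $R\to I$, such that the $H_\bullet$-descent datum $\{\sigma_\ell\}_{\ell\in S_1}$ corresponding to $\sigma$ is of the form $\sigma_\ell=\gamma^*(s_\ell)\times(\tau_1)_\ell$. Vice-versa, any such descent datum (a consistent $S_\bullet$-descent datum on a family $R\to I$) on a self-dual simplicial hypercover refinement $H_\bullet\to\gamma^*(S_\bullet)$ of the Čech simplicial family satisfying condition G determines a covering projection trivialized by the cover $U\to\gamma^*I$.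
   Context: $\gamma^*:\mathrm{Set}\to\mathcal{E}$ is the inverse image functor. A family $U\xrightarrow{\zeta}\gamma^*I$ is the same as $\{U_i\}_{i\in I}$, $U=\sum_iU_i$, with all $U_i$ non-empty (not initial); it is a cover if $U\to1$ is epimorphic. Simplicial families. A simplicial family $H_\bullet\to\gamma^*(S_\bullet)$ consists of a simplicial object $H_\bullet$ in $\mathcal{E}$ (faces $d_i$, degeneracies $s_i$), a simplicial set $S_\bullet$ (faces $\partial_i$, degeneracies $\sigma_i$) and a morphism of simplicial objects $H_\bullet\to\gamma^*(S_\bullet)$; $H_n=\sum_{w\in S_n}(H_n)_w$ with $(d_i)_w:(H_n)_w\to(H_{n-1})_{\partial_i(w)}$, $(s_i)_w:(H_{n-1})_w\to(H_n)_{\sigma_i(w)}$, all components non-empty. For $\ell\in S_1$, $i\xrightarrow{\ell}j$ means $i=\partial_1(\ell)$, $j=\partial_0(\ell)$. A strict duality on a simplicial object is a family of isomorphisms $\tau_n$ with $\tau_0=\mathrm{id}$, $d_i\tau_n=\tau_{n-1}d_{n-i}$, $s_i\tau_{n-1}=\tau_ns_{n-1-i}$; a simplicial family is self-dual if $H_\bullet$ and $S_\bullet$ carry strict dualities $\tau$ compatible with $H_\bullet\to\gamma^*S_\bullet$; write $w^{op}=\tau_n(w)$, so $(\tau_n)_w:(H_n)_w\to(H_n)_{w^{op}}$. Čech family: $N_n=\{(i_0,\dots,i_n)\in I^{n+1}\mid U_{i_0}\times\cdots\times U_{i_n}\ne\emptyset\}$, $U_n=U^{n+1}=\sum_{N_n}U_{i_0}\times\cdots\times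 U_{i_n}$, with projections as faces ($\partial_1(i,j)=i$, $\partial_0(i,j)=j$), diagonals as degeneracies, and duality reversing the order. For a simplicial family with $S_0=I$, $H_0=U$ (same structure map $\zeta$) there is a canonical morphism $(h_\bullet,\alpha_\bullet)$ to the Čech family given by the vertices, e.g. $\alpha_1(\ell)=(\partial_1\ell,\partial_0\ell)$, $(h_1)_\ell=((d_1)_\ell,(d_0)_\ell)$. Such a simplicial family is a hypercover refinement of the Čech family if the maps $H_k\to(\mathrm{cosk}_{k-1}H_\bullet)_k$ are epimorphisms for all $k\ge1$. Condition G: for every $\ell\in S_1$, with $i=\partial_1(\ell)$, there exists $w\in S_2$ with $\partial_2(w)=\ell$, $\partial_0(w)=\ell^{op}$ and $(d_1)_{\partial_1(w)}=(d_0)_{\partial_1(w)}$ as maps $(H_1)_{\partial_1(w)}\to(H_0)_i$. $S_\bullet$-descent datum on a family of sets $R\to I=S_0$: bijections $s_\ell:R_i\to R_j$ for each $i\xrightarrow{\ell}j$ in $S_1$, with $s_{\sigma_0(i)}=\mathrm{id}_{R_i}$ and $s_{\partial_1(w)}=s_{\partial_0(w)}\circ s_{\partial_2(w)}$ for $w\in S_2$. It is consistent if $s_\ell=s_t$ for all $\ell,t:i\to j$ in $S_1$ for which there is an arrow $f:(H_1)_\ell\to(H_1)_t$ with $(d_1)_tf=(d_1)_\ell$ and $(d_0)_tf=(d_0)_\ell$. $H_\bullet$-descent datum on $\gamma^*R\times_{\gamma^*I}U\to U$: for each $i\xrightarrow{\ell}j$ in $S_1$ an isomorphism $\sigma_\ell:\gamma^*R_i\times(H_1)_\ell\to\gamma^*R_j\times(H_1)_{\ell^{op}}$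 over $(\tau_1)_\ell$; it is determined by its first projection, equivalently by a map $\widehat\sigma_\ell:(H_1)_\ell\to(\gamma^*R_j)^{\gamma^*R_i}$. One requires (in internal language) $\widehat\sigma_{\sigma_0(i)}((s_0)_i(x))=\mathrm{id}$ for $x\in(H_0)_i$, and $\widehat\sigma_{\partial_0(w)}(d_0x)\circ\widehat\sigma_{\partial_2(w)}(d_2x)=\widehat\sigma_{\partial_1(w)}(d_1x)$ for $w\in S_2$, $x\in(H_2)_w$. Applied to the Čech family this gives $U_\bullet$-descent data $\{\sigma_{j,i}\}_{(i,j)\in N_1}$, $\sigma_{j,i}:\gamma^*R_i\times U_i\times U_j\to\gamma^*R_j\times U_j\times U_i$. For a hypercover refinement, $U_\bullet$-descent data $\sigma_{j,i}$ and $H_\bullet$-descent data $\sigma_\ell$ on $\gamma^*R\times_{\gamma^*I}U\to U$ correspond bijectively via $\widehat\sigma_\ell=\widehat\sigma_{j,i}\circ(h_1)_\ell$ for $i\xrightarrow{\ell}j$. An $S_\bullet$-descent datum $\{s_\ell\}$ induces the $H_\bullet$-descent datum $\gamma^*(s_\ell)\times(\tau_1)_\ell$; the object it determines is the locally constant object constructed by descent from the corresponding $U_\bullet$-descent datum. Locally constant object trivialized by $U\to\gamma^*I$: an object $X$ with a family of sets $\{R_i\}_{i\in I}$ and isomorphisms $\theta_i:\gamma^*R_i\times U_i\to X\times U_i$ over $U_i$. These correspond, by descent, to $U_\bullet$-descent data $\sigma$ via $(\theta_j\times U_i)\circ\sigma_{j,i}=(X\times\tau)\circ(\theta_i\times U_j)$,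 $\tau$ the symmetry; write $X\sim(R\to I,\sigma)$. An action span for $X$ is a span $\ell=(U_i\xleftarrow{u}V\xrightarrow{v}U_j)$ with $V\ne\emptyset$ for which there is a (necessarily unique) bijection $s_\ell:R_i\to R_j$ with $\sigma_{j,i}\circ(\gamma^*R_i\times(u,v))=(\gamma^*R_j\times(v,u))\circ(\gamma^*s_\ell\times V)$. $X\sim(R\to I,\sigma)$ is a covering projection if for each $(i,j)\in N_1$ the family of maps $(u,v):V\to U_i\times U_j$, over all action spans, is epimorphic. *)

theory Defs
  imports Main "HOL-Library.FuncSet"
begin

unbundle cardinal_syntax

section \<open>Categories\<close>

record ('o, 'a) category =
  Obj :: "'o set"
  Arr :: "'a set"
  Dom :: "'a \<Rightarrow> 'o"
  Cod :: "'a \<Rightarrow> 'o"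
  Id :: "'o \<Rightarrow> 'a"
  Comp :: "'a \<Rightarrow> 'a \<Rightarrow> 'a" (infixr "\<cdot>\<index>" 70)

definition hom :: "('o, 'a) category \<Rightarrow> 'o \<Rightarrow> 'o \<Rightarrow> 'a set" where
  "hom C X Y = {f \<in> Arr C. Dom C f = X \<and> Cod C f = Y}"

definition is_category :: "('o, 'a) category \<Rightarrow> bool" where
  "is_category C \<longleftrightarrow>
    (\<forall>f \<in> Arr C. Dom C f \<in> Obj C \<and> Cod C f \<in> Obj C) \<and>
    (\<forall>X \<in> Obj C. Id C X \<in> hom C X X) \<and>
    (\<forall>f \<in> Arr C. \<forall>g \<in> Arr C. Dom C g = Cod C f \<longrightarrow>
       g \<cdot>\<^bsub>C\<^esub> f \<in> hom C (Dom C f) (Cod C g)) \<and>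
    (\<forall>f \<in> Arr C. f \<cdot>\<^bsub>C\<^esub> Id C (Dom C f) = f \<and> Id C (Cod C f) \<cdot>\<^bsub>C\<^esub> f = f) \<and>
    (\<forall>f \<in> Arr C. \<forall>g \<in> Arr C. \<forall>h \<in> Arr C. Dom C g = Cod C f \<and> Dom C h = Cod C g \<longrightarrow>
       (h \<cdot>\<^bsub>C\<^esub> g) \<cdot>\<^bsub>C\<^esub> f = h \<cdot>\<^bsub>C\<^esub> (g \<cdot>\<^bsub>C\<^esub> f))"

definition is_iso :: "('o, 'a) category \<Rightarrow> 'a \<Rightarrow> bool" where
  "is_iso C f \<longleftrightarrow> f \<in> Arr C \<and>
    (\<exists>g \<in> hom C (Cod C f) (Dom C f).
       g \<cdot>\<^bsub>C\<^esub> f = Id C (Dom C f) \<and> f \<cdot>\<^bsub>C\<^esub> g = Id C (Cod C f))"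

definition is_epi :: "('o, 'a) category \<Rightarrow> 'a \<Rightarrow> bool" where
  "is_epi C f \<longleftrightarrow> f \<in> Arr C \<and>
    (\<forall>Z \<in> Obj C. \<forall>g \<in> hom C (Cod C f) Z. \<forall>h \<in> hom C (Cod C f) Z.
       g \<cdot>\<^bsub>C\<^esub> f = h \<cdot>\<^bsub>C\<^esub> f \<longrightarrow> g = h)"

definition epimorphic_family :: "('o, 'a) category \<Rightarrow> 'o \<Rightarrow> 'a set \<Rightarrow> bool" where
  "epimorphic_family C X \<F> \<longleftrightarrow> \<F> \<subseteq> {f \<in> Arr C. Cod C f = X} \<and>
    (\<forall>Z \<in> Obj C. \<forall>g \<in> hom C X Z. \<forall>h \<in> hom C X Z.
       (\<forall>f \<in> \<F>. g \<cdot>\<^bsub>C\<^esub> f = h \<cdot>\<^bsub>C\<^esub> f) \<longrightarrow> g = h)"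

definition initial :: "('o, 'a) category \<Rightarrow> 'o \<Rightarrow> bool" where
  "initial C X \<longleftrightarrow> X \<in> Obj C \<and> (\<forall>Y \<in> Obj C. \<exists>!f. f \<in> hom C X Y)"

definition terminal :: "('o, 'a) category \<Rightarrow> 'o \<Rightarrow> bool" where
  "terminal C X \<longleftrightarrow> X \<in> Obj C \<and> (\<forall>Y \<in> Obj C. \<exists>!f. f \<in> hom C Y X)"

definition nonempty :: "('o, 'a) category \<Rightarrow> 'o \<Rightarrow> bool" where
  "nonempty C X \<longleftrightarrow> X \<in> Obj C \<and> \<not> initial C X"

definition is_pullback :: "('o, 'a) category \<Rightarrow> 'a \<Rightarrow> 'a \<Rightarrow> 'a \<Rightarrow> 'a \<Rightarrow> bool" where
  "is_pullback C f g p q \<longleftrightarrow>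
    {f, g, p, q} \<subseteq> Arr C \<and> Cod C f = Cod C g \<and> Dom C p = Dom C q \<and>
    Cod C p = Dom C f \<and> Cod C q = Dom C g \<and> f \<cdot>\<^bsub>C\<^esub> p = g \<cdot>\<^bsub>C\<^esub> q \<and>
    (\<forall>Z \<in> Obj C. \<forall>a \<in> hom C Z (Dom C f). \<forall>b \<in> hom C Z (Dom C g).
       f \<cdot>\<^bsub>C\<^esub> a = g \<cdot>\<^bsub>C\<^esub> b \<longrightarrow>
       (\<exists>!h. h \<in> hom C Z (Dom C p) \<and> p \<cdot>\<^bsub>C\<^esub> h = a \<and> q \<cdot>\<^bsub>C\<^esub> h = b))"

definition is_product ::
  "('o, 'a) category \<Rightarrow> 'o list \<Rightarrow> 'o \<Rightarrow> (nat \<Rightarrow> 'a) \<Rightarrow> bool" where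
  "is_product C Xs P \<pi> \<longleftrightarrow>
    P \<in> Obj C \<and> (\<forall>k < length Xs. \<pi> k \<in> hom C P (Xs ! k)) \<and>
    (\<forall>Z \<in> Obj C. \<forall>f. (\<forall>k < length Xs. f k \<in> hom C Z (Xs ! k)) \<longrightarrow>
       (\<exists>!h. h \<in> hom C Z P \<and> (\<forall>k < length Xs. \<pi> k \<cdot>\<^bsub>C\<^esub> h = f k)))"

text \<open>Finite products of lists of objects are chosen once and for all, with the unary product
  chosen to be the object itself; \<open>Prod C [X, Y]\<close> is the binary product.\<close>

definition product_cone :: "('o, 'a) category \<Rightarrow> 'o list \<Rightarrow> 'o \<times> (nat \<Rightarrow> 'a)" where
  "product_cone C Xs =
    (case Xs of [X] \<Rightarrow> (X, \<lambda>_. Id C X) | _ \<Rightarrow> (SOME (P, \<pi>). is_product C Xs P \<pi>))"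

definition Prod :: "('o, 'a) category \<Rightarrow> 'o list \<Rightarrow> 'o" where
  "Prod C Xs = fst (product_cone C Xs)"

definition pr :: "('o, 'a) category \<Rightarrow> 'o list \<Rightarrow> nat \<Rightarrow> 'a" where
  "pr C Xs = snd (product_cone C Xs)"

text \<open>The arrow into the product given by a nonempty list of arrows with common domain.\<close>

definition tup :: "('o, 'a) category \<Rightarrow> 'a list \<Rightarrow> 'a" where
  "tup C fs = (THE h. h \<in> hom C (Dom C (hd fs)) (Prod C (map (Cod C) fs)) \<and>
     (\<forall>k < length fs. pr C (map (Cod C) fs) k \<cdot>\<^bsub>C\<^esub> h = fs ! k))"

definition arr_prod :: "('o, 'a) category \<Rightarrow> 'a \<Rightarrow> 'a \<Rightarrow> 'a" where
  "arr_prod C f g = tup C [f \<cdot>\<^bsub>C\<^esub> pr C [Dom C f, Dom C g] 0, g \<cdot>\<^bsub>C\<^esub> pr C [Dom C f, Dom C g] 1]"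


section \<open>Functors\<close>

record ('o, 'a, 'p, 'b) cfunctor =
  on_obj :: "'o \<Rightarrow> 'p"
  on_arr :: "'a \<Rightarrow> 'b"

definition is_functor ::
  "('o, 'a) category \<Rightarrow> ('p, 'b) category \<Rightarrow> ('o, 'a, 'p, 'b) cfunctor \<Rightarrow> bool" where
  "is_functor C D F \<longleftrightarrow> is_category C \<and> is_category D \<and>
    (\<forall>X \<in> Obj C. on_obj F X \<in> Obj D \<and> on_arr F (Id C X) = Id D (on_obj F X)) \<and>
    (\<forall>f \<in> Arr C. on_arr F f \<in> hom D (on_obj F (Dom C f)) (on_obj F (Cod C f))) \<and>
    (\<forall>f \<in> Arr C. \<forall>g \<in> Arr C. Dom C g = Cod C f \<longrightarrow>
       on_arr F (g \<cdot>\<^bsub>C\<^esub> f) = on_arr F g \<cdot>\<^bsub>D\<^esub> on_arr F f)"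

definition equivalent :: "('o, 'a) category \<Rightarrow> ('p, 'b) category \<Rightarrow> bool" where
  "equivalent C D \<longleftrightarrow> (\<exists>F. is_functor C D F \<and>
    (\<forall>X \<in> Obj C. \<forall>Y \<in> Obj C.
       bij_betw (on_arr F) (hom C X Y) (hom D (on_obj F X) (on_obj F Y))) \<and>
    (\<forall>Z \<in> Obj D. \<exists>X \<in> Obj C. \<exists>f \<in> hom D (on_obj F X) Z. is_iso D f))"

definition left_exact ::
  "('o, 'a) category \<Rightarrow> ('p, 'b) category \<Rightarrow> ('o, 'a, 'p, 'b) cfunctor \<Rightarrow> bool" where
  "left_exact C D F \<longleftrightarrow>
    (\<forall>X. terminal C X \<longrightarrow> terminal D (on_obj F X)) \<and>
    (\<forall>f g p q. is_pullback C f g p q \<longrightarrow>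
       is_pullback D (on_arr F f) (on_arr F g) (on_arr F p) (on_arr F q))"

definition is_adjunction ::
  "('o, 'a) category \<Rightarrow> ('p, 'b) category \<Rightarrow>
   ('o, 'a, 'p, 'b) cfunctor \<Rightarrow> ('p, 'b, 'o, 'a) cfunctor \<Rightarrow> bool" where
  "is_adjunction C D F G \<longleftrightarrow> is_functor C D F \<and> is_functor D C G \<and>
    (\<exists>\<phi>.
      (\<forall>A \<in> Obj C. \<forall>X \<in> Obj D. bij_betw (\<phi> A X) (hom D (on_obj F A) X) (hom C A (on_obj G X))) \<and>
      (\<forall>f \<in> Arr C. \<forall>g \<in> Arr D. \<forall>h \<in> hom D (on_obj F (Cod C f)) (Dom D g).
         \<phi> (Dom C f) (Cod D g) (g \<cdot>\<^bsub>D\<^esub> h \<cdot>\<^bsub>D\<^esub> on_arr F f) =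
         on_arr G g \<cdot>\<^bsub>C\<^esub> \<phi> (Cod C f) (Dom D g) h \<cdot>\<^bsub>C\<^esub> f))"

definition opposite :: "('o, 'a) category \<Rightarrow> ('o, 'a) category" where
  "opposite C = \<lparr>Obj = Obj C, Arr = Arr C, Dom = Cod C, Cod = Dom C, Id = Id C,
     Comp = (\<lambda>g f. f \<cdot>\<^bsub>C\<^esub> g)\<rparr>"

definition full_subcategory :: "('o, 'a) category \<Rightarrow> ('o \<Rightarrow> bool) \<Rightarrow> ('o, 'a) category" where
  "full_subcategory C P = C\<lparr>Obj := {X \<in> Obj C. P X},
     Arr := {f \<in> Arr C. P (Dom C f) \<and> P (Cod C f)}\<rparr>"

record ('o, 'a, 'p, 'b) nat_trans =
  nt_dom :: "('o, 'a, 'p, 'b) cfunctor"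
  nt_cod :: "('o, 'a, 'p, 'b) cfunctor"
  nt_at :: "'o \<Rightarrow> 'b"

definition functor_category ::
  "('o, 'a) category \<Rightarrow> ('p, 'b) category \<Rightarrow>
   (('o, 'a, 'p, 'b) cfunctor, ('o, 'a, 'p, 'b) nat_trans) category" where
  "functor_category C D =
    \<lparr>Obj = {F. is_functor C D F},
     Arr = {\<eta>. is_functor C D (nt_dom \<eta>) \<and> is_functor C D (nt_cod \<eta>) \<and>
       nt_at \<eta> \<in> (\<Pi>\<^sub>E X \<in> Obj C. hom D (on_obj (nt_dom \<eta>) X) (on_obj (nt_cod \<eta>) X)) \<and>
       (\<forall>f \<in> Arr C. nt_at \<eta> (Cod C f) \<cdot>\<^bsub>D\<^esub> on_arr (nt_dom \<eta>) f =
                    on_arr (nt_cod \<eta>) f \<cdot>\<^bsub>D\<^esub> nt_at \<eta> (Dom C f))},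
     Dom = nt_dom, Cod = nt_cod,
     Id = (\<lambda>F. \<lparr>nt_dom = F, nt_cod = F, nt_at = (\<lambda>X \<in> Obj C. Id D (on_obj F X))\<rparr>),
     Comp = (\<lambda>\<theta> \<eta>. \<lparr>nt_dom = nt_dom \<eta>, nt_cod = nt_cod \<theta>,
       nt_at = (\<lambda>X \<in> Obj C. nt_at \<theta> X \<cdot>\<^bsub>D\<^esub> nt_at \<eta> X)\<rparr>)\<rparr>"


section \<open>Sets\<close>

text \<open>The type \<open>'u\<close> plays the role of a Grothendieck universe: a set is small if its cardinality
  is less than that of \<open>'u\<close>, and that cardinality is a regular strong limit. The category of sets
  is the category of small sets of elements of \<open>'u\<close>. (As with the Bourbaki universes, the
  hereditarily finite sets, \<open>'u = nat\<close>, are not excluded.)\<close>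

definition small :: "'u set \<Rightarrow> bool" where
  "small A \<longleftrightarrow> |A| <o |UNIV :: 'u set|"

definition grothendieck_universe :: "'u itself \<Rightarrow> bool" where
  "grothendieck_universe _ \<longleftrightarrow>
    infinite (UNIV :: 'u set) \<and>
    (\<forall>A :: 'u set. small A \<longrightarrow> |Pow A| <o |UNIV :: 'u set| ) \<and>
    (\<forall>(A :: 'u set) (F :: 'u \<Rightarrow> 'u set).
       small A \<and> (\<forall>a \<in> A. small (F a)) \<longrightarrow> small (\<Union>a \<in> A. F a))"

record 'u set_map =
  sm_dom :: "'u set"
  sm_cod :: "'u set"
  sm_fun :: "'u \<Rightarrow> 'u"

definition SET :: "('u set, 'u set_map) category" where
  "SET =
    \<lparr>Obj = {A. small A},
     Arr = {f. small (sm_dom f) \<and> small (sm_cod f) \<and> sm_fun f \<in> sm_dom f \<rightarrow>\<^sub>E sm_cod f},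
     Dom = sm_dom, Cod = sm_cod,
     Id = (\<lambda>A. \<lparr>sm_dom = A, sm_cod = A, sm_fun = (\<lambda>x \<in> A. x)\<rparr>),
     Comp = (\<lambda>g f. \<lparr>sm_dom = sm_dom f, sm_cod = sm_cod g,
       sm_fun = (\<lambda>x \<in> sm_dom f. sm_fun g (sm_fun f x))\<rparr>)\<rparr>"

definition set_bijection :: "'u set \<Rightarrow> 'u set \<Rightarrow> 'u set_map \<Rightarrow> bool" where
  "set_bijection A B f \<longleftrightarrow> f \<in> hom SET A B \<and> bij_betw (sm_fun f) A B"

definition point :: "'u set \<Rightarrow> 'u \<Rightarrow> 'u set_map" where
  "point A i = \<lparr>sm_dom = {i}, sm_cod = A, sm_fun = (\<lambda>x \<in> {i}. x)\<rparr>"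


section \<open>Grothendieck toposes over Set\<close>

definition sieves :: "('o, 'a) category \<Rightarrow> 'o \<Rightarrow> 'a set set" where
  "sieves C c = {S. S \<subseteq> {f \<in> Arr C. Cod C f = c} \<and>
     (\<forall>f \<in> S. \<forall>g \<in> Arr C. Cod C g = Dom C f \<longrightarrow> f \<cdot>\<^bsub>C\<^esub> g \<in> S)}"

definition pullback_sieve :: "('o, 'a) category \<Rightarrow> 'a set \<Rightarrow> 'a \<Rightarrow> 'a set" where
  "pullback_sieve C S h = {g \<in> Arr C. Cod C g = Dom C h \<and> h \<cdot>\<^bsub>C\<^esub> g \<in> S}"

definition grothendieck_topology :: "('o, 'a) category \<Rightarrow> ('o \<Rightarrow> 'a set set) \<Rightarrow> bool" where
  "grothendieck_topology C J \<longleftrightarrow>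
    (\<forall>c \<in> Obj C. J c \<subseteq> sieves C c \<and> {f \<in> Arr C. Cod C f = c} \<in> J c) \<and>
    (\<forall>c \<in> Obj C. \<forall>S \<in> J c. \<forall>h \<in> Arr C. Cod C h = c \<longrightarrow> pullback_sieve C S h \<in> J (Dom C h)) \<and>
    (\<forall>c \<in> Obj C. \<forall>S \<in> J c. \<forall>T \<in> sieves C c.
       (\<forall>h \<in> S. pullback_sieve C T h \<in> J (Dom C h)) \<longrightarrow> T \<in> J c)"

definition is_sheaf ::
  "('u, 'u) category \<Rightarrow> ('u \<Rightarrow> 'u set set) \<Rightarrow> ('u, 'u, 'u set, 'u set_map) cfunctor \<Rightarrow> bool" where
  "is_sheaf C J P \<longleftrightarrow> is_functor (opposite C) SET P \<and>
    (\<forall>c \<in> Obj C. \<forall>S \<in> J c. \<forall>x.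
       (\<forall>f \<in> S. x f \<in> on_obj P (Dom C f)) \<and>
       (\<forall>f \<in> S. \<forall>g \<in> Arr C. Cod C g = Dom C f \<longrightarrow> sm_fun (on_arr P g) (x f) = x (f \<cdot>\<^bsub>C\<^esub> g)) \<longrightarrow>
       (\<exists>!y. y \<in> on_obj P c \<and> (\<forall>f \<in> S. sm_fun (on_arr P f) y = x f)))"

definition sheaves ::
  "('u, 'u) category \<Rightarrow> ('u \<Rightarrow> 'u set set) \<Rightarrow>
   (('u, 'u, 'u set, 'u set_map) cfunctor, ('u, 'u, 'u set, 'u set_map) nat_trans) category" where
  "sheaves C J = full_subcategory (functor_category (opposite C) SET) (is_sheaf C J)"

definition grothendieck_topos :: "'u itself \<Rightarrow> ('o, 'a) category \<Rightarrow> bool" where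
  "grothendieck_topos _ E \<longleftrightarrow>
    (\<exists>(C :: ('u, 'u) category) J. is_category C \<and> small (Obj C) \<and> small (Arr C) \<and>
       grothendieck_topology C J \<and> equivalent E (sheaves C J))"

text \<open>A geometric morphism to Set is given by its inverse image functor.\<close>

definition inverse_image ::
  "('o, 'a) category \<Rightarrow> ('u set, 'u set_map, 'o, 'a) cfunctor \<Rightarrow> bool" where
  "inverse_image E \<gamma> \<longleftrightarrow> left_exact SET E \<gamma> \<and> (\<exists>\<Gamma>. is_adjunction SET E \<gamma> \<Gamma>)"


section \<open>Simplicial objects\<close>

text \<open>\<open>dd X n i\<close> is the face from level \<open>n\<close> to level \<open>n - 1\<close> (for \<open>n \<ge> 1\<close>), \<open>ss X n i\<close> the
  degeneracy from level \<open>n\<close> to level \<open>n + 1\<close>.\<close>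

record ('o, 'a) simplicial =
  lev :: "nat \<Rightarrow> 'o"
  dd :: "nat \<Rightarrow> nat \<Rightarrow> 'a"
  ss :: "nat \<Rightarrow> nat \<Rightarrow> 'a"

definition is_simplicial :: "('o, 'a) category \<Rightarrow> ('o, 'a) simplicial \<Rightarrow> bool" where
  "is_simplicial C X \<longleftrightarrow>
    (\<forall>n. lev X n \<in> Obj C) \<and>
    (\<forall>n. \<forall>i \<le> Suc n. dd X (Suc n) i \<in> hom C (lev X (Suc n)) (lev X n)) \<and>
    (\<forall>n. \<forall>i \<le> n. ss X n i \<in> hom C (lev X n) (lev X (Suc n))) \<and>
    (\<forall>n. \<forall>j \<le> n + 2. \<forall>i < j.
       dd X (n + 1) i \<cdot>\<^bsub>C\<^esub> dd X (n + 2) j = dd X (n + 1) (j - 1) \<cdot>\<^bsub>C\<^esub> dd X (n + 2) i) \<and>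
    (\<forall>n. \<forall>j \<le> n. \<forall>i \<le> j.
       ss X (n + 1) i \<cdot>\<^bsub>C\<^esub> ss X n j = ss X (n + 1) (j + 1) \<cdot>\<^bsub>C\<^esub> ss X n i) \<and>
    (\<forall>n. \<forall>j \<le> n. \<forall>i \<le> n + 1.
       dd X (n + 1) i \<cdot>\<^bsub>C\<^esub> ss X n j =
         (if i < j then ss X (n - 1) (j - 1) \<cdot>\<^bsub>C\<^esub> dd X n i
          else if i \<le> j + 1 then Id C (lev X n)
          else ss X (n - 1) j \<cdot>\<^bsub>C\<^esub> dd X n (i - 1)))"

definition is_simplicial_map ::
  "('o, 'a) category \<Rightarrow> ('o, 'a) simplicial \<Rightarrow> ('o, 'a) simplicial \<Rightarrow> (nat \<Rightarrow> 'a) \<Rightarrow> bool" where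
  "is_simplicial_map C X Y f \<longleftrightarrow>
    (\<forall>n. f n \<in> hom C (lev X n) (lev Y n)) \<and>
    (\<forall>n. \<forall>i \<le> Suc n. dd Y (Suc n) i \<cdot>\<^bsub>C\<^esub> f (Suc n) = f n \<cdot>\<^bsub>C\<^esub> dd X (Suc n) i) \<and>
    (\<forall>n. \<forall>i \<le> n. ss Y n i \<cdot>\<^bsub>C\<^esub> f n = f (Suc n) \<cdot>\<^bsub>C\<^esub> ss X n i)"

definition map_simplicial ::
  "('o, 'a, 'p, 'b) cfunctor \<Rightarrow> ('o, 'a) simplicial \<Rightarrow> ('p, 'b) simplicial" where
  "map_simplicial F X = \<lparr>lev = (\<lambda>n. on_obj F (lev X n)),
     dd = (\<lambda>n i. on_arr F (dd X n i)), ss = (\<lambda>n i. on_arr F (ss X n i))\<rparr>"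

definition strict_duality ::
  "('o, 'a) category \<Rightarrow> ('o, 'a) simplicial \<Rightarrow> (nat \<Rightarrow> 'a) \<Rightarrow> bool" where
  "strict_duality C X \<tau> \<longleftrightarrow>
    (\<forall>n. \<tau> n \<in> hom C (lev X n) (lev X n) \<and> is_iso C (\<tau> n)) \<and>
    \<tau> 0 = Id C (lev X 0) \<and>
    (\<forall>n. \<forall>i \<le> Suc n. dd X (Suc n) i \<cdot>\<^bsub>C\<^esub> \<tau> (Suc n) = \<tau> n \<cdot>\<^bsub>C\<^esub> dd X (Suc n) (Suc n - i)) \<and>
    (\<forall>n. \<forall>i \<le> n. ss X n i \<cdot>\<^bsub>C\<^esub> \<tau> n = \<tau> (Suc n) \<cdot>\<^bsub>C\<^esub> ss X n (n - i))"

definition omit :: "nat \<Rightarrow> 'w list \<Rightarrow> 'w list" where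
  "omit i xs = take i xs @ drop (Suc i) xs"

definition double :: "nat \<Rightarrow> 'w list \<Rightarrow> 'w list" where
  "double i xs = take (Suc i) xs @ drop i xs"

text \<open>The level \<open>k\<close> of the coskeleton is given by the pointwise formula for the right Kan
  extension: it is the limit of the objects \<open>lev X m\<close> over all monotone maps
  \<open>x : [m] \<rightarrow> [k]\<close> with \<open>m \<le> n\<close>. Such a map is written as the sorted list
  \<open>[x 0, \<dots>, x m]\<close>; composing it with the cofaces and codegeneracies is \<open>omit\<close> and \<open>double\<close>.\<close>

definition monotone_maps :: "nat \<Rightarrow> nat \<Rightarrow> nat list set" where
  "monotone_maps m k = {x. length x = Suc m \<and> sorted x \<and> set x \<subseteq> {0..k}}"

definition cosk_cone ::
  "('o, 'a) category \<Rightarrow> nat \<Rightarrow> ('o, 'a) simplicial \<Rightarrow> nat \<Rightarrow> 'o \<Rightarrow> (nat list \<Rightarrow> 'a) \<Rightarrow> bool" where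
  "cosk_cone C n X k Z q \<longleftrightarrow> Z \<in> Obj C \<and>
    (\<forall>m \<le> n. \<forall>x \<in> monotone_maps m k. q x \<in> hom C Z (lev X m)) \<and>
    (\<forall>m. Suc m \<le> n \<longrightarrow> (\<forall>x \<in> monotone_maps (Suc m) k. \<forall>i \<le> Suc m.
       q (omit i x) = dd X (Suc m) i \<cdot>\<^bsub>C\<^esub> q x)) \<and>
    (\<forall>m. Suc m \<le> n \<longrightarrow> (\<forall>x \<in> monotone_maps m k. \<forall>i \<le> m.
       q (double i x) = ss X m i \<cdot>\<^bsub>C\<^esub> q x))"

definition is_cosk ::
  "('o, 'a) category \<Rightarrow> nat \<Rightarrow> ('o, 'a) simplicial \<Rightarrow> nat \<Rightarrow> 'o \<Rightarrow> (nat list \<Rightarrow> 'a) \<Rightarrow> bool" where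
  "is_cosk C n X k M q \<longleftrightarrow> cosk_cone C n X k M q \<and>
    (\<forall>Z p. cosk_cone C n X k Z p \<longrightarrow>
       (\<exists>!h. h \<in> hom C Z M \<and> (\<forall>m \<le> n. \<forall>x \<in> monotone_maps m k. q x \<cdot>\<^bsub>C\<^esub> h = p x)))"

text \<open>The canonical map from \<open>lev X k\<close> to level \<open>k\<close> of the \<open>(k - 1)\<close>-coskeleton is determined by
  its composites with the projections at the cofaces \<open>[k - 1] \<rightarrow> [k]\<close>, which are the faces.\<close>

definition is_hypercover :: "('o, 'a) category \<Rightarrow> ('o, 'a) simplicial \<Rightarrow> bool" where
  "is_hypercover C X \<longleftrightarrow> (\<forall>k \<ge> 1. \<exists>M q c.
     is_cosk C (k - 1) X k M q \<and> c \<in> hom C (lev X k) M \<and>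
     (\<forall>i \<le> k. q (omit i [0..<Suc k]) \<cdot>\<^bsub>C\<^esub> c = dd X k i) \<and> is_epi C c)"


section \<open>Families\<close>

record ('o, 'a, 'u) simplicial_family =
  fam_H :: "('o, 'a) simplicial"
  fam_S :: "('u set, 'u set_map) simplicial"
  fam_p :: "nat \<Rightarrow> 'a"
  fam_tau :: "nat \<Rightarrow> 'a"
  fam_tauS :: "nat \<Rightarrow> 'u set_map"

text \<open>A simplicial family in components: index sets with faces, degeneracies and duality, the
  component over each index, and the components of the faces, degeneracies and duality.\<close>

record ('w, 'o, 'a) components =
  ix :: "nat \<Rightarrow> 'w set"
  ix_d :: "nat \<Rightarrow> nat \<Rightarrow> 'w \<Rightarrow> 'w"
  ix_s :: "nat \<Rightarrow> nat \<Rightarrow> 'w \<Rightarrow> 'w"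
  ix_op :: "nat \<Rightarrow> 'w \<Rightarrow> 'w"
  co :: "nat \<Rightarrow> 'w \<Rightarrow> 'o"
  co_d :: "nat \<Rightarrow> nat \<Rightarrow> 'w \<Rightarrow> 'a"
  co_s :: "nat \<Rightarrow> nat \<Rightarrow> 'w \<Rightarrow> 'a"
  co_op :: "nat \<Rightarrow> 'w \<Rightarrow> 'a"

context
  fixes E :: "('o, 'a) category"
    and \<gamma> :: "('u set, 'u set_map, 'o, 'a) cfunctor"
begin

text \<open>The component of \<open>\<zeta> : U \<rightarrow> \<gamma>\<^sup>*I\<close> at \<open>i\<close> and its inclusion into \<open>U\<close>: the pullback of \<open>\<zeta>\<close>
  along the image of the point \<open>{i} \<rightarrow> I\<close>.\<close>

definition comp_incl :: "'u set \<Rightarrow> 'a \<Rightarrow> 'u \<Rightarrow> 'a" where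
  "comp_incl I \<zeta> i = (SOME p. \<exists>q. is_pullback E \<zeta> (on_arr \<gamma> (point I i)) p q)"

definition component :: "'u set \<Rightarrow> 'a \<Rightarrow> 'u \<Rightarrow> 'o" where
  "component I \<zeta> i = Dom E (comp_incl I \<zeta> i)"

definition is_family :: "'u set \<Rightarrow> 'o \<Rightarrow> 'a \<Rightarrow> bool" where
  "is_family I U \<zeta> \<longleftrightarrow> small I \<and> \<zeta> \<in> hom E U (on_obj \<gamma> I) \<and>
    (\<forall>i \<in> I. nonempty E (component I \<zeta> i))"

definition is_cover :: "'u set \<Rightarrow> 'o \<Rightarrow> 'a \<Rightarrow> bool" where
  "is_cover I U \<zeta> \<longleftrightarrow> is_family I U \<zeta> \<and> (\<forall>T. \<forall>f \<in> hom E U T. terminal E T \<longrightarrow> is_epi E f)"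

text \<open>The arrow from the component of \<open>\<zeta>\<close> at \<open>i\<close> to that of \<open>\<xi>\<close> at \<open>j\<close> induced by \<open>f\<close>.\<close>

definition comp_map :: "'u set \<Rightarrow> 'a \<Rightarrow> 'u \<Rightarrow> 'u set \<Rightarrow> 'a \<Rightarrow> 'u \<Rightarrow> 'a \<Rightarrow> 'a" where
  "comp_map I \<zeta> i J \<xi> j f = (THE g. g \<in> hom E (component I \<zeta> i) (component J \<xi> j) \<and>
     comp_incl J \<xi> j \<cdot>\<^bsub>E\<^esub> g = f \<cdot>\<^bsub>E\<^esub> comp_incl I \<zeta> i)"

definition is_simplicial_family :: "('o, 'a, 'u) simplicial_family \<Rightarrow> bool" where
  "is_simplicial_family F \<longleftrightarrow>
    is_simplicial E (fam_H F) \<and> is_simplicial SET (fam_S F) \<and>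
    is_simplicial_map E (fam_H F) (map_simplicial \<gamma> (fam_S F)) (fam_p F) \<and>
    (\<forall>n. is_family (lev (fam_S F) n) (lev (fam_H F) n) (fam_p F n))"

definition is_self_dual :: "('o, 'a, 'u) simplicial_family \<Rightarrow> bool" where
  "is_self_dual F \<longleftrightarrow>
    strict_duality E (fam_H F) (fam_tau F) \<and> strict_duality SET (fam_S F) (fam_tauS F) \<and>
    (\<forall>n. fam_p F n \<cdot>\<^bsub>E\<^esub> fam_tau F n = on_arr \<gamma> (fam_tauS F n) \<cdot>\<^bsub>E\<^esub> fam_p F n)"

definition family_components :: "('o, 'a, 'u) simplicial_family \<Rightarrow> ('u, 'o, 'a) components" where
  "family_components F = (let S = fam_S F; H = fam_H F; p = fam_p F in
    \<lparr>ix = lev S,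
     ix_d = (\<lambda>n i. sm_fun (dd S n i)),
     ix_s = (\<lambda>n i. sm_fun (ss S n i)),
     ix_op = (\<lambda>n. sm_fun (fam_tauS F n)),
     co = (\<lambda>n. component (lev S n) (p n)),
     co_d = (\<lambda>n i w. comp_map (lev S n) (p n) w
       (lev S (n - 1)) (p (n - 1)) (sm_fun (dd S n i) w) (dd H n i)),
     co_s = (\<lambda>n i w. comp_map (lev S n) (p n) w
       (lev S (n + 1)) (p (n + 1)) (sm_fun (ss S n i) w) (ss H n i)),
     co_op = (\<lambda>n w. comp_map (lev S n) (p n) w
       (lev S n) (p n) (sm_fun (fam_tauS F n) w) (fam_tau F n))\<rparr>)"

text \<open>The tuple \<open>(i\<^sub>0, \<dots>, i\<^sub>n)\<close> is the list \<open>[i\<^sub>0, \<dots>, i\<^sub>n]\<close>, and \<open>i \<in> I\<close> as a vertex is \<open>[i]\<close>.\<close>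

definition cech :: "'u set \<Rightarrow> 'a \<Rightarrow> ('u list, 'o, 'a) components" where
  "cech I \<zeta> = (let U = map (component I \<zeta>) in
    \<lparr>ix = (\<lambda>n. {x. length x = Suc n \<and> set x \<subseteq> I \<and> nonempty E (Prod E (U x))}),
     ix_d = (\<lambda>n i. omit i),
     ix_s = (\<lambda>n i. double i),
     ix_op = (\<lambda>n. rev),
     co = (\<lambda>n x. Prod E (U x)),
     co_d = (\<lambda>n i x. tup E (map (pr E (U x)) (omit i [0..<Suc n]))),
     co_s = (\<lambda>n i x. tup E (map (pr E (U x)) (double i [0..<Suc n]))),
     co_op = (\<lambda>n x. tup E (map (pr E (U x)) (rev [0..<Suc n])))\<rparr>)"

definition hypercover_refinement ::
  "'u set \<Rightarrow> 'o \<Rightarrow> 'a \<Rightarrow> ('o, 'a, 'u) simplicial_family \<Rightarrow> bool" where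
  "hypercover_refinement I U \<zeta> F \<longleftrightarrow> is_simplicial_family F \<and>
    lev (fam_S F) 0 = I \<and> lev (fam_H F) 0 = U \<and> fam_p F 0 = \<zeta> \<and> is_hypercover E (fam_H F)"

definition condition_G :: "('o, 'a, 'u) simplicial_family \<Rightarrow> bool" where
  "condition_G F \<longleftrightarrow> (let K = family_components F in
    \<forall>l \<in> ix K 1. \<exists>w \<in> ix K 2. ix_d K 2 2 w = l \<and> ix_d K 2 0 w = ix_op K 1 l \<and>
      co_d K 1 1 (ix_d K 2 1 w) = co_d K 1 0 (ix_d K 2 1 w))"


section \<open>Descent data\<close>

definition S_descent_datum ::
  "('o, 'a, 'u) simplicial_family \<Rightarrow> ('u \<Rightarrow> 'u set) \<Rightarrow> ('u \<Rightarrow> 'u set_map) \<Rightarrow> bool" where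
  "S_descent_datum F R s \<longleftrightarrow> (let K = family_components F in
    (\<forall>l \<in> ix K 1. set_bijection (R (ix_d K 1 1 l)) (R (ix_d K 1 0 l)) (s l)) \<and>
    (\<forall>i \<in> ix K 0. s (ix_s K 0 0 i) = Id SET (R i)) \<and>
    (\<forall>w \<in> ix K 2. s (ix_d K 2 1 w) = s (ix_d K 2 0 w) \<cdot>\<^bsub>SET\<^esub> s (ix_d K 2 2 w)))"

definition consistent :: "('o, 'a, 'u) simplicial_family \<Rightarrow> ('u \<Rightarrow> 'u set_map) \<Rightarrow> bool" where
  "consistent F s \<longleftrightarrow> (let K = family_components F in
    \<forall>l \<in> ix K 1. \<forall>t \<in> ix K 1.
      ix_d K 1 1 l = ix_d K 1 1 t \<and> ix_d K 1 0 l = ix_d K 1 0 t \<and>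
      (\<exists>f \<in> hom E (co K 1 l) (co K 1 t).
         co_d K 1 1 t \<cdot>\<^bsub>E\<^esub> f = co_d K 1 1 l \<and> co_d K 1 0 t \<cdot>\<^bsub>E\<^esub> f = co_d K 1 0 l) \<longrightarrow>
      s l = s t)"

text \<open>The first projection of \<open>\<sigma>\<^sub>l\<close>, which is the transpose of \<open>\<sigma>\<close>-hat.\<close>

definition hat ::
  "('w, 'o, 'a) components \<Rightarrow> ('w \<Rightarrow> 'u set) \<Rightarrow> ('w \<Rightarrow> 'a) \<Rightarrow> 'w \<Rightarrow> 'a" where
  "hat K R \<sigma> l = pr E [on_obj \<gamma> (R (ix_d K 1 0 l)), co K 1 (ix_op K 1 l)] 0 \<cdot>\<^bsub>E\<^esub> \<sigma> l"

text \<open>Under transposition the internal-language conditions become equations between arrows out of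
  \<open>\<gamma>\<^sup>*R\<^sub>i \<times> (H\<^sub>0)\<^sub>i\<close> and \<open>\<gamma>\<^sup>*R\<^sub>i \<times> (H\<^sub>2)\<^sub>w\<close>.\<close>

definition descent_datum ::
  "('w, 'o, 'a) components \<Rightarrow> ('w \<Rightarrow> 'u set) \<Rightarrow> ('w \<Rightarrow> 'a) \<Rightarrow> bool" where
  "descent_datum K R \<sigma> \<longleftrightarrow> (let A = (\<lambda>i. on_obj \<gamma> (R i)) in
    (\<forall>l \<in> ix K 1. let i = ix_d K 1 1 l; j = ix_d K 1 0 l in
       \<sigma> l \<in> hom E (Prod E [A i, co K 1 l]) (Prod E [A j, co K 1 (ix_op K 1 l)]) \<and>
       is_iso E (\<sigma> l) \<and>
       pr E [A j, co K 1 (ix_op K 1 l)] 1 \<cdot>\<^bsub>E\<^esub> \<sigma> l = co_op K 1 l \<cdot>\<^bsub>E\<^esub> pr E [A i, co K 1 l] 1) \<and>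
    (\<forall>i \<in> ix K 0.
       hat K R \<sigma> (ix_s K 0 0 i) \<cdot>\<^bsub>E\<^esub> arr_prod E (Id E (A i)) (co_s K 0 0 i) =
       pr E [A i, co K 0 i] 0) \<and>
    (\<forall>w \<in> ix K 2. let i = ix_d K 1 1 (ix_d K 2 2 w) in
       hat K R \<sigma> (ix_d K 2 0 w) \<cdot>\<^bsub>E\<^esub>
         tup E [hat K R \<sigma> (ix_d K 2 2 w) \<cdot>\<^bsub>E\<^esub> arr_prod E (Id E (A i)) (co_d K 2 2 w),
                co_d K 2 0 w \<cdot>\<^bsub>E\<^esub> pr E [A i, co K 2 w] 1] =
       hat K R \<sigma> (ix_d K 2 1 w) \<cdot>\<^bsub>E\<^esub> arr_prod E (Id E (A i)) (co_d K 2 1 w)))"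

definition H_descent_datum ::
  "('o, 'a, 'u) simplicial_family \<Rightarrow> ('u \<Rightarrow> 'u set) \<Rightarrow> ('u \<Rightarrow> 'a) \<Rightarrow> bool" where
  "H_descent_datum F R \<sigma>H \<longleftrightarrow> descent_datum (family_components F) R \<sigma>H"

text \<open>\<open>\<sigma> [i, j]\<close> is \<open>\<sigma>\<^sub>j\<^sub>,\<^sub>i\<close>.\<close>

definition U_descent_datum ::
  "'u set \<Rightarrow> 'a \<Rightarrow> ('u \<Rightarrow> 'u set) \<Rightarrow> ('u list \<Rightarrow> 'a) \<Rightarrow> bool" where
  "U_descent_datum I \<zeta> R \<sigma> \<longleftrightarrow> descent_datum (cech I \<zeta>) (\<lambda>x. R (hd x)) \<sigma>"

definition corresponding ::
  "'u set \<Rightarrow> 'a \<Rightarrow> ('o, 'a, 'u) simplicial_family \<Rightarrow> ('u \<Rightarrow> 'u set) \<Rightarrow>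
   ('u list \<Rightarrow> 'a) \<Rightarrow> ('u \<Rightarrow> 'a) \<Rightarrow> bool" where
  "corresponding I \<zeta> F R \<sigma> \<sigma>H \<longleftrightarrow> (let K = family_components F in
    \<forall>l \<in> ix K 1. let i = ix_d K 1 1 l; j = ix_d K 1 0 l in
      hat K R \<sigma>H l =
      hat (cech I \<zeta>) (\<lambda>x. R (hd x)) \<sigma> [i, j] \<cdot>\<^bsub>E\<^esub>
        arr_prod E (Id E (on_obj \<gamma> (R i))) (tup E [co_d K 1 1 l, co_d K 1 0 l]))"

definition induced_datum ::
  "('o, 'a, 'u) simplicial_family \<Rightarrow> ('u \<Rightarrow> 'u set_map) \<Rightarrow> 'u \<Rightarrow> 'a" where
  "induced_datum F s l = arr_prod E (on_arr \<gamma> (s l)) (co_op (family_components F) 1 l)"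


section \<open>Locally constant objects and covering projections\<close>

definition set_family :: "'u set \<Rightarrow> ('u \<Rightarrow> 'u set) \<Rightarrow> bool" where
  "set_family I R \<longleftrightarrow> (\<forall>i \<in> I. small (R i))"

definition trivialized ::
  "'u set \<Rightarrow> 'a \<Rightarrow> ('u \<Rightarrow> 'u set) \<Rightarrow> 'o \<Rightarrow> ('u \<Rightarrow> 'a) \<Rightarrow> bool" where
  "trivialized I \<zeta> R X \<theta> \<longleftrightarrow> set_family I R \<and> X \<in> Obj E \<and>
    (\<forall>i \<in> I. let A = on_obj \<gamma> (R i); Ui = component I \<zeta> i in
       \<theta> i \<in> hom E (Prod E [A, Ui]) (Prod E [X, Ui]) \<and> is_iso E (\<theta> i) \<and>
       pr E [X, Ui] 1 \<cdot>\<^bsub>E\<^esub> \<theta> i = pr E [A, Ui] 1)"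

text \<open>For \<open>f : A \<times> P \<rightarrow> B \<times> P\<close>, the arrow \<open>f \<times> Q\<close>, bracketed as
  \<open>A \<times> (P \<times> Q) \<rightarrow> B \<times> (P \<times> Q)\<close>.\<close>

definition times_obj :: "'o \<Rightarrow> 'o \<Rightarrow> 'o \<Rightarrow> 'o \<Rightarrow> 'a \<Rightarrow> 'a" where
  "times_obj A B P Q f =
    (let \<pi> = pr E [A, Prod E [P, Q]];
         g = f \<cdot>\<^bsub>E\<^esub> tup E [\<pi> 0, pr E [P, Q] 0 \<cdot>\<^bsub>E\<^esub> \<pi> 1]
     in tup E [pr E [B, P] 0 \<cdot>\<^bsub>E\<^esub> g, tup E [pr E [B, P] 1 \<cdot>\<^bsub>E\<^esub> g, pr E [P, Q] 1 \<cdot>\<^bsub>E\<^esub> \<pi> 1]])"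

text \<open>\<open>X \<sim> (R \<rightarrow> I, \<sigma>)\<close> by means of the isomorphisms \<open>\<theta>\<close>.\<close>

definition locally_constant ::
  "'u set \<Rightarrow> 'a \<Rightarrow> ('u \<Rightarrow> 'u set) \<Rightarrow> ('u list \<Rightarrow> 'a) \<Rightarrow> 'o \<Rightarrow> ('u \<Rightarrow> 'a) \<Rightarrow> bool" where
  "locally_constant I \<zeta> R \<sigma> X \<theta> \<longleftrightarrow>
    trivialized I \<zeta> R X \<theta> \<and> U_descent_datum I \<zeta> R \<sigma> \<and>
    (\<forall>i j. [i, j] \<in> ix (cech I \<zeta>) 1 \<longrightarrow>
      (let A = (\<lambda>i. on_obj \<gamma> (R i)); U = component I \<zeta> in
       times_obj (A j) X (U j) (U i) (\<theta> j) \<cdot>\<^bsub>E\<^esub> \<sigma> [i, j] =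
       arr_prod E (Id E X) (co_op (cech I \<zeta>) 1 [i, j]) \<cdot>\<^bsub>E\<^esub> times_obj (A i) X (U i) (U j) (\<theta> i)))"

definition is_action_span ::
  "'u set \<Rightarrow> 'a \<Rightarrow> ('u \<Rightarrow> 'u set) \<Rightarrow> ('u list \<Rightarrow> 'a) \<Rightarrow> 'u \<Rightarrow> 'u \<Rightarrow> 'o \<Rightarrow> 'a \<Rightarrow> 'a \<Rightarrow> bool" where
  "is_action_span I \<zeta> R \<sigma> i j V u v \<longleftrightarrow>
    nonempty E V \<and> u \<in> hom E V (component I \<zeta> i) \<and> v \<in> hom E V (component I \<zeta> j) \<and>
    (\<exists>s. set_bijection (R i) (R j) s \<and>
       \<sigma> [i, j] \<cdot>\<^bsub>E\<^esub> arr_prod E (Id E (on_obj \<gamma> (R i))) (tup E [u, v]) =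
       arr_prod E (Id E (on_obj \<gamma> (R j))) (tup E [v, u]) \<cdot>\<^bsub>E\<^esub> arr_prod E (on_arr \<gamma> s) (Id E V))"

definition covering_projection ::
  "'u set \<Rightarrow> 'a \<Rightarrow> ('u \<Rightarrow> 'u set) \<Rightarrow> ('u list \<Rightarrow> 'a) \<Rightarrow> 'o \<Rightarrow> ('u \<Rightarrow> 'a) \<Rightarrow> bool" where
  "covering_projection I \<zeta> R \<sigma> X \<theta> \<longleftrightarrow>
    locally_constant I \<zeta> R \<sigma> X \<theta> \<and>
    (\<forall>i j. [i, j] \<in> ix (cech I \<zeta>) 1 \<longrightarrow>
       epimorphic_family E (Prod E [component I \<zeta> i, component I \<zeta> j])
         {tup E [u, v] | V u v. is_action_span I \<zeta> R \<sigma> i j V u v})"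

end

end

theory Submission
  imports Defs
begin

text \<open>A Grothendieck topos is treated as a category of sheaves on a site, and all arguments are carried out
  with sections over the objects of the site that are not covered by the empty sieve, where existence
  means local existence.

  For a covering projection, the hypercover is the Cech nerve of \<open>U\<close> in which pairs of vertices carry an
  additional decidable mark; the mark of a degenerate edge forces its vertices to agree. Its simplices
  are indexed by the indices of their vertices, the marks, and the bijections of the fibres through
  which the descent datum acts on each pair of vertices. These bijections exist locally since action
  spans are epimorphic, and the edges carry them as the required constant datum \<open>s\<close>.

  Conversely, \<open>s\<close> determines the descent datum locally on \<open>U \<times> U\<close>, since pairs of vertices lift
  locally to edges. Two lifts give the same bijection because a triangle formed by both lifts and a
  degenerate edge lifts to a 2-simplex, and the cocycle condition follows in the same way. The components
  of the edges then are action spans that cover \<open>U \<times> U\<close>.\<close>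

section \<open>Small sets\<close>

text \<open>Condition G is the obstacle that shapes the hypercover. In the Cech nerve refined only
  by bijections, the triangle with vertices \<open>i, j, i\<close> has as middle edge the component
  of all pairs of points of \<open>U_i\<close> on which the descent datum acts as the identity, and
  its two faces differ in general. The marks split off a component on which they agree. A mark is a
  section of the constant object on two elements, so it is locally constant and can enter an index,
  although equality in \<open>U\<close> need not be decidable. It forces equality in one direction
  only: any two points may be marked \<open>ff\<close>, which keeps the map from edges to
  \<open>U \<times> U\<close> epimorphic. Vertices and marks live on the 1-skeleton, so from level 2
  on each level is its own coskeleton and an epimorphism has to be checked at level 1 only.

  Indices and transition maps exist only locally. They become arrows as relations that are
  single-valued and locally total. Local preimages under an epimorphism are found by testing it
  against the subobject classifier.\<close>

abbreviation (input) sml :: "'u itself \<Rightarrow> 'x set \<Rightarrow> bool" where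
  "sml ty A \<equiv> |A| <o |UNIV :: 'u set|"

locale universe =
  fixes ty :: "'u itself"
  assumes universe: "grothendieck_universe TYPE('u)"
begin

lemma infinite_universe: "infinite (UNIV :: 'u set)"
  using universe by (simp add: grothendieck_universe_def)

lemma sml_finite:
  assumes "finite A"
  shows "sml ty A"
proof -
  have "\<not> |UNIV :: 'u set| \<le>o |A|"
    using assms infinite_universe card_of_ordLeq_finite by blast
  then show ?thesis by (simp add: card_of_Well_order not_ordLeq_iff_ordLess)
qed

lemma sml_subset: "A \<subseteq> B \<Longrightarrow> sml ty B \<Longrightarrow> sml ty A"
  by (rule ordLeq_ordLess_trans[OF card_of_mono1])

lemma sml_image: "sml ty A \<Longrightarrow> sml ty (f ` A)"
  by (rule ordLeq_ordLess_trans[OF card_of_image])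

lemma sml_inj:
  assumes "inj_on f A" "f ` A \<subseteq> B" "sml ty B"
  shows "sml ty A"
proof -
  have "|A| \<le>o |B|" using assms card_of_ordLeq[of A B] by blast
  then show ?thesis using assms(3) ordLeq_ordLess_trans by blast
qed

text \<open>\<open>small\<close> is a predicate on subsets of \<open>'u\<close>, whereas sheaf
  values and simplex indices are first built in other types (functions, sieves, tuples). This is the
  way back into \<open>'u\<close>.\<close>

lemma sml_encode:
  assumes "sml ty A"
  obtains e :: "'x \<Rightarrow> 'u" where "inj_on e A" "small (e ` A)"
proof -
  have "|A| \<le>o |UNIV :: 'u set|" using assms ordLess_imp_ordLeq by blast
  then obtain e :: "'x \<Rightarrow> 'u" where "inj_on e A" using card_of_ordLeq[of A "UNIV :: 'u set"] by auto
  then show ?thesis using that sml_image[OF assms] by (auto simp: small_def)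
qed

lemma sml_Pow:
  assumes "sml ty A"
  shows "sml ty (Pow A)"
proof -
  obtain e :: "_ \<Rightarrow> 'u" where e: "inj_on e A" "small (e ` A)" using assms by (rule sml_encode)
  have "sml ty (Pow (e ` A))" using e universe by (auto simp: grothendieck_universe_def)
  moreover have "inj_on ((`) e) (Pow A)" using e(1) by (rule inj_on_image_Pow)
  ultimately show ?thesis by (rule sml_inj[rotated 2]) auto
qed

text \<open>The union axiom of the universe speaks of families of subsets of \<open>'u\<close> only.
  Base and fibres are therefore encoded in \<open>'u\<close>, and the fibres are made disjoint by an
  injection of pairs into \<open>'u\<close>, which exists because \<open>'u\<close> is
  infinite.\<close>

lemma sml_Sigma:
  assumes "sml ty A" "\<And>a. a \<in> A \<Longrightarrow> sml ty (B a)"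
  shows "sml ty (Sigma A B)"
proof -
  obtain e :: "_ \<Rightarrow> 'u" where e: "inj_on e A" "small (e ` A)" using assms(1) by (rule sml_encode)
  have "\<exists>g::_\<Rightarrow>'u. inj_on g (B a) \<and> small (g ` B a)" if "a \<in> A" for a
    using sml_encode[OF assms(2)[OF that]] by blast
  then obtain g where g: "\<And>a. a \<in> A \<Longrightarrow> inj_on (g a :: _ \<Rightarrow> 'u) (B a) \<and> small (g a ` B a)"
    using bchoice[of A "\<lambda>a g. inj_on g (B a) \<and> small (g ` B a)"] by blast
  have "|UNIV :: ('u \<times> 'u) set| \<le>o |UNIV :: 'u set|"
    using card_of_Times_same_infinite[OF infinite_universe] ordIso_iff_ordLeq by auto
  then obtain p :: "'u \<times> 'u \<Rightarrow> 'u" where p: "inj p"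
    using card_of_ordLeq[of "UNIV :: ('u * 'u) set" "UNIV :: 'u set"] by auto
  let ?F = "\<lambda>x. p ` Pair x ` g (inv_into A e x) ` B (inv_into A e x)"
  have "small (\<Union>x\<in>e ` A. ?F x)"
  proof -
    have F: "small (?F x)" if "x \<in> e ` A" for x
    proof -
      have "inv_into A e x \<in> A" using that by (rule inv_into_into)
      then have "sml ty (g (inv_into A e x) ` B (inv_into A e x))"
        using g by (simp add: small_def)
      then show ?thesis unfolding small_def by (intro sml_image[of _ "p"] sml_image[of _ "Pair x"])
    qed
    have un: "small (\<Union>a\<in>A. F a)" if "small A" "\<And>a. a \<in> A \<Longrightarrow> small (F a)" for A and F :: "'u \<Rightarrow> 'u set"
    proof -
      have "\<forall>(A :: 'u set) (F :: 'u \<Rightarrow> 'u set). small A \<and> (\<forall>a\<in>A. small (F a)) \<longrightarrow> small (\<Union> (F ` A))"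
        using universe unfolding grothendieck_universe_def by (elim conjE)
      then show ?thesis using that by (elim allE[of _ A] allE[of _ F]) simp
    qed
    show ?thesis by (rule un[OF e(2)]) (rule F)
  qed
  then have "sml ty (\<Union>x\<in>e ` A. ?F x)" by (simp add: small_def)
  moreover have "inj_on (\<lambda>(a,b). p (e a, g a b)) (Sigma A B)"
  proof (rule inj_onI)
    fix x y assume xy: "x \<in> Sigma A B" "y \<in> Sigma A B"
      and "(\<lambda>(a,b). p (e a, g a b)) x = (\<lambda>(a,b). p (e a, g a b)) y"
    then have *: "e (fst x) = e (fst y)" "g (fst x) (snd x) = g (fst y) (snd y)"
      using injD[OF p] by (auto simp: case_prod_beta)
    then have "fst x = fst y" using inj_onD[OF e(1)] xy by auto
    moreover from this have "snd x = snd y" using inj_onD[of "g (fst x)" "B (fst x)"] g xy * by auto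
    ultimately show "x = y" by (rule prod_eqI)
  qed
  moreover have "(\<lambda>(a,b). p (e a, g a b)) ` Sigma A B \<subseteq> (\<Union>x\<in>e ` A. ?F x)"
    using e(1) by auto
  ultimately show ?thesis using sml_inj by blast
qed

lemma sml_Times: "sml ty A \<Longrightarrow> sml ty B \<Longrightarrow> sml ty (A \<times> B)"
  by (rule sml_Sigma)

lemma sml_UNION:
  assumes "sml ty A" "\<And>a. a \<in> A \<Longrightarrow> sml ty (B a)"
  shows "sml ty (\<Union>a\<in>A. B a)"
proof -
  have "(\<Union>a\<in>A. B a) = snd ` Sigma A B" by force
  then show ?thesis using sml_image[OF sml_Sigma[OF assms]] by simp
qed

text \<open>A function on \<open>A\<close> is determined by its graph, a subset of
  \<open>Sigma A B\<close>.\<close>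

lemma sml_PiE:
  assumes "sml ty A" "\<And>a. a \<in> A \<Longrightarrow> sml ty (B a)"
  shows "sml ty (PiE A B)"
proof -
  have "inj_on (\<lambda>f. (\<lambda>a. (a, f a)) ` A) (PiE A B)"
  proof (rule inj_onI)
    fix f g assume f: "f \<in> PiE A B" "g \<in> PiE A B" and eq: "(\<lambda>a. (a, f a)) ` A = (\<lambda>a. (a, g a)) ` A"
    have "f a = g a" if "a \<in> A" for a
    proof -
      have "(a, f a) \<in> (\<lambda>a. (a, g a)) ` A" using that eq by blast
      then show ?thesis by auto
    qed
    then show "f = g" using f by (intro PiE_ext) auto
  qed
  moreover have "(\<lambda>f. (\<lambda>a. (a, f a)) ` A) ` PiE A B \<subseteq> Pow (Sigma A B)" by auto
  ultimately show ?thesis by (rule sml_inj[OF _ _ sml_Pow[OF sml_Sigma[OF assms]]])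
qed

end

section \<open>Categories\<close>

lemma in_hom: "f \<in> hom C X Y \<longleftrightarrow> f \<in> Arr C \<and> Dom C f = X \<and> Cod C f = Y"
  by (auto simp: hom_def)

lemma comp_in_hom:
  assumes "is_category C" "f \<in> hom C X Y" "g \<in> hom C Y Z"
  shows "Comp C g f \<in> hom C X Z"
  using assms unfolding is_category_def hom_def by blast

lemma id_in_hom: "is_category C \<Longrightarrow> X \<in> Obj C \<Longrightarrow> Id C X \<in> hom C X X"
  unfolding is_category_def by blast

lemma hom_obj:
  assumes "is_category C" "f \<in> hom C X Y"
  shows "X \<in> Obj C" "Y \<in> Obj C"
  using assms unfolding is_category_def hom_def by blast+

lemma comp_id:
  assumes "is_category C" "f \<in> hom C X Y"
  shows "Comp C f (Id C X) = f" "Comp C (Id C Y) f = f"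
  using assms unfolding is_category_def hom_def by blast+

lemma comp_assoc:
  assumes "is_category C" "f \<in> hom C X Y" "g \<in> hom C Y Z" "h \<in> hom C Z W"
  shows "Comp C (Comp C h g) f = Comp C h (Comp C g f)"
proof -
  have "f \<in> Arr C" "g \<in> Arr C" "h \<in> Arr C" "Dom C g = Cod C f" "Dom C h = Cod C g"
    using assms by (auto simp: hom_def)
  then show ?thesis using assms(1) unfolding is_category_def by blast
qed

section \<open>Sections of objects of a Grothendieck topos\<close>

type_synonym ('o, 'a, 'u) sheaf_functor =
  "('o, 'a, ('u, 'u, 'u set, 'u set_map) cfunctor, ('u, 'u, 'u set, 'u set_map) nat_trans) cfunctor"

text \<open>Objects and arrows of \<open>E\<close> have arbitrary types. With the site and the
  equivalence \<open>\<Phi>\<close> fixed, every object can be treated through the sections of its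
  sheaf, and fullness, faithfulness and essential surjectivity of \<open>\<Phi>\<close> carry the
  results back.\<close>

locale topos = universe ty for ty :: "'u itself" +
  fixes E :: "('o, 'a) category"
    and C :: "('u, 'u) category"
    and J :: "'u \<Rightarrow> 'u set set"
    and \<Phi> :: "('o, 'a, 'u) sheaf_functor"
  assumes C: "is_category C"
    and small_C: "small (Obj C)" "small (Arr C)"
    and topology: "grothendieck_topology C J"
    and \<Phi>: "is_functor E (sheaves C J) \<Phi>"
    and \<Phi>_full: "\<And>X Y. X \<in> Obj E \<Longrightarrow> Y \<in> Obj E \<Longrightarrow>
       bij_betw (on_arr \<Phi>) (hom E X Y) (hom (sheaves C J) (on_obj \<Phi> X) (on_obj \<Phi> Y))"
    and \<Phi>_surj: "\<And>Z. Z \<in> Obj (sheaves C J) \<Longrightarrow>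
       \<exists>X \<in> Obj E. \<exists>f \<in> hom (sheaves C J) (on_obj \<Phi> X) Z. is_iso (sheaves C J) f"
begin

abbreviation comp_C (infixr "\<odot>" 70) where "g \<odot> f \<equiv> Comp C g f"
abbreviation comp_E (infixr "\<bullet>" 70) where "g \<bullet> f \<equiv> Comp E g f"

lemma E: "is_category E"
  using \<Phi> by (simp add: is_functor_def)

subsection \<open>The topology at inhabited stages\<close>

text \<open>Every sheaf has exactly one section over an object that is covered by the empty sieve, so
  such objects can be ignored throughout.\<close>

definition inh :: "'u \<Rightarrow> bool" where
  "inh c \<longleftrightarrow> c \<in> Obj C \<and> {} \<notin> J c"

definition st :: "'u \<Rightarrow> 'u \<Rightarrow> 'u set" where
  "st d c = {h \<in> hom C d c. inh d}"

definition loc :: "'u \<Rightarrow> ('u \<Rightarrow> 'u \<Rightarrow> bool) \<Rightarrow> bool" where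
  "loc c P \<longleftrightarrow> (\<exists>S \<in> J c. \<forall>d. \<forall>f \<in> st d c. f \<in> S \<longrightarrow> P d f)"

lemma J_max: "c \<in> Obj C \<Longrightarrow> {f \<in> Arr C. Cod C f = c} \<in> J c"
  and J_sieve: "c \<in> Obj C \<Longrightarrow> S \<in> J c \<Longrightarrow> S \<in> sieves C c"
  and J_pullback: "c \<in> Obj C \<Longrightarrow> S \<in> J c \<Longrightarrow> h \<in> hom C d c \<Longrightarrow> pullback_sieve C S h \<in> J d"
  and J_trans: "c \<in> Obj C \<Longrightarrow> S \<in> J c \<Longrightarrow> T \<in> sieves C c \<Longrightarrow>
     (\<And>h d. h \<in> S \<Longrightarrow> h \<in> hom C d c \<Longrightarrow> pullback_sieve C T h \<in> J d) \<Longrightarrow> T \<in> J c"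
proof -
  let ?I = "\<forall>c \<in> Obj C. J c \<subseteq> sieves C c \<and> {f \<in> Arr C. Cod C f = c} \<in> J c"
  let ?P = "\<forall>c \<in> Obj C. \<forall>S \<in> J c. \<forall>h \<in> Arr C. Cod C h = c \<longrightarrow> pullback_sieve C S h \<in> J (Dom C h)"
  let ?T = "\<forall>c \<in> Obj C. \<forall>S \<in> J c. \<forall>T \<in> sieves C c.
       (\<forall>h \<in> S. pullback_sieve C T h \<in> J (Dom C h)) \<longrightarrow> T \<in> J c"
  have I: ?I and P: ?P and T: ?T using topology unfolding grothendieck_topology_def by - (elim conjE, assumption)+
  show "c \<in> Obj C \<Longrightarrow> {f \<in> Arr C. Cod C f = c} \<in> J c" using I by blast
  show sv: "c \<in> Obj C \<Longrightarrow> S \<in> J c \<Longrightarrow> S \<in> sieves C c" using I by blast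
  show "c \<in> Obj C \<Longrightarrow> S \<in> J c \<Longrightarrow> h \<in> hom C d c \<Longrightarrow> pullback_sieve C S h \<in> J d"
    using P by (auto simp: hom_def)
  assume c: "c \<in> Obj C" "S \<in> J c" "T \<in> sieves C c"
    and *: "\<And>h d. h \<in> S \<Longrightarrow> h \<in> hom C d c \<Longrightarrow> pullback_sieve C T h \<in> J d"
  have "h \<in> hom C (Dom C h) c" if "h \<in> S" for h
    using sv[OF c(1,2)] that by (auto simp: sieves_def hom_def)
  then have "\<forall>h\<in>S. pullback_sieve C T h \<in> J (Dom C h)" using * by blast
  then show "T \<in> J c"
    using T[THEN bspec, OF c(1), THEN bspec, OF c(2), THEN bspec, OF c(3)] by blast
qed

end

section \<open>Sets\<close>

lemma hom_SET:
  "f \<in> hom SET A B \<longleftrightarrow> small A \<and> small B \<and> sm_dom f = A \<and> sm_cod f = B \<and> sm_fun f \<in> A \<rightarrow>\<^sub>E B"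
  by (auto simp: hom_def SET_def)

lemma SET_ext:
  assumes "f \<in> hom SET A B" "g \<in> hom SET A B" "\<And>x. x \<in> A \<Longrightarrow> sm_fun f x = sm_fun g x"
  shows "f = g"
proof -
  have "sm_fun f = sm_fun g" using assms by (intro PiE_ext[of _ A "\<lambda>_. B"]) (auto simp: hom_SET)
  then show ?thesis using assms by (simp add: hom_SET)
qed

lemma SET_comp:
  "Comp SET g f = \<lparr>sm_dom = sm_dom f, sm_cod = sm_cod g,
       sm_fun = (\<lambda>x \<in> sm_dom f. sm_fun g (sm_fun f x))\<rparr>"
  by (simp add: SET_def)

lemma SET_comp_fun: "f \<in> hom SET A B \<Longrightarrow> x \<in> A \<Longrightarrow> sm_fun (Comp SET g f) x = sm_fun g (sm_fun f x)"
  by (simp add: SET_comp hom_SET)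

lemma SET_id_fun: "x \<in> A \<Longrightarrow> sm_fun (Id SET A) x = x"
  by (simp add: SET_def)

lemma SET_fun_in: "f \<in> hom SET A B \<Longrightarrow> x \<in> A \<Longrightarrow> sm_fun f x \<in> B"
  by (auto simp: hom_SET)

lemma SET_comp_hom: "f \<in> hom SET A B \<Longrightarrow> g \<in> hom SET B D \<Longrightarrow> Comp SET g f \<in> hom SET A D"
  by (auto simp: hom_SET SET_comp)

lemma SET_id_hom: "small A \<Longrightarrow> Id SET A \<in> hom SET A A"
  by (auto simp: SET_def hom_def)

lemma SET_category: "is_category SET"
proof -
  have 1: "f \<in> hom SET (Dom SET f) (Cod SET f)" if "f \<in> Arr SET" for f
    using that by (simp add: hom_def)
  have 2: "Dom SET f \<in> Obj SET \<and> Cod SET f \<in> Obj SET" if "f \<in> Arr SET" for f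
    using that by (auto simp: SET_def)
  have 3: "small (Dom SET f)" "small (Cod SET f)" if "f \<in> Arr SET" for f
    using that by (auto simp: SET_def)
  have 4: "Comp SET f (Id SET (Dom SET f)) = f \<and> Comp SET (Id SET (Cod SET f)) f = f" if f: "f \<in> Arr SET" for f
  proof (intro conjI; rule SET_ext)
    show "Comp SET f (Id SET (Dom SET f)) \<in> hom SET (Dom SET f) (Cod SET f)"
      "Comp SET (Id SET (Cod SET f)) f \<in> hom SET (Dom SET f) (Cod SET f)"
      using 1[OF f] 3[OF f] SET_comp_hom SET_id_hom by blast+
  qed (use 1[OF f] 3[OF f] in \<open>auto simp: SET_comp_fun[OF SET_id_hom] SET_comp_fun SET_id_fun SET_fun_in\<close>)
  have 5: "Comp SET (Comp SET h g) f = Comp SET h (Comp SET g f)"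
    if "f \<in> Arr SET" "g \<in> Arr SET" "h \<in> Arr SET" "Dom SET g = Cod SET f" "Dom SET h = Cod SET g" for f g h
  proof -
    have f: "f \<in> hom SET (Dom SET f) (Cod SET f)" and g: "g \<in> hom SET (Cod SET f) (Cod SET g)"
      and h: "h \<in> hom SET (Cod SET g) (Cod SET h)" using that by (auto simp: hom_def)
    show ?thesis
    proof (rule SET_ext)
      show "Comp SET (Comp SET h g) f \<in> hom SET (Dom SET f) (Cod SET h)"
        "Comp SET h (Comp SET g f) \<in> hom SET (Dom SET f) (Cod SET h)"
        using f g h SET_comp_hom by blast+
      fix x assume x: "x \<in> Dom SET f"
      show "sm_fun (Comp SET (Comp SET h g) f) x = sm_fun (Comp SET h (Comp SET g f)) x"
        using SET_comp_fun[OF f x] SET_comp_fun[OF g SET_fun_in[OF f x]] SET_comp_fun[OF SET_comp_hom[OF f g] x]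
        by simp
    qed
  qed
  show ?thesis unfolding is_category_def
  proof (intro conjI ballI impI)
    fix f g assume "f \<in> Arr SET" "g \<in> Arr SET" "Dom SET g = Cod SET f"
    then show "Comp SET g f \<in> hom SET (Dom SET f) (Cod SET g)"
      using SET_comp_hom by (metis 1)
  next
    fix X :: "'a set" assume "X \<in> Obj SET"
    then show "Id SET X \<in> hom SET X X" by (intro SET_id_hom) (simp add: SET_def)
  qed (use 2 4 5 in blast)+
qed

lemma SET_homI:
  "small A \<Longrightarrow> small B \<Longrightarrow> (\<And>x. x \<in> A \<Longrightarrow> f x \<in> B) \<Longrightarrow> \<lparr>sm_dom = A, sm_cod = B, sm_fun = restrict f A\<rparr> \<in> hom SET A B"
  by (simp add: hom_SET)

context topos
begin

section \<open>Locality\<close>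

lemma st_hom: "h \<in> st d c \<Longrightarrow> h \<in> hom C d c"
  and st_inh: "h \<in> st d c \<Longrightarrow> inh d"
  by (auto simp: st_def)

lemma inh_obj: "inh c \<Longrightarrow> c \<in> Obj C"
  by (simp add: inh_def)

text \<open>The pullback of the empty sieve is empty, so being covered by it passes from
  \<open>c\<close> to \<open>d\<close>.\<close>

lemma inh_cod:
  assumes "h \<in> hom C d c" "inh d"
  shows "inh c"
proof -
  have "{} \<notin> J c"
  proof
    assume "{} \<in> J c"
    then have "pullback_sieve C {} h \<in> J d" using assms hom_obj[OF C] J_pullback by blast
    then show False using assms by (simp add: pullback_sieve_def inh_def)
  qed
  then show ?thesis using assms hom_obj[OF C] by (auto simp: inh_def)
qed

lemma st_inh': "h \<in> st d c \<Longrightarrow> inh c"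
  using inh_cod by (auto simp: st_def)

lemma st_id: "inh c \<Longrightarrow> Id C c \<in> st c c"
  by (simp add: st_def id_in_hom[OF C] inh_obj)

lemma st_comp: "h \<in> st d c \<Longrightarrow> g \<in> st e d \<Longrightarrow> h \<odot> g \<in> st e c"
  by (auto simp: st_def intro: comp_in_hom[OF C])

lemma st_assoc: "h \<in> st d c \<Longrightarrow> g \<in> st e d \<Longrightarrow> k \<in> st b e \<Longrightarrow> (h \<odot> g) \<odot> k = h \<odot> (g \<odot> k)"
  by (auto simp: st_def intro: comp_assoc[OF C])

lemma st_comp_id: "h \<in> st d c \<Longrightarrow> h \<odot> Id C d = h" "h \<in> st d c \<Longrightarrow> Id C c \<odot> h = h"
  by (auto simp: st_def intro: comp_id[OF C])

lemma sieve_comp: "S \<in> J c \<Longrightarrow> inh c \<Longrightarrow> f \<in> S \<Longrightarrow> f \<in> hom C d c \<Longrightarrow> g \<in> hom C e d \<Longrightarrow> f \<odot> g \<in> S"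
  using J_sieve[OF inh_obj] by (auto simp: sieves_def hom_def)

lemma J_up:
  assumes "c \<in> Obj C" "S \<in> J c" "T \<in> sieves C c" "S \<subseteq> T"
  shows "T \<in> J c"
proof (rule J_trans[OF assms(1-3)])
  fix h d assume h: "h \<in> S" "h \<in> hom C d c"
  have "pullback_sieve C T h = {f \<in> Arr C. Cod C f = d}"
    using assms h by (auto simp: pullback_sieve_def sieves_def hom_def)
  then show "pullback_sieve C T h \<in> J d" using J_max hom_obj[OF C h(2)] by simp
qed

lemma pullback_sieves:
  assumes S: "S \<in> sieves C c" and h: "h \<in> hom C d c"
  shows "pullback_sieve C S h \<in> sieves C d"
proof -
  have "f \<odot> g \<in> pullback_sieve C S h"
    if f: "f \<in> pullback_sieve C S h" and g: "g \<in> Arr C" "Cod C g = Dom C f" for f g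
  proof -
    have fh: "f \<in> hom C (Dom C f) d" "g \<in> hom C (Dom C g) (Dom C f)" "h \<odot> f \<in> S"
      using f g h by (auto simp: pullback_sieve_def hom_def)
    have "h \<odot> f \<in> hom C (Dom C f) c" by (rule comp_in_hom[OF C fh(1) h])
    then have "(h \<odot> f) \<odot> g \<in> S" using S fh(3) g by (auto simp: sieves_def in_hom)
    moreover have "(h \<odot> f) \<odot> g = h \<odot> (f \<odot> g)" using comp_assoc[OF C fh(2) fh(1) h] .
    moreover have "f \<odot> g \<in> hom C (Dom C g) d" by (rule comp_in_hom[OF C fh(2,1)])
    ultimately show ?thesis using h by (simp add: pullback_sieve_def in_hom)
  qed
  moreover have "pullback_sieve C S h \<subseteq> {f \<in> Arr C. Cod C f = d}"
    using h by (auto simp: pullback_sieve_def in_hom)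
  ultimately show ?thesis by (auto simp: sieves_def)
qed

text \<open>\<open>loc\<close> tests inhabited stages only. Adding all arrows with uninhabited
  domain makes the set large enough to contain the sieve that witnesses \<open>loc\<close>, so that
  it covers.\<close>

lemma loc_sieve:
  assumes c: "inh c" and P: "loc c P"
    and stable: "\<And>d e f g. f \<in> st d c \<Longrightarrow> g \<in> st e d \<Longrightarrow> P d f \<Longrightarrow> P e (f \<odot> g)"
  shows "{f \<in> Arr C. Cod C f = c \<and> (inh (Dom C f) \<longrightarrow> P (Dom C f) f)} \<in> J c" (is "?T \<in> _")
proof -
  obtain S where S: "S \<in> J c" "\<And>d f. f \<in> st d c \<Longrightarrow> f \<in> S \<Longrightarrow> P d f" using P by (auto simp: loc_def)
  have "f \<odot> g \<in> ?T" if "f \<in> ?T" "g \<in> Arr C" "Cod C g = Dom C f" for f g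
  proof -
    have fg: "f \<in> hom C (Dom C f) c" "g \<in> hom C (Dom C g) (Dom C f)" using that by (auto simp: hom_def)
    then have *: "f \<odot> g \<in> hom C (Dom C g) c" using comp_in_hom[OF C] by blast
    moreover have "P (Dom C g) (f \<odot> g)" if "inh (Dom C g)"
      using stable[of f "Dom C f" g "Dom C g"] fg that inh_cod[OF fg(2)] \<open>f \<in> ?T\<close> by (auto simp: st_def)
    ultimately show ?thesis by (auto simp: in_hom)
  qed
  then have "?T \<in> sieves C c" by (auto simp: sieves_def)
  moreover have "S \<subseteq> ?T"
    using S J_sieve[OF inh_obj[OF c]] by (auto simp: sieves_def st_def hom_def)
  ultimately show ?thesis using J_up S(1) inh_obj[OF c] by blast
qed

lemma loc_mono: "loc c P \<Longrightarrow> (\<And>d f. f \<in> st d c \<Longrightarrow> P d f \<Longrightarrow> Q d f) \<Longrightarrow> loc c Q"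
  unfolding loc_def by blast

lemma loc_triv: "inh c \<Longrightarrow> (\<And>d f. f \<in> st d c \<Longrightarrow> P d f) \<Longrightarrow> loc c P"
  unfolding loc_def using J_max[OF inh_obj] by blast

lemma loc_J: "S \<in> J c \<Longrightarrow> loc c (\<lambda>d f. f \<in> S)"
  unfolding loc_def by blast

lemma J_all:
  assumes "c \<in> Obj C" "\<not> inh c" "T \<in> sieves C c"
  shows "T \<in> J c"
  using J_up[of c "{}" T] assms by (auto simp: inh_def)

lemma loc_res:
  assumes "h \<in> st d c" "loc c P"
  shows "loc d (\<lambda>e g. P e (h \<odot> g))"
proof -
  obtain S where S: "S \<in> J c" "\<And>d f. f \<in> st d c \<Longrightarrow> f \<in> S \<Longrightarrow> P d f" using assms by (auto simp: loc_def)
  have "pullback_sieve C S h \<in> J d" using J_pullback S(1) assms st_hom st_inh' inh_obj by blast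
  moreover have "P e (h \<odot> g)" if "g \<in> st e d" "g \<in> pullback_sieve C S h" for e g
    using that S(2)[of "h \<odot> g"] st_comp[OF assms(1)] by (auto simp: pullback_sieve_def)
  ultimately show ?thesis unfolding loc_def by blast
qed

lemma loc_trans:
  assumes c: "inh c" and L: "loc c (\<lambda>d f. loc d (\<lambda>e g. P e (f \<odot> g)))"
  shows "loc c P"
proof -
  \<comment> \<open>The largest part of \<open>P\<close> that is stable under restriction. It is
    needed because \<open>P\<close> itself need not cut out a sieve; the identity arrow leads back
    from \<open>?Q\<close> to \<open>P\<close>.\<close>
  let ?Q = "\<lambda>d f. \<forall>e. \<forall>g \<in> st e d. P e (f \<odot> g)"
  let ?T = "{k \<in> Arr C. Cod C k = c \<and> (inh (Dom C k) \<longrightarrow> ?Q (Dom C k) k)}"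
  obtain S where S: "S \<in> J c" "\<And>d f. f \<in> st d c \<Longrightarrow> f \<in> S \<Longrightarrow> loc d (\<lambda>e g. P e (f \<odot> g))"
    using L by (auto simp: loc_def)
  have stable: "?Q e (f \<odot> g)" if "f \<in> st d c" "g \<in> st e d" "?Q d f" for d e f g
    using that st_comp st_assoc by (metis)
  have T: "?T \<in> sieves C c"
  proof -
    have "f \<odot> g \<in> ?T" if "f \<in> ?T" "g \<in> Arr C" "Cod C g = Dom C f" for f g
    proof -
      have fg: "f \<in> hom C (Dom C f) c" "g \<in> hom C (Dom C g) (Dom C f)" using that by (auto simp: hom_def)
      then have *: "f \<odot> g \<in> hom C (Dom C g) c" using comp_in_hom[OF C] by blast
      moreover have "?Q (Dom C g) (f \<odot> g)" if "inh (Dom C g)"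
        using stable[of f "Dom C f" g "Dom C g"] fg that inh_cod[OF fg(2)] \<open>f \<in> ?T\<close> by (auto simp: st_def)
      ultimately show ?thesis by (auto simp: in_hom)
    qed
    then show ?thesis by (auto simp: sieves_def)
  qed
  have "?T \<in> J c"
  proof (rule J_trans[OF inh_obj[OF c] S(1) T])
    fix h d assume h: "h \<in> S" "h \<in> hom C d c"
    have ps: "pullback_sieve C ?T h \<in> sieves C d" by (rule pullback_sieves[OF T h(2)])
    have d: "d \<in> Obj C" using hom_obj[OF C h(2)] by simp
    show "pullback_sieve C ?T h \<in> J d"
    proof (cases "inh d")
      case False then show ?thesis using J_all ps d by blast
    next
      case True
      then have hs: "h \<in> st d c" using h by (simp add: st_def)
      obtain R where R: "R \<in> J d" "\<And>e g. g \<in> st e d \<Longrightarrow> g \<in> R \<Longrightarrow> P e (h \<odot> g)"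
        using S(2)[OF hs h(1)] by (auto simp: loc_def)
      have "g \<in> pullback_sieve C ?T h" if "g \<in> R" for g
      proof -
        have g: "g \<in> hom C (Dom C g) d" using J_sieve[OF d R(1)] that by (auto simp: sieves_def hom_def)
        have "?Q (Dom C g) (h \<odot> g)" if "inh (Dom C g)"
        proof (intro allI ballI)
          fix e k assume k: "k \<in> st e (Dom C g)"
          have gs: "g \<in> st (Dom C g) d" using g that by (simp add: st_def)
          have "g \<odot> k \<in> R" using sieve_comp[OF R(1) True \<open>g \<in> R\<close> g st_hom[OF k]] .
          then show "P e ((h \<odot> g) \<odot> k)" using R(2) st_comp[OF gs k] st_assoc[OF hs gs k] by simp
        qed
        moreover have "h \<odot> g \<in> hom C (Dom C g) c" by (rule comp_in_hom[OF C g h(2)])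
        ultimately show ?thesis using g h by (auto simp: pullback_sieve_def in_hom)
      qed
      then show ?thesis using J_up[OF d R(1) ps] by blast
    qed
  qed
  moreover have "P d k" if "k \<in> st d c" "k \<in> ?T" for d k
  proof -
    have "Dom C k = d" "inh d" using that by (auto simp: st_def in_hom)
    then have "P d (k \<odot> Id C d)" using that st_id by blast
    then show ?thesis using st_comp_id(1)[OF that(1)] by simp
  qed
  ultimately show ?thesis unfolding loc_def by blast
qed

lemma loc_conj:
  assumes "inh c" "loc c P" "loc c Q"
  shows "loc c (\<lambda>d f. P d f \<and> Q d f)"
proof (rule loc_trans[OF assms(1)])
  obtain S where S: "S \<in> J c" "\<And>d f. f \<in> st d c \<Longrightarrow> f \<in> S \<Longrightarrow> P d f" using assms by (auto simp: loc_def)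
  show "loc c (\<lambda>d f. loc d (\<lambda>e g. P e (f \<odot> g) \<and> Q e (f \<odot> g)))"
  proof (rule loc_mono[OF loc_J[OF S(1)]])
    fix d f assume f: "f \<in> st d c" "f \<in> S"
    show "loc d (\<lambda>e g. P e (f \<odot> g) \<and> Q e (f \<odot> g))"
    proof (rule loc_mono[OF loc_res[OF f(1) assms(3)]])
      fix e g assume g: "g \<in> st e d" "Q e (f \<odot> g)"
      have "f \<odot> g \<in> S" using sieve_comp[OF S(1) assms(1) f(2)] f g st_hom by blast
      then show "P e (f \<odot> g) \<and> Q e (f \<odot> g)" using S(2) st_comp[OF f(1) g(1)] g(2) by blast
    qed
  qed
qed

lemma loc_ball:
  assumes "finite K" "inh c" "\<And>k. k \<in> K \<Longrightarrow> loc c (P k)"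
  shows "loc c (\<lambda>d f. \<forall>k\<in>K. P k d f)"
  using assms
proof (induction K)
  case empty show ?case by (rule loc_triv) (use empty in auto)
next
  case (insert k K)
  then have "loc c (\<lambda>d f. P k d f \<and> (\<forall>k\<in>K. P k d f))" by (intro loc_conj) auto
  then show ?case by (rule loc_mono) auto
qed

text \<open>Passes from local existence to one actual stage. If no member of the covering sieve had
  an inhabited domain, transitivity of the topology would make the empty sieve cover
  \<open>c\<close>.\<close>

lemma loc_ex:
  assumes "inh c" "loc c P"
  obtains d f where "f \<in> st d c" "P d f"
proof -
  have "\<exists>d. \<exists>f \<in> st d c. P d f"
  proof (rule ccontr)
    assume n: "\<not> (\<exists>d. \<exists>f \<in> st d c. P d f)"
    obtain S where S: "S \<in> J c" "\<And>d f. f \<in> st d c \<Longrightarrow> f \<in> S \<Longrightarrow> P d f" using assms by (auto simp: loc_def)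
    have "{} \<in> J c"
    proof (rule J_trans[OF inh_obj[OF assms(1)] S(1)])
      show "{} \<in> sieves C c" by (simp add: sieves_def)
      fix h d assume h: "h \<in> S" "h \<in> hom C d c"
      then have "\<not> inh d" using n S(2) by (auto simp: st_def)
      then show "pullback_sieve C {} h \<in> J d"
        using hom_obj[OF C h(2)] by (simp add: pullback_sieve_def inh_def)
    qed
    then show False using assms(1) by (simp add: inh_def)
  qed
  then show ?thesis using that by blast
qed

end

context topos
begin

section \<open>Sections and arrows\<close>

definition el :: "'o \<Rightarrow> 'u \<Rightarrow> 'u set" where
  "el X c = on_obj (on_obj \<Phi> X) c"

definition rs :: "'o \<Rightarrow> 'u \<Rightarrow> 'u \<Rightarrow> 'u" where
  "rs X h x = sm_fun (on_arr (on_obj \<Phi> X) h) x"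

definition ap :: "'a \<Rightarrow> 'u \<Rightarrow> 'u \<Rightarrow> 'u" where
  "ap f c x = sm_fun (nt_at (on_arr \<Phi> f) c) x"

lemma sheaves_Obj: "F \<in> Obj (sheaves C J) \<longleftrightarrow> is_sheaf C J F"
  by (auto simp: sheaves_def full_subcategory_def functor_category_def is_sheaf_def)

lemma opposite_simps:
  "Obj (opposite C) = Obj C" "Arr (opposite C) = Arr C" "Dom (opposite C) = Cod C"
  "Cod (opposite C) = Dom C" "Id (opposite C) = Id C" "Comp (opposite C) = (\<lambda>g f. Comp C f g)"
  by (simp_all add: opposite_def)

lemma sheaves_hom:
  "\<eta> \<in> hom (sheaves C J) F G \<longleftrightarrow> is_sheaf C J F \<and> is_sheaf C J G \<and> nt_dom \<eta> = F \<and> nt_cod \<eta> = G \<and>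
     nt_at \<eta> \<in> (\<Pi>\<^sub>E X \<in> Obj C. hom SET (on_obj F X) (on_obj G X)) \<and>
     (\<forall>f \<in> Arr C. Comp SET (nt_at \<eta> (Dom C f)) (on_arr F f) = Comp SET (on_arr G f) (nt_at \<eta> (Cod C f)))"
  by (auto simp: hom_def sheaves_def full_subcategory_def functor_category_def opposite_simps is_sheaf_def)

lemma sheaf_functor:
  assumes "is_sheaf C J F"
  shows "c \<in> Obj C \<Longrightarrow> small (on_obj F c)"
    and "h \<in> hom C d c \<Longrightarrow> on_arr F h \<in> hom SET (on_obj F c) (on_obj F d)"
    and "c \<in> Obj C \<Longrightarrow> on_arr F (Id C c) = Id SET (on_obj F c)"
    and "h \<in> hom C d c \<Longrightarrow> g \<in> hom C e d \<Longrightarrow> on_arr F (h \<odot> g) = Comp SET (on_arr F g) (on_arr F h)"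
proof -
  have *: "is_functor (opposite C) SET F" using assms by (simp add: is_sheaf_def)
  have 1: "\<forall>X \<in> Obj C. on_obj F X \<in> Obj SET \<and> on_arr F (Id C X) = Id SET (on_obj F X)"
    and 2: "\<forall>f \<in> Arr C. on_arr F f \<in> hom SET (on_obj F (Cod C f)) (on_obj F (Dom C f))"
    and 3: "\<forall>f \<in> Arr C. \<forall>g \<in> Arr C. Cod C g = Dom C f \<longrightarrow> on_arr F (f \<odot> g) = Comp SET (on_arr F g) (on_arr F f)"
    using * unfolding is_functor_def opposite_simps by - (elim conjE, assumption)+
  show "c \<in> Obj C \<Longrightarrow> small (on_obj F c)" "c \<in> Obj C \<Longrightarrow> on_arr F (Id C c) = Id SET (on_obj F c)"
    using 1 by (auto simp: SET_def)
  show "h \<in> hom C d c \<Longrightarrow> on_arr F h \<in> hom SET (on_obj F c) (on_obj F d)"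
    using 2 by (auto simp: in_hom)
  show "h \<in> hom C d c \<Longrightarrow> g \<in> hom C e d \<Longrightarrow> on_arr F (h \<odot> g) = Comp SET (on_arr F g) (on_arr F h)"
    using 3 by (simp add: in_hom)
qed

lemma \<Phi>_sheaf: "X \<in> Obj E \<Longrightarrow> is_sheaf C J (on_obj \<Phi> X)"
  using \<Phi> by (auto simp: is_functor_def sheaves_Obj[symmetric])

lemma \<Phi>_hom: "f \<in> hom E X Y \<Longrightarrow> on_arr \<Phi> f \<in> hom (sheaves C J) (on_obj \<Phi> X) (on_obj \<Phi> Y)"
  using \<Phi> by (auto simp: is_functor_def in_hom)

lemma E_obj: "f \<in> hom E X Y \<Longrightarrow> X \<in> Obj E" "f \<in> hom E X Y \<Longrightarrow> Y \<in> Obj E"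
  using hom_obj[OF E] by auto

lemmas E_comp = comp_in_hom[OF E]
lemmas E_id = id_in_hom[OF E]
lemmas E_assoc = comp_assoc[OF E]
lemmas E_comp_id = comp_id[OF E]

lemma sml_el: "X \<in> Obj E \<Longrightarrow> inh c \<Longrightarrow> sml ty (el X c)"
  using sheaf_functor(1)[OF \<Phi>_sheaf inh_obj] by (simp add: small_def el_def)

lemma rs_el_hom: "X \<in> Obj E \<Longrightarrow> h \<in> hom C d c \<Longrightarrow> x \<in> el X c \<Longrightarrow> rs X h x \<in> el X d"
  unfolding el_def rs_def by (rule SET_fun_in[OF sheaf_functor(2)[OF \<Phi>_sheaf]])

lemma rs_el: "X \<in> Obj E \<Longrightarrow> h \<in> st d c \<Longrightarrow> x \<in> el X c \<Longrightarrow> rs X h x \<in> el X d"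
  by (rule rs_el_hom[OF _ st_hom])

lemma rs_id: "X \<in> Obj E \<Longrightarrow> inh c \<Longrightarrow> x \<in> el X c \<Longrightarrow> rs X (Id C c) x = x"
  using sheaf_functor(3)[OF \<Phi>_sheaf inh_obj] by (simp add: el_def rs_def SET_id_fun)

lemma rs_comp:
  assumes "X \<in> Obj E" "h \<in> st d c" "g \<in> st e d" "x \<in> el X c"
  shows "rs X (h \<odot> g) x = rs X g (rs X h x)"
proof -
  have "on_arr (on_obj \<Phi> X) h \<in> hom SET (on_obj (on_obj \<Phi> X) c) (on_obj (on_obj \<Phi> X) d)"
    using sheaf_functor(2)[OF \<Phi>_sheaf] assms st_hom by blast
  then show ?thesis
    using sheaf_functor(4)[OF \<Phi>_sheaf, OF assms(1) st_hom st_hom, OF assms(2,3)] SET_comp_fun assms(4)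
    by (simp add: el_def rs_def)
qed

lemma ap_SET: "f \<in> hom E X Y \<Longrightarrow> c \<in> Obj C \<Longrightarrow> nt_at (on_arr \<Phi> f) c \<in> hom SET (el X c) (el Y c)"
  using \<Phi>_hom[of f X Y] by (auto simp: sheaves_hom el_def)

lemma ap_el: "f \<in> hom E X Y \<Longrightarrow> inh c \<Longrightarrow> x \<in> el X c \<Longrightarrow> ap f c x \<in> el Y c"
  unfolding ap_def by (rule SET_fun_in[OF ap_SET[OF _ inh_obj]])

lemma ap_rs:
  assumes f: "f \<in> hom E X Y" and h: "h \<in> st d c" and x: "x \<in> el X c"
  shows "ap f d (rs X h x) = rs Y h (ap f c x)"
proof -
  have "Comp SET (nt_at (on_arr \<Phi> f) d) (on_arr (on_obj \<Phi> X) h) =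
      Comp SET (on_arr (on_obj \<Phi> Y) h) (nt_at (on_arr \<Phi> f) c)"
    using \<Phi>_hom[OF f] st_hom[OF h] unfolding sheaves_hom by (auto simp: in_hom[of h])
  moreover have hX: "on_arr (on_obj \<Phi> X) h \<in> hom SET (el X c) (el X d)"
    using sheaf_functor(2)[OF \<Phi>_sheaf[OF E_obj(1)[OF f]] st_hom[OF h]] by (simp add: el_def)
  ultimately show ?thesis
    using SET_comp_fun[OF hX x, of "nt_at (on_arr \<Phi> f) d"]
      SET_comp_fun[OF ap_SET[OF f inh_obj[OF st_inh'[OF h]]] x, of "on_arr (on_obj \<Phi> Y) h"]
    unfolding ap_def rs_def by simp
qed

lemma ap_comp:
  assumes f: "f \<in> hom E X Y" and g: "g \<in> hom E Y Z" and c: "inh c" and x: "x \<in> el X c"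
  shows "ap (g \<bullet> f) c x = ap g c (ap f c x)"
proof -
  have "on_arr \<Phi> (g \<bullet> f) = Comp (sheaves C J) (on_arr \<Phi> g) (on_arr \<Phi> f)"
    using \<Phi> f g by (auto simp: is_functor_def in_hom)
  then have "nt_at (on_arr \<Phi> (g \<bullet> f)) c = Comp SET (nt_at (on_arr \<Phi> g) c) (nt_at (on_arr \<Phi> f) c)"
    using inh_obj[OF c] by (simp add: sheaves_def full_subcategory_def functor_category_def opposite_simps)
  then show ?thesis using SET_comp_fun[OF ap_SET[OF f inh_obj[OF c]] x] by (simp add: ap_def)
qed

lemma ap_id: "X \<in> Obj E \<Longrightarrow> inh c \<Longrightarrow> x \<in> el X c \<Longrightarrow> ap (Id E X) c x = x"
  using \<Phi> inh_obj[of c] unfolding ap_def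
  by (simp add: is_functor_def sheaves_def full_subcategory_def functor_category_def opposite_simps el_def SET_id_fun)

text \<open>The sheaf condition for the empty covering sieve: the empty family has exactly one
  amalgamation.\<close>

lemma collapse:
  assumes "X \<in> Obj E" "c \<in> Obj C" "\<not> inh c"
  shows "\<exists>!x. x \<in> el X c"
proof -
  have "\<forall>c \<in> Obj C. \<forall>S \<in> J c. \<forall>x.
       (\<forall>f \<in> S. x f \<in> on_obj (on_obj \<Phi> X) (Dom C f)) \<and>
       (\<forall>f \<in> S. \<forall>g \<in> Arr C. Cod C g = Dom C f \<longrightarrow> sm_fun (on_arr (on_obj \<Phi> X) g) (x f) = x (f \<odot> g)) \<longrightarrow>
       (\<exists>!y. y \<in> on_obj (on_obj \<Phi> X) c \<and> (\<forall>f \<in> S. sm_fun (on_arr (on_obj \<Phi> X) f) y = x f))"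
    using \<Phi>_sheaf[OF assms(1)] unfolding is_sheaf_def by (elim conjE)
  moreover have "{} \<in> J c" using assms by (simp add: inh_def)
  ultimately show ?thesis using assms(2) unfolding el_def by fastforce
qed

lemma sheaf_amalgamation:
  assumes "X \<in> Obj E" "inh c" "S \<in> J c"
    and "\<And>f d. f \<in> S \<Longrightarrow> f \<in> hom C d c \<Longrightarrow> x f \<in> el X d"
    and "\<And>f d g e. f \<in> S \<Longrightarrow> f \<in> hom C d c \<Longrightarrow> g \<in> hom C e d \<Longrightarrow> rs X g (x f) = x (f \<odot> g)"
  shows "\<exists>!y. y \<in> el X c \<and> (\<forall>f \<in> S. rs X f y = x f)"
proof -
  have "\<forall>c \<in> Obj C. \<forall>S \<in> J c. \<forall>x.
       (\<forall>f \<in> S. x f \<in> on_obj (on_obj \<Phi> X) (Dom C f)) \<and>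
       (\<forall>f \<in> S. \<forall>g \<in> Arr C. Cod C g = Dom C f \<longrightarrow> sm_fun (on_arr (on_obj \<Phi> X) g) (x f) = x (f \<odot> g)) \<longrightarrow>
       (\<exists>!y. y \<in> on_obj (on_obj \<Phi> X) c \<and> (\<forall>f \<in> S. sm_fun (on_arr (on_obj \<Phi> X) f) y = x f))"
    using \<Phi>_sheaf[OF assms(1)] unfolding is_sheaf_def by (elim conjE)
  note * = this[THEN bspec, OF inh_obj[OF assms(2)], THEN bspec, OF assms(3), THEN spec[of _ x]]
  have sv: "f \<in> hom C (Dom C f) c" if "f \<in> S" for f
    using J_sieve[OF inh_obj[OF assms(2)] assms(3)] that by (auto simp: sieves_def in_hom)
  show ?thesis using * assms(4,5) sv unfolding el_def rs_def by (simp add: in_hom)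
qed

text \<open>At an uninhabited stage both values are the one section there, so the sheaf maps agree
  everywhere, and \<open>\<Phi>\<close> is faithful. Almost every equation between arrows below is
  proved by this lemma.\<close>

lemma ext_stage:
  assumes f: "f \<in> hom E X Y" and g: "g \<in> hom E X Y"
    and eq: "\<And>c x. inh c \<Longrightarrow> x \<in> el X c \<Longrightarrow> ap f c x = ap g c x"
  shows "f = g"
proof -
  note X = E_obj[OF f]
  have "nt_at (on_arr \<Phi> f) c = nt_at (on_arr \<Phi> g) c" if c: "c \<in> Obj C" for c
  proof (rule SET_ext)
    show "nt_at (on_arr \<Phi> f) c \<in> hom SET (el X c) (el Y c)" "nt_at (on_arr \<Phi> g) c \<in> hom SET (el X c) (el Y c)"
      using ap_SET f g c by auto
    fix x assume x: "x \<in> el X c"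
    have "ap f c x \<in> el Y c" "ap g c x \<in> el Y c"
      using SET_fun_in[OF ap_SET] f g c x unfolding ap_def by blast+
    then show "sm_fun (nt_at (on_arr \<Phi> f) c) x = sm_fun (nt_at (on_arr \<Phi> g) c) x"
      using eq[OF _ x] collapse[OF X(2) c] by (cases "inh c") (auto simp: ap_def)
  qed
  then have "nt_at (on_arr \<Phi> f) = nt_at (on_arr \<Phi> g)"
    using \<Phi>_hom[OF f] \<Phi>_hom[OF g] unfolding sheaves_hom
    by (intro PiE_ext[of _ "Obj C" "\<lambda>c. hom SET (el X c) (el Y c)"]) (auto simp: el_def)
  then have "on_arr \<Phi> f = on_arr \<Phi> g"
    using \<Phi>_hom[OF f] \<Phi>_hom[OF g] unfolding sheaves_hom by simp
  then show ?thesis using bij_betw_imp_inj_on[OF \<Phi>_full[OF X]] f g by (auto dest: inj_onD)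
qed

lemma sep:
  assumes X: "X \<in> Obj E" and c: "inh c" and x: "x \<in> el X c" "y \<in> el X c"
    and L: "loc c (\<lambda>d f. rs X f x = rs X f y)"
  shows "x = y"
proof -
  obtain S where S: "S \<in> J c" "\<And>d f. f \<in> st d c \<Longrightarrow> f \<in> S \<Longrightarrow> rs X f x = rs X f y"
    using L by (auto simp: loc_def)
  have hc: "f \<in> hom C (Dom C f) c" if "f \<in> S" for f
    using J_sieve[OF inh_obj[OF c] S(1)] that by (auto simp: sieves_def in_hom)
  have eq: "rs X f x = rs X f y" if f: "f \<in> S" for f
  proof (cases "inh (Dom C f)")
    case True then show ?thesis using S(2)[OF _ f] hc[OF f] by (auto simp: st_def)
  next
    case False
    then show ?thesis using collapse[OF X] rs_el_hom[OF X hc[OF f]] x hom_obj[OF C hc[OF f]] by blast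
  qed
  have "\<exists>!z. z \<in> el X c \<and> (\<forall>f \<in> S. rs X f z = rs X f x)"
  proof (rule sheaf_amalgamation[OF X c S(1)])
    fix f d g e assume f: "f \<in> S" "f \<in> hom C d c" and g: "g \<in> hom C e d"
    then show "rs X g (rs X f x) = rs X (f \<odot> g) x"
      unfolding rs_def sheaf_functor(4)[OF \<Phi>_sheaf[OF X] f(2) g]
      by (intro SET_comp_fun[symmetric, OF sheaf_functor(2)[OF \<Phi>_sheaf[OF X] f(2)]] x(1)[unfolded el_def])
  qed (rule rs_el_hom[OF X _ x(1)])
  moreover have "\<forall>f \<in> S. rs X f y = rs X f x" using eq by (metis)
  ultimately show ?thesis using x by blast
qed

text \<open>The local sections are given by a relation \<open>V\<close> instead of a function.
  Single-valuedness and stability make it a compatible family on the sieve of those arrows where it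
  has a value.\<close>

lemma glue:
  assumes X: "X \<in> Obj E" and c: "inh c"
    and V: "\<And>d f y. f \<in> st d c \<Longrightarrow> V d f y \<Longrightarrow> y \<in> el X d"
    and stable: "\<And>d e f g y. f \<in> st d c \<Longrightarrow> g \<in> st e d \<Longrightarrow> V d f y \<Longrightarrow> V e (f \<odot> g) (rs X g y)"
    and uniq: "\<And>d f y z. f \<in> st d c \<Longrightarrow> V d f y \<Longrightarrow> V d f z \<Longrightarrow> y = z"
    and L: "loc c (\<lambda>d f. \<exists>y. V d f y)"
  obtains y where "y \<in> el X c" "\<And>d f z. f \<in> st d c \<Longrightarrow> V d f z \<Longrightarrow> rs X f y = z"
proof -
  let ?S = "{f \<in> Arr C. Cod C f = c \<and> (inh (Dom C f) \<longrightarrow> (\<exists>y. V (Dom C f) f y))}"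
  have S: "?S \<in> J c" by (rule loc_sieve[OF c L]) (use stable in blast)
  \<comment> \<open>The sheaf condition wants values on the whole sieve; where the domain is
    uninhabited the only section available is taken.\<close>
  define x where "x f = (if inh (Dom C f) then THE y. V (Dom C f) f y else THE y. y \<in> el X (Dom C f))" for f
  have x1: "x f = y" if "f \<in> st d c" "V d f y" for d f y
    using that uniq[OF that(1)] unfolding x_def by (auto simp: st_def in_hom)
  have x2: "V d f (x f)" if "f \<in> ?S" "f \<in> st d c" for d f
    using that x1[OF that(2)] by (auto simp: st_def in_hom)
  have x3: "x f \<in> el X d" if "f \<in> ?S" "f \<in> hom C d c" for d f
  proof (cases "inh d")
    case True then show ?thesis using x2[of f d] V that by (auto simp: st_def)
  next
    case False then show ?thesis using theI'[OF collapse[OF X _ False]] hom_obj[OF C that(2)] that(2)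
      by (auto simp: x_def in_hom)
  qed
  have "\<exists>!y. y \<in> el X c \<and> (\<forall>f \<in> ?S. rs X f y = x f)"
  proof (rule sheaf_amalgamation[OF X c S x3])
    fix f d g e assume f: "f \<in> ?S" "f \<in> hom C d c" and g: "g \<in> hom C e d"
    have fg: "f \<odot> g \<in> hom C e c" "f \<odot> g \<in> ?S"
      using sieve_comp[OF S c f g] comp_in_hom[OF C g f(2)] by auto
    show "rs X g (x f) = x (f \<odot> g)"
    proof (cases "inh e")
      case True
      then have gs: "g \<in> st e d" using g by (simp add: st_def)
      then have fs: "f \<in> st d c" using f inh_cod[OF g True] by (simp add: st_def)
      show ?thesis using x1[OF st_comp[OF fs gs] stable[OF fs gs x2[OF f(1) fs]]] by simp
    next
      case False
      then show ?thesis
        using collapse[OF X _ False] x3[OF fg(2,1)] rs_el_hom[OF X g x3[OF f]] hom_obj[OF C g] by blast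
    qed
  qed auto
  then obtain y where y: "y \<in> el X c" "\<forall>f \<in> ?S. rs X f y = x f" by blast
  have "rs X f y = z" if "f \<in> st d c" "V d f z" for d f z
  proof -
    have "f \<in> ?S" using that by (auto simp: st_def in_hom)
    then show ?thesis using y(2) x1[OF that] by blast
  qed
  then show ?thesis using y(1) that by blast
qed

text \<open>The family is extended to uninhabited stages by the unique section there. It is then a
  natural transformation of sheaves, and \<open>\<Phi>\<close> is full.\<close>

lemma arrow_of_family:
  assumes X: "X \<in> Obj E" and Y: "Y \<in> Obj E"
    and \<phi>: "\<And>c x. inh c \<Longrightarrow> x \<in> el X c \<Longrightarrow> \<phi> c x \<in> el Y c"
    and nat: "\<And>d c h x. h \<in> st d c \<Longrightarrow> x \<in> el X c \<Longrightarrow> \<phi> d (rs X h x) = rs Y h (\<phi> c x)"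
  obtains f where "f \<in> hom E X Y" "\<And>c x. inh c \<Longrightarrow> x \<in> el X c \<Longrightarrow> ap f c x = \<phi> c x"
proof -
  define \<psi> where "\<psi> c x = (if inh c then \<phi> c x else THE y. y \<in> el Y c)" for c x
  have \<psi>: "\<psi> c x \<in> el Y c" if "c \<in> Obj C" "x \<in> el X c" for c x
    using \<phi> that theI'[OF collapse[OF Y that(1)]] by (auto simp: \<psi>_def)
  have \<psi>n: "\<psi> d (rs X h x) = rs Y h (\<psi> c x)" if h: "h \<in> hom C d c" and x: "x \<in> el X c" for h d c x
  proof (cases "inh d")
    case True
    then show ?thesis using nat[of h d c x] h x inh_cod[OF h True] by (simp add: \<psi>_def st_def)
  next
    case False
    then show ?thesis using collapse[OF Y _ False] \<psi> x hom_obj[OF C h] rs_el_hom[OF _ h] X Y by blast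
  qed
  define \<eta> where "\<eta> = \<lparr>nt_dom = on_obj \<Phi> X, nt_cod = on_obj \<Phi> Y,
    nt_at = (\<lambda>c \<in> Obj C. \<lparr>sm_dom = el X c, sm_cod = el Y c, sm_fun = restrict (\<psi> c) (el X c)\<rparr>)\<rparr>"
  have sm: "small (el X c)" "small (el Y c)" if "c \<in> Obj C" for c
    using sheaf_functor(1)[OF \<Phi>_sheaf that] X Y by (simp_all add: el_def)
  have at: "nt_at \<eta> c \<in> hom SET (el X c) (el Y c)" if "c \<in> Obj C" for c
    using sm[OF that] \<psi>[OF that] by (simp add: \<eta>_def that SET_homI)
  have at': "sm_fun (nt_at \<eta> c) x = \<psi> c x" if "c \<in> Obj C" "x \<in> el X c" for c x
    using that by (simp add: \<eta>_def)
  have "Comp SET (nt_at \<eta> (Dom C h)) (on_arr (on_obj \<Phi> X) h) =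
     Comp SET (on_arr (on_obj \<Phi> Y) h) (nt_at \<eta> (Cod C h))" if hA: "h \<in> Arr C" for h
  proof -
    define d c where "d = Dom C h" and "c = Cod C h"
    have h: "h \<in> hom C d c" using hA by (simp add: d_def c_def in_hom)
    note o = hom_obj[OF C h]
    have hX: "on_arr (on_obj \<Phi> X) h \<in> hom SET (el X c) (el X d)"
      and hY: "on_arr (on_obj \<Phi> Y) h \<in> hom SET (el Y c) (el Y d)"
      using sheaf_functor(2)[OF \<Phi>_sheaf h] X Y by (auto simp: el_def)
    have "Comp SET (nt_at \<eta> d) (on_arr (on_obj \<Phi> X) h) = Comp SET (on_arr (on_obj \<Phi> Y) h) (nt_at \<eta> c)"
    proof (rule SET_ext[OF SET_comp_hom[OF hX at[OF o(1)]] SET_comp_hom[OF at[OF o(2)] hY]])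
      fix x assume x: "x \<in> el X c"
      show "sm_fun (Comp SET (nt_at \<eta> d) (on_arr (on_obj \<Phi> X) h)) x =
         sm_fun (Comp SET (on_arr (on_obj \<Phi> Y) h) (nt_at \<eta> c)) x"
        using \<psi>n[OF h x] at'[OF o(1) SET_fun_in[OF hX x]] at'[OF o(2) x]
        by (simp add: SET_comp_fun[OF hX x] SET_comp_fun[OF at[OF o(2)] x] rs_def)
    qed
    then show ?thesis by (simp add: d_def c_def)
  qed
  moreover have "nt_at \<eta> \<in> (\<Pi>\<^sub>E c \<in> Obj C. hom SET (el X c) (el Y c))"
    using at by (auto simp: \<eta>_def)
  ultimately have "\<eta> \<in> hom (sheaves C J) (on_obj \<Phi> X) (on_obj \<Phi> Y)"
    using \<Phi>_sheaf X Y by (simp add: sheaves_hom el_def \<eta>_def)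
  then have "\<eta> \<in> on_arr \<Phi> ` hom E X Y"
    using \<Phi>_full[OF X Y] by (simp add: bij_betw_def)
  then obtain f where f: "f \<in> hom E X Y" "on_arr \<Phi> f = \<eta>" by blast
  show ?thesis
    using that[OF f(1)] at' inh_obj by (simp add: ap_def f(2) \<psi>_def)
qed

text \<open>The principle of unique description: a relation that is stable, single-valued and
  locally total is contained in the graph of an arrow. At each section the local values are glued,
  and separatedness gives naturality.\<close>

lemma arrow_of_graph:
  assumes X: "X \<in> Obj E" and Y: "Y \<in> Obj E"
    and V: "\<And>c x y. inh c \<Longrightarrow> x \<in> el X c \<Longrightarrow> G c x y \<Longrightarrow> y \<in> el Y c"
    and stable: "\<And>c d h x y. h \<in> st d c \<Longrightarrow> x \<in> el X c \<Longrightarrow> G c x y \<Longrightarrow> G d (rs X h x) (rs Y h y)"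
    and uniq: "\<And>c x y z. inh c \<Longrightarrow> x \<in> el X c \<Longrightarrow> G c x y \<Longrightarrow> G c x z \<Longrightarrow> y = z"
    and L: "\<And>c x. inh c \<Longrightarrow> x \<in> el X c \<Longrightarrow> loc c (\<lambda>d h. \<exists>y. G d (rs X h x) y)"
  obtains f where "f \<in> hom E X Y" "\<And>c x y. inh c \<Longrightarrow> x \<in> el X c \<Longrightarrow> G c x y \<Longrightarrow> ap f c x = y"
proof -
  have ex: "\<exists>y \<in> el Y c. \<forall>d h z. h \<in> st d c \<longrightarrow> G d (rs X h x) z \<longrightarrow> rs Y h y = z"
    if c: "inh c" and x: "x \<in> el X c" for c x
  proof -
    have 1: "z \<in> el Y d" if "h \<in> st d c" "G d (rs X h x) z" for d h z
      using V[OF st_inh[OF that(1)] rs_el[OF X that(1) x] that(2)] .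
    have 2: "G e (rs X (f \<odot> g) x) (rs Y g y)" if "f \<in> st d c" "g \<in> st e d" "G d (rs X f x) y" for d e f g y
      using stable[OF that(2) rs_el[OF X that(1) x] that(3)] rs_comp[OF X that(1,2) x] by simp
    have 3: "y = z" if "f \<in> st d c" "G d (rs X f x) y" "G d (rs X f x) z" for d f y z
      using uniq[OF st_inh[OF that(1)] rs_el[OF X that(1) x] that(2,3)] .
    obtain y where "y \<in> el Y c" "\<And>d f z. f \<in> st d c \<Longrightarrow> G d (rs X f x) z \<Longrightarrow> rs Y f y = z"
      by (rule glue[OF Y c, of "\<lambda>d h y. G d (rs X h x) y"]) (use 1 2 3 L[OF c x] in blast)+
    then show ?thesis by blast
  qed
  define \<phi> where "\<phi> c x = (SOME y. y \<in> el Y c \<and> (\<forall>d h z. h \<in> st d c \<longrightarrow> G d (rs X h x) z \<longrightarrow> rs Y h y = z))" for c x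
  have \<phi>: "\<phi> c x \<in> el Y c \<and> (\<forall>d h z. h \<in> st d c \<longrightarrow> G d (rs X h x) z \<longrightarrow> rs Y h (\<phi> c x) = z)"
    if "inh c" "x \<in> el X c" for c x
    unfolding \<phi>_def by (rule someI_ex) (use ex[OF that] in blast)
  have nat: "\<phi> d (rs X h x) = rs Y h (\<phi> c x)" if h: "h \<in> st d c" and x: "x \<in> el X c" for h d c x
  proof (rule sep[OF Y st_inh[OF h]])
    note hx = rs_el[OF X h x]
    show "\<phi> d (rs X h x) \<in> el Y d" using \<phi> st_inh[OF h] hx by blast
    show "rs Y h (\<phi> c x) \<in> el Y d" using \<phi> st_inh'[OF h] x rs_el[OF Y h] by blast
    show "loc d (\<lambda>e f. rs Y f (\<phi> d (rs X h x)) = rs Y f (rs Y h (\<phi> c x)))"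
    proof (rule loc_mono[OF L[OF st_inh[OF h] hx]])
      fix e f assume f: "f \<in> st e d" "\<exists>y. G e (rs X f (rs X h x)) y"
      then obtain y where y: "G e (rs X f (rs X h x)) y" by blast
      then have "rs Y f (\<phi> d (rs X h x)) = y" using \<phi>[OF st_inh[OF h] hx] f by blast
      moreover have "rs Y (h \<odot> f) (\<phi> c x) = y"
        using \<phi>[OF st_inh'[OF h] x] y rs_comp[OF X h f(1) x] st_comp[OF h f(1)] by auto
      ultimately show "rs Y f (\<phi> d (rs X h x)) = rs Y f (rs Y h (\<phi> c x))"
        using rs_comp[OF Y h f(1)] \<phi> st_inh'[OF h] x by auto
    qed
  qed
  obtain f where f: "f \<in> hom E X Y" "\<And>c x. inh c \<Longrightarrow> x \<in> el X c \<Longrightarrow> ap f c x = \<phi> c x"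
    by (rule arrow_of_family[OF X Y, of \<phi>]) (use \<phi> nat in blast)+
  have "ap f c x = y" if "inh c" "x \<in> el X c" "G c x y" for c x y
  proof -
    have "rs Y (Id C c) (\<phi> c x) = y" using \<phi>[OF that(1,2)] st_id[OF that(1)] rs_id[OF X that(1,2)] that(3) by auto
    then show ?thesis using f(2)[OF that(1,2)] rs_id[OF Y that(1)] \<phi>[OF that(1,2)] by simp
  qed
  then show ?thesis using that f(1) by blast
qed

end

section \<open>Objects of the topos from sheaf data given at the inhabited stages\<close>

context topos
begin

lemma st_dom: "h \<in> st d c \<Longrightarrow> Dom C h = d" "h \<in> st d c \<Longrightarrow> Cod C h = c"
  by (auto simp: st_def in_hom)

lemma sheaves_comp_at:
  assumes "f \<in> hom (sheaves C J) F G" "g \<in> hom (sheaves C J) G H" "c \<in> Obj C" "x \<in> on_obj F c"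
  shows "sm_fun (nt_at (Comp (sheaves C J) g f) c) x = sm_fun (nt_at g c) (sm_fun (nt_at f c) x)"
proof -
  have "nt_at f c \<in> hom SET (on_obj F c) (on_obj G c)" using assms by (auto simp: sheaves_hom)
  then show ?thesis using assms(3,4)
    by (simp add: sheaves_def full_subcategory_def functor_category_def opposite_simps SET_comp_fun)
qed

lemma sheaves_id_at:
  assumes "c \<in> Obj C" "x \<in> on_obj F c"
  shows "sm_fun (nt_at (Id (sheaves C J) F) c) x = x"
  using assms by (simp add: sheaves_def full_subcategory_def functor_category_def opposite_simps SET_id_fun)

text \<open>The source of all new objects: essential surjectivity of \<open>\<Phi>\<close>, for
  sheaves that are specified only at inhabited stages and whose values may have any type. The map
  \<open>en\<close> names the sections of the resulting object.\<close>

lemma represent: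
  fixes P :: "'u \<Rightarrow> 'x set" and r :: "'u \<Rightarrow> 'x \<Rightarrow> 'x"
  assumes sml: "\<And>c. inh c \<Longrightarrow> sml ty (P c)"
    and r: "\<And>c d h x. h \<in> st d c \<Longrightarrow> x \<in> P c \<Longrightarrow> r h x \<in> P d"
    and r_id: "\<And>c x. inh c \<Longrightarrow> x \<in> P c \<Longrightarrow> r (Id C c) x = x"
    and r_comp: "\<And>c d e h g x. h \<in> st d c \<Longrightarrow> g \<in> st e d \<Longrightarrow> x \<in> P c \<Longrightarrow> r (h \<odot> g) x = r g (r h x)"
    and sep: "\<And>c x y. inh c \<Longrightarrow> x \<in> P c \<Longrightarrow> y \<in> P c \<Longrightarrow> loc c (\<lambda>d f. r f x = r f y) \<Longrightarrow> x = y"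
    and glue: "\<And>c S x. inh c \<Longrightarrow> S \<in> J c \<Longrightarrow> (\<And>d f. f \<in> st d c \<Longrightarrow> f \<in> S \<Longrightarrow> x f \<in> P d) \<Longrightarrow>
      (\<And>d f e g. f \<in> st d c \<Longrightarrow> f \<in> S \<Longrightarrow> g \<in> st e d \<Longrightarrow> r g (x f) = x (f \<odot> g)) \<Longrightarrow>
      \<exists>y \<in> P c. \<forall>d. \<forall>f \<in> st d c. f \<in> S \<longrightarrow> r f y = x f"
  obtains M en where "M \<in> Obj E" "\<And>c. inh c \<Longrightarrow> bij_betw (en c) (P c) (el M c)"
    "\<And>c d h x. h \<in> st d c \<Longrightarrow> x \<in> P c \<Longrightarrow> rs M h (en c x) = en d (r h x)"
proof -
  have "\<exists>e :: 'x \<Rightarrow> 'u. inh c \<longrightarrow> inj_on e (P c) \<and> small (e ` P c)" for c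
    using sml_encode[OF sml[of c]] by metis
  then obtain e :: "'u \<Rightarrow> 'x \<Rightarrow> 'u" where e: "\<And>c. inh c \<Longrightarrow> inj_on (e c) (P c)" "\<And>c. inh c \<Longrightarrow> small (e c ` P c)"
    by metis
  \<comment> \<open>A sheaf must have exactly one section at an uninhabited stage, so the singleton
    of \<open>undefined\<close> is put there.\<close>
  define Q where "Q c = (if inh c then e c ` P c else {undefined})" for c
  define de where "de c = inv_into (P c) (e c)" for c
  have de: "x \<in> P c \<Longrightarrow> inh c \<Longrightarrow> de c (e c x) = x" for x c by (simp add: de_def inv_into_f_f e(1))
  have de': "y \<in> Q c \<Longrightarrow> inh c \<Longrightarrow> de c y \<in> P c \<and> e c (de c y) = y" for y c
  proof -
    assume "y \<in> Q c" "inh c"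
    then obtain x where x: "x \<in> P c" "y = e c x" by (auto simp: Q_def)
    then show "de c y \<in> P c \<and> e c (de c y) = y" using de[OF x(1) \<open>inh c\<close>] by simp
  qed
  have eQ: "x \<in> P c \<Longrightarrow> inh c \<Longrightarrow> e c x \<in> Q c" for x c by (simp add: Q_def)
  have nQ: "\<not> inh c \<Longrightarrow> y \<in> Q c \<longleftrightarrow> y = undefined" for c y by (simp add: Q_def)
  define \<rho> where "\<rho> h y = (if inh (Dom C h) then e (Dom C h) (r h (de (Cod C h) y)) else undefined)" for h y
  have \<rho>1: "\<rho> h (e c x) = e d (r h x)" if "h \<in> st d c" "x \<in> P c" for h d c x
    using st_dom[OF that(1)] st_inh[OF that(1)] de[OF that(2) st_inh'[OF that(1)]] by (simp add: \<rho>_def)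
  have \<rho>2: "\<rho> h y = undefined" if "h \<in> hom C d c" "\<not> inh d" for h d c y
    using that by (auto simp: \<rho>_def in_hom)
  have \<rho>Q: "\<rho> h y \<in> Q d" if "h \<in> hom C d c" "y \<in> Q c" for h d c y
  proof (cases "inh d")
    case True
    then have h: "h \<in> st d c" using that by (simp add: st_def)
    note y = de'[OF that(2) st_inh'[OF h]]
    show ?thesis using \<rho>1[OF h, of "de c y"] y r[OF h, of "de c y"] True by (auto simp: Q_def)
  qed (use that \<rho>2 in \<open>auto simp: Q_def\<close>)
  have smQ: "small (Q c)" for c
    using e(2) sml_finite[of "{undefined :: 'u}"] by (simp add: Q_def small_def)
  define F where "F = \<lparr>on_obj = Q, on_arr = (\<lambda>h. \<lparr>sm_dom = Q (Cod C h), sm_cod = Q (Dom C h),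
     sm_fun = restrict (\<rho> h) (Q (Cod C h))\<rparr>)\<rparr>"
  have Farr: "on_arr F h \<in> hom SET (Q c) (Q d)" if "h \<in> hom C d c" for h d c
  proof -
    have "Dom C h = d" "Cod C h = c" using that by (auto simp: in_hom)
    then show ?thesis using \<rho>Q[OF that] smQ by (simp add: F_def SET_homI)
  qed
  have Fap: "sm_fun (on_arr F h) y = \<rho> h y" if "h \<in> hom C d c" "y \<in> Q c" for h d c y
    using that by (auto simp: F_def in_hom)
  have \<rho>id: "\<rho> (Id C c) y = y" if "c \<in> Obj C" "y \<in> Q c" for c y
  proof (cases "inh c")
    case True
    then show ?thesis using \<rho>1[OF st_id[OF True], of "de c y"] de'[OF that(2) True] r_id by simp
  qed (use that \<rho>2[OF id_in_hom[OF C]] in \<open>auto simp: nQ\<close>)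
  have \<rho>comp: "\<rho> (h \<odot> g) y = \<rho> g (\<rho> h y)" if h: "h \<in> hom C d c" and g: "g \<in> hom C b d" and y: "y \<in> Q c" for h g d b c y
  proof (cases "inh b")
    case True
    then have gs: "g \<in> st b d" using g by (simp add: st_def)
    then have hs: "h \<in> st d c" using h st_inh'[OF gs] by (simp add: st_def)
    note y' = de'[OF y st_inh'[OF hs]]
    have "\<rho> (h \<odot> g) y = e b (r (h \<odot> g) (de c y))" using \<rho>1[OF st_comp[OF hs gs], of "de c y"] y' by simp
    also have "\<dots> = e b (r g (r h (de c y)))" using r_comp[OF hs gs] y' by simp
    also have "\<dots> = \<rho> g (e d (r h (de c y)))" using \<rho>1[OF gs] r[OF hs] y' by simp
    also have "e d (r h (de c y)) = \<rho> h y" using \<rho>1[OF hs, of "de c y"] y' by simp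
    finally show ?thesis .
  next
    case False
    then show ?thesis using \<rho>2[OF g] \<rho>2[OF comp_in_hom[OF C g h]] by simp
  qed
  have Ffun: "is_functor (opposite C) SET F"
  proof -
    have oh: "hom (opposite C) X Y = hom C Y X" for X Y by (auto simp: hom_def opposite_simps)
    have 1: "is_category (opposite C)"
      unfolding is_category_def opposite_simps oh
    proof (intro conjI ballI impI)
      fix f g h assume "f \<in> Arr C" "g \<in> Arr C" "h \<in> Arr C" "Cod C g = Dom C f \<and> Cod C h = Dom C g"
      then show "f \<odot> g \<odot> h = (f \<odot> g) \<odot> h"
        using comp_assoc[OF C, of h "Dom C h" "Dom C g" g "Dom C f" f "Cod C f"] by (simp add: in_hom)
    next
      fix f g assume "f \<in> Arr C" "g \<in> Arr C" "Cod C g = Dom C f"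
      then show "f \<odot> g \<in> hom C (Dom C g) (Cod C f)"
        using comp_in_hom[OF C, of g "Dom C g" "Dom C f" f "Cod C f"] by (simp add: in_hom)
    next
      fix f assume "f \<in> Arr C"
      then have f: "f \<in> hom C (Dom C f) (Cod C f)" by (simp add: in_hom)
      show "Cod C f \<in> Obj C" "Dom C f \<in> Obj C" using hom_obj[OF C f] by auto
      show "Id C (Cod C f) \<odot> f = f" "f \<odot> Id C (Dom C f) = f" using comp_id[OF C f] by auto
    next
      fix X assume "X \<in> Obj C" then show "Id C X \<in> hom C X X" by (rule id_in_hom[OF C])
    qed
    have 2: "\<forall>X \<in> Obj C. on_obj F X \<in> Obj SET \<and> on_arr F (Id C X) = Id SET (on_obj F X)"
    proof (intro ballI conjI)
      fix X assume X: "X \<in> Obj C"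
      show "on_obj F X \<in> Obj SET" using smQ by (simp add: F_def SET_def)
      have "on_arr F (Id C X) = Id SET (Q X)"
        by (rule SET_ext[OF Farr[OF id_in_hom[OF C X]] SET_id_hom[OF smQ]])
          (simp add: Fap[OF id_in_hom[OF C X]] \<rho>id[OF X] SET_id_fun)
      then show "on_arr F (Id C X) = Id SET (on_obj F X)" by (simp add: F_def)
    qed
    have 3: "\<forall>f \<in> Arr C. on_arr F f \<in> hom SET (on_obj F (Cod C f)) (on_obj F (Dom C f))"
      using Farr by (auto simp: in_hom F_def)
    have 4: "\<forall>f \<in> Arr C. \<forall>g \<in> Arr C. Cod C g = Dom C f \<longrightarrow> on_arr F (f \<odot> g) = Comp SET (on_arr F g) (on_arr F f)"
    proof (intro ballI impI)
      fix f g assume "f \<in> Arr C" "g \<in> Arr C" "Cod C g = Dom C f"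
      then have f: "f \<in> hom C (Dom C f) (Cod C f)" and g: "g \<in> hom C (Dom C g) (Dom C f)" by (auto simp: in_hom)
      show "on_arr F (f \<odot> g) = Comp SET (on_arr F g) (on_arr F f)"
      proof (rule SET_ext[OF Farr[OF comp_in_hom[OF C g f]] SET_comp_hom[OF Farr[OF f] Farr[OF g]]])
        fix y assume y: "y \<in> Q (Cod C f)"
        show "sm_fun (on_arr F (f \<odot> g)) y = sm_fun (Comp SET (on_arr F g) (on_arr F f)) y"
          by (simp add: SET_comp_fun[OF Farr[OF f] y] Fap[OF f y] Fap[OF g \<rho>Q[OF f y]]
              Fap[OF comp_in_hom[OF C g f] y] \<rho>comp[OF f g y])
      qed
    qed
    show ?thesis unfolding is_functor_def opposite_simps
      using 1 2 3 4 SET_category by (intro conjI) assumption+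
  qed
  have Fsheaf: "is_sheaf C J F"
    unfolding is_sheaf_def
  proof (intro conjI ballI allI impI Ffun)
    fix c S x
    assume c: "c \<in> Obj C" and S: "S \<in> J c"
      and x: "(\<forall>f\<in>S. x f \<in> on_obj F (Dom C f)) \<and>
        (\<forall>f\<in>S. \<forall>g\<in>Arr C. Cod C g = Dom C f \<longrightarrow> sm_fun (on_arr F g) (x f) = x (f \<odot> g))"
    have hc: "f \<in> hom C (Dom C f) c" if "f \<in> S" for f
      using J_sieve[OF c S] that by (auto simp: sieves_def in_hom)
    have xQ: "x f \<in> Q (Dom C f)" if "f \<in> S" for f using x that by (simp add: F_def)
    have xr: "\<rho> g (x f) = x (f \<odot> g)" if "f \<in> S" "g \<in> hom C d (Dom C f)" for f g d
    proof -
      have "sm_fun (on_arr F g) (x f) = x (f \<odot> g)" using x that by (auto simp: in_hom)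
      then show ?thesis using Fap[OF that(2) xQ[OF that(1)]] by simp
    qed
    have "\<exists>!y. y \<in> Q c \<and> (\<forall>f\<in>S. \<rho> f y = x f)"
    proof (cases "inh c")
      case False
      have "\<not> inh (Dom C f)" if "f \<in> S" for f using hc[OF that] inh_cod False by blast
      then have "\<rho> f y = x f" if "f \<in> S" for f y using xQ \<rho>2[OF hc[OF that]] nQ that by metis
      then show ?thesis using nQ[OF False] by auto
    next
      case True
      have 1: "de d (x f) \<in> P d" "e d (de d (x f)) = x f" if "f \<in> st d c" "f \<in> S" for d f
        using de'[OF _ st_inh[OF that(1)], of "x f"] xQ[OF that(2)] that(1) by (auto simp: st_def in_hom)
      have 2: "r g (de d (x f)) = de b (x (f \<odot> g))" if f: "f \<in> st d c" "f \<in> S" and g: "g \<in> st b d" for d f b g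
      proof -
        have d: "Dom C f = d" using f(1) by (simp add: st_def in_hom)
        have "e b (r g (de d (x f))) = \<rho> g (x f)" using \<rho>1[OF g 1(1)[OF f]] 1(2)[OF f] by simp
        also have "\<dots> = x (f \<odot> g)" using xr[OF f(2)] st_hom[OF g] d by auto
        finally have "de b (e b (r g (de d (x f)))) = de b (x (f \<odot> g))" by simp
        then show ?thesis using de[OF r[OF g 1(1)[OF f]] st_inh[OF g]] by simp
      qed
      have "\<exists>y\<in>P c. \<forall>d. \<forall>f\<in>st d c. f \<in> S \<longrightarrow> r f y = de (Dom C f) (x f)"
      proof (rule glue[OF True S])
        show "de (Dom C f) (x f) \<in> P d" if "f \<in> st d c" "f \<in> S" for d f
          using 1(1)[OF that] st_dom[OF that(1)] by simp
        show "r g (de (Dom C f) (x f)) = de (Dom C (f \<odot> g)) (x (f \<odot> g))"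
          if "f \<in> st d c" "f \<in> S" "g \<in> st b d" for d f b g
          using 2[OF that] st_dom[OF that(1)] st_dom[OF st_comp[OF that(1,3)]] by simp
      qed
      then obtain y where y: "y \<in> P c" "\<And>d f. f \<in> st d c \<Longrightarrow> f \<in> S \<Longrightarrow> r f y = de d (x f)"
        using st_dom by metis
      have "\<rho> f (e c y) = x f" if f: "f \<in> S" for f
      proof (cases "inh (Dom C f)")
        case True
        then have fs: "f \<in> st (Dom C f) c" using hc[OF f] by (simp add: st_def)
        show ?thesis using \<rho>1[OF fs y(1)] y(2)[OF fs f] 1[OF fs f] by simp
      next
        case False
        then show ?thesis using \<rho>2[OF hc[OF f]] xQ[OF f] nQ by auto
      qed
      moreover have "z = e c y" if z: "z \<in> Q c" "\<forall>f\<in>S. \<rho> f z = x f" for z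
      proof -
        note z' = de'[OF z(1) True]
        have "de c z = y"
        proof (rule sep[OF True _ y(1)])
          show "loc c (\<lambda>d f. r f (de c z) = r f y)"
          proof (rule loc_mono[OF loc_J[OF S]])
            fix d f assume f: "f \<in> st d c" "f \<in> S"
            have "e d (r f (de c z)) = x f" using \<rho>1[OF f(1), of "de c z"] z' z(2) f(2) by simp
            then have "de d (e d (r f (de c z))) = de d (x f)" by simp
            then show "r f (de c z) = r f y" using de[OF r[OF f(1)] st_inh[OF f(1)]] z' y(2)[OF f] by simp
          qed
        qed (use z' in blast)
        then show ?thesis using z' by simp
      qed
      ultimately show ?thesis using eQ[OF y(1) True] by blast
    qed
    moreover have "sm_fun (on_arr F f) y = \<rho> f y" if "f \<in> S" "y \<in> Q c" for f y
      using Fap[OF hc[OF that(1)] that(2)] .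
    ultimately show "\<exists>!y. y \<in> on_obj F c \<and> (\<forall>f\<in>S. sm_fun (on_arr F f) y = x f)"
      by (simp add: F_def cong: conj_cong)
  qed
  then have "F \<in> Obj (sheaves C J)" by (simp add: sheaves_Obj)
  then obtain M g where M: "M \<in> Obj E" and g: "g \<in> hom (sheaves C J) (on_obj \<Phi> M) F" and iso: "is_iso (sheaves C J) g"
    using \<Phi>_surj by blast
  obtain k where k: "k \<in> hom (sheaves C J) F (on_obj \<Phi> M)"
    "Comp (sheaves C J) k g = Id (sheaves C J) (on_obj \<Phi> M)" "Comp (sheaves C J) g k = Id (sheaves C J) F"
    using iso g by (auto simp: is_iso_def in_hom)
  define en where "en c x = sm_fun (nt_at k c) (e c x)" for c x
  have kb: "bij_betw (sm_fun (nt_at k c)) (Q c) (el M c)" if c: "c \<in> Obj C" for c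
  proof (rule bij_betw_byWitness[where f' = "sm_fun (nt_at g c)"])
    show "\<forall>x\<in>Q c. sm_fun (nt_at g c) (sm_fun (nt_at k c) x) = x"
      using sheaves_comp_at[OF k(1) g c] sheaves_id_at[OF c, of _ F] k(3) by (simp add: F_def)
    show "\<forall>x\<in>el M c. sm_fun (nt_at k c) (sm_fun (nt_at g c) x) = x"
      using sheaves_comp_at[OF g k(1) c] sheaves_id_at[OF c, of _ "on_obj \<Phi> M"] k(2) by (simp add: el_def)
    show "sm_fun (nt_at k c) ` Q c \<subseteq> el M c" "sm_fun (nt_at g c) ` el M c \<subseteq> Q c"
      using k(1) g c unfolding sheaves_hom by (auto simp: F_def el_def PiE_iff hom_SET)
  qed
  have "bij_betw (en c) (P c) (el M c)" if "inh c" for c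
  proof -
    have "bij_betw (e c) (P c) (Q c)" using e(1)[OF that] that by (simp add: bij_betw_def Q_def)
    then show ?thesis using bij_betw_trans[OF _ kb[OF inh_obj[OF that]]] by (simp add: en_def[abs_def] comp_def)
  qed
  moreover have "rs M h (en c x) = en d (r h x)" if h: "h \<in> st d c" and x: "x \<in> P c" for h d c x
  proof -
    have "\<forall>f \<in> Arr C. Comp SET (nt_at k (Dom C f)) (on_arr F f) = Comp SET (on_arr (on_obj \<Phi> M) f) (nt_at k (Cod C f))"
      using k(1) unfolding sheaves_hom by blast
    then have *: "Comp SET (nt_at k d) (on_arr F h) = Comp SET (on_arr (on_obj \<Phi> M) h) (nt_at k c)"
      using st_hom[OF h] by (auto simp: in_hom)
    have kc: "nt_at k c \<in> hom SET (Q c) (el M c)"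
      using k(1) inh_obj[OF st_inh'[OF h]] unfolding sheaves_hom by (auto simp: F_def el_def)
    have ex: "e c x \<in> Q c" using eQ[OF x st_inh'[OF h]] .
    have "sm_fun (Comp SET (on_arr (on_obj \<Phi> M) h) (nt_at k c)) (e c x) = rs M h (en c x)"
      using SET_comp_fun[OF kc ex] by (simp add: rs_def en_def)
    moreover have "sm_fun (Comp SET (nt_at k d) (on_arr F h)) (e c x) = en d (r h x)"
      using SET_comp_fun[OF Farr[OF st_hom[OF h]] ex] Fap[OF st_hom[OF h] ex] \<rho>1[OF h x] by (simp add: en_def)
    ultimately show ?thesis using * by simp
  qed
  ultimately show ?thesis using that M by blast
qed

text \<open>A condition on families of sections that is stable and of local character cuts a
  subsheaf out of a finite product; gluing is done entry by entry.\<close>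

lemma represent_PiE:
  fixes X :: "'k \<Rightarrow> 'o"
  assumes K: "finite K" and X: "\<And>k. k \<in> K \<Longrightarrow> X k \<in> Obj E"
    and stable: "\<And>c d h x. h \<in> st d c \<Longrightarrow> x \<in> (\<Pi>\<^sub>E k\<in>K. el (X k) c) \<Longrightarrow> Q c x \<Longrightarrow> Q d (\<lambda>k\<in>K. rs (X k) h (x k))"
    and local: "\<And>c x. inh c \<Longrightarrow> x \<in> (\<Pi>\<^sub>E k\<in>K. el (X k) c) \<Longrightarrow> loc c (\<lambda>d h. Q d (\<lambda>k\<in>K. rs (X k) h (x k))) \<Longrightarrow> Q c x"
  obtains M en where "M \<in> Obj E"
    "\<And>c. inh c \<Longrightarrow> bij_betw (en c) {x \<in> (\<Pi>\<^sub>E k\<in>K. el (X k) c). Q c x} (el M c)"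
    "\<And>c d h x. h \<in> st d c \<Longrightarrow> x \<in> (\<Pi>\<^sub>E k\<in>K. el (X k) c) \<Longrightarrow> Q c x \<Longrightarrow> rs M h (en c x) = en d (\<lambda>k\<in>K. rs (X k) h (x k))"
proof -
  let ?P = "\<lambda>c. {x \<in> (\<Pi>\<^sub>E k\<in>K. el (X k) c). Q c x}"
  let ?r = "\<lambda>h x. (\<lambda>k\<in>K. rs (X k) h (x k))"
  obtain M en where "M \<in> Obj E" "\<And>c. inh c \<Longrightarrow> bij_betw (en c) (?P c) (el M c)"
    "\<And>c d h x. h \<in> st d c \<Longrightarrow> x \<in> ?P c \<Longrightarrow> rs M h (en c x) = en d (?r h x)"
  proof (rule represent[of ?P ?r])
    show "sml ty (?P c)" if "inh c" for c
      using sml_subset[OF _ sml_PiE[OF sml_finite[OF K]], of "?P c" "\<lambda>k. el (X k) c"] sml_el[OF X that] by auto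
    show "?r h x \<in> ?P d" if "h \<in> st d c" "x \<in> ?P c" for c d h x
      using that stable[of h d c x] rs_el[OF X that(1)] by auto
    show "?r (Id C c) x = x" if "inh c" "x \<in> ?P c" for c x
      using that rs_id[OF X] by (intro PiE_ext[of _ K "\<lambda>k. el (X k) c"]) (auto simp: PiE_iff)
    show "?r (h \<odot> g) x = ?r g (?r h x)" if "h \<in> st d c" "g \<in> st e d" "x \<in> ?P c" for c d e h g x
      using that rs_comp[OF X that(1,2)] by (intro restrict_ext) auto
    show "x = y" if c: "inh c" and x: "x \<in> ?P c" and y: "y \<in> ?P c" and L: "loc c (\<lambda>d f. ?r f x = ?r f y)" for c x y
    proof (rule PiE_ext[of _ K "\<lambda>k. el (X k) c"])
      fix k assume k: "k \<in> K"
      show "x k = y k"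
      proof (rule sep[OF X[OF k] c])
        show "loc c (\<lambda>d f. rs (X k) f (x k) = rs (X k) f (y k))"
          by (rule loc_mono[OF L]) (drule fun_cong[of _ _ k], use k in simp)
      qed (use x y k in auto)
    qed (use x y in auto)
    show "\<exists>y\<in>?P c. \<forall>d. \<forall>f\<in>st d c. f \<in> S \<longrightarrow> ?r f y = x f"
      if c: "inh c" and S: "S \<in> J c" and x: "\<And>d f. f \<in> st d c \<Longrightarrow> f \<in> S \<Longrightarrow> x f \<in> ?P d"
        and xr: "\<And>d f e g. f \<in> st d c \<Longrightarrow> f \<in> S \<Longrightarrow> g \<in> st e d \<Longrightarrow> ?r g (x f) = x (f \<odot> g)" for c S x
    proof -
      have "\<exists>y. y \<in> el (X k) c \<and> (\<forall>d. \<forall>f \<in> st d c. f \<in> S \<longrightarrow> rs (X k) f y = x f k)" if k: "k \<in> K" for k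
      proof -
        have 1: "x f k \<in> el (X k) d" if "f \<in> st d c" "f \<in> S" for d f using x[OF that] k by auto
        have 2: "rs (X k) g (x f k) = x (f \<odot> g) k" if "f \<in> st d c" "f \<in> S" "g \<in> st e d" for d f e g
          using fun_cong[OF xr[OF that], of k] k by simp
        have 3: "f \<odot> g \<in> S" if "f \<in> st d c" "f \<in> S" "g \<in> st e d" for d f e g
          using sieve_comp[OF S c that(2)] that st_hom by blast
        obtain y where "y \<in> el (X k) c" "\<And>d f z. f \<in> st d c \<Longrightarrow> f \<in> S \<and> z = x f k \<Longrightarrow> rs (X k) f y = z"
          by (rule glue[OF X[OF k] c, of "\<lambda>d f z. f \<in> S \<and> z = x f k"])
            (use 1 2 3 loc_J[OF S] in auto)
        then show ?thesis by blast
      qed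
      then obtain y where y: "\<And>k. k \<in> K \<Longrightarrow> y k \<in> el (X k) c"
        "\<And>k d f. k \<in> K \<Longrightarrow> f \<in> st d c \<Longrightarrow> f \<in> S \<Longrightarrow> rs (X k) f (y k) = x f k" by metis
      have r: "?r f (restrict y K) = x f" if "f \<in> st d c" "f \<in> S" for d f
        using y(2)[OF _ that] x[OF that] by (intro PiE_ext[of _ K "\<lambda>k. el (X k) d"]) auto
      have P: "restrict y K \<in> (\<Pi>\<^sub>E k\<in>K. el (X k) c)" using y by auto
      have "Q c (restrict y K)"
        by (rule local[OF c P], rule loc_mono[OF loc_J[OF S]]) (use r x in auto)
      then show ?thesis using P r by blast
    qed
  qed blast
  then show ?thesis using that[of M en] by auto
qed

end

context topos
begin

section \<open>Finite limits\<close>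

text \<open>The subobject of a finite product that is cut out by \<open>Q\<close>, described through
  its sections. Products, pullbacks, the object of triangles and the levels of the hypercover are
  all of this form.\<close>

definition subproduct :: "'k set \<Rightarrow> ('k \<Rightarrow> 'o) \<Rightarrow> ('u \<Rightarrow> ('k \<Rightarrow> 'u) \<Rightarrow> bool) \<Rightarrow> 'o \<Rightarrow> ('k \<Rightarrow> 'a) \<Rightarrow> bool" where
  "subproduct K X Q M \<pi> \<longleftrightarrow> M \<in> Obj E \<and> (\<forall>k\<in>K. \<pi> k \<in> hom E M (X k)) \<and>
    (\<forall>c. inh c \<longrightarrow>
      (\<forall>m \<in> el M c. \<forall>n \<in> el M c. (\<forall>k\<in>K. ap (\<pi> k) c m = ap (\<pi> k) c n) \<longrightarrow> m = n) \<and>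
      (\<forall>m \<in> el M c. Q c (\<lambda>k\<in>K. ap (\<pi> k) c m)) \<and>
      (\<forall>x \<in> (\<Pi>\<^sub>E k\<in>K. el (X k) c). Q c x \<longrightarrow> (\<exists>m \<in> el M c. \<forall>k\<in>K. ap (\<pi> k) c m = x k)))"

lemma subproduct_obj: "subproduct K X Q M \<pi> \<Longrightarrow> M \<in> Obj E"
  and subproduct_pr: "subproduct K X Q M \<pi> \<Longrightarrow> k \<in> K \<Longrightarrow> \<pi> k \<in> hom E M (X k)"
  and subproduct_inj: "subproduct K X Q M \<pi> \<Longrightarrow> inh c \<Longrightarrow> m \<in> el M c \<Longrightarrow> n \<in> el M c \<Longrightarrow>
      (\<And>k. k \<in> K \<Longrightarrow> ap (\<pi> k) c m = ap (\<pi> k) c n) \<Longrightarrow> m = n"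
  and subproduct_Q: "subproduct K X Q M \<pi> \<Longrightarrow> inh c \<Longrightarrow> m \<in> el M c \<Longrightarrow> Q c (\<lambda>k\<in>K. ap (\<pi> k) c m)"
  and subproduct_ex: "subproduct K X Q M \<pi> \<Longrightarrow> inh c \<Longrightarrow> x \<in> (\<Pi>\<^sub>E k\<in>K. el (X k) c) \<Longrightarrow> Q c x \<Longrightarrow>
      \<exists>m \<in> el M c. \<forall>k\<in>K. ap (\<pi> k) c m = x k"
  unfolding subproduct_def by blast+

lemma subproduct_exists:
  fixes X :: "'k \<Rightarrow> 'o"
  assumes K: "finite K" and X: "\<And>k. k \<in> K \<Longrightarrow> X k \<in> Obj E"
    and stable: "\<And>c d h x. h \<in> st d c \<Longrightarrow> x \<in> (\<Pi>\<^sub>E k\<in>K. el (X k) c) \<Longrightarrow> Q c x \<Longrightarrow> Q d (\<lambda>k\<in>K. rs (X k) h (x k))"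
    and local: "\<And>c x. inh c \<Longrightarrow> x \<in> (\<Pi>\<^sub>E k\<in>K. el (X k) c) \<Longrightarrow> loc c (\<lambda>d h. Q d (\<lambda>k\<in>K. rs (X k) h (x k))) \<Longrightarrow> Q c x"
  obtains M \<pi> where "subproduct K X Q M \<pi>"
proof -
  let ?P = "\<lambda>c. {x \<in> (\<Pi>\<^sub>E k\<in>K. el (X k) c). Q c x}"
  obtain M en where M: "M \<in> Obj E" and en: "\<And>c. inh c \<Longrightarrow> bij_betw (en c) (?P c) (el M c)"
    and rs: "\<And>c d h x. h \<in> st d c \<Longrightarrow> x \<in> (\<Pi>\<^sub>E k\<in>K. el (X k) c) \<Longrightarrow> Q c x \<Longrightarrow> rs M h (en c x) = en d (\<lambda>k\<in>K. rs (X k) h (x k))"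
    by (rule represent_PiE[of K X Q, OF K X stable local]) blast+
  define de where "de c = inv_into (?P c) (en c)" for c
  have de: "de c m \<in> ?P c" "en c (de c m) = m" if "inh c" "m \<in> el M c" for c m
    using bij_betw_inv_into[OF en[OF that(1)]] bij_betw_inv_into_right[OF en[OF that(1)]] that(2)
    unfolding de_def by (auto dest: bij_betwE)
  have de': "de c (en c x) = x" if "inh c" "x \<in> ?P c" for c x
    using bij_betw_inv_into_left[OF en[OF that(1)] that(2)] by (simp add: de_def)
  have enM: "en c x \<in> el M c" if "inh c" "x \<in> ?P c" for c x
    using bij_betwE[OF en[OF that(1)]] that(2) by blast
  have "\<exists>f \<in> hom E M (X k). \<forall>c m. inh c \<longrightarrow> m \<in> el M c \<longrightarrow> ap f c m = de c m k" if k: "k \<in> K" for k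
  proof -
    have 1: "de c m k \<in> el (X k) c" if "inh c" "m \<in> el M c" for c m
      using de(1)[OF that] k by auto
    have 2: "de d (rs M h m) k = rs (X k) h (de c m k)" if h: "h \<in> st d c" and m: "m \<in> el M c" for h d c m
    proof -
      note dm = de[OF st_inh'[OF h] m]
      have "rs M h m = en d (\<lambda>k\<in>K. rs (X k) h (de c m k))" using rs[OF h, of "de c m"] dm by simp
      moreover have "(\<lambda>k\<in>K. rs (X k) h (de c m k)) \<in> ?P d"
        using stable[OF h] dm(1) rs_el[OF X h] by auto
      ultimately show ?thesis using de'[OF st_inh[OF h]] k by simp
    qed
    obtain f where "f \<in> hom E M (X k)" "\<And>c m. inh c \<Longrightarrow> m \<in> el M c \<Longrightarrow> ap f c m = de c m k"
      by (rule arrow_of_family[OF M X[OF k], of "\<lambda>c m. de c m k"]) (use 1 2 in blast)+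
    then show ?thesis by blast
  qed
  then obtain \<pi> where \<pi>: "\<And>k. k \<in> K \<Longrightarrow> \<pi> k \<in> hom E M (X k)"
    "\<And>k c m. k \<in> K \<Longrightarrow> inh c \<Longrightarrow> m \<in> el M c \<Longrightarrow> ap (\<pi> k) c m = de c m k" by metis
  have \<pi>': "(\<lambda>k\<in>K. ap (\<pi> k) c m) = de c m" if "inh c" "m \<in> el M c" for c m
    using \<pi>(2)[OF _ that] de(1)[OF that] by (intro PiE_ext[of _ K "\<lambda>k. el (X k) c"]) auto
  have "subproduct K X Q M \<pi>"
    unfolding subproduct_def
  proof (intro conjI ballI allI impI M \<pi>(1))
    fix c m n assume c: "inh c" and m: "m \<in> el M c" and n: "n \<in> el M c" and eq: "\<forall>k\<in>K. ap (\<pi> k) c m = ap (\<pi> k) c n"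
    have "(\<lambda>k\<in>K. ap (\<pi> k) c m) = (\<lambda>k\<in>K. ap (\<pi> k) c n)" using eq by (intro restrict_ext) simp
    then have "de c m = de c n" using \<pi>'[OF c] m n by simp
    then show "m = n" using de(2)[OF c] m n by metis
  next
    fix c m assume "inh c" "m \<in> el M c"
    then show "Q c (\<lambda>k\<in>K. ap (\<pi> k) c m)" using \<pi>' de(1) by auto
  next
    fix c x assume c: "inh c" and x: "x \<in> (\<Pi>\<^sub>E k\<in>K. el (X k) c)" "Q c x"
    have "en c x \<in> el M c" "\<forall>k\<in>K. ap (\<pi> k) c (en c x) = x k"
      using enM[OF c] de'[OF c] x \<pi>(2)[OF _ c] by auto
    then show "\<exists>m \<in> el M c. \<forall>k\<in>K. ap (\<pi> k) c m = x k" by blast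
  qed
  then show ?thesis by (rule that)
qed

lemma subproduct_arrow:
  assumes M: "subproduct K X Q M \<pi>" and Z: "Z \<in> Obj E"
    and f: "\<And>k. k \<in> K \<Longrightarrow> f k \<in> hom E Z (X k)"
    and Q: "\<And>c z. inh c \<Longrightarrow> z \<in> el Z c \<Longrightarrow> Q c (\<lambda>k\<in>K. ap (f k) c z)"
  shows "\<exists>!h. h \<in> hom E Z M \<and> (\<forall>k\<in>K. \<pi> k \<bullet> h = f k)"
proof -
  note Mo = subproduct_obj[OF M] and \<pi> = subproduct_pr[OF M]
  have "\<exists>m \<in> el M c. \<forall>k\<in>K. ap (\<pi> k) c m = ap (f k) c z" if "inh c" "z \<in> el Z c" for c z
    using subproduct_ex[OF M that(1), of "\<lambda>k\<in>K. ap (f k) c z"] ap_el[OF f that] Q[OF that] by auto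
  then obtain \<phi> where \<phi>: "\<And>c z. inh c \<Longrightarrow> z \<in> el Z c \<Longrightarrow> \<phi> c z \<in> el M c \<and> (\<forall>k\<in>K. ap (\<pi> k) c (\<phi> c z) = ap (f k) c z)"
    by metis
  have nat: "\<phi> d (rs Z h z) = rs M h (\<phi> c z)" if h: "h \<in> st d c" and z: "z \<in> el Z c" for h d c z
  proof (rule subproduct_inj[OF M st_inh[OF h]])
    note hz = rs_el[OF Z h z] and p = \<phi>[OF st_inh'[OF h] z]
    show "\<phi> d (rs Z h z) \<in> el M d" using \<phi>[OF st_inh[OF h] hz] by simp
    show "rs M h (\<phi> c z) \<in> el M d" using rs_el[OF Mo h] p by simp
    fix k assume k: "k \<in> K"
    show "ap (\<pi> k) d (\<phi> d (rs Z h z)) = ap (\<pi> k) d (rs M h (\<phi> c z))"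
      using \<phi>[OF st_inh[OF h] hz] p k ap_rs[OF f[OF k] h z] ap_rs[OF \<pi>[OF k] h] by simp
  qed
  obtain h where h: "h \<in> hom E Z M" "\<And>c z. inh c \<Longrightarrow> z \<in> el Z c \<Longrightarrow> ap h c z = \<phi> c z"
    by (rule arrow_of_family[OF Z Mo, of \<phi>]) (use \<phi> nat in blast)+
  have \<pi>h: "\<pi> k \<bullet> h = f k" if k: "k \<in> K" for k
    by (rule ext_stage[OF E_comp[OF h(1) \<pi>[OF k]] f[OF k]]) (use ap_comp[OF h(1) \<pi>[OF k]] h(2) \<phi> k in auto)
  have "g = h" if g: "g \<in> hom E Z M" "\<forall>k\<in>K. \<pi> k \<bullet> g = f k" for g
  proof (rule ext_stage[OF g(1) h(1)])
    fix c z assume c: "inh c" and z: "z \<in> el Z c"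
    show "ap g c z = ap h c z"
    proof (rule subproduct_inj[OF M c ap_el[OF g(1) c z] ap_el[OF h(1) c z]])
      fix k assume k: "k \<in> K"
      show "ap (\<pi> k) c (ap g c z) = ap (\<pi> k) c (ap h c z)"
        using ap_comp[OF g(1) \<pi>[OF k] c z] ap_comp[OF h(1) \<pi>[OF k] c z] g(2) k \<pi>h[OF k] by simp
    qed
  qed
  then show ?thesis using h(1) \<pi>h by blast
qed

subsection \<open>Products\<close>

lemma product_exists:
  assumes "set Xs \<subseteq> Obj E"
  obtains M \<pi> where "subproduct {..<length Xs} ((!) Xs) (\<lambda>_ _. True) M \<pi>" "is_product E Xs M \<pi>"
proof -
  obtain M \<pi> where M: "subproduct {..<length Xs} ((!) Xs) (\<lambda>_ _. True) M \<pi>"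
    by (rule subproduct_exists[of "{..<length Xs}" "(!) Xs" "\<lambda>_ _. True"]) (use assms nth_mem in auto)
  moreover have "is_product E Xs M \<pi>"
    unfolding is_product_def
  proof (intro conjI allI impI ballI)
    fix Z f assume Z: "Z \<in> Obj E" and f: "\<forall>k<length Xs. f k \<in> hom E Z (Xs ! k)"
    show "\<exists>!h. h \<in> hom E Z M \<and> (\<forall>k<length Xs. \<pi> k \<bullet> h = f k)"
      using subproduct_arrow[OF M Z, of f] f by (simp add: Ball_def)
  qed (use subproduct_obj[OF M] subproduct_pr[OF M] in auto)
  ultimately show ?thesis by (rule that)
qed

lemma product_univ:
  assumes "is_product E Xs P \<rho>" "Z \<in> Obj E" "\<And>k. k < length Xs \<Longrightarrow> f k \<in> hom E Z (Xs ! k)"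
  shows "\<exists>!h. h \<in> hom E Z P \<and> (\<forall>k<length Xs. \<rho> k \<bullet> h = f k)"
proof -
  have "\<forall>Z \<in> Obj E. \<forall>f. (\<forall>k < length Xs. f k \<in> hom E Z (Xs ! k)) \<longrightarrow>
       (\<exists>!h. h \<in> hom E Z P \<and> (\<forall>k < length Xs. \<rho> k \<bullet> h = f k))"
    using assms(1) unfolding is_product_def by (elim conjE)
  from this[THEN bspec, OF assms(2), THEN spec, of f] show ?thesis using assms(3) by blast
qed

lemma product_sub:
  assumes P: "is_product E Xs P \<rho>" and Xs: "set Xs \<subseteq> Obj E"
  shows "subproduct {..<length Xs} ((!) Xs) (\<lambda>_ _. True) P \<rho>"
proof -
  obtain M \<pi> where M: "subproduct {..<length Xs} ((!) Xs) (\<lambda>_ _. True) M \<pi>" "is_product E Xs M \<pi>"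
    using product_exists[OF Xs] .
  have Mo: "M \<in> Obj E" and \<pi>: "\<And>k. k < length Xs \<Longrightarrow> \<pi> k \<in> hom E M (Xs ! k)"
    using subproduct_obj[OF M(1)] subproduct_pr[OF M(1)] by auto
  have Po: "P \<in> Obj E" and \<rho>: "\<And>k. k < length Xs \<Longrightarrow> \<rho> k \<in> hom E P (Xs ! k)"
    using P unfolding is_product_def by simp_all
  note Pu = product_univ[OF P]
  obtain h where h: "h \<in> hom E M P" "\<And>k. k < length Xs \<Longrightarrow> \<rho> k \<bullet> h = \<pi> k"
    using Pu[OF Mo \<pi>] by blast
  obtain g where g: "g \<in> hom E P M" "\<And>k. k < length Xs \<Longrightarrow> \<pi> k \<bullet> g = \<rho> k"
    using product_univ[OF M(2) Po \<rho>] by blast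
  have "h \<bullet> g \<in> hom E P P" "\<forall>k<length Xs. \<rho> k \<bullet> (h \<bullet> g) = \<rho> k"
    using E_comp[OF g(1) h(1)] E_assoc[OF g(1) h(1) \<rho>] h(2) g(2) by auto
  moreover have "Id E P \<in> hom E P P" "\<forall>k<length Xs. \<rho> k \<bullet> Id E P = \<rho> k"
    using E_id[OF Po] E_comp_id(1)[OF \<rho>] by auto
  ultimately have hg: "h \<bullet> g = Id E P" using Pu[OF Po \<rho>] by blast
  have hgp: "ap h c (ap g c p) = p" if "inh c" "p \<in> el P c" for c p
    using ap_comp[OF g(1) h(1) that] ap_id[OF Po that] hg by simp
  have \<pi>g: "ap (\<pi> k) c (ap g c p) = ap (\<rho> k) c p" if "inh c" "p \<in> el P c" "k < length Xs" for c p k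
    using ap_comp[OF g(1) \<pi>[OF that(3)] that(1,2)] g(2)[OF that(3)] by simp
  have \<rho>h: "ap (\<rho> k) c (ap h c m) = ap (\<pi> k) c m" if "inh c" "m \<in> el M c" "k < length Xs" for c m k
    using ap_comp[OF h(1) \<rho>[OF that(3)] that(1,2)] h(2)[OF that(3)] by simp
  show ?thesis unfolding subproduct_def
  proof (intro conjI ballI allI impI Po)
    fix c m n assume c: "inh c" and m: "m \<in> el P c" and n: "n \<in> el P c"
      and eq: "\<forall>k\<in>{..<length Xs}. ap (\<rho> k) c m = ap (\<rho> k) c n"
    have "ap g c m = ap g c n"
      by (rule subproduct_inj[OF M(1) c ap_el[OF g(1) c m] ap_el[OF g(1) c n]]) (use \<pi>g c m n eq in auto)
    then show "m = n" using hgp c m n by metis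
  next
    fix c x assume c: "inh c" and x: "x \<in> (\<Pi>\<^sub>E k\<in>{..<length Xs}. el (Xs ! k) c)"
    obtain m where m: "m \<in> el M c" "\<forall>k\<in>{..<length Xs}. ap (\<pi> k) c m = x k"
      using subproduct_ex[OF M(1) c x] by auto
    then have "ap h c m \<in> el P c" "\<forall>k\<in>{..<length Xs}. ap (\<rho> k) c (ap h c m) = x k"
      using ap_el[OF h(1) c m(1)] \<rho>h[OF c m(1)] by auto
    then show "\<exists>m\<in>el P c. \<forall>k\<in>{..<length Xs}. ap (\<rho> k) c m = x k" by blast
  qed (use \<rho> in auto)
qed

lemma Prod_product:
  assumes "set Xs \<subseteq> Obj E"
  shows "is_product E Xs (Prod E Xs) (pr E Xs)"
proof (cases "\<exists>X. Xs = [X]")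
  case True
  then obtain X where X: "Xs = [X]" by blast
  have "\<exists>!h. h \<in> hom E Z X \<and> Id E X \<bullet> h = f" if "f \<in> hom E Z X" for Z f
    using E_comp_id(2) that by metis
  then show ?thesis using assms E_id by (auto simp: X Prod_def pr_def product_cone_def is_product_def)
next
  case False
  then have "product_cone E Xs = (SOME (P, \<pi>). is_product E Xs P \<pi>)"
    by (auto simp: product_cone_def split: list.split)
  moreover have "\<exists>x. (\<lambda>(P, \<pi>). is_product E Xs P \<pi>) x"
    by (rule product_exists[OF assms]) auto
  ultimately have "(\<lambda>(P, \<pi>). is_product E Xs P \<pi>) (product_cone E Xs)"
    using someI_ex[of "\<lambda>(P, \<pi>). is_product E Xs P \<pi>"] by simp
  then show ?thesis by (simp add: Prod_def pr_def split_beta)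
qed

lemmas Prod_sub = product_sub[OF Prod_product]

lemma Prod_obj: "set Xs \<subseteq> Obj E \<Longrightarrow> Prod E Xs \<in> Obj E"
  using Prod_sub subproduct_obj by blast

lemma pr_hom: "set Xs \<subseteq> Obj E \<Longrightarrow> k < length Xs \<Longrightarrow> pr E Xs k \<in> hom E (Prod E Xs) (Xs ! k)"
  using subproduct_pr[OF Prod_sub] by blast

text \<open>The notation for a tuple of sections of the chosen product. By \<open>tp_cases\<close>
  every section has this form, and projections, \<open>tup\<close> and \<open>arr_prod\<close>
  compute on it.\<close>

definition tp :: "'o list \<Rightarrow> 'u \<Rightarrow> 'u list \<Rightarrow> 'u" where
  "tp Xs c xs = (THE x. x \<in> el (Prod E Xs) c \<and> (\<forall>k<length Xs. ap (pr E Xs k) c x = xs ! k))"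

lemma tp:
  assumes Xs: "set Xs \<subseteq> Obj E" and c: "inh c" and xs: "\<And>k. k < length Xs \<Longrightarrow> xs ! k \<in> el (Xs ! k) c"
  shows tp_el: "tp Xs c xs \<in> el (Prod E Xs) c"
    and pr_tp: "\<And>k. k < length Xs \<Longrightarrow> ap (pr E Xs k) c (tp Xs c xs) = xs ! k"
proof -
  note P = Prod_sub[OF Xs Xs]
  obtain x where x: "x \<in> el (Prod E Xs) c" "\<And>k. k < length Xs \<Longrightarrow> ap (pr E Xs k) c x = xs ! k"
    using subproduct_ex[OF P c, of "\<lambda>k\<in>{..<length Xs}. xs ! k"] xs by auto
  have "\<exists>!x. x \<in> el (Prod E Xs) c \<and> (\<forall>k<length Xs. ap (pr E Xs k) c x = xs ! k)"
  proof (intro ex1I conjI)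
    fix y assume y: "y \<in> el (Prod E Xs) c \<and> (\<forall>k<length Xs. ap (pr E Xs k) c y = xs ! k)"
    show "y = x" by (rule subproduct_inj[OF P c]) (use x y in auto)
  qed (use x in auto)
  from theI'[OF this]
  show "tp Xs c xs \<in> el (Prod E Xs) c" "\<And>k. k < length Xs \<Longrightarrow> ap (pr E Xs k) c (tp Xs c xs) = xs ! k"
    by (auto simp: tp_def)
qed

lemma tp_eqI:
  assumes Xs: "set Xs \<subseteq> Obj E" and c: "inh c" and x: "x \<in> el (Prod E Xs) c"
    and "\<And>k. k < length Xs \<Longrightarrow> ap (pr E Xs k) c x = xs ! k"
  shows "x = tp Xs c xs"
proof -
  have xs: "xs ! k \<in> el (Xs ! k) c" if "k < length Xs" for k
    using assms(4)[OF that] ap_el[OF pr_hom[OF Xs that] c x] by simp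
  show ?thesis
    by (rule subproduct_inj[OF Prod_sub[OF Xs Xs] c x tp_el[OF Xs c xs]])
      (use assms(4) pr_tp[OF Xs c xs] in auto)
qed

lemma tp_cases:
  assumes Xs: "set Xs \<subseteq> Obj E" and c: "inh c" and x: "x \<in> el (Prod E Xs) c"
  shows "x = tp Xs c (map (\<lambda>k. ap (pr E Xs k) c x) [0..<length Xs])"
  by (rule tp_eqI[OF assms]) simp

lemma tup_hom_ap:
  assumes fs: "fs \<noteq> []" and f: "\<And>k. k < length fs \<Longrightarrow> fs ! k \<in> hom E Z (Xs ! k)" and len: "length Xs = length fs"
  shows tup_hom: "tup E fs \<in> hom E Z (Prod E Xs)"
    and ap_tup: "\<And>c z. inh c \<Longrightarrow> z \<in> el Z c \<Longrightarrow> ap (tup E fs) c z = tp Xs c (map (\<lambda>f. ap f c z) fs)"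
proof -
  have Xs: "Xs = map (Cod E) fs" using f len by (intro nth_equalityI) (auto simp: in_hom)
  have Z: "Dom E (hd fs) = Z" "Z \<in> Obj E"
    using f[of 0] fs E_obj(1)[of "hd fs" Z] by (auto simp: in_hom hd_conv_nth)
  have o: "set Xs \<subseteq> Obj E" using f len E_obj(2) by (fastforce simp: in_set_conv_nth)
  have "\<exists>!h. h \<in> hom E Z (Prod E Xs) \<and> (\<forall>k<length fs. pr E Xs k \<bullet> h = fs ! k)"
    using product_univ[OF Prod_product[OF o] Z(2), of "(!) fs"] f unfolding len by blast
  from theI'[OF this] have h: "tup E fs \<in> hom E Z (Prod E Xs)" "\<And>k. k < length fs \<Longrightarrow> pr E Xs k \<bullet> tup E fs = fs ! k"
    unfolding tup_def Z(1) Xs by auto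
  show "tup E fs \<in> hom E Z (Prod E Xs)" by (rule h(1))
  fix c z assume c: "inh c" and z: "z \<in> el Z c"
  show "ap (tup E fs) c z = tp Xs c (map (\<lambda>f. ap f c z) fs)"
  proof (rule tp_eqI[OF o c ap_el[OF h(1) c z]])
    fix k assume "k < length Xs"
    then show "ap (pr E Xs k) c (ap (tup E fs) c z) = map (\<lambda>f. ap f c z) fs ! k"
      using ap_comp[OF h(1) pr_hom[OF o] c z] h(2) len by simp
  qed
qed

lemma rs_tp:
  assumes Xs: "set Xs \<subseteq> Obj E" and h: "h \<in> st d c" and xs: "\<And>k. k < length Xs \<Longrightarrow> xs ! k \<in> el (Xs ! k) c"
    and len: "length xs = length Xs"
  shows "rs (Prod E Xs) h (tp Xs c xs) = tp Xs d (map2 (\<lambda>X x. rs X h x) Xs xs)"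
proof (rule tp_eqI[OF Xs st_inh[OF h]])
  have t: "tp Xs c xs \<in> el (Prod E Xs) c" "\<And>k. k < length Xs \<Longrightarrow> ap (pr E Xs k) c (tp Xs c xs) = xs ! k"
    using tp_el[OF Xs st_inh'[OF h], of xs] pr_tp[OF Xs st_inh'[OF h], of xs] xs by blast+
  show "rs (Prod E Xs) h (tp Xs c xs) \<in> el (Prod E Xs) d" using rs_el[OF Prod_obj[OF Xs] h] t(1) by blast
  fix k assume k: "k < length Xs"
  show "ap (pr E Xs k) d (rs (Prod E Xs) h (tp Xs c xs)) = map2 (\<lambda>X x. rs X h x) Xs xs ! k"
    using ap_rs[OF pr_hom[OF Xs k] h t(1)] t(2)[OF k] k len by simp
qed

subsection \<open>Binary and ternary products\<close>

context
  fixes X Y assumes XY: "X \<in> Obj E" "Y \<in> Obj E"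
begin

lemma Prod2_obj: "Prod E [X, Y] \<in> Obj E"
  using Prod_obj XY by simp

lemma pr2_hom: "pr E [X, Y] 0 \<in> hom E (Prod E [X, Y]) X" "pr E [X, Y] 1 \<in> hom E (Prod E [X, Y]) Y"
  "pr E [X, Y] (Suc 0) \<in> hom E (Prod E [X, Y]) Y"
  using pr_hom[of "[X, Y]" 0] pr_hom[of "[X, Y]" 1] XY by simp_all

lemma tp2:
  assumes "inh c" "x \<in> el X c" "y \<in> el Y c"
  shows "tp [X, Y] c [x, y] \<in> el (Prod E [X, Y]) c" "ap (pr E [X, Y] 0) c (tp [X, Y] c [x, y]) = x"
    "ap (pr E [X, Y] 1) c (tp [X, Y] c [x, y]) = y" "ap (pr E [X, Y] (Suc 0)) c (tp [X, Y] c [x, y]) = y"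
proof -
  have o: "set [X, Y] \<subseteq> Obj E" using XY by simp
  have *: "[x, y] ! k \<in> el ([X, Y] ! k) c" if "k < length [X, Y]" for k
    using assms that by (auto simp: less_Suc_eq)
  show "tp [X, Y] c [x, y] \<in> el (Prod E [X, Y]) c" by (rule tp_el[OF o assms(1) *])
  show "ap (pr E [X, Y] 0) c (tp [X, Y] c [x, y]) = x"
    "ap (pr E [X, Y] 1) c (tp [X, Y] c [x, y]) = y" "ap (pr E [X, Y] (Suc 0)) c (tp [X, Y] c [x, y]) = y"
    using pr_tp[OF o assms(1) *, of 0] pr_tp[OF o assms(1) *, of 1] by simp_all
qed

lemma tp2_cases:
  assumes "inh c" "z \<in> el (Prod E [X, Y]) c"
  obtains x y where "x \<in> el X c" "y \<in> el Y c" "z = tp [X, Y] c [x, y]"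
proof (rule that)
  show "z = tp [X, Y] c [ap (pr E [X, Y] 0) c z, ap (pr E [X, Y] 1) c z]"
    using tp_cases[of "[X, Y]" c z] XY assms by (simp add: upt_rec)
qed (use ap_el[OF pr2_hom(1)] ap_el[OF pr2_hom(2)] assms in auto)

lemma rs_tp2:
  assumes "h \<in> st d c" "x \<in> el X c" "y \<in> el Y c"
  shows "rs (Prod E [X, Y]) h (tp [X, Y] c [x, y]) = tp [X, Y] d [rs X h x, rs Y h y]"
proof -
  have *: "[x, y] ! k \<in> el ([X, Y] ! k) c" if "k < length [X, Y]" for k
    using assms that by (auto simp: less_Suc_eq)
  show ?thesis using rs_tp[OF _ assms(1) *] XY by simp
qed

end

lemma tup2:
  assumes "f \<in> hom E Z X" "g \<in> hom E Z Y"
  shows "tup E [f, g] \<in> hom E Z (Prod E [X, Y])"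
    "\<And>c z. inh c \<Longrightarrow> z \<in> el Z c \<Longrightarrow> ap (tup E [f, g]) c z = tp [X, Y] c [ap f c z, ap g c z]"
proof -
  have *: "[f, g] ! k \<in> hom E Z ([X, Y] ! k)" if "k < length [f, g]" for k
    using assms that by (auto simp: less_Suc_eq)
  show "tup E [f, g] \<in> hom E Z (Prod E [X, Y])"
    "\<And>c z. inh c \<Longrightarrow> z \<in> el Z c \<Longrightarrow> ap (tup E [f, g]) c z = tp [X, Y] c [ap f c z, ap g c z]"
    using tup_hom_ap[OF _ *] by simp_all
qed

lemma arr_prod:
  assumes f: "f \<in> hom E X X'" and g: "g \<in> hom E Y Y'"
  shows "arr_prod E f g \<in> hom E (Prod E [X, Y]) (Prod E [X', Y'])"
    "\<And>c x y. inh c \<Longrightarrow> x \<in> el X c \<Longrightarrow> y \<in> el Y c \<Longrightarrow>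
       ap (arr_prod E f g) c (tp [X, Y] c [x, y]) = tp [X', Y'] c [ap f c x, ap g c y]"
proof -
  note XY = E_obj(1)[OF f] E_obj(1)[OF g]
  have D: "Dom E f = X" "Dom E g = Y" using f g by (auto simp: in_hom)
  note t = tup2[OF E_comp[OF pr2_hom(1)[OF XY] f] E_comp[OF pr2_hom(2)[OF XY] g]]
  show "arr_prod E f g \<in> hom E (Prod E [X, Y]) (Prod E [X', Y'])" using t(1) by (simp add: arr_prod_def D)
  fix c x y assume "inh c" "x \<in> el X c" "y \<in> el Y c"
  then show "ap (arr_prod E f g) c (tp [X, Y] c [x, y]) = tp [X', Y'] c [ap f c x, ap g c y]"
    using t(2) tp2[OF XY] ap_comp[OF pr2_hom(1)[OF XY] f] ap_comp[OF pr2_hom(2)[OF XY] g]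
    by (simp add: arr_prod_def D)
qed

subsection \<open>Pullbacks\<close>

lemma pullback_exists:
  assumes f: "f \<in> hom E X Z" and g: "g \<in> hom E Y Z"
  obtains p q where "is_pullback E f g p q"
    "subproduct {0, 1::nat} (\<lambda>k. if k = 0 then X else Y) (\<lambda>c x. ap f c (x 0) = ap g c (x 1)) (Dom E p) (\<lambda>k. if k = 0 then p else q)"
proof -
  let ?X = "\<lambda>k::nat. if k = 0 then X else Y"
  let ?Q = "\<lambda>c x. ap f c (x (0::nat)) = ap g c (x 1)"
  note o = E_obj[OF f] E_obj[OF g]
  obtain M \<pi> where M: "subproduct {0, 1::nat} ?X ?Q M \<pi>"
  proof (rule subproduct_exists[of "{0, 1::nat}" ?X ?Q])
    fix c d h x assume "h \<in> st d c" "x \<in> (\<Pi>\<^sub>E k\<in>{0, 1}. el (?X k) c)" "?Q c x"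
    then show "?Q d (\<lambda>k\<in>{0, 1}. rs (?X k) h (x k))"
      using ap_rs[OF f, of h d c "x 0"] ap_rs[OF g, of h d c "x 1"] by (auto simp: PiE_iff)
  next
    fix c x assume c: "inh c" and x: "x \<in> (\<Pi>\<^sub>E k\<in>{0, 1}. el (?X k) c)"
      and L: "loc c (\<lambda>d h. ?Q d (\<lambda>k\<in>{0, 1}. rs (?X k) h (x k)))"
    have x': "x 0 \<in> el X c" "x 1 \<in> el Y c" using x by (auto simp: PiE_iff)
    show "?Q c x"
    proof (rule sep[OF o(2) c ap_el[OF f c x'(1)] ap_el[OF g c x'(2)]])
      show "loc c (\<lambda>d h. rs Z h (ap f c (x 0)) = rs Z h (ap g c (x 1)))"
        by (rule loc_mono[OF L]) (use ap_rs[OF f _ x'(1)] ap_rs[OF g _ x'(2)] in auto)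
    qed
  qed (use o in auto)
  define p q where "p = \<pi> 0" and "q = \<pi> 1"
  have p: "p \<in> hom E M X" and q: "q \<in> hom E M Y"
    using subproduct_pr[OF M, of 0] subproduct_pr[OF M, of 1] by (simp_all add: p_def q_def)
  have M': "subproduct {0, 1::nat} ?X ?Q M (\<lambda>k. if k = 0 then p else q)"
    using M unfolding subproduct_def p_def q_def restrict_def by (auto cong: conj_cong)
  have fp: "f \<bullet> p = g \<bullet> q"
  proof (rule ext_stage[OF E_comp[OF p f] E_comp[OF q g]])
    fix c m assume m: "inh c" "m \<in> el M c"
    show "ap (f \<bullet> p) c m = ap (g \<bullet> q) c m"
      using subproduct_Q[OF M' m] ap_comp[OF p f m] ap_comp[OF q g m] by simp
  qed
  have "is_pullback E f g p q"
    unfolding is_pullback_def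
  proof (intro conjI ballI impI fp)
    fix W a b assume W: "W \<in> Obj E" and a: "a \<in> hom E W (Dom E f)" and b: "b \<in> hom E W (Dom E g)" and ab: "f \<bullet> a = g \<bullet> b"
    have a': "a \<in> hom E W X" and b': "b \<in> hom E W Y" and D: "Dom E p = M" using a b f g p by (auto simp: in_hom)
    have "\<exists>!h. h \<in> hom E W M \<and> (\<forall>k\<in>{0, 1::nat}. (if k = 0 then p else q) \<bullet> h = (if k = 0 then a else b))"
      by (rule subproduct_arrow[OF M' W])
        (use a' b' ab ap_comp[OF a' f] ap_comp[OF b' g] in auto)
    then show "\<exists>!h. h \<in> hom E W (Dom E p) \<and> p \<bullet> h = a \<and> q \<bullet> h = b" by (simp add: D)
  qed (use f g p q in \<open>auto simp: in_hom\<close>)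
  then show ?thesis using that M' p by (auto simp: in_hom)
qed

text \<open>Components are defined by a pullback chosen arbitrarily, and left exactness yields
  pullbacks that are merely given. Hence the sections are described for every pullback, by
  comparison with the constructed one.\<close>

lemma pullback_sub:
  assumes P: "is_pullback E f g p q" and f: "f \<in> hom E X Z" and g: "g \<in> hom E Y Z"
  shows "p \<in> hom E (Dom E p) X" "q \<in> hom E (Dom E p) Y"
    and "inh c \<Longrightarrow> m \<in> el (Dom E p) c \<Longrightarrow> ap f c (ap p c m) = ap g c (ap q c m)"
    and "inh c \<Longrightarrow> m \<in> el (Dom E p) c \<Longrightarrow> n \<in> el (Dom E p) c \<Longrightarrow> ap p c m = ap p c n \<Longrightarrow> ap q c m = ap q c n \<Longrightarrow> m = n"
    and "inh c \<Longrightarrow> x \<in> el X c \<Longrightarrow> y \<in> el Y c \<Longrightarrow> ap f c x = ap g c y \<Longrightarrow>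
       \<exists>m \<in> el (Dom E p) c. ap p c m = x \<and> ap q c m = y"
proof -
  define M where "M = Dom E p"
  have p: "p \<in> hom E M X" and q: "q \<in> hom E M Y" and fp: "f \<bullet> p = g \<bullet> q"
    using P f g by (auto simp: is_pullback_def in_hom M_def)
  have Pu: "\<exists>!h. h \<in> hom E W M \<and> p \<bullet> h = a \<and> q \<bullet> h = b"
    if "a \<in> hom E W X" "b \<in> hom E W Y" "f \<bullet> a = g \<bullet> b" for W a b
  proof -
    have D: "Dom E f = X" "Dom E g = Y" using f g by (auto simp: in_hom)
    have "\<forall>Z \<in> Obj E. \<forall>a \<in> hom E Z (Dom E f). \<forall>b \<in> hom E Z (Dom E g).
       f \<bullet> a = g \<bullet> b \<longrightarrow> (\<exists>!h. h \<in> hom E Z (Dom E p) \<and> p \<bullet> h = a \<and> q \<bullet> h = b)"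
      using P unfolding is_pullback_def by (elim conjE)
    then show ?thesis using that E_obj(1)[OF that(1)] unfolding D M_def by blast
  qed
  obtain p' q' where P': "is_pullback E f g p' q'" and
    S: "subproduct {0, 1::nat} (\<lambda>k. if k = 0 then X else Y) (\<lambda>c x. ap f c (x 0) = ap g c (x 1)) (Dom E p') (\<lambda>k. if k = 0 then p' else q')"
    using pullback_exists[OF f g] .
  define N where "N = Dom E p'"
  have p': "p' \<in> hom E N X" and q': "q' \<in> hom E N Y" and fp': "f \<bullet> p' = g \<bullet> q'"
    using P' f g by (auto simp: is_pullback_def in_hom N_def)
  obtain h where h: "h \<in> hom E N M" "p \<bullet> h = p'" "q \<bullet> h = q'" using Pu[OF p' q' fp'] by blast
  have "\<exists>!h. h \<in> hom E M N \<and> (\<forall>k\<in>{0, 1::nat}. (if k = 0 then p' else q') \<bullet> h = (if k = 0 then p else q))"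
    unfolding N_def by (rule subproduct_arrow[OF S E_obj(1)[OF p]])
      (use p q fp ap_comp[OF p f] ap_comp[OF q g] in auto)
  then obtain k where k: "k \<in> hom E M N" "p' \<bullet> k = p" "q' \<bullet> k = q" by auto
  have "h \<bullet> k = Id E M"
  proof -
    have "\<exists>!h. h \<in> hom E M M \<and> p \<bullet> h = p \<and> q \<bullet> h = q" by (rule Pu[OF p q fp])
    moreover have "p \<bullet> (h \<bullet> k) = p" "q \<bullet> (h \<bullet> k) = q"
      using E_assoc[OF k(1) h(1) p] E_assoc[OF k(1) h(1) q] h k by simp_all
    ultimately show ?thesis
      using E_comp[OF k(1) h(1)] E_id[OF E_obj(1)[OF p]] E_comp_id(1)[OF p] E_comp_id(1)[OF q] by blast
  qed
  then have hk: "ap h c (ap k c m) = m" if "inh c" "m \<in> el M c" for c m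
    using ap_comp[OF k(1) h(1) that] ap_id[OF E_obj(1)[OF p] that] by simp
  have pk: "ap p' c (ap k c m) = ap p c m" "ap q' c (ap k c m) = ap q c m" if "inh c" "m \<in> el M c" for c m
    using ap_comp[OF k(1) p' that] ap_comp[OF k(1) q' that] k by simp_all
  have ph: "ap p c (ap h c m) = ap p' c m" "ap q c (ap h c m) = ap q' c m" if "inh c" "m \<in> el N c" for c m
    using ap_comp[OF h(1) p that] ap_comp[OF h(1) q that] h by simp_all
  show "p \<in> hom E (Dom E p) X" "q \<in> hom E (Dom E p) Y" using p q by (simp_all add: M_def)
  show "ap f c (ap p c m) = ap g c (ap q c m)" if "inh c" "m \<in> el (Dom E p) c"
    using that ap_comp[OF p f that(1)] ap_comp[OF q g that(1)] fp by (simp add: M_def)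
  show "m = n" if c: "inh c" and m: "m \<in> el (Dom E p) c" and n: "n \<in> el (Dom E p) c"
    and eq: "ap p c m = ap p c n" "ap q c m = ap q c n"
  proof -
    have m': "m \<in> el M c" "n \<in> el M c" using m n by (simp_all add: M_def)
    have "ap k c m = ap k c n"
      by (rule subproduct_inj[OF S c])
        (use ap_el[OF k(1) c] m' pk[OF c] eq in \<open>auto simp: N_def\<close>)
    then show ?thesis using hk[OF c] m' by metis
  qed
  show "\<exists>m \<in> el (Dom E p) c. ap p c m = x \<and> ap q c m = y"
    if c: "inh c" and x: "x \<in> el X c" and y: "y \<in> el Y c" and eq: "ap f c x = ap g c y"
  proof -
    have "(\<lambda>k\<in>{0, 1}. if k = 0 then x else y) \<in> (\<Pi>\<^sub>E k\<in>{0, 1::nat}. el (if k = 0 then X else Y) c)"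
      using x y by auto
    from subproduct_ex[OF S c this] obtain m where "m \<in> el N c" "ap p' c m = x" "ap q' c m = y"
      using eq by (auto simp: N_def)
    then show ?thesis using ph[OF c] ap_el[OF h(1) c] by (auto simp: M_def)
  qed
qed

end

context topos
begin

section \<open>Initial and terminal objects, epimorphisms\<close>

text \<open>The family without sections at inhabited stages is a sheaf, because a covering sieve of
  an inhabited object has a member with inhabited domain. An arrow from an initial object into it
  leaves no room for sections.\<close>

lemma initial_iff:
  assumes X: "X \<in> Obj E"
  shows "initial E X \<longleftrightarrow> (\<forall>c. inh c \<longrightarrow> el X c = {})"
proof
  assume i: "initial E X"
  obtain Z and en :: "'u \<Rightarrow> 'u \<Rightarrow> 'u" where Z: "Z \<in> Obj E" and en: "\<And>c. inh c \<Longrightarrow> bij_betw (en c) {} (el Z c)"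
  proof (rule represent[of "\<lambda>_. {}" "\<lambda>_ x. x"])
    show "\<exists>y\<in>{}. \<forall>d. \<forall>f\<in>st d c. f \<in> S \<longrightarrow> y = x f" if "inh c" "S \<in> J c" "\<And>d f. f \<in> st d c \<Longrightarrow> f \<in> S \<Longrightarrow> x f \<in> {}"
      for c S and x :: "'u \<Rightarrow> 'u"
      by (rule loc_ex[OF that(1) loc_J[OF that(2)]]) (use that(3) in blast)
  qed (blast | simp add: sml_finite)+
  obtain f where f: "f \<in> hom E X Z" using i Z by (auto simp: initial_def)
  show "\<forall>c. inh c \<longrightarrow> el X c = {}"
  proof (intro allI impI)
    fix c assume c: "inh c"
    have "el Z c = {}" using en[OF c] by (simp add: bij_betw_def)
    then show "el X c = {}" using ap_el[OF f c] by blast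
  qed
next
  assume e: "\<forall>c. inh c \<longrightarrow> el X c = {}"
  show "initial E X" unfolding initial_def
  proof (intro conjI X ballI)
    fix Y assume Y: "Y \<in> Obj E"
    obtain f where f: "f \<in> hom E X Y"
      by (rule arrow_of_family[OF X Y, of "\<lambda>_ _. undefined"]) (use e st_inh' in blast)+
    moreover have "g = f" if "g \<in> hom E X Y" for g by (rule ext_stage[OF that f]) (use e in blast)
    ultimately show "\<exists>!f. f \<in> hom E X Y" by blast
  qed
qed

lemma nonempty_iff: "nonempty E X \<longleftrightarrow> X \<in> Obj E \<and> (\<exists>c x. inh c \<and> x \<in> el X c)"
  using initial_iff by (auto simp: nonempty_def)

lemma nonemptyI: "X \<in> Obj E \<Longrightarrow> inh c \<Longrightarrow> x \<in> el X c \<Longrightarrow> nonempty E X"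
  using nonempty_iff by blast

text \<open>The empty product visibly has one section at each inhabited stage, and any terminal
  object is isomorphic to it.\<close>

lemma terminal_el:
  assumes T: "terminal E T" and c: "inh c"
  shows "\<exists>!x. x \<in> el T c"
proof -
  have To: "T \<in> Obj E" and Tu: "\<And>Y. Y \<in> Obj E \<Longrightarrow> \<exists>!f. f \<in> hom E Y T" using T by (auto simp: terminal_def)
  obtain P \<pi> where P: "subproduct {..<length []} ((!) []) (\<lambda>_ _. True) P (\<pi> :: nat \<Rightarrow> 'a)" "is_product E [] P \<pi>"
    by (rule product_exists[of "[]"]) simp_all
  have Po: "P \<in> Obj E" using P(2) by (simp add: is_product_def)
  obtain p where p: "p \<in> el P c" using subproduct_ex[OF P(1) c, of "\<lambda>k. undefined"] by auto
  obtain h where h: "h \<in> hom E T P" using product_univ[OF P(2) To, of "\<lambda>_. undefined"] by auto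
  obtain k where k: "k \<in> hom E P T" using Tu[OF Po] by blast
  have kh: "k \<bullet> h = Id E T" using Tu[OF To] E_comp[OF h k] E_id[OF To] by blast
  show ?thesis
  proof (rule ex1I[of _ "ap k c p"])
    show "ap k c p \<in> el T c" by (rule ap_el[OF k c p])
    fix x assume x: "x \<in> el T c"
    have "ap h c x = p" by (rule subproduct_inj[OF P(1) c ap_el[OF h c x] p]) simp
    then show "x = ap k c p" using ap_comp[OF h k c x] kh ap_id[OF To c x] by simp
  qed
qed

text \<open>The sections of the subobject classifier. The single equivalence contains two closure
  properties: under local membership, and, as shown in the next proof, under restriction.\<close>

definition closed_sieve :: "'u \<Rightarrow> ('u \<times> 'u) set \<Rightarrow> bool" where
  "closed_sieve c A \<longleftrightarrow> A \<subseteq> {(d, f). f \<in> st d c} \<and>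
     (\<forall>d f. f \<in> st d c \<longrightarrow> ((d, f) \<in> A \<longleftrightarrow> loc d (\<lambda>e g. (e, f \<odot> g) \<in> A)))"

text \<open>The subobject classifier, against which an epimorphism is tested to find local preimages.\<close>

lemma closed_sieves:
  obtains Om en where "Om \<in> Obj E"
    "\<And>c. inh c \<Longrightarrow> bij_betw (en c) {A. closed_sieve c A} (el Om c)"
    "\<And>c d h A. h \<in> st d c \<Longrightarrow> closed_sieve c A \<Longrightarrow> rs Om h (en c A) = en d {(e, g). g \<in> st e d \<and> (e, h \<odot> g) \<in> A}"
proof -
  define P where "P c = {A. A \<subseteq> {(d, f). f \<in> st d c} \<and>
       (\<forall>d f. f \<in> st d c \<longrightarrow> ((d, f) \<in> A \<longleftrightarrow> loc d (\<lambda>e g. (e, f \<odot> g) \<in> A)))}" for c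
  have Pc: "P c = {A. closed_sieve c A}" for c by (simp add: P_def closed_sieve_def)
  define r where "r h A = {(e, g). g \<in> st e (Dom C h) \<and> (e, h \<odot> g) \<in> A}" for h and A :: "('u \<times> 'u) set"
  have r: "r h A = {(e, g). g \<in> st e d \<and> (e, h \<odot> g) \<in> A}" if "h \<in> st d c" for h d c A
    using st_dom[OF that] by (simp add: r_def)
  \<comment> \<open>Membership of \<open>f\<close> is local membership below \<open>f\<close>.
    Restricting the latter along \<open>g\<close> and reading the equivalence backwards gives
    membership of the composite.\<close>
  have Pres: "(e, f \<odot> g) \<in> A" if "A \<in> P c" "f \<in> st d c" "(d, f) \<in> A" "g \<in> st e d" for A c d f e g
  proof -
    have "loc d (\<lambda>e g. (e, f \<odot> g) \<in> A)" using that by (auto simp: P_def)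
    from loc_res[OF that(4) this] have "loc e (\<lambda>b k. (b, f \<odot> (g \<odot> k)) \<in> A)" .
    then have "loc e (\<lambda>b k. (b, (f \<odot> g) \<odot> k) \<in> A)"
      by (rule loc_mono) (use st_assoc[OF that(2,4)] in auto)
    then show ?thesis using that(1) st_comp[OF that(2,4)] by (auto simp: P_def)
  qed
  have Pcl: "(d, f) \<in> A" if "A \<in> P c" "f \<in> st d c" "loc d (\<lambda>e g. (e, f \<odot> g) \<in> A)" for A c d f
    using that by (auto simp: P_def)
  have PI: "A \<in> P c" if A: "A \<subseteq> {(d, f). f \<in> st d c}"
    and res: "\<And>d f e g. f \<in> st d c \<Longrightarrow> (d, f) \<in> A \<Longrightarrow> g \<in> st e d \<Longrightarrow> (e, f \<odot> g) \<in> A"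
    and cl: "\<And>d f. f \<in> st d c \<Longrightarrow> loc d (\<lambda>e g. (e, f \<odot> g) \<in> A) \<Longrightarrow> (d, f) \<in> A" for A c
  proof -
    have "loc d (\<lambda>e g. (e, f \<odot> g) \<in> A)" if "f \<in> st d c" "(d, f) \<in> A" for d f
      by (rule loc_triv[OF st_inh[OF that(1)]]) (rule res[OF that])
    then show ?thesis using A cl unfolding P_def by blast
  qed
  have Pst: "f \<in> st d c" if "A \<in> P c" "(d, f) \<in> A" for A c d f using that by (auto simp: P_def)
  have rP: "r h A \<in> P d" if h: "h \<in> st d c" and A: "A \<in> P c" for h d c A
    unfolding r[OF h]
  proof (rule PI)
    fix b f e g assume f: "f \<in> st b d" "(b, f) \<in> {(e, g). g \<in> st e d \<and> (e, h \<odot> g) \<in> A}" and g: "g \<in> st e b"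
    then have "(e, (h \<odot> f) \<odot> g) \<in> A" using Pres[OF A st_comp[OF h f(1)] _ g] by simp
    then show "(e, f \<odot> g) \<in> {(e, g). g \<in> st e d \<and> (e, h \<odot> g) \<in> A}"
      using st_comp[OF f(1) g] st_assoc[OF h f(1) g] by simp
  next
    fix b f assume f: "f \<in> st b d" and L: "loc b (\<lambda>e g. (e, f \<odot> g) \<in> {(e, g). g \<in> st e d \<and> (e, h \<odot> g) \<in> A})"
    have "loc b (\<lambda>e g. (e, (h \<odot> f) \<odot> g) \<in> A)"
      by (rule loc_mono[OF L]) (use st_assoc[OF h f] in auto)
    then show "(b, f) \<in> {(e, g). g \<in> st e d \<and> (e, h \<odot> g) \<in> A}" using Pcl[OF A st_comp[OF h f]] f by simp
  qed auto
  obtain Om en where "Om \<in> Obj E" "\<And>c. inh c \<Longrightarrow> bij_betw (en c) (P c) (el Om c)"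
    "\<And>c d h x. h \<in> st d c \<Longrightarrow> x \<in> P c \<Longrightarrow> rs Om h (en c x) = en d (r h x)"
  proof (rule represent[of P r])
    \<comment> \<open>Here the smallness of the site is used: sieves are subsets of a small
      set.\<close>
    show "sml ty (P c)" if "inh c" for c
    proof (rule sml_subset)
      show "P c \<subseteq> Pow (Obj C \<times> Arr C)" using hom_obj[OF C st_hom] st_hom by (fastforce simp: P_def in_hom)
      show "sml ty (Pow (Obj C \<times> Arr C))" using small_C by (intro sml_Pow sml_Times) (simp_all add: small_def)
    qed
    show "r h x \<in> P d" if "h \<in> st d c" "x \<in> P c" for c d h x using rP that .
    show "r (Id C c) x = x" if "inh c" "x \<in> P c" for c x
    proof -
      have "f \<in> st d c \<and> (d, Id C c \<odot> f) \<in> x \<longleftrightarrow> (d, f) \<in> x" for d f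
        using Pst[OF that(2), of d f] st_comp_id(2)[of f d c] by metis
      then show ?thesis by (simp add: r[OF st_id[OF that(1)]])
    qed
    show "r (h \<odot> g) x = r g (r h x)" if "h \<in> st d c" "g \<in> st e d" "x \<in> P c" for c d e h g x
      using st_assoc[OF that(1,2)] st_comp[OF that(2)] by (auto simp: r[OF that(1)] r[OF that(2)] r[OF st_comp[OF that(1,2)]])
    have sub: "x \<subseteq> y" if c: "inh c" and x: "x \<in> P c" and y: "y \<in> P c" and L: "loc c (\<lambda>d f. r f x = r f y)" for c x y
    proof clarify
      fix d f assume f: "(d, f) \<in> x"
      then have fs: "f \<in> st d c" using Pst[OF x] by blast
      show "(d, f) \<in> y"
      proof (rule Pcl[OF y fs], rule loc_mono[OF loc_res[OF fs L]])
        fix e g assume g: "g \<in> st e d" "r (f \<odot> g) x = r (f \<odot> g) y"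
        note fg = st_comp[OF fs g(1)]
        have "(e, (f \<odot> g) \<odot> Id C e) \<in> x" using Pres[OF x fs f g(1)] st_comp_id(1)[OF fg] by simp
        then have "(e, Id C e) \<in> r (f \<odot> g) x" using st_id[OF st_inh[OF g(1)]] by (simp add: r[OF fg])
        then have "(e, Id C e) \<in> r (f \<odot> g) y" using g(2) by simp
        then show "(e, f \<odot> g) \<in> y" using st_comp_id(1)[OF fg] by (simp add: r[OF fg])
      qed
    qed
    show "x = y" if "inh c" "x \<in> P c" "y \<in> P c" "loc c (\<lambda>d f. r f x = r f y)" for c x y
      using sub[OF that] sub[OF that(1,3,2)] loc_mono[OF that(4), of "\<lambda>d f. r f y = r f x"] by auto
    show "\<exists>y\<in>P c. \<forall>d. \<forall>f\<in>st d c. f \<in> S \<longrightarrow> r f y = x f"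
      if c: "inh c" and S: "S \<in> J c" and x: "\<And>d f. f \<in> st d c \<Longrightarrow> f \<in> S \<Longrightarrow> x f \<in> P d"
        and xr: "\<And>d f e g. f \<in> st d c \<Longrightarrow> f \<in> S \<Longrightarrow> g \<in> st e d \<Longrightarrow> r g (x f) = x (f \<odot> g)" for c S x
    proof -
      \<comment> \<open>An arrow \<open>k\<close> of \<open>S\<close> lies in the glued sieve when
        the prescribed sieve \<open>x k\<close> contains the identity. Arrows outside
        \<open>S\<close> are then decided by local membership.\<close>
      let ?W = "\<lambda>e k. k \<in> S \<and> (e, Id C e) \<in> x k"
      define y where "y = {(d, h). h \<in> st d c \<and> loc d (\<lambda>e g. ?W e (h \<odot> g))}"
      have key: "(e, g) \<in> x f \<longleftrightarrow> ?W e (f \<odot> g)" if f: "f \<in> st d c" "f \<in> S" and g: "g \<in> st e d" for d f e g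
      proof -
        have "f \<odot> g \<in> S" using sieve_comp[OF S c f(2)] f g st_hom by blast
        moreover have "(e, Id C e) \<in> r g (x f) \<longleftrightarrow> (e, g) \<in> x f"
          using st_id[OF st_inh[OF g]] st_comp_id(1)[OF g] by (simp add: r[OF g])
        ultimately show ?thesis using xr[OF f g] by simp
      qed
      have yP: "y \<in> P c"
      proof (rule PI)
        fix d f e g assume f: "f \<in> st d c" "(d, f) \<in> y" and g: "g \<in> st e d"
        have "loc e (\<lambda>b k. ?W b (f \<odot> (g \<odot> k)))" using loc_res[OF g, of "\<lambda>e g. ?W e (f \<odot> g)"] f by (simp add: y_def)
        then have "loc e (\<lambda>b k. ?W b ((f \<odot> g) \<odot> k))" by (rule loc_mono) (use st_assoc[OF f(1) g] in auto)
        then show "(e, f \<odot> g) \<in> y" using st_comp[OF f(1) g] by (simp add: y_def)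
      next
        fix d f assume f: "f \<in> st d c" and L: "loc d (\<lambda>e g. (e, f \<odot> g) \<in> y)"
        have "loc d (\<lambda>e g. loc e (\<lambda>b k. ?W b (f \<odot> (g \<odot> k))))"
        proof (rule loc_mono[OF L])
          fix e g assume g: "g \<in> st e d" "(e, f \<odot> g) \<in> y"
          then have "loc e (\<lambda>b k. ?W b ((f \<odot> g) \<odot> k))" by (simp add: y_def)
          then show "loc e (\<lambda>b k. ?W b (f \<odot> (g \<odot> k)))" by (rule loc_mono) (use st_assoc[OF f g(1)] in auto)
        qed
        then have "loc d (\<lambda>e g. ?W e (f \<odot> g))" by (rule loc_trans[OF st_inh[OF f]])
        then show "(d, f) \<in> y" using f by (simp add: y_def)
      qed (auto simp: y_def)
      have "r f y = x f" if f: "f \<in> st d c" "f \<in> S" for d f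
      proof -
        have "(e, f \<odot> g) \<in> y \<longleftrightarrow> (e, g) \<in> x f" if g: "g \<in> st e d" for e g
        proof -
          have "(e, f \<odot> g) \<in> y \<longleftrightarrow> loc e (\<lambda>b k. ?W b ((f \<odot> g) \<odot> k))"
            using st_comp[OF f(1) g] by (simp add: y_def)
          also have "\<dots> \<longleftrightarrow> loc e (\<lambda>b k. (b, g \<odot> k) \<in> x f)"
            using key[OF f st_comp[OF g]] st_assoc[OF f(1) g] by (auto elim!: loc_mono)
          also have "\<dots> \<longleftrightarrow> (e, g) \<in> x f" using x[OF f] g by (auto simp: P_def)
          finally show ?thesis .
        qed
        then show ?thesis using Pst[OF x[OF f]] by (auto simp: r[OF f(1)])
      qed
      then show ?thesis using yP by blast
    qed
  qed blast
  then show ?thesis using that[of Om en] r unfolding Pc by simp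
qed

text \<open>The union of the images of the family is a subobject of \<open>X\<close>. Its
  characteristic arrow and the constantly true arrow agree after composition with each member of the
  family, hence are equal, and so every section lies locally in the union.\<close>

lemma epimorphic_loc:
  assumes ef: "epimorphic_family E X \<F>" and X: "X \<in> Obj E" and c: "inh c" and x: "x \<in> el X c"
  shows "loc c (\<lambda>d h. \<exists>f\<in>\<F>. \<exists>y \<in> el (Dom E f) d. ap f d y = rs X h x)"
proof -
  obtain Om en where Om: "Om \<in> Obj E" and en: "\<And>c. inh c \<Longrightarrow> bij_betw (en c) {A. closed_sieve c A} (el Om c)"
    and rOm: "\<And>c d h A. h \<in> st d c \<Longrightarrow> closed_sieve c A \<Longrightarrow> rs Om h (en c A) = en d {(e, g). g \<in> st e d \<and> (e, h \<odot> g) \<in> A}"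
    by (rule closed_sieves) blast
  let ?R = "\<lambda>d z. \<exists>f\<in>\<F>. \<exists>y \<in> el (Dom E f) d. ap f d y = z"
  have Fh: "f \<in> hom E (Dom E f) X" if "f \<in> \<F>" for f using ef that by (auto simp: epimorphic_family_def in_hom)
  have Rres: "?R e (rs X g z)" if g: "g \<in> st e d" and R: "?R d z" for e g d z
  proof -
    obtain f y where f: "f \<in> \<F>" "y \<in> el (Dom E f) d" "ap f d y = z" using R by blast
    then have "ap f e (rs (Dom E f) g y) = rs X g z" using ap_rs[OF Fh[OF f(1)] g f(2)] by simp
    then show ?thesis using rs_el[OF E_obj(1)[OF Fh[OF f(1)]] g f(2)] f(1) by blast
  qed
  \<comment> \<open>\<open>A c z\<close> is the truth value of the statement that \<open>z\<close>
    lies in the union of the images; \<open>T c\<close> is the value true.\<close>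
  define A where "A c z = {(d, h). h \<in> st d c \<and> loc d (\<lambda>e g. ?R e (rs X g (rs X h z)))}" for c z
  define T where "T c = {(d, h). h \<in> st d c}" for c
  have T: "closed_sieve c (T c)" if "inh c" for c
    unfolding closed_sieve_def T_def using st_comp by (auto intro!: loc_triv[OF st_inh])
  have A: "closed_sieve c (A c z)" if c: "inh c" and z: "z \<in> el X c" for c z
    unfolding closed_sieve_def
  proof (intro conjI allI impI iffI)
    fix d f assume f: "f \<in> st d c" and "(d, f) \<in> A c z"
    then have L: "loc d (\<lambda>e g. ?R e (rs X g (rs X f z)))" by (simp add: A_def)
    show "loc d (\<lambda>e g. (e, f \<odot> g) \<in> A c z)"
    proof (rule loc_triv[OF st_inh[OF f]])
      fix e g assume g: "g \<in> st e d"
      have "loc e (\<lambda>b k. ?R b (rs X k (rs X (f \<odot> g) z)))"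
        by (rule loc_mono[OF loc_res[OF g L]])
          (use rs_comp[OF X g _ rs_el[OF X f z]] rs_comp[OF X f g z] in auto)
      then show "(e, f \<odot> g) \<in> A c z" using st_comp[OF f g] by (simp add: A_def)
    qed
  next
    fix d f assume f: "f \<in> st d c" and L: "loc d (\<lambda>e g. (e, f \<odot> g) \<in> A c z)"
    have "loc d (\<lambda>e g. loc e (\<lambda>b k. ?R b (rs X (g \<odot> k) (rs X f z))))"
    proof (rule loc_mono[OF L])
      fix e g assume g: "g \<in> st e d" "(e, f \<odot> g) \<in> A c z"
      then have "loc e (\<lambda>b k. ?R b (rs X k (rs X (f \<odot> g) z)))" by (simp add: A_def)
      then show "loc e (\<lambda>b k. ?R b (rs X (g \<odot> k) (rs X f z)))"
        by (rule loc_mono) (use rs_comp[OF X g(1) _ rs_el[OF X f z]] rs_comp[OF X f g(1) z] in auto)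
    qed
    then have "loc d (\<lambda>e g. ?R e (rs X g (rs X f z)))" by (rule loc_trans[OF st_inh[OF f]])
    then show "(d, f) \<in> A c z" using f by (simp add: A_def)
  qed (auto simp: A_def)
  have Ar: "{(e, g). g \<in> st e d \<and> (e, h \<odot> g) \<in> A c z} = A d (rs X h z)" if h: "h \<in> st d c" and z: "z \<in> el X c" for h d c z
    using st_comp[OF h] rs_comp[OF X h _ z] by (auto simp: A_def)
  have Tr: "{(e, g). g \<in> st e d \<and> (e, h \<odot> g) \<in> T c} = T d" if h: "h \<in> st d c" for h d c
    using st_comp[OF h] by (auto simp: T_def)
  have enO: "en c B \<in> el Om c" if "inh c" "closed_sieve c B" for c B using bij_betwE[OF en[OF that(1)]] that(2) by blast
  obtain \<chi> where \<chi>: "\<chi> \<in> hom E X Om" "\<And>c z. inh c \<Longrightarrow> z \<in> el X c \<Longrightarrow> ap \<chi> c z = en c (A c z)"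
  proof (rule arrow_of_family[OF X Om, of "\<lambda>c z. en c (A c z)"])
    show "en d (A d (rs X h z)) = rs Om h (en c (A c z))" if "h \<in> st d c" "z \<in> el X c" for h d c z
      using rOm[OF that(1) A[OF st_inh'[OF that(1)] that(2)]] Ar[OF that] by simp
  qed (use enO A in blast)+
  obtain t where t: "t \<in> hom E X Om" "\<And>c z. inh c \<Longrightarrow> z \<in> el X c \<Longrightarrow> ap t c z = en c (T c)"
  proof (rule arrow_of_family[OF X Om, of "\<lambda>c z. en c (T c)"])
    show "en d (T d) = rs Om h (en c (T c))" if "h \<in> st d c" "z \<in> el X c" for h d c z
      using rOm[OF that(1) T[OF st_inh'[OF that(1)]]] Tr[OF that(1)] by simp
  qed (use enO T in blast)+
  have "\<chi> \<bullet> f = t \<bullet> f" if f: "f \<in> \<F>" for f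
  proof (rule ext_stage[OF E_comp[OF Fh[OF f] \<chi>(1)] E_comp[OF Fh[OF f] t(1)]])
    fix c y assume c: "inh c" and y: "y \<in> el (Dom E f) c"
    note fy = ap_el[OF Fh[OF f] c y]
    have "A c (ap f c y) = T c"
    proof -
      have "loc d (\<lambda>e g. ?R e (rs X g (rs X h (ap f c y))))" if h: "h \<in> st d c" for d h
        by (rule loc_triv[OF st_inh[OF h]], rule Rres, assumption, rule Rres[OF h]) (use f y in blast)
      then show ?thesis by (auto simp: A_def T_def)
    qed
    then show "ap (\<chi> \<bullet> f) c y = ap (t \<bullet> f) c y"
      using ap_comp[OF Fh[OF f] \<chi>(1) c y] ap_comp[OF Fh[OF f] t(1) c y] \<chi>(2)[OF c fy] t(2)[OF c fy] by simp
  qed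
  then have "\<chi> = t" using ef \<chi>(1) t(1) Om unfolding epimorphic_family_def by blast
  then have "en c (A c x) = en c (T c)" using \<chi>(2)[OF c x] t(2)[OF c x] by simp
  then have "A c x = T c" using inj_onD[OF bij_betw_imp_inj_on[OF en[OF c]]] A[OF c x] T[OF c] by blast
  then have "(c, Id C c) \<in> A c x" using st_id[OF c] by (simp add: T_def)
  then have "loc c (\<lambda>e g. ?R e (rs X g (rs X (Id C c) x)))" by (simp add: A_def)
  then show ?thesis using rs_id[OF X c x] by simp
qed

lemma loc_epimorphic:
  assumes F: "\<And>f. f \<in> \<F> \<Longrightarrow> f \<in> hom E (Dom E f) X"
    and L: "\<And>c x. inh c \<Longrightarrow> x \<in> el X c \<Longrightarrow> loc c (\<lambda>d h. \<exists>f\<in>\<F>. \<exists>y \<in> el (Dom E f) d. ap f d y = rs X h x)"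
  shows "epimorphic_family E X \<F>"
  unfolding epimorphic_family_def
proof (intro conjI ballI impI)
  fix Z g h assume Z: "Z \<in> Obj E" and g: "g \<in> hom E X Z" and h: "h \<in> hom E X Z" and eq: "\<forall>f\<in>\<F>. g \<bullet> f = h \<bullet> f"
  show "g = h"
  proof (rule ext_stage[OF g h])
    fix c x assume c: "inh c" and x: "x \<in> el X c"
    show "ap g c x = ap h c x"
    proof (rule sep[OF Z c ap_el[OF g c x] ap_el[OF h c x]], rule loc_mono[OF L[OF c x]])
      fix d k assume k: "k \<in> st d c" "\<exists>f\<in>\<F>. \<exists>y \<in> el (Dom E f) d. ap f d y = rs X k x"
      then obtain f y where f: "f \<in> \<F>" "y \<in> el (Dom E f) d" "ap f d y = rs X k x" by blast
      note d = st_inh[OF k(1)]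
      have "ap g d (rs X k x) = ap h d (rs X k x)"
        using ap_comp[OF F[OF f(1)] g d f(2)] ap_comp[OF F[OF f(1)] h d f(2)] eq f by auto
      then show "rs Z k (ap g c x) = rs Z k (ap h c x)" using ap_rs[OF g k(1) x] ap_rs[OF h k(1) x] by simp
    qed
  qed
qed (use F in \<open>auto simp: in_hom\<close>)

lemma epi_loc:
  assumes "is_epi E f" "f \<in> hom E Y X" "inh c" "x \<in> el X c"
  shows "loc c (\<lambda>d h. \<exists>y \<in> el Y d. ap f d y = rs X h x)"
proof -
  have "epimorphic_family E X {f}" using assms(1,2) by (auto simp: is_epi_def epimorphic_family_def in_hom)
  then show ?thesis using epimorphic_loc[of X "{f}" c x] assms E_obj[OF assms(2)] by (auto simp: in_hom)
qed

lemma loc_epi: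
  assumes "f \<in> hom E Y X" "\<And>c x. inh c \<Longrightarrow> x \<in> el X c \<Longrightarrow> loc c (\<lambda>d h. \<exists>y \<in> el Y d. ap f d y = rs X h x)"
  shows "is_epi E f"
proof -
  have "epimorphic_family E X {f}" by (rule loc_epimorphic) (use assms in \<open>auto simp: in_hom\<close>)
  then show ?thesis using assms(1) by (auto simp: is_epi_def epimorphic_family_def in_hom)
qed

lemma ext_loc:
  assumes f: "f \<in> hom E X Y" and g: "g \<in> hom E X Y"
    and L: "\<And>c x. inh c \<Longrightarrow> x \<in> el X c \<Longrightarrow> loc c (\<lambda>d h. ap f d (rs X h x) = ap g d (rs X h x))"
  shows "f = g"
proof (rule ext_stage[OF f g])
  fix c x assume c: "inh c" and x: "x \<in> el X c"
  show "ap f c x = ap g c x"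
    by (rule sep[OF E_obj(2)[OF f] c ap_el[OF f c x] ap_el[OF g c x]], rule loc_mono[OF L[OF c x]])
      (use ap_rs[OF f _ x] ap_rs[OF g _ x] in auto)
qed

lemma iso_bij:
  assumes f: "f \<in> hom E X Y" and b: "\<And>c. inh c \<Longrightarrow> bij_betw (ap f c) (el X c) (el Y c)"
  shows "is_iso E f"
proof -
  define \<phi> where "\<phi> c = inv_into (el X c) (ap f c)" for c
  have \<phi>: "\<phi> c y \<in> el X c" "ap f c (\<phi> c y) = y" if "inh c" "y \<in> el Y c" for c y
    using bij_betwE[OF bij_betw_inv_into[OF b[OF that(1)]]] bij_betw_inv_into_right[OF b[OF that(1)]] that(2)
    by (auto simp: \<phi>_def)
  have \<phi>': "\<phi> c (ap f c x) = x" if "inh c" "x \<in> el X c" for c x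
    using bij_betw_inv_into_left[OF b[OF that(1)] that(2)] by (simp add: \<phi>_def)
  have nat: "\<phi> d (rs Y h y) = rs X h (\<phi> c y)" if h: "h \<in> st d c" and y: "y \<in> el Y c" for h d c y
  proof -
    note p = \<phi>[OF st_inh'[OF h] y]
    have "rs Y h y = ap f d (rs X h (\<phi> c y))" using ap_rs[OF f h p(1)] p(2) by simp
    then show ?thesis using \<phi>'[OF st_inh[OF h] rs_el[OF E_obj(1)[OF f] h p(1)]] by simp
  qed
  obtain g where g: "g \<in> hom E Y X" "\<And>c y. inh c \<Longrightarrow> y \<in> el Y c \<Longrightarrow> ap g c y = \<phi> c y"
    by (rule arrow_of_family[OF E_obj(2)[OF f] E_obj(1)[OF f], of \<phi>]) (use \<phi>(1) nat in blast)+
  have "g \<bullet> f = Id E X"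
    by (rule ext_stage[OF E_comp[OF f g(1)] E_id[OF E_obj(1)[OF f]]])
      (use ap_comp[OF f g(1)] g(2) \<phi>' ap_el[OF f] ap_id[OF E_obj(1)[OF f]] in auto)
  moreover have "f \<bullet> g = Id E Y"
    by (rule ext_stage[OF E_comp[OF g(1) f] E_id[OF E_obj(2)[OF f]]])
      (use ap_comp[OF g(1) f] g(2) \<phi>(2) ap_id[OF E_obj(2)[OF f]] in auto)
  ultimately show ?thesis using f g(1) by (auto simp: is_iso_def in_hom)
qed

end

section \<open>Constant objects and families\<close>

lemma point_hom: "small {i} \<Longrightarrow> small A \<Longrightarrow> i \<in> A \<Longrightarrow> point A i \<in> hom SET {i} A"
  by (simp add: point_def hom_SET)

lemma point_fun: "sm_fun (point A i) i = i"
  by (simp add: point_def)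

locale topos_over_Set = topos ty E C J \<Phi>
  for ty :: "'u itself" and E :: "('o, 'a) category" and C :: "('u, 'u) category" and J
    and \<Phi> :: "('o, 'a, 'u) sheaf_functor" +
  fixes \<gamma> :: "('u set, 'u set_map, 'o, 'a) cfunctor"
  assumes inverse_image: "inverse_image E \<gamma>"
begin

section \<open>Constant objects and their constant sections\<close>

lemma \<gamma>_functor: "is_functor SET E \<gamma>"
  using inverse_image by (auto simp: inverse_image_def is_adjunction_def)

lemma SET_obj: "small A \<longleftrightarrow> A \<in> Obj SET"
  by (simp add: SET_def)

lemma \<gamma>_obj: "small A \<Longrightarrow> on_obj \<gamma> A \<in> Obj E"
  using \<gamma>_functor unfolding is_functor_def SET_obj by blast

lemma \<gamma>_hom: "f \<in> hom SET A B \<Longrightarrow> on_arr \<gamma> f \<in> hom E (on_obj \<gamma> A) (on_obj \<gamma> B)"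
  using \<gamma>_functor unfolding is_functor_def in_hom by blast

lemma \<gamma>_comp: "f \<in> hom SET A B \<Longrightarrow> g \<in> hom SET B D \<Longrightarrow> on_arr \<gamma> (Comp SET g f) = on_arr \<gamma> g \<bullet> on_arr \<gamma> f"
  using \<gamma>_functor unfolding is_functor_def in_hom by simp

lemma \<gamma>_id: "small A \<Longrightarrow> on_arr \<gamma> (Id SET A) = Id E (on_obj \<gamma> A)"
  using \<gamma>_functor unfolding is_functor_def SET_obj by blast

lemma small_singleton: "small {i :: 'u}"
  using sml_finite[of "{i}"] by (simp add: small_def)

lemma small_empty: "small ({} :: 'u set)"
  using sml_finite[of "{} :: 'u set"] by (simp add: small_def)

text \<open>A one-element set is terminal, and \<open>\<gamma>\<close> preserves terminal
  objects.\<close>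

lemma \<gamma>_singleton: "inh c \<Longrightarrow> \<exists>!x. x \<in> el (on_obj \<gamma> {i}) c"
proof (rule terminal_el)
  have "terminal SET {i}"
    unfolding terminal_def
  proof (intro conjI ballI)
    fix A :: "'u set" assume "A \<in> Obj SET"
    then have A: "small A" by (simp add: SET_obj)
    have "\<lparr>sm_dom = A, sm_cod = {i}, sm_fun = restrict (\<lambda>_. i) A\<rparr> \<in> hom SET A {i}"
      by (rule SET_homI[OF A small_singleton]) simp
    moreover have "f = g" if "f \<in> hom SET A {i}" "g \<in> hom SET A {i}" for f g
      by (rule SET_ext[OF that]) (use SET_fun_in[OF that(1)] SET_fun_in[OF that(2)] in auto)
    ultimately show "\<exists>!f. f \<in> hom SET A {i}" by blast
  qed (use small_singleton SET_obj in blast)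
  then show "terminal E (on_obj \<gamma> {i})"
    using inverse_image by (simp add: inverse_image_def left_exact_def)
qed

text \<open>Of the naturality of the adjunction only the set variable is kept, by taking the other
  arrow to be an identity. This reduces arrows out of constant objects to maps out of sets.\<close>

lemma adjoint:
  obtains \<Gamma> :: "('o, 'a, 'u set, 'u set_map) cfunctor" and \<phi> where "\<And>X. X \<in> Obj E \<Longrightarrow> small (on_obj \<Gamma> X)"
    "\<And>A X. small A \<Longrightarrow> X \<in> Obj E \<Longrightarrow> bij_betw (\<phi> A X) (hom E (on_obj \<gamma> A) X) (hom SET A (on_obj \<Gamma> X))"
    "\<And>A B X f h. f \<in> hom SET A B \<Longrightarrow> h \<in> hom E (on_obj \<gamma> B) X \<Longrightarrow> \<phi> A X (h \<bullet> on_arr \<gamma> f) = Comp SET (\<phi> B X h) f"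
proof -
  obtain \<Gamma> where ad: "is_adjunction SET E \<gamma> \<Gamma>" using inverse_image by (auto simp: inverse_image_def)
  then have \<Gamma>: "is_functor E SET \<Gamma>" by (simp add: is_adjunction_def)
  obtain \<phi> where bij: "\<forall>A \<in> Obj SET. \<forall>X \<in> Obj E. bij_betw (\<phi> A X) (hom E (on_obj \<gamma> A) X) (hom SET A (on_obj \<Gamma> X))"
    and nat: "\<forall>f \<in> Arr SET. \<forall>g \<in> Arr E. \<forall>h \<in> hom E (on_obj \<gamma> (Cod SET f)) (Dom E g).
         \<phi> (Dom SET f) (Cod E g) (g \<bullet> h \<bullet> on_arr \<gamma> f) =
         Comp SET (on_arr \<Gamma> g) (Comp SET (\<phi> (Cod SET f) (Dom E g) h) f)"
    using ad unfolding is_adjunction_def by blast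
  show ?thesis
  proof (rule that[of \<Gamma> \<phi>])
    show "small (on_obj \<Gamma> X)" if "X \<in> Obj E" for X
      using \<Gamma> that unfolding is_functor_def SET_obj by blast
    show "bij_betw (\<phi> A X) (hom E (on_obj \<gamma> A) X) (hom SET A (on_obj \<Gamma> X))" if "small A" "X \<in> Obj E" for A X
      using bij that by (simp add: SET_obj)
    fix A B X f h assume f: "f \<in> hom SET A B" and h: "h \<in> hom E (on_obj \<gamma> B) X"
    note X = E_obj(2)[OF h]
    have B: "small B" using f by (simp add: hom_SET)
    have hf: "h \<bullet> on_arr \<gamma> f \<in> hom E (on_obj \<gamma> A) X" by (rule E_comp[OF \<gamma>_hom[OF f] h])
    have \<phi>h: "\<phi> B X h \<in> hom SET B (on_obj \<Gamma> X)"
      using bij_betwE[OF bij[THEN bspec, of B, THEN bspec, of X]] B X h by (simp add: SET_obj)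
    have "\<phi> A X (Id E X \<bullet> h \<bullet> on_arr \<gamma> f) = Comp SET (on_arr \<Gamma> (Id E X)) (Comp SET (\<phi> B X h) f)"
      using nat[THEN bspec, of f, THEN bspec, of "Id E X", THEN bspec, of h] f h E_id[OF X] by (simp add: in_hom)
    moreover have "on_arr \<Gamma> (Id E X) = Id SET (on_obj \<Gamma> X)" using \<Gamma> X by (simp add: is_functor_def)
    moreover have "Comp SET (Id SET (on_obj \<Gamma> X)) (Comp SET (\<phi> B X h) f) = Comp SET (\<phi> B X h) f"
      by (rule comp_id(2)[OF SET_category SET_comp_hom[OF f \<phi>h]])
    ultimately show "\<phi> A X (h \<bullet> on_arr \<gamma> f) = Comp SET (\<phi> B X h) f"
      using E_comp_id(2)[OF hf] by simp
  qed
qed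

text \<open>The constant section of \<open>\<gamma>\<close> of \<open>A\<close> named by
  \<open>i\<close>: the one section of \<open>\<gamma>\<close> of the singleton, carried along the
  inclusion of the point.\<close>

definition kap :: "'u set \<Rightarrow> 'u \<Rightarrow> 'u \<Rightarrow> 'u" where
  "kap A i c = ap (on_arr \<gamma> (point A i)) c (THE x. x \<in> el (on_obj \<gamma> {i}) c)"

lemma kap_point:
  assumes "inh c" "x \<in> el (on_obj \<gamma> {i}) c"
  shows "ap (on_arr \<gamma> (point A i)) c x = kap A i c"
  using \<gamma>_singleton[OF assms(1), of i] assms(2) by (simp add: kap_def the1_equality)

lemma kap_ex:
  assumes "inh c"
  obtains x where "x \<in> el (on_obj \<gamma> {i}) c" "\<And>A. kap A i c = ap (on_arr \<gamma> (point A i)) c x"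
  using \<gamma>_singleton[OF assms, of i] kap_point[OF assms] by metis

lemma kap_el: "small A \<Longrightarrow> i \<in> A \<Longrightarrow> inh c \<Longrightarrow> kap A i c \<in> el (on_obj \<gamma> A) c"
  by (metis kap_ex ap_el \<gamma>_hom point_hom small_singleton)

lemma kap_rs:
  assumes "small A" "i \<in> A" "h \<in> st d c"
  shows "rs (on_obj \<gamma> A) h (kap A i c) = kap A i d"
proof -
  obtain x where x: "x \<in> el (on_obj \<gamma> {i}) c" "\<And>A. kap A i c = ap (on_arr \<gamma> (point A i)) c x"
    using kap_ex[OF st_inh'[OF assms(3)]] by blast
  note p = \<gamma>_hom[OF point_hom[OF small_singleton assms(1,2)]]
  have "rs (on_obj \<gamma> A) h (kap A i c) = ap (on_arr \<gamma> (point A i)) d (rs (on_obj \<gamma> {i}) h x)"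
    using x(2) ap_rs[OF p assms(3) x(1)] by simp
  also have "\<dots> = kap A i d"
    by (rule kap_point[OF st_inh[OF assms(3)] rs_el[OF \<gamma>_obj[OF small_singleton] assms(3) x(1)]])
  finally show ?thesis .
qed

lemma kap_map:
  assumes f: "f \<in> hom SET A B" and i: "i \<in> A" and c: "inh c"
  shows "ap (on_arr \<gamma> f) c (kap A i c) = kap B (sm_fun f i) c"
proof -
  have A: "small A" and B: "small B" using f by (auto simp: hom_SET)
  let ?j = "sm_fun f i"
  have j: "?j \<in> B" using SET_fun_in[OF f i] .
  define t where "t = \<lparr>sm_dom = {i}, sm_cod = {?j}, sm_fun = restrict (\<lambda>_. ?j) {i}\<rparr>"
  have t: "t \<in> hom SET {i} {?j}" unfolding t_def by (rule SET_homI[OF small_singleton small_singleton]) simp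
  note pi = point_hom[OF small_singleton A i] and pj = point_hom[OF small_singleton B j]
  have "Comp SET f (point A i) = Comp SET (point B ?j) t"
    by (rule SET_ext[OF SET_comp_hom[OF pi f] SET_comp_hom[OF t pj]])
      (simp add: SET_comp_fun[OF pi] SET_comp_fun[OF t] point_fun, simp add: t_def point_fun)
  then have eq: "on_arr \<gamma> f \<bullet> on_arr \<gamma> (point A i) = on_arr \<gamma> (point B ?j) \<bullet> on_arr \<gamma> t"
    using \<gamma>_comp[OF pi f] \<gamma>_comp[OF t pj] by simp
  obtain x where x: "x \<in> el (on_obj \<gamma> {i}) c" "\<And>A. kap A i c = ap (on_arr \<gamma> (point A i)) c x"
    using kap_ex[OF c] by blast
  have "ap (on_arr \<gamma> f) c (kap A i c) = ap (on_arr \<gamma> (point B ?j)) c (ap (on_arr \<gamma> t) c x)"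
    using x(2) ap_comp[OF \<gamma>_hom[OF pi] \<gamma>_hom[OF f] c x(1)] ap_comp[OF \<gamma>_hom[OF t] \<gamma>_hom[OF pj] c x(1)] eq by simp
  then show ?thesis using kap_point[OF c ap_el[OF \<gamma>_hom[OF t] c x(1)]] by simp
qed

text \<open>A left adjoint preserves the initial object: arrows out of it correspond to maps out of
  the empty set, of which there is one.\<close>

lemma \<gamma>_empty: "inh c \<Longrightarrow> el (on_obj \<gamma> {}) c = {}"
proof -
  assume c: "inh c"
  obtain \<Gamma> :: "('o, 'a, 'u set, 'u set_map) cfunctor" and \<phi> where b: "\<And>A X. small A \<Longrightarrow> X \<in> Obj E \<Longrightarrow> bij_betw (\<phi> A X) (hom E (on_obj \<gamma> A) X) (hom SET A (on_obj \<Gamma> X))"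
    and G: "\<And>X. X \<in> Obj E \<Longrightarrow> small (on_obj \<Gamma> X)"
    by (rule adjoint) blast
  have "initial E (on_obj \<gamma> {})"
    unfolding initial_def
  proof (intro conjI ballI \<gamma>_obj[OF small_empty])
    fix X assume X: "X \<in> Obj E"
    note bX = b[OF small_empty X]
    have "\<exists>!f. f \<in> hom SET {} (on_obj \<Gamma> X)"
    proof (rule ex1I)
      show e: "\<lparr>sm_dom = {}, sm_cod = on_obj \<Gamma> X, sm_fun = restrict (\<lambda>x. x) {}\<rparr> \<in> hom SET {} (on_obj \<Gamma> X)"
        by (rule SET_homI[OF small_empty G[OF X]]) simp
      show "f = \<lparr>sm_dom = {}, sm_cod = on_obj \<Gamma> X, sm_fun = restrict (\<lambda>x. x) {}\<rparr>" if "f \<in> hom SET {} (on_obj \<Gamma> X)" for f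
        by (rule SET_ext[OF that e]) simp
    qed
    then obtain g where g: "hom SET {} (on_obj \<Gamma> X) = {g}" by blast
    have "card (hom E (on_obj \<gamma> {}) X) = 1" using bij_betw_same_card[OF bX] g by simp
    then obtain f where "hom E (on_obj \<gamma> {}) X = {f}" using card_1_singletonE by blast
    then show "\<exists>!f. f \<in> hom E (on_obj \<gamma> {}) X" by simp
  qed
  then show ?thesis using initial_iff[OF \<gamma>_obj[OF small_empty]] c by blast
qed

text \<open>Two different points have the empty set as their pullback, and \<open>\<gamma>\<close>
  preserves this pullback. A common value of the two constant sections would therefore give a
  section of \<open>\<gamma>\<close> of the empty set.\<close>

lemma kap_inj:
  assumes "small A" "i \<in> A" "j \<in> A" "inh c" "kap A i c = kap A j c"
  shows "i = j"
proof (rule ccontr)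
  assume ne: "i \<noteq> j"
  note p = point_hom[OF small_singleton assms(1)]
  define e where "e k = \<lparr>sm_dom = {} :: 'u set, sm_cod = {k :: 'u}, sm_fun = restrict (\<lambda>x. x) {}\<rparr>" for k
  have e: "e k \<in> hom SET {} {k}" for k unfolding e_def by (rule SET_homI[OF small_empty small_singleton]) simp
  have "is_pullback SET (point A i) (point A j) (e i) (e j)"
    unfolding is_pullback_def
  proof (intro conjI ballI impI)
    show "Comp SET (point A i) (e i) = Comp SET (point A j) (e j)"
      by (rule SET_ext[OF SET_comp_hom[OF e p[OF assms(2)]] SET_comp_hom[OF e p[OF assms(3)]]]) simp
    fix Z a b
    assume a: "a \<in> hom SET Z (Dom SET (point A i))" and b: "b \<in> hom SET Z (Dom SET (point A j))"
      and eq: "Comp SET (point A i) a = Comp SET (point A j) b"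
    have D: "Dom SET (point A k) = {k}" for k by (simp add: SET_def point_def)
    have Z: "Z = {}"
    proof (rule ccontr)
      assume "Z \<noteq> {}"
      then obtain z where z: "z \<in> Z" by blast
      have "sm_fun a z = i" "sm_fun b z = j" using SET_fun_in[OF a z] SET_fun_in[OF b z] D by auto
      moreover have "sm_fun (point A i) (sm_fun a z) = sm_fun (point A j) (sm_fun b z)"
        using SET_comp_fun[OF a z] SET_comp_fun[OF b z] eq by metis
      ultimately show False using ne by (simp add: point_fun)
    qed
    have De: "Dom SET (e i) = {}" by (simp add: SET_def e_def)
    have ide: "Id SET {} \<in> hom SET {} ({} :: 'u set)" by (rule SET_id_hom[OF small_empty])
    have u: "f = g" if "f \<in> hom SET {} B" "g \<in> hom SET {} B" for f g and B :: "'u set"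
      by (rule SET_ext[OF that]) simp
    show "\<exists>!h. h \<in> hom SET Z (Dom SET (e i)) \<and> Comp SET (e i) h = a \<and> Comp SET (e j) h = b"
      unfolding De Z
      using ide u[OF SET_comp_hom[OF ide e], of a] u[OF SET_comp_hom[OF ide e], of b] a b u[OF _ ide]
      unfolding D Z by blast
  qed (use p e assms in \<open>auto simp: in_hom\<close>)
  then have pb: "is_pullback E (on_arr \<gamma> (point A i)) (on_arr \<gamma> (point A j)) (on_arr \<gamma> (e i)) (on_arr \<gamma> (e j))"
    using inverse_image by (simp add: inverse_image_def left_exact_def)
  obtain x where x: "x \<in> el (on_obj \<gamma> {i}) c" "\<And>A. kap A i c = ap (on_arr \<gamma> (point A i)) c x"
    using kap_ex[OF assms(4)] by blast
  obtain y where y: "y \<in> el (on_obj \<gamma> {j}) c" "\<And>A. kap A j c = ap (on_arr \<gamma> (point A j)) c y"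
    using kap_ex[OF assms(4)] by blast
  have "\<exists>m \<in> el (Dom E (on_arr \<gamma> (e i))) c. True"
    using pullback_sub(5)[OF pb \<gamma>_hom[OF p[OF assms(2)]] \<gamma>_hom[OF p[OF assms(3)]] assms(4) x(1) y(1)] x(2) y(2) assms(5)
    by auto
  moreover have "Dom E (on_arr \<gamma> (e i)) = on_obj \<gamma> {}" using \<gamma>_hom[OF e] by (simp add: in_hom)
  ultimately show False using \<gamma>_empty[OF assms(4)] by simp
qed

text \<open>The points of a set are jointly epimorphic and a left adjoint preserves that, so
  \<open>epimorphic_loc\<close> applies: a section of a constant object is locally constant.\<close>

lemma kap_loc:
  assumes A: "small A" and c: "inh c" and x: "x \<in> el (on_obj \<gamma> A) c"
  shows "loc c (\<lambda>d h. \<exists>i\<in>A. rs (on_obj \<gamma> A) h x = kap A i d)"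
proof -
  obtain \<Gamma> :: "('o, 'a, 'u set, 'u set_map) cfunctor" and \<phi> where b: "\<And>A X. small A \<Longrightarrow> X \<in> Obj E \<Longrightarrow> bij_betw (\<phi> A X) (hom E (on_obj \<gamma> A) X) (hom SET A (on_obj \<Gamma> X))"
    and nat: "\<And>A B X f h. f \<in> hom SET A B \<Longrightarrow> h \<in> hom E (on_obj \<gamma> B) X \<Longrightarrow> \<phi> A X (h \<bullet> on_arr \<gamma> f) = Comp SET (\<phi> B X h) f"
    by (rule adjoint) blast
  note p = point_hom[OF small_singleton A]
  let ?F = "(\<lambda>i. on_arr \<gamma> (point A i)) ` A"
  have "epimorphic_family E (on_obj \<gamma> A) ?F"
    unfolding epimorphic_family_def
  proof (intro conjI ballI impI)
    fix Z g h assume Z: "Z \<in> Obj E" and g: "g \<in> hom E (on_obj \<gamma> A) Z" and h: "h \<in> hom E (on_obj \<gamma> A) Z"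
      and eq: "\<forall>f\<in>?F. g \<bullet> f = h \<bullet> f"
    note bA = b[OF A Z]
    have \<phi>g: "\<phi> A Z g \<in> hom SET A (on_obj \<Gamma> Z)" "\<phi> A Z h \<in> hom SET A (on_obj \<Gamma> Z)"
      using bij_betwE[OF bA] g h by auto
    have "\<phi> A Z g = \<phi> A Z h"
    proof (rule SET_ext[OF \<phi>g])
      fix i assume i: "i \<in> A"
      have "Comp SET (\<phi> A Z g) (point A i) = Comp SET (\<phi> A Z h) (point A i)"
        using nat[OF p[OF i] g] nat[OF p[OF i] h] eq i by simp
      then have "sm_fun (\<phi> A Z g) (sm_fun (point A i) i) = sm_fun (\<phi> A Z h) (sm_fun (point A i) i)"
        using SET_comp_fun[OF p[OF i], of i] by (metis singletonI)
      then show "sm_fun (\<phi> A Z g) i = sm_fun (\<phi> A Z h) i" by (simp add: point_fun)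
    qed
    then show "g = h" using inj_onD[OF bij_betw_imp_inj_on[OF bA]] g h by blast
  qed (use \<gamma>_hom[OF p] in \<open>auto simp: in_hom\<close>)
  from epimorphic_loc[OF this \<gamma>_obj[OF A] c x] show ?thesis
  proof (rule loc_mono)
    fix d h assume h: "h \<in> st d c" "\<exists>f\<in>?F. \<exists>y\<in>el (Dom E f) d. ap f d y = rs (on_obj \<gamma> A) h x"
    then obtain i y where i: "i \<in> A" "y \<in> el (Dom E (on_arr \<gamma> (point A i))) d" "ap (on_arr \<gamma> (point A i)) d y = rs (on_obj \<gamma> A) h x"
      by blast
    have "Dom E (on_arr \<gamma> (point A i)) = on_obj \<gamma> {i}" using \<gamma>_hom[OF p[OF i(1)]] by (simp add: in_hom)
    then show "\<exists>i\<in>A. rs (on_obj \<gamma> A) h x = kap A i d"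
      using i kap_point[OF st_inh[OF h(1)], of y i A] by (intro bexI[of _ i]) simp_all
  qed
qed

end

section \<open>Bijections between constant objects, index maps and components\<close>

context topos_over_Set
begin

lemma iso_el_bij:
  assumes f: "f \<in> hom E X Y" "is_iso E f" and c: "inh c"
  shows "bij_betw (ap f c) (el X c) (el Y c)"
proof -
  obtain g where g: "g \<in> hom E Y X" "g \<bullet> f = Id E X" "f \<bullet> g = Id E Y"
    using f by (auto simp: is_iso_def in_hom)
  show ?thesis
    by (rule bij_betw_byWitness[where f' = "ap g c"])
      (use ap_comp[OF f(1) g(1) c] ap_comp[OF g(1) f(1) c] ap_id[OF E_obj(1)[OF f(1)] c]
        ap_id[OF E_obj(2)[OF f(1)] c] g ap_el[OF f(1) c] ap_el[OF g(1) c] in auto)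
qed

lemma SET_iso_bij:
  assumes "f \<in> hom SET A B" "is_iso SET f"
  shows "bij_betw (sm_fun f) A B"
proof -
  obtain g where g: "g \<in> hom SET B A" "Comp SET g f = Id SET A" "Comp SET f g = Id SET B"
    using assms by (auto simp: is_iso_def in_hom)
  have "sm_fun g (sm_fun f x) = x" if "x \<in> A" for x
    using SET_comp_fun[OF assms(1) that, of g] g(2) SET_id_fun[OF that] by simp
  moreover have "sm_fun f (sm_fun g x) = x" if "x \<in> B" for x
    using SET_comp_fun[OF g(1) that, of f] g(3) SET_id_fun[OF that] by simp
  ultimately show ?thesis
    by (intro bij_betw_byWitness[where f' = "sm_fun g"]) (use SET_fun_in[OF assms(1)] SET_fun_in[OF g(1)] in auto)
qed

lemma \<gamma>_bij:
  assumes s: "set_bijection A B s" and c: "inh c"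
  shows "bij_betw (ap (on_arr \<gamma> s) c) (el (on_obj \<gamma> A) c) (el (on_obj \<gamma> B) c)"
proof -
  have h: "s \<in> hom SET A B" and b: "bij_betw (sm_fun s) A B" using s by (auto simp: set_bijection_def)
  have A: "small A" and B: "small B" using h by (auto simp: hom_SET)
  define t where "t = \<lparr>sm_dom = B, sm_cod = A, sm_fun = restrict (inv_into A (sm_fun s)) B\<rparr>"
  have t: "t \<in> hom SET B A" unfolding t_def
    by (rule SET_homI[OF B A]) (use bij_betwE[OF bij_betw_inv_into[OF b]] in blast)
  have "Comp SET t s = Id SET A"
    by (rule SET_ext[OF SET_comp_hom[OF h t] SET_id_hom[OF A]])
      (use SET_fun_in[OF h] bij_betw_inv_into_left[OF b] in \<open>auto simp: SET_comp_fun[OF h] SET_id_fun t_def\<close>)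
  moreover have "Comp SET s t = Id SET B"
    by (rule SET_ext[OF SET_comp_hom[OF t h] SET_id_hom[OF B]])
      (use bij_betw_inv_into_right[OF b] in \<open>simp add: SET_comp_fun[OF t] SET_id_fun, simp add: t_def\<close>)
  ultimately have "is_iso E (on_arr \<gamma> s)"
    using \<gamma>_comp[OF h t] \<gamma>_comp[OF t h] \<gamma>_id[OF A] \<gamma>_id[OF B] \<gamma>_hom[OF h] \<gamma>_hom[OF t]
    by (auto simp: is_iso_def in_hom)
  then show ?thesis using iso_el_bij \<gamma>_hom[OF h] c by blast
qed

text \<open>Turns an indexing of the sections of \<open>X\<close> that is defined only locally into
  an arrow to a constant object. The last conclusion reads an index back from its value, again only
  locally.\<close>

lemma index_arrow:
  assumes X: "X \<in> Obj E" and S: "small S"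
    and W: "\<And>c x w. inh c \<Longrightarrow> x \<in> el X c \<Longrightarrow> W c x w \<Longrightarrow> w \<in> S"
    and stable: "\<And>c d h x w. h \<in> st d c \<Longrightarrow> x \<in> el X c \<Longrightarrow> W c x w \<Longrightarrow> W d (rs X h x) w"
    and uniq: "\<And>c x w w'. inh c \<Longrightarrow> x \<in> el X c \<Longrightarrow> W c x w \<Longrightarrow> W c x w' \<Longrightarrow> w = w'"
    and total: "\<And>c x. inh c \<Longrightarrow> x \<in> el X c \<Longrightarrow> loc c (\<lambda>d h. \<exists>w. W d (rs X h x) w)"
  obtains p where "p \<in> hom E X (on_obj \<gamma> S)"
    "\<And>c x w. inh c \<Longrightarrow> x \<in> el X c \<Longrightarrow> W c x w \<Longrightarrow> ap p c x = kap S w c"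
    "\<And>c x w. inh c \<Longrightarrow> x \<in> el X c \<Longrightarrow> w \<in> S \<Longrightarrow> ap p c x = kap S w c \<Longrightarrow> loc c (\<lambda>d h. W d (rs X h x) w)"
proof -
  obtain p where p: "p \<in> hom E X (on_obj \<gamma> S)"
    "\<And>c x y. inh c \<Longrightarrow> x \<in> el X c \<Longrightarrow> (\<exists>w. W c x w \<and> y = kap S w c) \<Longrightarrow> ap p c x = y"
  proof (rule arrow_of_graph[OF X \<gamma>_obj[OF S], of "\<lambda>c x y. \<exists>w. W c x w \<and> y = kap S w c"])
    show "y \<in> el (on_obj \<gamma> S) c" if "inh c" "x \<in> el X c" "\<exists>w. W c x w \<and> y = kap S w c" for c x y
      using that kap_el[OF S] W by blast
    show "\<exists>w. W d (rs X h x) w \<and> rs (on_obj \<gamma> S) h y = kap S w d"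
      if "h \<in> st d c" "x \<in> el X c" "\<exists>w. W c x w \<and> y = kap S w c" for c d h x y
      using that stable kap_rs[OF S W _] st_inh'[OF that(1)] by (metis kap_rs S W)
    show "y = z" if "inh c" "x \<in> el X c" "\<exists>w. W c x w \<and> y = kap S w c" "\<exists>w. W c x w \<and> z = kap S w c" for c x y z
      using that uniq by blast
    show "loc c (\<lambda>d h. \<exists>y w. W d (rs X h x) w \<and> y = kap S w d)" if "inh c" "x \<in> el X c" for c x
      by (rule loc_mono[OF total[OF that]]) blast
  qed blast
  have "loc c (\<lambda>d h. W d (rs X h x) w)" if c: "inh c" and x: "x \<in> el X c" and w: "w \<in> S" "ap p c x = kap S w c" for c x w
  proof (rule loc_mono[OF total[OF c x]])
    fix d h assume h: "h \<in> st d c" "\<exists>w. W d (rs X h x) w"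
    then obtain v where v: "W d (rs X h x) v" by blast
    note d = st_inh[OF h(1)] and hx = rs_el[OF X h(1) x]
    have "ap p d (rs X h x) = kap S v d" using p(2)[OF d hx] v by blast
    then have "kap S v d = kap S w d" using ap_rs[OF p(1) h(1) x] w(2) kap_rs[OF S w(1) h(1)] by simp
    then have "v = w" using kap_inj[OF S W[OF d hx v] w(1) d] by blast
    then show "W d (rs X h x) w" using v by simp
  qed
  then show ?thesis using that[of p] p by blast
qed

subsection \<open>Components\<close>

context
  fixes I U \<zeta> assumes I: "small I" and \<zeta>: "\<zeta> \<in> hom E U (on_obj \<gamma> I)"
begin

lemma comp_pullback:
  assumes "i \<in> I"
  obtains q where "is_pullback E \<zeta> (on_arr \<gamma> (point I i)) (comp_incl E \<gamma> I \<zeta> i) q"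
proof -
  have p: "on_arr \<gamma> (point I i) \<in> hom E (on_obj \<gamma> {i}) (on_obj \<gamma> I)"
    using \<gamma>_hom point_hom[OF small_singleton I assms] by blast
  have "\<exists>p q. is_pullback E \<zeta> (on_arr \<gamma> (point I i)) p q"
    by (rule pullback_exists[OF \<zeta> p]) blast
  from someI_ex[OF this] show ?thesis using that unfolding comp_incl_def by blast
qed

text \<open>Since \<open>\<gamma>\<close> of a singleton has one section per stage, the pullback
  along a point is the subobject of those sections of \<open>U\<close> whose index is constantly
  \<open>i\<close>.\<close>

lemma comp_incl:
  assumes i: "i \<in> I"
  shows comp_incl_hom: "comp_incl E \<gamma> I \<zeta> i \<in> hom E (component E \<gamma> I \<zeta> i) U"
    and comp_incl_kap: "\<And>c m. inh c \<Longrightarrow> m \<in> el (component E \<gamma> I \<zeta> i) c \<Longrightarrow>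
      ap \<zeta> c (ap (comp_incl E \<gamma> I \<zeta> i) c m) = kap I i c"
    and comp_incl_inj: "\<And>c m n. inh c \<Longrightarrow> m \<in> el (component E \<gamma> I \<zeta> i) c \<Longrightarrow> n \<in> el (component E \<gamma> I \<zeta> i) c \<Longrightarrow>
      ap (comp_incl E \<gamma> I \<zeta> i) c m = ap (comp_incl E \<gamma> I \<zeta> i) c n \<Longrightarrow> m = n"
    and comp_incl_ex: "\<And>c u. inh c \<Longrightarrow> u \<in> el U c \<Longrightarrow> ap \<zeta> c u = kap I i c \<Longrightarrow>
      \<exists>m \<in> el (component E \<gamma> I \<zeta> i) c. ap (comp_incl E \<gamma> I \<zeta> i) c m = u"
proof -
  have p: "on_arr \<gamma> (point I i) \<in> hom E (on_obj \<gamma> {i}) (on_obj \<gamma> I)"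
    using \<gamma>_hom point_hom[OF small_singleton I assms] by blast
  obtain q where P: "is_pullback E \<zeta> (on_arr \<gamma> (point I i)) (comp_incl E \<gamma> I \<zeta> i) q"
    using comp_pullback[OF i] .
  note s = pullback_sub[OF P \<zeta> p, folded component_def[of E \<gamma> I \<zeta> i]]
  show "comp_incl E \<gamma> I \<zeta> i \<in> hom E (component E \<gamma> I \<zeta> i) U" by (rule s(1))
  show "ap \<zeta> c (ap (comp_incl E \<gamma> I \<zeta> i) c m) = kap I i c" if "inh c" "m \<in> el (component E \<gamma> I \<zeta> i) c" for c m
    using s(3)[OF that] kap_point[OF that(1) ap_el[OF s(2) that]] by simp
  show "m = n" if "inh c" "m \<in> el (component E \<gamma> I \<zeta> i) c" "n \<in> el (component E \<gamma> I \<zeta> i) c"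
    "ap (comp_incl E \<gamma> I \<zeta> i) c m = ap (comp_incl E \<gamma> I \<zeta> i) c n" for c m n
  proof (rule s(4)[OF that])
    show "ap q c m = ap q c n"
      using \<gamma>_singleton[OF that(1)] ap_el[OF s(2) that(1,2)] ap_el[OF s(2) that(1,3)] by blast
  qed
  show "\<exists>m \<in> el (component E \<gamma> I \<zeta> i) c. ap (comp_incl E \<gamma> I \<zeta> i) c m = u"
    if c: "inh c" and u: "u \<in> el U c" and eq: "ap \<zeta> c u = kap I i c" for c u
  proof -
    obtain x where "x \<in> el (on_obj \<gamma> {i}) c" using \<gamma>_singleton[OF c] by blast
    then show ?thesis using s(5)[OF c u, of x] kap_point[OF c] eq by fastforce
  qed
qed

lemma component_obj: "i \<in> I \<Longrightarrow> component E \<gamma> I \<zeta> i \<in> Obj E"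
  using comp_incl_hom E_obj(1) by blast

lemma nonempty_component:
  assumes "i \<in> I"
  shows "nonempty E (component E \<gamma> I \<zeta> i) \<longleftrightarrow> (\<exists>c u. inh c \<and> u \<in> el U c \<and> ap \<zeta> c u = kap I i c)"
proof
  assume "nonempty E (component E \<gamma> I \<zeta> i)"
  then obtain c m where "inh c" "m \<in> el (component E \<gamma> I \<zeta> i) c" using nonempty_iff by blast
  then show "\<exists>c u. inh c \<and> u \<in> el U c \<and> ap \<zeta> c u = kap I i c"
    using comp_incl_kap[OF assms] ap_el[OF comp_incl_hom[OF assms]] by blast
next
  assume "\<exists>c u. inh c \<and> u \<in> el U c \<and> ap \<zeta> c u = kap I i c"
  then show "nonempty E (component E \<gamma> I \<zeta> i)"
    using comp_incl_ex[OF assms] nonemptyI[OF component_obj[OF assms]] by blast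
qed

end

text \<open>The inclusion of a component is injective on sections, so there is at most one induced
  arrow; by \<open>fi\<close> the image of a section with index \<open>i\<close> has index
  \<open>i'\<close>, so there is one.\<close>

lemma comp_map:
  assumes I: "small I" and \<zeta>: "\<zeta> \<in> hom E U (on_obj \<gamma> I)" and i: "i \<in> I"
    and I': "small I'" and \<zeta>': "\<zeta>' \<in> hom E U' (on_obj \<gamma> I')" and i': "i' \<in> I'"
    and f: "f \<in> hom E U U'"
    and fi: "\<And>c u. inh c \<Longrightarrow> u \<in> el U c \<Longrightarrow> ap \<zeta> c u = kap I i c \<Longrightarrow> ap \<zeta>' c (ap f c u) = kap I' i' c"
  shows "comp_map E \<gamma> I \<zeta> i I' \<zeta>' i' f \<in> hom E (component E \<gamma> I \<zeta> i) (component E \<gamma> I' \<zeta>' i')"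
    and "\<And>c m. inh c \<Longrightarrow> m \<in> el (component E \<gamma> I \<zeta> i) c \<Longrightarrow>
       ap (comp_incl E \<gamma> I' \<zeta>' i') c (ap (comp_map E \<gamma> I \<zeta> i I' \<zeta>' i' f) c m) = ap f c (ap (comp_incl E \<gamma> I \<zeta> i) c m)"
proof -
  let ?g = "comp_map E \<gamma> I \<zeta> i I' \<zeta>' i' f" and ?X = "component E \<gamma> I \<zeta> i" and ?Y = "component E \<gamma> I' \<zeta>' i'"
  let ?p = "comp_incl E \<gamma> I \<zeta> i" and ?q = "comp_incl E \<gamma> I' \<zeta>' i'"
  note p = comp_incl[OF I \<zeta> i] and q = comp_incl[OF I' \<zeta>' i']
  have "\<exists>n \<in> el ?Y c. ap ?q c n = ap f c (ap ?p c m)" if "inh c" "m \<in> el ?X c" for c m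
    using q(4)[OF that(1) ap_el[OF f that(1) ap_el[OF p(1) that]]] fi[OF that(1) ap_el[OF p(1) that]] p(2)[OF that] by simp
  then obtain \<phi> where \<phi>: "\<And>c m. inh c \<Longrightarrow> m \<in> el ?X c \<Longrightarrow> \<phi> c m \<in> el ?Y c \<and> ap ?q c (\<phi> c m) = ap f c (ap ?p c m)"
    by metis
  have nat: "\<phi> d (rs ?X h m) = rs ?Y h (\<phi> c m)" if h: "h \<in> st d c" and m: "m \<in> el ?X c" for h d c m
  proof (rule q(3)[OF st_inh[OF h]])
    note hm = rs_el[OF E_obj(1)[OF p(1)] h m] and \<phi>m = \<phi>[OF st_inh'[OF h] m]
    show "\<phi> d (rs ?X h m) \<in> el ?Y d" using \<phi>[OF st_inh[OF h] hm] by blast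
    show "rs ?Y h (\<phi> c m) \<in> el ?Y d" using rs_el[OF E_obj(1)[OF q(1)] h] \<phi>m by blast
    have "ap ?q d (\<phi> d (rs ?X h m)) = ap f d (ap ?p d (rs ?X h m))" using \<phi>[OF st_inh[OF h] hm] by simp
    also have "\<dots> = rs U' h (ap f c (ap ?p c m))"
      using ap_rs[OF p(1) h m] ap_rs[OF f h ap_el[OF p(1) st_inh'[OF h] m]] by simp
    also have "\<dots> = ap ?q d (rs ?Y h (\<phi> c m))" using \<phi>m ap_rs[OF q(1) h] by simp
    finally show "ap ?q d (\<phi> d (rs ?X h m)) = ap ?q d (rs ?Y h (\<phi> c m))" .
  qed
  obtain g where g: "g \<in> hom E ?X ?Y" "\<And>c m. inh c \<Longrightarrow> m \<in> el ?X c \<Longrightarrow> ap g c m = \<phi> c m"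
    by (rule arrow_of_family[OF E_obj(1)[OF p(1)] E_obj(1)[OF q(1)], of \<phi>]) (use \<phi> nat in blast)+
  have 1: "?q \<bullet> g = f \<bullet> ?p"
    by (rule ext_stage[OF E_comp[OF g(1) q(1)] E_comp[OF p(1) f]])
      (use ap_comp[OF g(1) q(1)] ap_comp[OF p(1) f] g(2) \<phi> in auto)
  have u: "h = g" if h: "h \<in> hom E ?X ?Y" "?q \<bullet> h = f \<bullet> ?p" for h
  proof (rule ext_stage[OF h(1) g(1)])
    fix c m assume c: "inh c" and m: "m \<in> el ?X c"
    show "ap h c m = ap g c m"
      by (rule q(3)[OF c ap_el[OF h(1) c m] ap_el[OF g(1) c m]])
        (use ap_comp[OF h(1) q(1) c m] ap_comp[OF g(1) q(1) c m] h(2) 1 in simp)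
  qed
  have "?g = g" unfolding comp_map_def
  proof (rule the_equality)
    show "g \<in> hom E ?X ?Y \<and> ?q \<bullet> g = f \<bullet> ?p" using g(1) 1 by (rule conjI)
    show "h = g" if "h \<in> hom E ?X ?Y \<and> ?q \<bullet> h = f \<bullet> ?p" for h using u that by blast
  qed
  then show "?g \<in> hom E ?X ?Y" using g(1) by simp
  show "ap ?q c (ap ?g c m) = ap f c (ap ?p c m)" if "inh c" "m \<in> el ?X c" for c m
    using g(2)[OF that] \<phi>[OF that] unfolding \<open>?g = g\<close> by simp
qed

end

section \<open>Simplicial families\<close>

locale simplicial_fam = topos_over_Set ty E C J \<Phi> \<gamma>
  for ty :: "'u itself" and E :: "('o, 'a) category" and C :: "('u, 'u) category" and J
    and \<Phi> :: "('o, 'a, 'u) sheaf_functor"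
    and \<gamma> :: "('u set, 'u set_map, 'o, 'a) cfunctor" +
  fixes F :: "('o, 'a, 'u) simplicial_family"
  assumes family: "is_simplicial_family E \<gamma> F"
    and self_dual: "is_self_dual E \<gamma> F"
begin

abbreviation S where "S \<equiv> fam_S F"
abbreviation H where "H \<equiv> fam_H F"
abbreviation p where "p \<equiv> fam_p F"
abbreviation K where "K \<equiv> family_components E \<gamma> F"

abbreviation src where "src l \<equiv> sm_fun (dd S (Suc 0) (Suc 0)) l"
abbreviation trg where "trg l \<equiv> sm_fun (dd S (Suc 0) 0) l"
abbreviation K1 where "K1 \<equiv> co K (Suc 0)"
abbreviation induced where "induced \<equiv> induced_datum E \<gamma> F"
abbreviation inc where "inc n w \<equiv> comp_incl E \<gamma> (lev S n) (p n) w"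

lemma K_simps:
  "ix K = lev S" "ix_d K n i = sm_fun (dd S n i)" "ix_s K n i = sm_fun (ss S n i)"
  "ix_op K n = sm_fun (fam_tauS F n)" "co K n = component E \<gamma> (lev S n) (p n)"
  by (simp_all add: family_components_def Let_def)

lemma S_small: "small (lev S n)"
  using family by (simp add: is_simplicial_family_def is_family_def)

lemma p_hom: "p n \<in> hom E (lev H n) (on_obj \<gamma> (lev S n))"
  using family by (simp add: is_simplicial_family_def is_family_def)

lemma co_nonempty: "w \<in> lev S n \<Longrightarrow> nonempty E (co K n w)"
  using family by (simp add: is_simplicial_family_def is_family_def K_simps)

lemma co_obj: "w \<in> lev S n \<Longrightarrow> co K n w \<in> Obj E"
  using co_nonempty by (simp add: nonempty_def)

lemma H_obj: "lev H n \<in> Obj E"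
  using p_hom E_obj by blast

lemma S_d: "i \<le> Suc n \<Longrightarrow> dd S (Suc n) i \<in> hom SET (lev S (Suc n)) (lev S n)"
  and H_d: "i \<le> Suc n \<Longrightarrow> dd H (Suc n) i \<in> hom E (lev H (Suc n)) (lev H n)"
  and S_s: "i \<le> n \<Longrightarrow> ss S n i \<in> hom SET (lev S n) (lev S (Suc n))"
  and H_s: "i \<le> n \<Longrightarrow> ss H n i \<in> hom E (lev H n) (lev H (Suc n))"
  using family by (simp_all add: is_simplicial_family_def is_simplicial_def)

lemma tau: "fam_tau F n \<in> hom E (lev H n) (lev H n)" "is_iso E (fam_tau F n)"
  and tauS: "fam_tauS F n \<in> hom SET (lev S n) (lev S n)" "is_iso SET (fam_tauS F n)"
  using self_dual by (simp_all add: is_self_dual_def strict_duality_def)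

lemmas inc_hom = comp_incl_hom[OF S_small p_hom, folded K_simps(5)]
lemmas inc_kap = comp_incl_kap[OF S_small p_hom, folded K_simps(5)]
lemmas inc_inj = comp_incl_inj[OF S_small p_hom, folded K_simps(5)]
lemmas inc_ex = comp_incl_ex[OF S_small p_hom, folded K_simps(5)]

lemma pd:
  assumes "i \<le> Suc n" "inh c" "x \<in> el (lev H (Suc n)) c" "w \<in> lev S (Suc n)" "ap (p (Suc n)) c x = kap (lev S (Suc n)) w c"
  shows "ap (p n) c (ap (dd H (Suc n) i) c x) = kap (lev S n) (sm_fun (dd S (Suc n) i) w) c"
proof -
  have "on_arr \<gamma> (dd S (Suc n) i) \<bullet> p (Suc n) = p n \<bullet> dd H (Suc n) i"
    using family assms(1) by (simp add: is_simplicial_family_def is_simplicial_map_def map_simplicial_def)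
  then show ?thesis
    using ap_comp[OF H_d[OF assms(1)] p_hom assms(2,3)] ap_comp[OF p_hom \<gamma>_hom[OF S_d[OF assms(1)]] assms(2,3)]
      kap_map[OF S_d[OF assms(1)] assms(4,2)] assms(5) by simp
qed

lemma ps:
  assumes "i \<le> n" "inh c" "x \<in> el (lev H n) c" "w \<in> lev S n" "ap (p n) c x = kap (lev S n) w c"
  shows "ap (p (Suc n)) c (ap (ss H n i) c x) = kap (lev S (Suc n)) (sm_fun (ss S n i) w) c"
proof -
  have "on_arr \<gamma> (ss S n i) \<bullet> p n = p (Suc n) \<bullet> ss H n i"
    using family assms(1) by (simp add: is_simplicial_family_def is_simplicial_map_def map_simplicial_def)
  then show ?thesis
    using ap_comp[OF H_s[OF assms(1)] p_hom assms(2,3)] ap_comp[OF p_hom \<gamma>_hom[OF S_s[OF assms(1)]] assms(2,3)]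
      kap_map[OF S_s[OF assms(1)] assms(4,2)] assms(5) by simp
qed

lemma ptau:
  assumes "inh c" "x \<in> el (lev H n) c" "w \<in> lev S n" "ap (p n) c x = kap (lev S n) w c"
  shows "ap (p n) c (ap (fam_tau F n) c x) = kap (lev S n) (sm_fun (fam_tauS F n) w) c"
proof -
  have "p n \<bullet> fam_tau F n = on_arr \<gamma> (fam_tauS F n) \<bullet> p n"
    using self_dual by (simp add: is_self_dual_def)
  then show ?thesis
    using ap_comp[OF tau(1) p_hom assms(1,2)] ap_comp[OF p_hom \<gamma>_hom[OF tauS(1)] assms(1,2)]
      kap_map[OF tauS(1) assms(3,1)] assms(4) by simp
qed

lemma S_d_in: "i \<le> Suc n \<Longrightarrow> w \<in> lev S (Suc n) \<Longrightarrow> sm_fun (dd S (Suc n) i) w \<in> lev S n"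
  and S_s_in: "i \<le> n \<Longrightarrow> w \<in> lev S n \<Longrightarrow> sm_fun (ss S n i) w \<in> lev S (Suc n)"
  and tauS_in: "w \<in> lev S n \<Longrightarrow> sm_fun (fam_tauS F n) w \<in> lev S n"
  using SET_fun_in[OF S_d] SET_fun_in[OF S_s] SET_fun_in[OF tauS(1)] by blast+

lemma co_d:
  assumes "i \<le> Suc n" "w \<in> lev S (Suc n)"
  shows "co_d K (Suc n) i w \<in> hom E (co K (Suc n) w) (co K n (sm_fun (dd S (Suc n) i) w))"
    "\<And>c m. inh c \<Longrightarrow> m \<in> el (co K (Suc n) w) c \<Longrightarrow>
      ap (inc n (sm_fun (dd S (Suc n) i) w)) c (ap (co_d K (Suc n) i w) c m) = ap (dd H (Suc n) i) c (ap (inc (Suc n) w) c m)"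
proof -
  have *: "co_d K (Suc n) i w = comp_map E \<gamma> (lev S (Suc n)) (p (Suc n)) w (lev S n) (p n) (sm_fun (dd S (Suc n) i) w) (dd H (Suc n) i)"
    by (simp add: family_components_def Let_def)
  note c = comp_map[OF S_small p_hom assms(2) S_small p_hom S_d_in[OF assms] H_d[OF assms(1)] pd[OF assms(1) _ _ assms(2)]]
  show "co_d K (Suc n) i w \<in> hom E (co K (Suc n) w) (co K n (sm_fun (dd S (Suc n) i) w))"
    "\<And>c m. inh c \<Longrightarrow> m \<in> el (co K (Suc n) w) c \<Longrightarrow>
      ap (inc n (sm_fun (dd S (Suc n) i) w)) c (ap (co_d K (Suc n) i w) c m) = ap (dd H (Suc n) i) c (ap (inc (Suc n) w) c m)"
    using c unfolding * K_simps by blast+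
qed

lemma co_s:
  assumes "i \<le> n" "w \<in> lev S n"
  shows "co_s K n i w \<in> hom E (co K n w) (co K (Suc n) (sm_fun (ss S n i) w))"
    "\<And>c m. inh c \<Longrightarrow> m \<in> el (co K n w) c \<Longrightarrow>
      ap (inc (Suc n) (sm_fun (ss S n i) w)) c (ap (co_s K n i w) c m) = ap (ss H n i) c (ap (inc n w) c m)"
proof -
  have *: "co_s K n i w = comp_map E \<gamma> (lev S n) (p n) w (lev S (Suc n)) (p (Suc n)) (sm_fun (ss S n i) w) (ss H n i)"
    by (simp add: family_components_def Let_def)
  note c = comp_map[OF S_small p_hom assms(2) S_small p_hom S_s_in[OF assms] H_s[OF assms(1)] ps[OF assms(1) _ _ assms(2)]]
  show "co_s K n i w \<in> hom E (co K n w) (co K (Suc n) (sm_fun (ss S n i) w))"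
    "\<And>c m. inh c \<Longrightarrow> m \<in> el (co K n w) c \<Longrightarrow>
      ap (inc (Suc n) (sm_fun (ss S n i) w)) c (ap (co_s K n i w) c m) = ap (ss H n i) c (ap (inc n w) c m)"
    using c unfolding * K_simps by blast+
qed

lemma co_op:
  assumes "w \<in> lev S n"
  shows "co_op K n w \<in> hom E (co K n w) (co K n (sm_fun (fam_tauS F n) w))"
    "\<And>c m. inh c \<Longrightarrow> m \<in> el (co K n w) c \<Longrightarrow>
      ap (inc n (sm_fun (fam_tauS F n) w)) c (ap (co_op K n w) c m) = ap (fam_tau F n) c (ap (inc n w) c m)"
proof -
  have *: "co_op K n w = comp_map E \<gamma> (lev S n) (p n) w (lev S n) (p n) (sm_fun (fam_tauS F n) w) (fam_tau F n)"
    by (simp add: family_components_def Let_def)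
  note c = comp_map[OF S_small p_hom assms(1) S_small p_hom tauS_in[OF assms(1)] tau(1) ptau[OF _ _ assms(1)]]
  show "co_op K n w \<in> hom E (co K n w) (co K n (sm_fun (fam_tauS F n) w))"
    "\<And>c m. inh c \<Longrightarrow> m \<in> el (co K n w) c \<Longrightarrow>
      ap (inc n (sm_fun (fam_tauS F n) w)) c (ap (co_op K n w) c m) = ap (fam_tau F n) c (ap (inc n w) c m)"
    using c unfolding * K_simps by blast+
qed

text \<open>The duality is bijective on all sections of the level. A preimage of a section of the
  opposite component lies in the component of \<open>w\<close>, because \<open>\<gamma>\<close> of
  the duality on indices is injective.\<close>

lemma co_op_bij:
  assumes w: "w \<in> lev S n" and c: "inh c"
  shows "bij_betw (ap (co_op K n w) c) (el (co K n w) c) (el (co K n (sm_fun (fam_tauS F n) w)) c)"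
proof -
  let ?v = "sm_fun (fam_tauS F n) w"
  note h = co_op[OF w] and v = tauS_in[OF w]
  have "inj_on (ap (co_op K n w) c) (el (co K n w) c)"
  proof (rule inj_onI)
    fix x y assume x: "x \<in> el (co K n w) c" and y: "y \<in> el (co K n w) c" and eq: "ap (co_op K n w) c x = ap (co_op K n w) c y"
    have "ap (fam_tau F n) c (ap (inc n w) c x) = ap (fam_tau F n) c (ap (inc n w) c y)"
      using h(2)[OF c x] h(2)[OF c y] eq by simp
    then have "ap (inc n w) c x = ap (inc n w) c y"
      using inj_onD[OF bij_betw_imp_inj_on[OF iso_el_bij[OF tau c]]] ap_el[OF inc_hom[OF w] c] x y by blast
    then show "x = y" using inc_inj[OF w c x y] by blast
  qed
  moreover have "y \<in> ap (co_op K n w) c ` el (co K n w) c" if y: "y \<in> el (co K n ?v) c" for y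
  proof -
    note iy = ap_el[OF inc_hom[OF v] c y]
    then have "ap (inc n ?v) c y \<in> ap (fam_tau F n) c ` el (lev H n) c"
      using bij_betw_imp_surj_on[OF iso_el_bij[OF tau[of n] c]] by simp
    then obtain x where x: "x \<in> el (lev H n) c" "ap (fam_tau F n) c x = ap (inc n ?v) c y"
      by (elim imageE) simp
    have bS: "set_bijection (lev S n) (lev S n) (fam_tauS F n)"
      using tauS[of n] SET_iso_bij[OF tauS[of n]] by (simp add: set_bijection_def)
    have "p n \<bullet> fam_tau F n = on_arr \<gamma> (fam_tauS F n) \<bullet> p n"
      using self_dual by (simp add: is_self_dual_def)
    then have "ap (on_arr \<gamma> (fam_tauS F n)) c (ap (p n) c x) = ap (on_arr \<gamma> (fam_tauS F n)) c (kap (lev S n) w c)"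
      using ap_comp[OF tau(1) p_hom c x(1)] ap_comp[OF p_hom \<gamma>_hom[OF tauS(1)] c x(1)] x(2) inc_kap[OF v c y]
        kap_map[OF tauS(1) w c] by simp
    then have "ap (p n) c x = kap (lev S n) w c"
      using inj_onD[OF bij_betw_imp_inj_on[OF \<gamma>_bij[OF bS c]]] ap_el[OF p_hom c x(1)] kap_el[OF S_small w c] by blast
    then obtain m where m: "m \<in> el (co K n w) c" "ap (inc n w) c m = x" using inc_ex[OF w c x(1)] by blast
    have "ap (co_op K n w) c m = y"
      by (rule inc_inj[OF v c ap_el[OF h(1) c m(1)] y]) (use h(2)[OF c m(1)] m x in simp)
    then show ?thesis using m(1) by blast
  qed
  moreover have "ap (co_op K n w) c ` el (co K n w) c \<subseteq> el (co K n ?v) c" using ap_el[OF h(1) c] by blast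
  ultimately show ?thesis by (intro bij_betw_imageI equalityI subsetI) blast+
qed

end

section \<open>The descent datum induced by bijections on the edges\<close>

context simplicial_fam
begin

lemma S_dd:
  assumes "j \<le> n + 2" "i < j" "w \<in> lev S (Suc (Suc n))"
  shows "sm_fun (dd S (Suc n) i) (sm_fun (dd S (Suc (Suc n)) j) w) =
    sm_fun (dd S (Suc n) (j - 1)) (sm_fun (dd S (Suc (Suc n)) i) w)"
proof -
  have "Comp SET (dd S (n + 1) i) (dd S (n + 2) j) = Comp SET (dd S (n + 1) (j - 1)) (dd S (n + 2) i)"
    using family assms(1,2) by (simp add: is_simplicial_family_def is_simplicial_def)
  then show ?thesis
    using SET_comp_fun[OF S_d[of j "Suc n"], of w "dd S (Suc n) i"]
      SET_comp_fun[OF S_d[of i "Suc n"], of w "dd S (Suc n) (j - 1)"] assms by simp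
qed

lemma S_ds:
  assumes "k \<le> Suc 0" "i \<in> lev S 0"
  shows "sm_fun (dd S (Suc 0) k) (sm_fun (ss S 0 0) i) = i"
proof -
  have "\<forall>n. \<forall>j\<le>n. \<forall>i\<le>n + 1. Comp SET (dd S (n + 1) i) (ss S n j) =
         (if i < j then Comp SET (ss S (n - 1) (j - 1)) (dd S n i)
          else if i \<le> j + 1 then Id SET (lev S n)
          else Comp SET (ss S (n - 1) j) (dd S n (i - 1)))"
    using family by (simp add: is_simplicial_family_def is_simplicial_def)
  from this[THEN spec, of 0, THEN spec, of 0] have "Comp SET (dd S (Suc 0) k) (ss S 0 0) = Id SET (lev S 0)"
    using assms(1) by simp
  then show ?thesis using SET_comp_fun[OF S_s[of 0 0] assms(2), of "dd S (Suc 0) k"] SET_id_fun[OF assms(2)] by simp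
qed

lemma H_ds:
  assumes "k \<le> Suc 0" "inh c" "x \<in> el (lev H 0) c"
  shows "ap (dd H (Suc 0) k) c (ap (ss H 0 0) c x) = x"
proof -
  have "\<forall>n. \<forall>j\<le>n. \<forall>i\<le>n + 1. Comp E (dd H (n + 1) i) (ss H n j) =
         (if i < j then Comp E (ss H (n - 1) (j - 1)) (dd H n i)
          else if i \<le> j + 1 then Id E (lev H n)
          else Comp E (ss H (n - 1) j) (dd H n (i - 1)))"
    using family by (simp add: is_simplicial_family_def is_simplicial_def)
  from this[THEN spec, of 0, THEN spec, of 0] have "dd H (Suc 0) k \<bullet> ss H 0 0 = Id E (lev H 0)"
    using assms(1) by simp
  then show ?thesis using ap_comp[OF H_s[of 0 0] H_d[of k 0] assms(2,3)] ap_id[OF H_obj assms(2,3)] assms(1) by simp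
qed

context
  fixes R s
  assumes sd: "S_descent_datum E \<gamma> F R s"
begin

lemma s_bij: "l \<in> lev S (Suc 0) \<Longrightarrow> set_bijection (R (src l)) (R (trg l)) (s l)"
  and s_id: "i \<in> lev S 0 \<Longrightarrow> s (sm_fun (ss S 0 0) i) = Id SET (R i)"
  and s_comp: "w \<in> lev S (Suc (Suc 0)) \<Longrightarrow> s (sm_fun (dd S (Suc (Suc 0)) (Suc 0)) w) =
     Comp SET (s (sm_fun (dd S (Suc (Suc 0)) 0) w)) (s (sm_fun (dd S (Suc (Suc 0)) (Suc (Suc 0))) w))"
  using sd by (simp_all add: S_descent_datum_def Let_def K_simps numeral_2_eq_2)

lemma s_hom: "l \<in> lev S (Suc 0) \<Longrightarrow> s l \<in> hom SET (R (src l)) (R (trg l))"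
  using s_bij by (simp add: set_bijection_def)

text \<open>The degenerate edge at \<open>i\<close> carries an arrow of \<open>SET\<close> with
  domain \<open>R i\<close>.\<close>

lemma R_small: "i \<in> lev S 0 \<Longrightarrow> small (R i)"
  using s_hom[OF S_s_in[of 0 0 i]] by (simp add: S_ds hom_SET)

lemma induced_hom:
  assumes l: "l \<in> lev S (Suc 0)"
  shows "induced s l \<in> hom E (Prod E [on_obj \<gamma> (R (src l)), K1 l])
     (Prod E [on_obj \<gamma> (R (trg l)), K1 (sm_fun (fam_tauS F (Suc 0)) l)])"
    "\<And>c r x. inh c \<Longrightarrow> r \<in> el (on_obj \<gamma> (R (src l))) c \<Longrightarrow> x \<in> el (K1 l) c \<Longrightarrow>
     ap (induced s l) c (tp [on_obj \<gamma> (R (src l)), K1 l] c [r, x]) =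
     tp [on_obj \<gamma> (R (trg l)), K1 (sm_fun (fam_tauS F (Suc 0)) l)] c
       [ap (on_arr \<gamma> (s l)) c r, ap (co_op K (Suc 0) l) c x]"
  using arr_prod[OF \<gamma>_hom[OF s_hom[OF l]] co_op(1)[OF l]] by (simp_all add: induced_datum_def)

text \<open>The first projection of the induced isomorphism forgets the point of the component: it
  is \<open>\<gamma>\<close> of a bijection, applied to \<open>r\<close>.\<close>

lemma hat_induced:
  assumes l: "l \<in> lev S (Suc 0)"
  shows "hat E \<gamma> K R (induced s) l \<in> hom E
      (Prod E [on_obj \<gamma> (R (src l)), K1 l]) (on_obj \<gamma> (R (trg l)))"
    "\<And>c r x. inh c \<Longrightarrow> r \<in> el (on_obj \<gamma> (R (src l))) c \<Longrightarrow> x \<in> el (K1 l) c \<Longrightarrow>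
     ap (hat E \<gamma> K R (induced s) l) c
       (tp [on_obj \<gamma> (R (src l)), K1 l] c [r, x]) = ap (on_arr \<gamma> (s l)) c r"
proof -
  note h = induced_hom[OF l] and o = E_obj(1)[OF \<gamma>_hom[OF s_hom[OF l]]] E_obj(2)[OF \<gamma>_hom[OF s_hom[OF l]]]
    co_obj[OF l] co_obj[OF tauS_in[OF l]]
  have eq: "hat E \<gamma> K R (induced s) l =
    pr E [on_obj \<gamma> (R (trg l)), K1 (sm_fun (fam_tauS F (Suc 0)) l)] 0 \<bullet> induced s l"
    by (simp add: hat_def K_simps)
  show "hat E \<gamma> K R (induced s) l \<in> hom E
      (Prod E [on_obj \<gamma> (R (src l)), K1 l]) (on_obj \<gamma> (R (trg l)))"
    unfolding eq by (rule E_comp[OF h(1) pr2_hom(1)[OF o(2,4)]])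
  fix c r x assume c: "inh c" and r: "r \<in> el (on_obj \<gamma> (R (src l))) c"
    and x: "x \<in> el (K1 l) c"
  show "ap (hat E \<gamma> K R (induced s) l) c
       (tp [on_obj \<gamma> (R (src l)), K1 l] c [r, x]) = ap (on_arr \<gamma> (s l)) c r"
    unfolding eq
    using ap_comp[OF h(1) pr2_hom(1)[OF o(2,4)] c tp2(1)[OF o(1,3) c r x]] h(2)[OF c r x]
      tp2(2)[OF o(2,4) c ap_el[OF \<gamma>_hom[OF s_hom[OF l]] c r] ap_el[OF co_op(1)[OF l] c x]] by simp
qed

lemma induced_iso:
  assumes l: "l \<in> lev S (Suc 0)"
  shows "is_iso E (induced s l)"
proof (rule iso_bij[OF induced_hom(1)[OF l]])
  fix c assume c: "inh c"
  let ?A = "on_obj \<gamma> (R (src l))" and ?B = "on_obj \<gamma> (R (trg l))"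
  let ?P = "K1 l" and ?Q = "K1 (sm_fun (fam_tauS F (Suc 0)) l)"
  note o = E_obj(1)[OF \<gamma>_hom[OF s_hom[OF l]]] E_obj(2)[OF \<gamma>_hom[OF s_hom[OF l]]]
    co_obj[OF l] co_obj[OF tauS_in[OF l]]
  note h = induced_hom[OF l]
  note bA = \<gamma>_bij[OF s_bij[OF l] c] and bP = co_op_bij[OF l c]
  show "bij_betw (ap (induced s l) c) (el (Prod E [?A, ?P]) c) (el (Prod E [?B, ?Q]) c)"
    unfolding bij_betw_def
  proof (intro conjI inj_onI equalityI subsetI)
    fix y z assume y: "y \<in> el (Prod E [?A, ?P]) c" and z: "z \<in> el (Prod E [?A, ?P]) c"
      and eq: "ap (induced s l) c y = ap (induced s l) c z"
    obtain r x where y': "r \<in> el ?A c" "x \<in> el ?P c" "y = tp [?A, ?P] c [r, x]" using tp2_cases[OF o(1,3) c y] .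
    obtain r' x' where z': "r' \<in> el ?A c" "x' \<in> el ?P c" "z = tp [?A, ?P] c [r', x']" using tp2_cases[OF o(1,3) c z] .
    have e: "tp [?B, ?Q] c [ap (on_arr \<gamma> (s l)) c r, ap (co_op K (Suc 0) l) c x] =
      tp [?B, ?Q] c [ap (on_arr \<gamma> (s l)) c r', ap (co_op K (Suc 0) l) c x']"
      using eq h(2)[OF c] y' z' by simp
    have m: "ap (on_arr \<gamma> (s l)) c r \<in> el ?B c" "ap (on_arr \<gamma> (s l)) c r' \<in> el ?B c"
      "ap (co_op K (Suc 0) l) c x \<in> el ?Q c" "ap (co_op K (Suc 0) l) c x' \<in> el ?Q c"
      using bij_betwE[OF bA] bij_betwE[OF bP] y' z' by blast+
    have "ap (on_arr \<gamma> (s l)) c r = ap (on_arr \<gamma> (s l)) c r'"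
      using tp2(2)[OF o(2,4) c m(1,3)] tp2(2)[OF o(2,4) c m(2,4)] e by simp
    moreover have "ap (co_op K (Suc 0) l) c x = ap (co_op K (Suc 0) l) c x'"
      using tp2(3)[OF o(2,4) c m(1,3)] tp2(3)[OF o(2,4) c m(2,4)] e by simp
    ultimately show "y = z"
      using inj_onD[OF bij_betw_imp_inj_on[OF bA]] inj_onD[OF bij_betw_imp_inj_on[OF bP]] y' z' by blast
  next
    fix z assume "z \<in> ap (induced s l) c ` el (Prod E [?A, ?P]) c"
    then show "z \<in> el (Prod E [?B, ?Q]) c" using ap_el[OF h(1) c] by blast
  next
    fix z assume z: "z \<in> el (Prod E [?B, ?Q]) c"
    obtain r x where z': "r \<in> el ?B c" "x \<in> el ?Q c" "z = tp [?B, ?Q] c [r, x]" using tp2_cases[OF o(2,4) c z] .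
    obtain r' where r': "r' \<in> el ?A c" "r = ap (on_arr \<gamma> (s l)) c r'"
      using z'(1) bij_betw_imp_surj_on[OF bA] by blast
    obtain x' where x': "x' \<in> el ?P c" "x = ap (co_op K (Suc 0) l) c x'"
      using z'(2) bij_betw_imp_surj_on[OF bP] by blast
    have "z = ap (induced s l) c (tp [?A, ?P] c [r', x'])" using h(2)[OF c r'(1) x'(1)] z' r' x' by simp
    then show "z \<in> ap (induced s l) c ` el (Prod E [?A, ?P]) c"
      using tp2(1)[OF o(1,3) c r'(1) x'(1)] by blast
  qed
qed

text \<open>By \<open>hat_induced\<close> the points of the components drop out of the unit and
  composition equations, which become the images under \<open>\<gamma>\<close> of
  \<open>s_id\<close> and \<open>s_comp\<close>. The condition over the duality holds because the
  induced arrow is a product.\<close>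

lemma H_descent: "H_descent_datum E \<gamma> F R (induced s)"
proof -
  let ?\<sigma> = "induced s" and ?A = "\<lambda>i. on_obj \<gamma> (R i)"
  let ?d = "\<lambda>n i. sm_fun (dd S n i)" and ?op = "sm_fun (fam_tauS F (Suc 0))"
  have ARo: "?A i \<in> Obj E" if "i \<in> lev S 0" for i using \<gamma>_obj[OF R_small[OF that]] .
  have 1: "pr E [?A (?d (Suc 0) 0 l), K1 (?op l)] (Suc 0) \<bullet> ?\<sigma> l =
      co_op K (Suc 0) l \<bullet> pr E [?A (?d (Suc 0) (Suc 0) l), K1 l] (Suc 0)" if l: "l \<in> lev S (Suc 0)" for l
  proof -
    note o = E_obj(1)[OF \<gamma>_hom[OF s_hom[OF l]]] E_obj(2)[OF \<gamma>_hom[OF s_hom[OF l]]]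
      co_obj[OF l] co_obj[OF tauS_in[OF l]]
    note h = induced_hom[OF l] and p' = pr2_hom(3)[OF o(2,4)] and p = pr2_hom(3)[OF o(1,3)] and op = co_op(1)[OF l]
    show ?thesis
    proof (rule ext_stage[OF E_comp[OF h(1) p'] E_comp[OF p op]])
      fix c y assume c: "inh c" and y: "y \<in> el (Prod E [?A (?d (Suc 0) (Suc 0) l), K1 l]) c"
      obtain r x where y': "r \<in> el (?A (?d (Suc 0) (Suc 0) l)) c" "x \<in> el (K1 l) c"
        "y = tp [?A (?d (Suc 0) (Suc 0) l), K1 l] c [r, x]" using tp2_cases[OF o(1,3) c y] .
      show "ap (pr E [?A (?d (Suc 0) 0 l), K1 (?op l)] (Suc 0) \<bullet> ?\<sigma> l) c y =
        ap (co_op K (Suc 0) l \<bullet> pr E [?A (?d (Suc 0) (Suc 0) l), K1 l] (Suc 0)) c y"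
        using ap_comp[OF h(1) p' c y] ap_comp[OF p op c y] h(2)[OF c y'(1,2)] y'
          tp2(4)[OF o(2,4) c ap_el[OF \<gamma>_hom[OF s_hom[OF l]] c y'(1)] ap_el[OF op c y'(2)]]
          tp2(4)[OF o(1,3) c y'(1,2)] by simp
    qed
  qed
  have 2: "hat E \<gamma> K R ?\<sigma> (sm_fun (ss S 0 0) i) \<bullet> arr_prod E (Id E (?A i)) (co_s K 0 0 i) = pr E [?A i, co K 0 i] 0"
    if i: "i \<in> lev S 0" for i
  proof -
    note Ao = ARo[OF i] and l = S_s_in[OF le0 i]
    note h = hat_induced[OF l, unfolded S_ds[OF le0 i] S_ds[OF le_refl i]]
    note a = arr_prod[OF E_id[OF Ao] co_s(1)[OF le0 i]]
    show ?thesis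
    proof (rule ext_stage[OF E_comp[OF a(1) h(1)] pr2_hom(1)[OF Ao co_obj[OF i]]])
      fix c y assume c: "inh c" and y: "y \<in> el (Prod E [?A i, co K 0 i]) c"
      obtain r x where y': "r \<in> el (?A i) c" "x \<in> el (co K 0 i) c" "y = tp [?A i, co K 0 i] c [r, x]"
        using tp2_cases[OF Ao co_obj[OF i] c y] .
      show "ap (hat E \<gamma> K R ?\<sigma> (sm_fun (ss S 0 0) i) \<bullet> arr_prod E (Id E (?A i)) (co_s K 0 0 i)) c y = ap (pr E [?A i, co K 0 i] 0) c y"
        using ap_comp[OF a(1) h(1) c y] a(2)[OF c y'(1,2)] h(2)[OF c y'(1) ap_el[OF co_s(1)[OF le0 i] c y'(2)]]
          y' ap_id[OF Ao c y'(1)] tp2(2)[OF Ao co_obj[OF i] c y'(1,2)] s_id[OF i] \<gamma>_id[OF R_small[OF i]] by simp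
    qed
  qed
  have 3: "hat E \<gamma> K R ?\<sigma> (?d (Suc (Suc 0)) 0 w) \<bullet>
         tup E [hat E \<gamma> K R ?\<sigma> (?d (Suc (Suc 0)) (Suc (Suc 0)) w) \<bullet>
             arr_prod E (Id E (?A (?d (Suc 0) (Suc 0) (?d (Suc (Suc 0)) (Suc (Suc 0)) w)))) (co_d K (Suc (Suc 0)) (Suc (Suc 0)) w),
                co_d K (Suc (Suc 0)) 0 w \<bullet> pr E [?A (?d (Suc 0) (Suc 0) (?d (Suc (Suc 0)) (Suc (Suc 0)) w)), co K (Suc (Suc 0)) w] (Suc 0)] =
       hat E \<gamma> K R ?\<sigma> (?d (Suc (Suc 0)) (Suc 0) w) \<bullet>
         arr_prod E (Id E (?A (?d (Suc 0) (Suc 0) (?d (Suc (Suc 0)) (Suc (Suc 0)) w)))) (co_d K (Suc (Suc 0)) (Suc 0) w)"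
    if w: "w \<in> lev S (Suc (Suc 0))" for w
  proof -
    let ?l2 = "?d (Suc (Suc 0)) (Suc (Suc 0)) w" and ?l1 = "?d (Suc (Suc 0)) (Suc 0) w" and ?l0 = "?d (Suc (Suc 0)) 0 w"
    let ?i = "?d (Suc 0) (Suc 0) ?l2"
    have l: "?l2 \<in> lev S (Suc 0)" "?l1 \<in> lev S (Suc 0)" "?l0 \<in> lev S (Suc 0)" using S_d_in[OF _ w] by auto
    have i: "?i \<in> lev S 0" using S_d_in[OF _ l(1)] by auto
    \<comment> \<open>The simplicial identities match the ends of the three faces of
      \<open>w\<close>, so that the bijections on them can be composed.\<close>
    have e1: "?d (Suc 0) (Suc 0) ?l1 = ?i" using S_dd[of 2 0 1 w] w by (simp add: numeral_2_eq_2)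
    have e2: "?d (Suc 0) 0 ?l2 = ?d (Suc 0) (Suc 0) ?l0" using S_dd[of 2 0 0 w] w by (simp add: numeral_2_eq_2)
    have e3: "?d (Suc 0) 0 ?l1 = ?d (Suc 0) 0 ?l0" using S_dd[of 1 0 0 w] w by simp
    note h0 = hat_induced[OF l(3)] and h1 = hat_induced[OF l(2), unfolded e1 e3] and h2 = hat_induced[OF l(1), unfolded e2]
    note d0 = co_d(1)[OF _ w, of 0, simplified] and d1 = co_d(1)[OF _ w, of "Suc 0", simplified]
      and d2 = co_d(1)[OF _ w, of "Suc (Suc 0)", simplified]
    note Ao = ARo[OF i] and wo = co_obj[OF w]
    note a2 = arr_prod[OF E_id[OF Ao] d2] and a1 = arr_prod[OF E_id[OF Ao] d1]
    note q = pr2_hom(3)[OF Ao wo]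
    note t = tup2[OF E_comp[OF a2(1) h2(1)] E_comp[OF q d0]]
    show ?thesis
    proof (rule ext_stage[OF E_comp[OF t(1) h0(1)] E_comp[OF a1(1) h1(1)]])
      fix c y assume c: "inh c" and y: "y \<in> el (Prod E [?A ?i, co K (Suc (Suc 0)) w]) c"
      obtain r x where y': "r \<in> el (?A ?i) c" "x \<in> el (co K (Suc (Suc 0)) w) c" "y = tp [?A ?i, co K (Suc (Suc 0)) w] c [r, x]"
        using tp2_cases[OF Ao wo c y] .
      note s2 = s_hom[OF l(1), unfolded e2] and s0 = s_hom[OF l(3)]
      have r2: "ap (hat E \<gamma> K R ?\<sigma> ?l2 \<bullet> arr_prod E (Id E (?A ?i)) (co_d K (Suc (Suc 0)) (Suc (Suc 0)) w)) c y = ap (on_arr \<gamma> (s ?l2)) c r"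
        using ap_comp[OF a2(1) h2(1) c y] a2(2)[OF c y'(1,2)] y' ap_id[OF Ao c y'(1)] h2(2)[OF c y'(1) ap_el[OF d2 c y'(2)]] by simp
      have x0: "ap (co_d K (Suc (Suc 0)) 0 w \<bullet> pr E [?A ?i, co K (Suc (Suc 0)) w] (Suc 0)) c y = ap (co_d K (Suc (Suc 0)) 0 w) c x"
        using ap_comp[OF q d0 c y] y' tp2(4)[OF Ao wo c y'(1,2)] by simp
      have r1: "ap (hat E \<gamma> K R ?\<sigma> ?l1 \<bullet> arr_prod E (Id E (?A ?i)) (co_d K (Suc (Suc 0)) (Suc 0) w)) c y = ap (on_arr \<gamma> (s ?l1)) c r"
        using ap_comp[OF a1(1) h1(1) c y] a1(2)[OF c y'(1,2)] y' ap_id[OF Ao c y'(1)] h1(2)[OF c y'(1) ap_el[OF d1 c y'(2)]] by simp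
      have "ap (on_arr \<gamma> (s ?l1)) c r = ap (on_arr \<gamma> (s ?l0)) c (ap (on_arr \<gamma> (s ?l2)) c r)"
        using s_comp[OF w] \<gamma>_comp[OF s2 s0] ap_comp[OF \<gamma>_hom[OF s2] \<gamma>_hom[OF s0] c y'(1)] by simp
      then show "ap (hat E \<gamma> K R ?\<sigma> ?l0 \<bullet> tup E [hat E \<gamma> K R ?\<sigma> ?l2 \<bullet> arr_prod E (Id E (?A ?i)) (co_d K (Suc (Suc 0)) (Suc (Suc 0)) w),
                co_d K (Suc (Suc 0)) 0 w \<bullet> pr E [?A ?i, co K (Suc (Suc 0)) w] (Suc 0)]) c y =
         ap (hat E \<gamma> K R ?\<sigma> ?l1 \<bullet> arr_prod E (Id E (?A ?i)) (co_d K (Suc (Suc 0)) (Suc 0) w)) c y"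
        using ap_comp[OF t(1) h0(1) c y] t(2)[OF c y] r2 x0 r1
          h0(2)[OF c ap_el[OF \<gamma>_hom[OF s2] c y'(1)] ap_el[OF d0 c y'(2)]] by simp
    qed
  qed
  show ?thesis
    unfolding H_descent_datum_def descent_datum_def Let_def K_simps(1-4) numeral_2_eq_2 One_nat_def
    using 1 2 3 induced_hom(1) induced_iso by simp
qed

end

end

section \<open>Descent data on the Cech family\<close>

locale cech_fam = topos_over_Set ty E C J \<Phi> \<gamma>
  for ty :: "'u itself" and E :: "('o, 'a) category" and C :: "('u, 'u) category" and J
    and \<Phi> :: "('o, 'a, 'u) sheaf_functor"
    and \<gamma> :: "('u set, 'u set_map, 'o, 'a) cfunctor" +
  fixes I :: "'u set" and U :: 'o and \<zeta> :: 'a and R :: "'u \<Rightarrow> 'u set"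
  assumes I: "small I" and \<zeta>: "\<zeta> \<in> hom E U (on_obj \<gamma> I)"
    and nonempty_V: "\<And>i. i \<in> I \<Longrightarrow> nonempty E (component E \<gamma> I \<zeta> i)"
    and R: "\<And>i. i \<in> I \<Longrightarrow> small (R i)"
begin

abbreviation A where "A i \<equiv> on_obj \<gamma> (R i)"
abbreviation V where "V \<equiv> component E \<gamma> I \<zeta>"
abbreviation cc where "cc \<equiv> comp_incl E \<gamma> I \<zeta>"
abbreviation NN where "NN \<equiv> cech E \<gamma> I \<zeta>"
abbreviation VV where "VV i j \<equiv> Prod E [V i, V j]"
abbreviation VVV where "VVV i j k \<equiv> Prod E [V i, V j, V k]"
abbreviation AV where "AV i j \<equiv> Prod E [A i, VV i j]"
abbreviation AVV where "AVV i j k \<equiv> Prod E [A i, VVV i j k]"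

lemmas cc_hom = comp_incl_hom[OF I \<zeta>]
lemmas cc_kap = comp_incl_kap[OF I \<zeta>]
lemmas cc_inj = comp_incl_inj[OF I \<zeta>]
lemmas cc_ex = comp_incl_ex[OF I \<zeta>]

lemma Vo: "i \<in> I \<Longrightarrow> V i \<in> Obj E"
  using component_obj[OF I \<zeta>] .

lemma Ao: "i \<in> I \<Longrightarrow> A i \<in> Obj E"
  using \<gamma>_obj R by blast

lemma V2o: "i \<in> I \<Longrightarrow> j \<in> I \<Longrightarrow> VV i j \<in> Obj E"
  using Prod2_obj Vo by blast

lemma NN_simps:
  "x \<in> ix NN n \<longleftrightarrow> length x = Suc n \<and> set x \<subseteq> I \<and> nonempty E (Prod E (map V x))"
  "ix_d NN n i x = omit i x" "ix_s NN n i x = double i x" "ix_op NN n x = rev x" "co NN n x = Prod E (map V x)"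
  "co_d NN n i x = tup E (map (pr E (map V x)) (omit i [0..<Suc n]))"
  "co_s NN n i x = tup E (map (pr E (map V x)) (double i [0..<Suc n]))"
  "co_op NN n x = tup E (map (pr E (map V x)) (rev [0..<Suc n]))"
  by (simp_all add: cech_def Let_def)

lemma N1: "[i, j] \<in> ix NN (Suc 0) \<longleftrightarrow> i \<in> I \<and> j \<in> I \<and> (\<exists>c u v. inh c \<and> u \<in> el (V i) c \<and> v \<in> el (V j) c)"
proof (cases "i \<in> I \<and> j \<in> I")
  case True
  then have "nonempty E (VV i j) \<longleftrightarrow> (\<exists>c u v. inh c \<and> u \<in> el (V i) c \<and> v \<in> el (V j) c)"
    using nonempty_iff[of "VV i j"] V2o tp2_cases[OF Vo Vo] tp2(1)[OF Vo Vo] by metis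
  then show ?thesis using True by (simp add: NN_simps)
qed (auto simp: NN_simps)

lemma N1I: "inh c \<Longrightarrow> i \<in> I \<Longrightarrow> j \<in> I \<Longrightarrow> u \<in> el (V i) c \<Longrightarrow> v \<in> el (V j) c \<Longrightarrow> [i, j] \<in> ix NN (Suc 0)"
  unfolding N1 by blast

definition swap :: "'u \<Rightarrow> 'u \<Rightarrow> 'a" where
  "swap i j = co_op NN (Suc 0) [i, j]"

lemma swap:
  assumes "i \<in> I" "j \<in> I"
  shows "swap i j \<in> hom E (VV i j) (VV j i)"
    "\<And>c u v. inh c \<Longrightarrow> u \<in> el (V i) c \<Longrightarrow> v \<in> el (V j) c \<Longrightarrow>
       ap (swap i j) c (tp [V i, V j] c [u, v]) = tp [V j, V i] c [v, u]"
proof -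
  have eq: "swap i j = tup E [pr E [V i, V j] (Suc 0), pr E [V i, V j] 0]" by (simp add: swap_def NN_simps)
  note o = Vo[OF assms(1)] Vo[OF assms(2)]
  note t = tup2[OF pr2_hom(3)[OF o] pr2_hom(1)[OF o]]
  show "swap i j \<in> hom E (VV i j) (VV j i)" unfolding eq by (rule t(1))
  show "ap (swap i j) c (tp [V i, V j] c [u, v]) = tp [V j, V i] c [v, u]"
    if "inh c" "u \<in> el (V i) c" "v \<in> el (V j) c" for c u v
    unfolding eq using t(2)[OF that(1) tp2(1)[OF o that]] tp2(2,4)[OF o that] by simp
qed

lemma diag:
  assumes "i \<in> I"
  shows "co_s NN 0 0 [i] \<in> hom E (V i) (VV i i)"
    "\<And>c u. inh c \<Longrightarrow> u \<in> el (V i) c \<Longrightarrow> ap (co_s NN 0 0 [i]) c u = tp [V i, V i] c [u, u]"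
proof -
  have eq: "co_s NN 0 0 [i] = tup E [Id E (V i), Id E (V i)]"
    by (simp add: NN_simps double_def pr_def product_cone_def)
  note t = tup2[OF E_id[OF Vo[OF assms]] E_id[OF Vo[OF assms]]]
  show "co_s NN 0 0 [i] \<in> hom E (V i) (VV i i)" unfolding eq by (rule t(1))
  show "ap (co_s NN 0 0 [i]) c u = tp [V i, V i] c [u, u]" if "inh c" "u \<in> el (V i) c" for c u
    unfolding eq using t(2)[OF that] ap_id[OF Vo[OF assms] that] by simp
qed

lemma tp3:
  assumes "i \<in> I" "j \<in> I" "k \<in> I" "inh c" "u \<in> el (V i) c" "v \<in> el (V j) c" "w \<in> el (V k) c"
  shows "tp [V i, V j, V k] c [u, v, w] \<in> el (VVV i j k) c"
    "ap (pr E [V i, V j, V k] 0) c (tp [V i, V j, V k] c [u, v, w]) = u"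
    "ap (pr E [V i, V j, V k] (Suc 0)) c (tp [V i, V j, V k] c [u, v, w]) = v"
    "ap (pr E [V i, V j, V k] (Suc (Suc 0))) c (tp [V i, V j, V k] c [u, v, w]) = w"
proof -
  have o: "set [V i, V j, V k] \<subseteq> Obj E" using Vo assms by simp
  have *: "[u, v, w] ! n \<in> el ([V i, V j, V k] ! n) c" if "n < length [V i, V j, V k]" for n
    using assms that by (auto simp: less_Suc_eq)
  show "tp [V i, V j, V k] c [u, v, w] \<in> el (VVV i j k) c" by (rule tp_el[OF o assms(4) *])
  show "ap (pr E [V i, V j, V k] 0) c (tp [V i, V j, V k] c [u, v, w]) = u"
    "ap (pr E [V i, V j, V k] (Suc 0)) c (tp [V i, V j, V k] c [u, v, w]) = v"
    "ap (pr E [V i, V j, V k] (Suc (Suc 0))) c (tp [V i, V j, V k] c [u, v, w]) = w"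
    using pr_tp[OF o assms(4) *, of 0] pr_tp[OF o assms(4) *, of 1] pr_tp[OF o assms(4) *, of 2]
    by (simp_all add: numeral_2_eq_2)
qed

lemma pr3:
  assumes "i \<in> I" "j \<in> I" "k \<in> I"
  shows "pr E [V i, V j, V k] 0 \<in> hom E (VVV i j k) (V i)"
    "pr E [V i, V j, V k] (Suc 0) \<in> hom E (VVV i j k) (V j)"
    "pr E [V i, V j, V k] (Suc (Suc 0)) \<in> hom E (VVV i j k) (V k)"
proof -
  have o: "set [V i, V j, V k] \<subseteq> Obj E" using Vo assms by simp
  show "pr E [V i, V j, V k] 0 \<in> hom E (VVV i j k) (V i)"
    "pr E [V i, V j, V k] (Suc 0) \<in> hom E (VVV i j k) (V j)"
    "pr E [V i, V j, V k] (Suc (Suc 0)) \<in> hom E (VVV i j k) (V k)"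
    using pr_hom[OF o, of 0] pr_hom[OF o, of 1] pr_hom[OF o, of 2] by (simp_all add: numeral_2_eq_2)
qed

lemma face2:
  assumes "i \<in> I" "j \<in> I" "k \<in> I"
  shows "co_d NN (Suc (Suc 0)) (Suc (Suc 0)) [i, j, k] \<in> hom E (VVV i j k) (VV i j)"
    "\<And>c x. inh c \<Longrightarrow> x \<in> el (VVV i j k) c \<Longrightarrow> ap (co_d NN (Suc (Suc 0)) (Suc (Suc 0)) [i, j, k]) c x =
      tp [V i, V j] c [ap (pr E [V i, V j, V k] 0) c x, ap (pr E [V i, V j, V k] (Suc 0)) c x]"
    "co_d NN (Suc (Suc 0)) (Suc 0) [i, j, k] \<in> hom E (VVV i j k) (VV i k)"
    "\<And>c x. inh c \<Longrightarrow> x \<in> el (VVV i j k) c \<Longrightarrow> ap (co_d NN (Suc (Suc 0)) (Suc 0) [i, j, k]) c x =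
      tp [V i, V k] c [ap (pr E [V i, V j, V k] 0) c x, ap (pr E [V i, V j, V k] (Suc (Suc 0))) c x]"
    "co_d NN (Suc (Suc 0)) 0 [i, j, k] \<in> hom E (VVV i j k) (VV j k)"
    "\<And>c x. inh c \<Longrightarrow> x \<in> el (VVV i j k) c \<Longrightarrow> ap (co_d NN (Suc (Suc 0)) 0 [i, j, k]) c x =
      tp [V j, V k] c [ap (pr E [V i, V j, V k] (Suc 0)) c x, ap (pr E [V i, V j, V k] (Suc (Suc 0))) c x]"
proof -
  have e2: "co_d NN (Suc (Suc 0)) (Suc (Suc 0)) [i, j, k] = tup E [pr E [V i, V j, V k] 0, pr E [V i, V j, V k] (Suc 0)]"
    and e1: "co_d NN (Suc (Suc 0)) (Suc 0) [i, j, k] = tup E [pr E [V i, V j, V k] 0, pr E [V i, V j, V k] (Suc (Suc 0))]"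
    and e0: "co_d NN (Suc (Suc 0)) 0 [i, j, k] = tup E [pr E [V i, V j, V k] (Suc 0), pr E [V i, V j, V k] (Suc (Suc 0))]"
    by (simp_all add: NN_simps omit_def)
  note p = pr3[OF assms]
  show "co_d NN (Suc (Suc 0)) (Suc (Suc 0)) [i, j, k] \<in> hom E (VVV i j k) (VV i j)"
    unfolding e2 by (rule tup2(1)[OF p(1,2)])
  show "co_d NN (Suc (Suc 0)) (Suc 0) [i, j, k] \<in> hom E (VVV i j k) (VV i k)"
    unfolding e1 by (rule tup2(1)[OF p(1,3)])
  show "co_d NN (Suc (Suc 0)) 0 [i, j, k] \<in> hom E (VVV i j k) (VV j k)"
    unfolding e0 by (rule tup2(1)[OF p(2,3)])
  fix c x assume cx: "inh c" "x \<in> el (VVV i j k) c"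
  show "ap (co_d NN (Suc (Suc 0)) (Suc (Suc 0)) [i, j, k]) c x =
      tp [V i, V j] c [ap (pr E [V i, V j, V k] 0) c x, ap (pr E [V i, V j, V k] (Suc 0)) c x]"
    unfolding e2 by (rule tup2(2)[OF p(1,2) cx])
  show "ap (co_d NN (Suc (Suc 0)) (Suc 0) [i, j, k]) c x =
      tp [V i, V k] c [ap (pr E [V i, V j, V k] 0) c x, ap (pr E [V i, V j, V k] (Suc (Suc 0))) c x]"
    unfolding e1 by (rule tup2(2)[OF p(1,3) cx])
  show "ap (co_d NN (Suc (Suc 0)) 0 [i, j, k]) c x =
      tp [V j, V k] c [ap (pr E [V i, V j, V k] (Suc 0)) c x, ap (pr E [V i, V j, V k] (Suc (Suc 0))) c x]"
    unfolding e0 by (rule tup2(2)[OF p(2,3) cx])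
qed

section \<open>Descent data on the Cech family as transition maps on sections\<close>

abbreviation tq where "tq i j c r u v \<equiv> tp [A i, VV i j] c [r, tp [V i, V j] c [u, v]]"

abbreviation hc where "hc \<sigma> i j \<equiv> hat E \<gamma> NN (\<lambda>x. R (hd x)) \<sigma> [i, j]"

text \<open>The transition map of the descent datum from the fibre over \<open>u\<close> to the
  fibre over \<open>v\<close>, applied to \<open>r\<close>. From here on a descent datum is used
  only through it.\<close>

definition sg :: "('u list \<Rightarrow> 'a) \<Rightarrow> 'u \<Rightarrow> 'u \<Rightarrow> 'u \<Rightarrow> 'u \<Rightarrow> 'u \<Rightarrow> 'u \<Rightarrow> 'u" where
  "sg \<sigma> i j c r u v = ap (hc \<sigma> i j) c (tq i j c r u v)"

lemma tq:
  assumes "i \<in> I" "j \<in> I" "inh c" "r \<in> el (A i) c" "u \<in> el (V i) c" "v \<in> el (V j) c"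
  shows "tq i j c r u v \<in> el (AV i j) c"
  using tp2(1)[OF Ao V2o] tp2(1)[OF Vo Vo] assms by blast

lemma tq_rs:
  assumes "i \<in> I" "j \<in> I" "h \<in> st d c" "r \<in> el (A i) c" "u \<in> el (V i) c" "v \<in> el (V j) c"
  shows "rs (AV i j) h (tq i j c r u v) = tq i j d (rs (A i) h r) (rs (V i) h u) (rs (V j) h v)"
  using rs_tp2[OF Ao V2o] rs_tp2[OF Vo Vo] tp2(1)[OF Vo Vo] assms st_inh' by simp

lemma tq_cases:
  assumes "i \<in> I" "j \<in> I" "inh c" "y \<in> el (AV i j) c"
  obtains r u v where "r \<in> el (A i) c" "u \<in> el (V i) c" "v \<in> el (V j) c" "y = tq i j c r u v"
proof -
  obtain r z where y: "r \<in> el (A i) c" "z \<in> el (VV i j) c" "y = tp [A i, VV i j] c [r, z]"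
    using tp2_cases[OF Ao V2o] assms by blast
  obtain u v where "u \<in> el (V i) c" "v \<in> el (V j) c" "z = tp [V i, V j] c [u, v]"
    using tp2_cases[OF Vo Vo] assms y(2) by blast
  then show ?thesis using that y by blast
qed

lemma tq_inj:
  assumes "i \<in> I" "j \<in> I" "inh c" "r \<in> el (A i) c" "u \<in> el (V i) c" "v \<in> el (V j) c"
    "r' \<in> el (A i) c" "u' \<in> el (V i) c" "v' \<in> el (V j) c" "tq i j c r u v = tq i j c r' u' v'"
  shows "r = r'" "u = u'" "v = v'"
proof -
  note o = Ao[OF assms(1)] V2o[OF assms(1,2)] Vo[OF assms(1)] Vo[OF assms(2)]
  note z = tp2(1)[OF o(3,4) assms(3,5,6)] and z' = tp2(1)[OF o(3,4) assms(3,8,9)]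
  show "r = r'" using tp2(2)[OF o(1,2) assms(3,4) z] tp2(2)[OF o(1,2) assms(3,7) z'] assms(10) by simp
  have "tp [V i, V j] c [u, v] = tp [V i, V j] c [u', v']"
    using tp2(3)[OF o(1,2) assms(3,4) z] tp2(3)[OF o(1,2) assms(3,7) z'] assms(10) by simp
  then show "u = u'" "v = v'"
    using tp2(2,3)[OF o(3,4) assms(3,5,6)] tp2(2,3)[OF o(3,4) assms(3,8,9)] by simp_all
qed

text \<open>Simplices of the Cech family are lists, so the quantifiers over levels 0, 1 and 2 become
  quantifiers over one, two and three indices. At level 0 the unary product is the object
  itself.\<close>

lemma U_descent_unfold:
  "U_descent_datum E \<gamma> I \<zeta> R \<sigma> \<longleftrightarrow>
   (\<forall>i j. [i, j] \<in> ix NN (Suc 0) \<longrightarrow>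
      \<sigma> [i, j] \<in> hom E (AV i j) (AV j i) \<and> is_iso E (\<sigma> [i, j]) \<and>
      pr E [A j, VV j i] (Suc 0) \<bullet> \<sigma> [i, j] = swap i j \<bullet> pr E [A i, VV i j] (Suc 0)) \<and>
   (\<forall>i \<in> I. hc \<sigma> i i \<bullet> arr_prod E (Id E (A i)) (co_s NN 0 0 [i]) = pr E [A i, V i] 0) \<and>
   (\<forall>i j k. [i, j, k] \<in> ix NN (Suc (Suc 0)) \<longrightarrow>
      hc \<sigma> j k \<bullet> tup E [hc \<sigma> i j \<bullet> arr_prod E (Id E (A i)) (co_d NN (Suc (Suc 0)) (Suc (Suc 0)) [i, j, k]),
         co_d NN (Suc (Suc 0)) 0 [i, j, k] \<bullet> pr E [A i, VVV i j k] (Suc 0)] =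
      hc \<sigma> i k \<bullet> arr_prod E (Id E (A i)) (co_d NN (Suc (Suc 0)) (Suc 0) [i, j, k]))"
proof -
  have 1: "(\<forall>l \<in> ix NN (Suc 0). P l) \<longleftrightarrow> (\<forall>i j. [i, j] \<in> ix NN (Suc 0) \<longrightarrow> P [i, j])" for P
    by (auto simp: NN_simps length_Suc_conv)
  have 2: "(\<forall>w \<in> ix NN (Suc (Suc 0)). P w) \<longleftrightarrow> (\<forall>i j k. [i, j, k] \<in> ix NN (Suc (Suc 0)) \<longrightarrow> P [i, j, k])" for P
    by (auto simp: NN_simps length_Suc_conv)
  have 3: "(\<forall>w \<in> ix NN 0. P w) \<longleftrightarrow> (\<forall>i \<in> I. P [i])" for P
    using nonempty_V by (auto simp: NN_simps length_Suc_conv Prod_def product_cone_def)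
  have P1: "Prod E [X] = X" for X by (simp add: Prod_def product_cone_def)
  show ?thesis
    unfolding U_descent_datum_def descent_datum_def Let_def numeral_2_eq_2 One_nat_def 1 2 3 swap_def
      NN_simps(2-5) omit_def double_def by (simp add: P1)
qed

context
  fixes \<sigma>
  assumes ud: "U_descent_datum E \<gamma> I \<zeta> R \<sigma>"
begin

lemma \<sigma>_hom:
  "[i, j] \<in> ix NN (Suc 0) \<Longrightarrow> \<sigma> [i, j] \<in> hom E (AV i j) (AV j i)"
  using ud unfolding U_descent_unfold by blast

lemma hc_hom:
  assumes ij: "[i, j] \<in> ix NN (Suc 0)"
  shows "hc \<sigma> i j \<in> hom E (AV i j) (A j)"
    "hc \<sigma> i j = pr E [A j, VV j i] 0 \<bullet> \<sigma> [i, j]"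
proof -
  have i: "i \<in> I" "j \<in> I" using ij by (auto simp: N1)
  show eq: "hc \<sigma> i j = pr E [A j, VV j i] 0 \<bullet> \<sigma> [i, j]" by (simp add: hat_def NN_simps omit_def)
  show "hc \<sigma> i j \<in> hom E (AV i j) (A j)"
    unfolding eq using E_comp[OF \<sigma>_hom[OF ij] pr2_hom(1)[OF Ao V2o]] i by blast
qed

lemma sg_el:
  assumes "i \<in> I" "j \<in> I" "inh c" "r \<in> el (A i) c" "u \<in> el (V i) c" "v \<in> el (V j) c"
  shows "sg \<sigma> i j c r u v \<in> el (A j) c"
  unfolding sg_def
  by (rule ap_el[OF hc_hom(1)[OF N1I[OF assms(3,1,2,5,6)]] assms(3) tq[OF assms]])

lemma sg_rs:
  assumes "i \<in> I" "j \<in> I" "h \<in> st d c" "r \<in> el (A i) c" "u \<in> el (V i) c" "v \<in> el (V j) c"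
  shows "rs (A j) h (sg \<sigma> i j c r u v) = sg \<sigma> i j d (rs (A i) h r) (rs (V i) h u) (rs (V j) h v)"
proof -
  note c = st_inh'[OF assms(3)]
  show ?thesis unfolding sg_def
    using ap_rs[OF hc_hom(1)[OF N1I[OF c assms(1,2,5,6)]] assms(3) tq[OF assms(1,2) c assms(4-6)]] tq_rs[OF assms] by simp
qed

text \<open>The isomorphism lies over the exchange of \<open>u\<close> and \<open>v\<close>, so its
  second component is forced and all its information is in the transition map.\<close>

lemma ap_\<sigma>:
  assumes "i \<in> I" "j \<in> I" "inh c" "r \<in> el (A i) c" "u \<in> el (V i) c" "v \<in> el (V j) c"
  shows "ap (\<sigma> [i, j]) c (tq i j c r u v) = tq j i c (sg \<sigma> i j c r u v) v u"
proof -
  note ij = N1I[OF assms(3,1,2,5,6)] and t = tq[OF assms]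
  note o = Ao[OF assms(2)] V2o[OF assms(2,1)] and o' = Ao[OF assms(1)] V2o[OF assms(1,2)]
  note z = ap_el[OF \<sigma>_hom[OF ij] assms(3) t]
  obtain s w where y: "s \<in> el (A j) c" "w \<in> el (VV j i) c"
    "ap (\<sigma> [i, j]) c (tq i j c r u v) = tp [A j, VV j i] c [s, w]"
    using tp2_cases[OF o assms(3) z] .
  have "s = sg \<sigma> i j c r u v"
    unfolding sg_def hc_hom(2)[OF ij]
    using ap_comp[OF \<sigma>_hom[OF ij] pr2_hom(1)[OF o] assms(3) t] tp2(2)[OF o assms(3) y(1,2)] y(3) by simp
  moreover have "w = tp [V j, V i] c [v, u]"
  proof -
    have "pr E [A j, VV j i] (Suc 0) \<bullet> \<sigma> [i, j] = swap i j \<bullet> pr E [A i, VV i j] (Suc 0)"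
      using ud ij unfolding U_descent_unfold by blast
    then have "w = ap (swap i j \<bullet> pr E [A i, VV i j] (Suc 0)) c (tq i j c r u v)"
      using ap_comp[OF \<sigma>_hom[OF ij] pr2_hom(3)[OF o] assms(3) t] tp2(4)[OF o assms(3) y(1,2)] y(3) by simp
    then show ?thesis
      using ap_comp[OF pr2_hom(3)[OF o'] swap(1)[OF assms(1,2)] assms(3) t]
        tp2(4)[OF o' assms(3,4) tp2(1)[OF Vo[OF assms(1)] Vo[OF assms(2)] assms(3,5,6)]]
        swap(2)[OF assms(1-3,5,6)] by simp
  qed
  ultimately show ?thesis using y(3) by simp
qed

lemma sg_id:
  assumes i: "i \<in> I" and c: "inh c" and r: "r \<in> el (A i) c" and u: "u \<in> el (V i) c"
  shows "sg \<sigma> i i c r u u = r"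
proof -
  have eq: "hc \<sigma> i i \<bullet> arr_prod E (Id E (A i)) (co_s NN 0 0 [i]) = pr E [A i, V i] 0"
    using ud i unfolding U_descent_unfold by blast
  note a = arr_prod[OF E_id[OF Ao[OF i]] diag(1)[OF i]] and h = hc_hom(1)[OF N1I[OF c i i u u]]
  note t = tp2[OF Ao[OF i] Vo[OF i] c r u]
  have "ap (pr E [A i, V i] 0) c (tp [A i, V i] c [r, u]) = sg \<sigma> i i c r u u"
    unfolding eq[symmetric] sg_def
    using ap_comp[OF a(1) h c t(1)] a(2)[OF c r u] ap_id[OF Ao[OF i] c r] diag(2)[OF i c u] by simp
  then show ?thesis using t(2) by simp
qed

lemma sg_comp:
  assumes i: "i \<in> I" and j: "j \<in> I" and k: "k \<in> I" and c: "inh c" and r: "r \<in> el (A i) c"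
    and u: "u \<in> el (V i) c" and v: "v \<in> el (V j) c" and w: "w \<in> el (V k) c"
  shows "sg \<sigma> j k c (sg \<sigma> i j c r u v) v w = sg \<sigma> i k c r u w"
proof -
  let ?X = "tp [V i, V j, V k] c [u, v, w]"
  note x = tp3[OF i j k c u v w] and f = face2[OF i j k]
  have P3: "VVV i j k \<in> Obj E" using Prod_obj[of "[V i, V j, V k]"] Vo i j k by simp
  have "[i, j, k] \<in> ix NN (Suc (Suc 0))"
    using i j k nonemptyI[OF P3 c x(1)] by (simp add: NN_simps)
  then have eq: "hc \<sigma> j k \<bullet> tup E [hc \<sigma> i j \<bullet> arr_prod E (Id E (A i)) (co_d NN (Suc (Suc 0)) (Suc (Suc 0)) [i, j, k]),
         co_d NN (Suc (Suc 0)) 0 [i, j, k] \<bullet> pr E [A i, VVV i j k] (Suc 0)] =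
      hc \<sigma> i k \<bullet> arr_prod E (Id E (A i)) (co_d NN (Suc (Suc 0)) (Suc 0) [i, j, k])"
    using ud unfolding U_descent_unfold by blast
  note hij = hc_hom(1)[OF N1I[OF c i j u v]] and hjk = hc_hom(1)[OF N1I[OF c j k v w]] and hik = hc_hom(1)[OF N1I[OF c i k u w]]
  note a2 = arr_prod[OF E_id[OF Ao[OF i]] f(1)] and a1 = arr_prod[OF E_id[OF Ao[OF i]] f(3)]
  note q = pr2_hom(3)[OF Ao[OF i] P3]
  note t = tup2[OF E_comp[OF a2(1) hij] E_comp[OF q f(5)]]
  let ?y = "tp [A i, VVV i j k] c [r, ?X]"
  note y = tp2[OF Ao[OF i] P3 c r x(1)]
  have "ap (hc \<sigma> j k \<bullet> tup E [hc \<sigma> i j \<bullet> arr_prod E (Id E (A i)) (co_d NN (Suc (Suc 0)) (Suc (Suc 0)) [i, j, k]),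
         co_d NN (Suc (Suc 0)) 0 [i, j, k] \<bullet> pr E [A i, VVV i j k] (Suc 0)]) c ?y = sg \<sigma> j k c (sg \<sigma> i j c r u v) v w"
    unfolding sg_def
    using ap_comp[OF t(1) hjk c y(1)] t(2)[OF c y(1)] ap_comp[OF a2(1) hij c y(1)] a2(2)[OF c r x(1)]
      ap_id[OF Ao[OF i] c r] ap_comp[OF q f(5) c y(1)] y(4) f(2)[OF c x(1)] f(6)[OF c x(1)] x(2-4) by simp
  moreover have "ap (hc \<sigma> i k \<bullet> arr_prod E (Id E (A i)) (co_d NN (Suc (Suc 0)) (Suc 0) [i, j, k])) c ?y = sg \<sigma> i k c r u w"
    unfolding sg_def
    using ap_comp[OF a1(1) hik c y(1)] a1(2)[OF c r x(1)] ap_id[OF Ao[OF i] c r] f(4)[OF c x(1)] x(2,4) by simp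
  ultimately show ?thesis using eq by simp
qed

end

text \<open>The converse passage: natural transition maps that satisfy the unit and cocycle laws
  come from a descent datum. Each law is checked on tuples of sections.\<close>

lemma U_descent_construct:
  assumes g: "\<And>i j c r u v. i \<in> I \<Longrightarrow> j \<in> I \<Longrightarrow> inh c \<Longrightarrow> r \<in> el (A i) c \<Longrightarrow> u \<in> el (V i) c \<Longrightarrow> v \<in> el (V j) c \<Longrightarrow> g i j c r u v \<in> el (A j) c"
    and g_rs: "\<And>i j h d c r u v. i \<in> I \<Longrightarrow> j \<in> I \<Longrightarrow> h \<in> st d c \<Longrightarrow> r \<in> el (A i) c \<Longrightarrow> u \<in> el (V i) c \<Longrightarrow> v \<in> el (V j) c \<Longrightarrow>
      rs (A j) h (g i j c r u v) = g i j d (rs (A i) h r) (rs (V i) h u) (rs (V j) h v)"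
    and g_id: "\<And>i c r u. i \<in> I \<Longrightarrow> inh c \<Longrightarrow> r \<in> el (A i) c \<Longrightarrow> u \<in> el (V i) c \<Longrightarrow> g i i c r u u = r"
    and g_comp: "\<And>i j k c r u v w. i \<in> I \<Longrightarrow> j \<in> I \<Longrightarrow> k \<in> I \<Longrightarrow> inh c \<Longrightarrow> r \<in> el (A i) c \<Longrightarrow> u \<in> el (V i) c \<Longrightarrow> v \<in> el (V j) c \<Longrightarrow>
      w \<in> el (V k) c \<Longrightarrow> g j k c (g i j c r u v) v w = g i k c r u w"
  obtains \<sigma> where "U_descent_datum E \<gamma> I \<zeta> R \<sigma>"
    "\<And>i j c r u v. i \<in> I \<Longrightarrow> j \<in> I \<Longrightarrow> inh c \<Longrightarrow> r \<in> el (A i) c \<Longrightarrow> u \<in> el (V i) c \<Longrightarrow> v \<in> el (V j) c \<Longrightarrow> sg \<sigma> i j c r u v = g i j c r u v"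
proof -
  have "\<exists>t \<in> hom E (AV i j) (AV j i).
     \<forall>c r u v. inh c \<longrightarrow> r \<in> el (A i) c \<longrightarrow> u \<in> el (V i) c \<longrightarrow> v \<in> el (V j) c \<longrightarrow>
       ap t c (tq i j c r u v) = tq j i c (g i j c r u v) v u" if ij: "i \<in> I" "j \<in> I" for i j
  proof -
    note o = Prod2_obj[OF Ao[OF ij(1)] V2o[OF ij]] Prod2_obj[OF Ao[OF ij(2)] V2o[OF ij(2,1)]]
    define G where "G c x y \<longleftrightarrow> (\<exists>r u v. r \<in> el (A i) c \<and> u \<in> el (V i) c \<and> v \<in> el (V j) c \<and> x = tq i j c r u v \<and>
       y = tq j i c (g i j c r u v) v u)" for c x y
    obtain t where t: "t \<in> hom E (AV i j) (AV j i)"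
      "\<And>c x y. inh c \<Longrightarrow> x \<in> el (AV i j) c \<Longrightarrow> G c x y \<Longrightarrow> ap t c x = y"
    proof (rule arrow_of_graph[OF o, of G])
      show "y \<in> el (AV j i) c" if "inh c" "G c x y" for c x y
        using that tq[OF ij(2,1)] g[OF ij] unfolding G_def by blast
      show "G d (rs (AV i j) h x) (rs (AV j i) h y)"
        if h: "h \<in> st d c" and G: "G c x y" for c d h x y
      proof -
        obtain r u v where r: "r \<in> el (A i) c" "u \<in> el (V i) c" "v \<in> el (V j) c" "x = tq i j c r u v"
          "y = tq j i c (g i j c r u v) v u" using G unfolding G_def by blast
        note m = rs_el[OF Ao[OF ij(1)] h r(1)] rs_el[OF Vo[OF ij(1)] h r(2)] rs_el[OF Vo[OF ij(2)] h r(3)]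
        have 1: "rs (AV i j) h x = tq i j d (rs (A i) h r) (rs (V i) h u) (rs (V j) h v)"
          using tq_rs[OF ij h r(1-3)] r(4) by simp
        have 2: "rs (AV j i) h y =
          tq j i d (g i j d (rs (A i) h r) (rs (V i) h u) (rs (V j) h v)) (rs (V j) h v) (rs (V i) h u)"
          using tq_rs[OF ij(2,1) h g[OF ij st_inh'[OF h] r(1-3)] r(3,2)] g_rs[OF ij h r(1-3)] r(5) by simp
        show ?thesis unfolding G_def using 1 2 m by blast
      qed
      show "y = z" if c: "inh c" and yz: "G c x y" "G c x z" for c x y z
      proof -
        obtain r u v where r: "r \<in> el (A i) c" "u \<in> el (V i) c" "v \<in> el (V j) c" "x = tq i j c r u v"
          "y = tq j i c (g i j c r u v) v u" using yz(1) unfolding G_def by blast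
        obtain r' u' v' where r': "r' \<in> el (A i) c" "u' \<in> el (V i) c" "v' \<in> el (V j) c" "x = tq i j c r' u' v'"
          "z = tq j i c (g i j c r' u' v') v' u'" using yz(2) unfolding G_def by blast
        have "r = r'" "u = u'" "v = v'" using tq_inj[OF ij c r(1-3) r'(1-3)] r(4) r'(4) by auto
        then show ?thesis using r(5) r'(5) by simp
      qed
      show "loc c (\<lambda>d h. \<exists>y. G d (rs (AV i j) h x) y)"
        if c: "inh c" and x: "x \<in> el (AV i j) c" for c x
      proof (rule loc_triv[OF c])
        fix d h assume h: "h \<in> st d c"
        obtain r u v where "r \<in> el (A i) d" "u \<in> el (V i) d" "v \<in> el (V j) d" "rs (AV i j) h x = tq i j d r u v"
          using tq_cases[OF ij st_inh[OF h] rs_el[OF o(1) h x]] .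
        then show "\<exists>y. G d (rs (AV i j) h x) y" unfolding G_def by blast
      qed
    qed blast
    show ?thesis
    proof (rule bexI[OF _ t(1)], intro allI impI)
      fix c r u v assume m: "inh c" "r \<in> el (A i) c" "u \<in> el (V i) c" "v \<in> el (V j) c"
      show "ap t c (tq i j c r u v) = tq j i c (g i j c r u v) v u"
        by (rule t(2)[OF m(1) tq[OF ij m]]) (use m in \<open>unfold G_def, blast\<close>)
    qed
  qed
  then obtain t where t: "\<And>i j. i \<in> I \<Longrightarrow> j \<in> I \<Longrightarrow> t i j \<in> hom E (AV i j) (AV j i)"
    "\<And>i j c r u v. i \<in> I \<Longrightarrow> j \<in> I \<Longrightarrow> inh c \<Longrightarrow> r \<in> el (A i) c \<Longrightarrow> u \<in> el (V i) c \<Longrightarrow> v \<in> el (V j) c \<Longrightarrow>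
       ap (t i j) c (tq i j c r u v) = tq j i c (g i j c r u v) v u" by metis
  define \<sigma> where "\<sigma> x = t (x ! 0) (x ! 1)" for x
  have \<sigma>: "\<sigma> [i, j] = t i j" for i j by (simp add: \<sigma>_def)
  have hc: "hc \<sigma> i j = pr E [A j, VV j i] 0 \<bullet> t i j" for i j by (simp add: hat_def NN_simps omit_def \<sigma>)
  have hch: "hc \<sigma> i j \<in> hom E (AV i j) (A j)" if ij: "i \<in> I" "j \<in> I" for i j
    unfolding hc by (rule E_comp[OF t(1)[OF ij] pr2_hom(1)[OF Ao[OF ij(2)] V2o[OF ij(2,1)]]])
  have hcap: "ap (hc \<sigma> i j) c (tq i j c r u v) = g i j c r u v"
    if m: "i \<in> I" "j \<in> I" "inh c" "r \<in> el (A i) c" "u \<in> el (V i) c" "v \<in> el (V j) c" for i j c r u v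
    unfolding hc
    using ap_comp[OF t(1)[OF m(1,2)] pr2_hom(1)[OF Ao[OF m(2)] V2o[OF m(2,1)]] m(3) tq[OF m]] t(2)[OF m]
      tp2(2)[OF Ao[OF m(2)] V2o[OF m(2,1)] m(3) g[OF m] tp2(1)[OF Vo[OF m(2)] Vo[OF m(1)] m(3,6,5)]] by simp
  \<comment> \<open>Transport along \<open>(u, v)\<close> and back along \<open>(v, u)\<close> is
    the cocycle law with third index \<open>i\<close>, followed by the unit law. This makes the
    arrows isomorphisms.\<close>
  have g_inv: "g j i c (g i j c r u v) v u = r" if "i \<in> I" "j \<in> I" "inh c" "r \<in> el (A i) c" "u \<in> el (V i) c" "v \<in> el (V j) c" for i j c r u v
    using g_comp[OF that(1,2,1,3-6,5)] g_id[OF that(1,3-5)] by simp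
  have iso: "is_iso E (t i j)" if ij: "i \<in> I" "j \<in> I" for i j
  proof (rule iso_bij[OF t(1)[OF ij]], rule bij_betw_byWitness[where f' = "ap (t j i) _"])
    fix c assume c: "inh c"
    show "\<forall>a\<in>el (AV i j) c. ap (t j i) c (ap (t i j) c a) = a"
      using tq_cases[OF ij c] t(2)[OF ij c] t(2)[OF ij(2,1) c] g[OF ij c] g_inv[OF ij c] by metis
    show "\<forall>a\<in>el (AV j i) c. ap (t i j) c (ap (t j i) c a) = a"
      using tq_cases[OF ij(2,1) c] t(2)[OF ij c] t(2)[OF ij(2,1) c] g[OF ij(2,1) c] g_inv[OF ij(2,1) c] by metis
    show "ap (t i j) c ` el (AV i j) c \<subseteq> el (AV j i) c"
      "ap (t j i) c ` el (AV j i) c \<subseteq> el (AV i j) c"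
      using ap_el[OF t(1)[OF ij] c] ap_el[OF t(1)[OF ij(2,1)] c] by blast+
  qed
  have 1: "pr E [A j, VV j i] (Suc 0) \<bullet> t i j = swap i j \<bullet> pr E [A i, VV i j] (Suc 0)"
    if ij: "i \<in> I" "j \<in> I" for i j
  proof -
    note o = Ao[OF ij(2)] V2o[OF ij(2,1)] and o' = Ao[OF ij(1)] V2o[OF ij]
    show ?thesis
    proof (rule ext_stage[OF E_comp[OF t(1)[OF ij] pr2_hom(3)[OF o]] E_comp[OF pr2_hom(3)[OF o'] swap(1)[OF ij]]])
      fix c x assume c: "inh c" and x: "x \<in> el (AV i j) c"
      obtain r u v where m: "r \<in> el (A i) c" "u \<in> el (V i) c" "v \<in> el (V j) c" "x = tq i j c r u v"
        using tq_cases[OF ij c x] .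
      show "ap (pr E [A j, VV j i] (Suc 0) \<bullet> t i j) c x = ap (swap i j \<bullet> pr E [A i, VV i j] (Suc 0)) c x"
        using ap_comp[OF t(1)[OF ij] pr2_hom(3)[OF o] c x] ap_comp[OF pr2_hom(3)[OF o'] swap(1)[OF ij] c x]
          t(2)[OF ij c m(1-3)] swap(2)[OF ij c m(2,3)] m(4)
          tp2(4)[OF o c g[OF ij c m(1-3)] tp2(1)[OF Vo[OF ij(2)] Vo[OF ij(1)] c m(3,2)]]
          tp2(4)[OF o' c m(1) tp2(1)[OF Vo[OF ij(1)] Vo[OF ij(2)] c m(2,3)]] by simp
    qed
  qed
  have 2: "hc \<sigma> i i \<bullet> arr_prod E (Id E (A i)) (co_s NN 0 0 [i]) = pr E [A i, V i] 0" if i: "i \<in> I" for i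
  proof -
    note a = arr_prod[OF E_id[OF Ao[OF i]] diag(1)[OF i]]
    show ?thesis
    proof (rule ext_stage[OF E_comp[OF a(1) hch[OF i i]] pr2_hom(1)[OF Ao[OF i] Vo[OF i]]])
      fix c x assume c: "inh c" and x: "x \<in> el (Prod E [A i, V i]) c"
      obtain r u where m: "r \<in> el (A i) c" "u \<in> el (V i) c" "x = tp [A i, V i] c [r, u]"
        using tp2_cases[OF Ao[OF i] Vo[OF i] c x] .
      show "ap (hc \<sigma> i i \<bullet> arr_prod E (Id E (A i)) (co_s NN 0 0 [i])) c x = ap (pr E [A i, V i] 0) c x"
        using ap_comp[OF a(1) hch[OF i i] c x] a(2)[OF c m(1,2)] m ap_id[OF Ao[OF i] c m(1)] diag(2)[OF i c m(2)]
          hcap[OF i i c m(1,2,2)] g_id[OF i c m(1,2)] tp2(2)[OF Ao[OF i] Vo[OF i] c m(1,2)] by simp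
    qed
  qed
  have 3: "hc \<sigma> j k \<bullet> tup E [hc \<sigma> i j \<bullet> arr_prod E (Id E (A i)) (co_d NN (Suc (Suc 0)) (Suc (Suc 0)) [i, j, k]),
         co_d NN (Suc (Suc 0)) 0 [i, j, k] \<bullet> pr E [A i, VVV i j k] (Suc 0)] =
      hc \<sigma> i k \<bullet> arr_prod E (Id E (A i)) (co_d NN (Suc (Suc 0)) (Suc 0) [i, j, k])"
    if i: "i \<in> I" and j: "j \<in> I" and k: "k \<in> I" for i j k
  proof -
    note f = face2[OF i j k] and Ai = Ao[OF i]
    have P3: "VVV i j k \<in> Obj E" using Prod_obj[of "[V i, V j, V k]"] Vo i j k by simp
    note a2 = arr_prod[OF E_id[OF Ai] f(1)] and a1 = arr_prod[OF E_id[OF Ai] f(3)]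
    note q = pr2_hom(3)[OF Ai P3]
    note tt = tup2[OF E_comp[OF a2(1) hch[OF i j]] E_comp[OF q f(5)]]
    show ?thesis
    proof (rule ext_stage[OF E_comp[OF tt(1) hch[OF j k]] E_comp[OF a1(1) hch[OF i k]]])
      fix c y assume c: "inh c" and y: "y \<in> el (AVV i j k) c"
      obtain r x where m: "r \<in> el (A i) c" "x \<in> el (VVV i j k) c" "y = tp [A i, VVV i j k] c [r, x]"
        using tp2_cases[OF Ai P3 c y] .
      define u v w where "u = ap (pr E [V i, V j, V k] 0) c x" and "v = ap (pr E [V i, V j, V k] (Suc 0)) c x"
        and "w = ap (pr E [V i, V j, V k] (Suc (Suc 0))) c x"
      have uvw: "u \<in> el (V i) c" "v \<in> el (V j) c" "w \<in> el (V k) c"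
        using ap_el[OF pr3(1)[OF i j k] c m(2)] ap_el[OF pr3(2)[OF i j k] c m(2)] ap_el[OF pr3(3)[OF i j k] c m(2)]
        by (simp_all add: u_def v_def w_def)
      have l: "ap (hc \<sigma> i j \<bullet> arr_prod E (Id E (A i)) (co_d NN (Suc (Suc 0)) (Suc (Suc 0)) [i, j, k])) c y = g i j c r u v"
        using ap_comp[OF a2(1) hch[OF i j] c y] a2(2)[OF c m(1,2)] m(3) ap_id[OF Ai c m(1)] f(2)[OF c m(2)]
          hcap[OF i j c m(1) uvw(1,2)] by (simp add: u_def v_def)
      have l': "ap (co_d NN (Suc (Suc 0)) 0 [i, j, k] \<bullet> pr E [A i, VVV i j k] (Suc 0)) c y = tp [V j, V k] c [v, w]"
        using ap_comp[OF q f(5) c y] m(3) tp2(4)[OF Ai P3 c m(1,2)] f(6)[OF c m(2)] by (simp add: v_def w_def)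
      have r: "ap (hc \<sigma> i k \<bullet> arr_prod E (Id E (A i)) (co_d NN (Suc (Suc 0)) (Suc 0) [i, j, k])) c y = g i k c r u w"
        using ap_comp[OF a1(1) hch[OF i k] c y] a1(2)[OF c m(1,2)] m(3) ap_id[OF Ai c m(1)] f(4)[OF c m(2)]
          hcap[OF i k c m(1) uvw(1,3)] by (simp add: u_def w_def)
      show "ap (hc \<sigma> j k \<bullet> tup E [hc \<sigma> i j \<bullet> arr_prod E (Id E (A i)) (co_d NN (Suc (Suc 0)) (Suc (Suc 0)) [i, j, k]),
         co_d NN (Suc (Suc 0)) 0 [i, j, k] \<bullet> pr E [A i, VVV i j k] (Suc 0)]) c y =
        ap (hc \<sigma> i k \<bullet> arr_prod E (Id E (A i)) (co_d NN (Suc (Suc 0)) (Suc 0) [i, j, k])) c y"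
        unfolding r
        using ap_comp[OF tt(1) hch[OF j k] c y] tt(2)[OF c y] l l' hcap[OF j k c g[OF i j c m(1) uvw(1,2)] uvw(2,3)]
          g_comp[OF i j k c m(1) uvw] by simp
    qed
  qed
  have "U_descent_datum E \<gamma> I \<zeta> R \<sigma>"
    unfolding U_descent_unfold \<sigma>
  proof (intro conjI allI impI ballI)
    fix i j assume "[i, j] \<in> ix NN (Suc 0)"
    then have ij: "i \<in> I" "j \<in> I" by (auto simp: N1)
    show "t i j \<in> hom E (AV i j) (AV j i)" "is_iso E (t i j)"
      "pr E [A j, VV j i] (Suc 0) \<bullet> t i j = swap i j \<bullet> pr E [A i, VV i j] (Suc 0)"
      using t(1)[OF ij] iso[OF ij] 1[OF ij] by auto
  next
    fix i j k assume "[i, j, k] \<in> ix NN (Suc (Suc 0))"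
    then have ijk: "i \<in> I" "j \<in> I" "k \<in> I" by (auto simp: NN_simps)
    show "hc \<sigma> j k \<bullet> tup E [hc \<sigma> i j \<bullet> arr_prod E (Id E (A i)) (co_d NN (Suc (Suc 0)) (Suc (Suc 0)) [i, j, k]),
         co_d NN (Suc (Suc 0)) 0 [i, j, k] \<bullet> pr E [A i, VVV i j k] (Suc 0)] =
      hc \<sigma> i k \<bullet> arr_prod E (Id E (A i)) (co_d NN (Suc (Suc 0)) (Suc 0) [i, j, k])" by (rule 3[OF ijk])
  qed (rule 2)
  moreover have "sg \<sigma> i j c r u v = g i j c r u v"
    if "i \<in> I" "j \<in> I" "inh c" "r \<in> el (A i) c" "u \<in> el (V i) c" "v \<in> el (V j) c" for i j c r u v
    unfolding sg_def by (rule hcap[OF that])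
  ultimately show ?thesis by (rule that)
qed

end

section \<open>Simplicial objects with an action of all maps of finite ordinals\<close>

definition coface :: "nat \<Rightarrow> nat \<Rightarrow> nat" where
  "coface i k = (if k < i then k else Suc k)"

definition codeg :: "nat \<Rightarrow> nat \<Rightarrow> nat" where
  "codeg i k = (if k \<le> i then k else k - 1)"

text \<open>A contravariant action of all maps from \<open>{..m}\<close> to \<open>{..n}\<close>,
  not only of the monotone ones: the order-reversing map then acts too, so faces, degeneracies and
  duality come from one construction. Maps are total functions on the naturals, and
  \<open>a_cong\<close> lets only their values up to \<open>m\<close> matter.\<close>

locale ordinal_action =
  fixes D :: "('x, 'y) category" and L :: "nat \<Rightarrow> 'x" and a :: "nat \<Rightarrow> nat \<Rightarrow> (nat \<Rightarrow> nat) \<Rightarrow> 'y"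
  assumes D: "is_category D"
    and a_hom: "\<And>m n \<phi>. \<phi> ` {..m} \<subseteq> {..n} \<Longrightarrow> a m n \<phi> \<in> hom D (L n) (L m)"
    and a_cong: "\<And>m n \<phi> \<psi>. (\<And>k. k \<le> m \<Longrightarrow> \<phi> k = \<psi> k) \<Longrightarrow> a m n \<phi> = a m n \<psi>"
    and a_comp: "\<And>k m n \<phi> \<psi>. \<phi> ` {..m} \<subseteq> {..n} \<Longrightarrow> \<psi> ` {..k} \<subseteq> {..m} \<Longrightarrow> Comp D (a k m \<psi>) (a m n \<phi>) = a k n (\<phi> \<circ> \<psi>)"
    and a_id: "\<And>n. a n n (\<lambda>k. k) = Id D (L n)"
    and L: "\<And>n. L n \<in> Obj D"
begin

definition X where
  "X = \<lparr>lev = L, dd = (\<lambda>n i. a (n - 1) n (coface i)), ss = (\<lambda>n i. a (Suc n) n (codeg i))\<rparr>"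

lemma coface_im: "i \<le> Suc n \<Longrightarrow> coface i ` {..n} \<subseteq> {..Suc n}"
  by (auto simp: coface_def)

lemma codeg_im: "i \<le> n \<Longrightarrow> codeg i ` {..Suc n} \<subseteq> {..n}"
  by (auto simp: codeg_def)

lemma simplicial: "is_simplicial D X"
  unfolding is_simplicial_def
proof (intro conjI allI impI)
  fix n show "lev X n \<in> Obj D" by (simp add: X_def L)
next
  fix n i :: nat assume "i \<le> Suc n"
  then show "dd X (Suc n) i \<in> hom D (lev X (Suc n)) (lev X n)"
    using a_hom[OF coface_im] by (simp add: X_def)
next
  fix n i :: nat assume "i \<le> n"
  then show "ss X n i \<in> hom D (lev X n) (lev X (Suc n))"
    using a_hom[OF codeg_im] by (simp add: X_def)
next
  fix n j i :: nat assume ij: "j \<le> n + 2" "i < j"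
  have "a n (Suc (Suc n)) (coface j \<circ> coface i) = a n (Suc (Suc n)) (coface i \<circ> coface (j - 1))"
    by (rule a_cong) (use ij in \<open>auto simp: coface_def\<close>)
  then show "Comp D (dd X (n + 1) i) (dd X (n + 2) j) = Comp D (dd X (n + 1) (j - 1)) (dd X (n + 2) i)"
    using a_comp[OF coface_im[of j "Suc n"] coface_im[of i n]] a_comp[OF coface_im[of i "Suc n"] coface_im[of "j - 1" n]] ij
    by (simp add: X_def)
next
  fix n j i :: nat assume ij: "j \<le> n" "i \<le> j"
  have "a (Suc (Suc n)) n (codeg j \<circ> codeg i) = a (Suc (Suc n)) n (codeg i \<circ> codeg (j + 1))"
    by (rule a_cong) (use ij in \<open>auto simp: codeg_def\<close>)
  then show "Comp D (ss X (n + 1) i) (ss X n j) = Comp D (ss X (n + 1) (j + 1)) (ss X n i)"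
    using a_comp[OF codeg_im[of j n] codeg_im[of i "Suc n"]] a_comp[OF codeg_im[of i n] codeg_im[of "Suc j" "Suc n"]] ij
    by (simp add: X_def)
next
  fix n j i :: nat assume ij: "j \<le> n" "i \<le> n + 1"
  have 1: "Comp D (dd X (n + 1) i) (ss X n j) = a n n (codeg j \<circ> coface i)"
    using a_comp[OF codeg_im[of j n] coface_im[of i n]] ij by (simp add: X_def)
  consider "i < j" | "j \<le> i" "i \<le> j + 1" | "j + 1 < i" by linarith
  then show "Comp D (dd X (n + 1) i) (ss X n j) =
         (if i < j then Comp D (ss X (n - 1) (j - 1)) (dd X n i)
          else if i \<le> j + 1 then Id D (lev X n)
          else Comp D (ss X (n - 1) j) (dd X n (i - 1)))"
  proof cases
    case 1
    then obtain n' where n: "n = Suc n'" using ij by (cases n) auto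
    have "a n n (codeg j \<circ> coface i) = a n n (coface i \<circ> codeg (j - 1))"
      by (rule a_cong) (use 1 in \<open>auto simp: codeg_def coface_def\<close>)
    then show ?thesis
      using a_comp[OF coface_im[of i n'] codeg_im[of "j - 1" n']] 1 ij
      unfolding \<open>Comp D (dd X (n + 1) i) (ss X n j) = _\<close> by (simp add: X_def n)
  next
    case 2
    have "a n n (codeg j \<circ> coface i) = a n n (\<lambda>k. k)"
      by (rule a_cong) (use 2 in \<open>auto simp: codeg_def coface_def\<close>)
    then show ?thesis using 2 a_id unfolding 1 by (simp add: X_def)
  next
    case 3
    then obtain n' where n: "n = Suc n'" using ij by (cases n) auto
    have "a n n (codeg j \<circ> coface i) = a n n (coface (i - 1) \<circ> codeg j)"
      by (rule a_cong) (use 3 in \<open>auto simp: codeg_def coface_def\<close>)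
    then show ?thesis
      using a_comp[OF coface_im[of "i - 1" n'] codeg_im[of j n']] 3 ij unfolding 1 by (simp add: X_def n)
  qed
qed

lemma rev_im: "(\<lambda>k. n - k) ` {..n} \<subseteq> {..n::nat}"
  by auto

lemma duality: "strict_duality D X (\<lambda>n. a n n (\<lambda>k. n - k))"
  unfolding strict_duality_def
proof (intro conjI allI impI)
  fix n
  show h: "a n n (\<lambda>k. n - k) \<in> hom D (lev X n) (lev X n)" using a_hom[OF rev_im] by (simp add: X_def)
  have "Comp D (a n n (\<lambda>k. n - k)) (a n n (\<lambda>k. n - k)) = a n n (\<lambda>k. k)"
    unfolding a_comp[OF rev_im rev_im] by (rule a_cong) simp
  then show "is_iso D (a n n (\<lambda>k. n - k))" using h a_id by (auto simp: is_iso_def in_hom X_def)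
next
  have "a 0 0 (\<lambda>k. 0 - k) = a 0 0 (\<lambda>k. k)" by (rule a_cong) simp
  then show "a 0 0 (\<lambda>k. 0 - k) = Id D (lev X 0)" using a_id by (simp add: X_def)
next
  fix n i :: nat assume i: "i \<le> Suc n"
  have "a n (Suc n) ((\<lambda>k. Suc n - k) \<circ> coface i) = a n (Suc n) (coface (Suc n - i) \<circ> (\<lambda>k. n - k))"
    by (rule a_cong) (use i in \<open>auto simp: coface_def\<close>)
  then show "Comp D (dd X (Suc n) i) (a (Suc n) (Suc n) (\<lambda>k. Suc n - k)) =
    Comp D (a n n (\<lambda>k. n - k)) (dd X (Suc n) (Suc n - i))"
    using a_comp[OF rev_im coface_im[OF i]] a_comp[OF coface_im[of "Suc n - i" n] rev_im] i by (simp add: X_def)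
next
  fix n i :: nat assume i: "i \<le> n"
  have "a (Suc n) n ((\<lambda>k. n - k) \<circ> codeg i) = a (Suc n) n (codeg (n - i) \<circ> (\<lambda>k. Suc n - k))"
    by (rule a_cong) (use i in \<open>auto simp: codeg_def\<close>)
  then show "Comp D (ss X n i) (a n n (\<lambda>k. n - k)) = Comp D (a (Suc n) (Suc n) (\<lambda>k. Suc n - k)) (ss X n (n - i))"
    using a_comp[OF rev_im codeg_im[OF i]] a_comp[OF codeg_im[of "n - i" n] rev_im] i by (simp add: X_def)
qed

end

section \<open>The hypercover of a covering projection\<close>

locale cover_data = cech_fam ty E C J \<Phi> \<gamma> I U \<zeta> R
  for ty :: "'u itself" and E :: "('o, 'a) category" and C :: "('u, 'u) category" and J
    and \<Phi> :: "('o, 'a, 'u) sheaf_functor"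
    and \<gamma> :: "('u set, 'u set_map, 'o, 'a) cfunctor"
    and I :: "'u set" and U :: 'o and \<zeta> :: 'a and R :: "'u \<Rightarrow> 'u set" +
  fixes \<sigma> :: "'u list \<Rightarrow> 'a" and tt ff :: 'u
  assumes ud: "U_descent_datum E \<gamma> I \<zeta> R \<sigma>"
    and cov: "\<And>i j. [i, j] \<in> ix (cech E \<gamma> I \<zeta>) 1 \<Longrightarrow>
      epimorphic_family E (Prod E [component E \<gamma> I \<zeta> i, component E \<gamma> I \<zeta> j])
         {tup E [u, v] | V u v. is_action_span E \<gamma> I \<zeta> R \<sigma> i j V u v}"
    and tf: "tt \<noteq> ff"
begin

text \<open>The descent datum acts over \<open>(u, v)\<close> as the constant bijection \<open>b\<close>; here \<open>u\<close> and \<open>v\<close> are sections of \<open>U\<close>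
  that need to lie in the components of \<open>i\<close> and \<open>j\<close>.\<close>

definition agr where
  "agr i j b c u v \<longleftrightarrow> (\<forall>d. \<forall>h \<in> st d c. \<forall>u' \<in> el (V i) d. \<forall>v' \<in> el (V j) d.
     ap (cc i) d u' = rs U h u \<longrightarrow> ap (cc j) d v' = rs U h v \<longrightarrow>
     (\<forall>r \<in> el (A i) d. sg \<sigma> i j d r u' v' = ap (on_arr \<gamma> b) d r))"

lemma Uo: "U \<in> Obj E"
  using E_obj(1)[OF \<zeta>] .

lemma agr_rs:
  assumes "h \<in> st d c" "u \<in> el U c" "v \<in> el U c" "agr i j b c u v"
  shows "agr i j b d (rs U h u) (rs U h v)"
  unfolding agr_def
proof (intro allI ballI impI)
  fix e g u' v' r assume g: "g \<in> st e d" and m: "u' \<in> el (V i) e" "v' \<in> el (V j) e"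
    "ap (cc i) e u' = rs U g (rs U h u)" "ap (cc j) e v' = rs U g (rs U h v)" "r \<in> el (A i) e"
  then show "sg \<sigma> i j e r u' v' = ap (on_arr \<gamma> b) e r"
    using assms(4) st_comp[OF assms(1) g] rs_comp[OF Uo assms(1) g] assms(2,3) unfolding agr_def by simp
qed

text \<open>The equation of an action span, evaluated at a point \<open>z\<close> of its apex, says
  that the transition map over the two legs of \<open>z\<close> is constant. Points of the
  components that lie over these legs are unique, as the inclusions into \<open>U\<close> are
  injective.\<close>

lemma span_agr:
  assumes ij: "i \<in> I" "j \<in> I" and sp: "is_action_span E \<gamma> I \<zeta> R \<sigma> i j Z a b"
    and c: "inh c" and z: "z \<in> el Z c"
  obtains s where "set_bijection (R i) (R j) s" "agr i j s c (ap (cc i) c (ap a c z)) (ap (cc j) c (ap b c z))"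
proof -
  obtain s where s: "set_bijection (R i) (R j) s"
    and a: "a \<in> hom E Z (V i)" and b: "b \<in> hom E Z (V j)"
    and eq: "\<sigma> [i, j] \<bullet> arr_prod E (Id E (A i)) (tup E [a, b]) =
       arr_prod E (Id E (A j)) (tup E [b, a]) \<bullet> arr_prod E (on_arr \<gamma> s) (Id E Z)"
    using sp unfolding is_action_span_def by blast
  have Z: "Z \<in> Obj E" using E_obj(1)[OF a] .
  have sh: "s \<in> hom SET (R i) (R j)" using s by (simp add: set_bijection_def)
  note gs = \<gamma>_hom[OF sh]
  note ta = tup2[OF a b] and tb = tup2[OF b a]
  note p1 = arr_prod[OF E_id[OF Ao[OF ij(1)]] ta(1)] and p2 = arr_prod[OF E_id[OF Ao[OF ij(2)]] tb(1)]
    and p3 = arr_prod[OF gs E_id[OF Z]]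
  have key: "sg \<sigma> i j d r (ap a d y) (ap b d y) = ap (on_arr \<gamma> s) d r"
    if d: "inh d" and y: "y \<in> el Z d" and r: "r \<in> el (A i) d" for d y r
  proof -
    note ya = ap_el[OF a d y] and yb = ap_el[OF b d y]
    note N = N1I[OF d ij ya yb]
    note t = tp2(1)[OF Ao[OF ij(1)] Z d r y]
    have "ap (\<sigma> [i, j] \<bullet> arr_prod E (Id E (A i)) (tup E [a, b])) d (tp [A i, Z] d [r, y]) =
      tq j i d (sg \<sigma> i j d r (ap a d y) (ap b d y)) (ap b d y) (ap a d y)"
      using ap_comp[OF p1(1) \<sigma>_hom[OF ud N] d t] p1(2)[OF d r y] ap_id[OF Ao[OF ij(1)] d r] ta(2)[OF d y]
        ap_\<sigma>[OF ud ij d r ya yb] by simp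
    moreover have "ap (arr_prod E (Id E (A j)) (tup E [b, a]) \<bullet> arr_prod E (on_arr \<gamma> s) (Id E Z)) d (tp [A i, Z] d [r, y]) =
      tq j i d (ap (on_arr \<gamma> s) d r) (ap b d y) (ap a d y)"
      using ap_comp[OF p3(1) p2(1) d t] p3(2)[OF d r y] ap_id[OF Z d y] p2(2)[OF d ap_el[OF gs d r] y]
        ap_id[OF Ao[OF ij(2)] d ap_el[OF gs d r]] tb(2)[OF d y] by simp
    ultimately have "tq j i d (sg \<sigma> i j d r (ap a d y) (ap b d y)) (ap b d y) (ap a d y) =
      tq j i d (ap (on_arr \<gamma> s) d r) (ap b d y) (ap a d y)" using eq by simp
    from tq_inj(1)[OF ij(2,1) d sg_el[OF ud ij d r ya yb] yb ya ap_el[OF gs d r] yb ya this]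
    show ?thesis .
  qed
  have "agr i j s c (ap (cc i) c (ap a c z)) (ap (cc j) c (ap b c z))"
    unfolding agr_def
  proof (intro allI ballI impI)
    fix d h u' v' r assume h: "h \<in> st d c" and u': "u' \<in> el (V i) d" and v': "v' \<in> el (V j) d"
      and eu: "ap (cc i) d u' = rs U h (ap (cc i) c (ap a c z))" and ev: "ap (cc j) d v' = rs U h (ap (cc j) c (ap b c z))"
      and r: "r \<in> el (A i) d"
    note d = st_inh[OF h] and hz = rs_el[OF Z h z]
    have "rs U h (ap (cc i) c (ap a c z)) = ap (cc i) d (ap a d (rs Z h z))"
      using ap_rs[OF cc_hom[OF ij(1)] h ap_el[OF a c z]] ap_rs[OF a h z] by simp
    then have "u' = ap a d (rs Z h z)" using cc_inj[OF ij(1) d u' ap_el[OF a d hz]] eu by simp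
    moreover have "rs U h (ap (cc j) c (ap b c z)) = ap (cc j) d (ap b d (rs Z h z))"
      using ap_rs[OF cc_hom[OF ij(2)] h ap_el[OF b c z]] ap_rs[OF b h z] by simp
    then have "v' = ap b d (rs Z h z)" using cc_inj[OF ij(2) d v' ap_el[OF b d hz]] ev by simp
    ultimately show "sg \<sigma> i j d r u' v' = ap (on_arr \<gamma> s) d r" using key[OF d hz r] by simp
  qed
  then show ?thesis using that s by blast
qed

text \<open>The covering condition read through \<open>epimorphic_loc\<close>: the pair of points
  locally factors through an action span, which supplies the bijection.\<close>

lemma agr_total:
  assumes ij: "i \<in> I" "j \<in> I" and c: "inh c" and u: "u \<in> el U c" "ap \<zeta> c u = kap I i c"
    and v: "v \<in> el U c" "ap \<zeta> c v = kap I j c"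
  shows "loc c (\<lambda>d h. \<exists>b. set_bijection (R i) (R j) b \<and> agr i j b d (rs U h u) (rs U h v))"
proof -
  obtain u' where u': "u' \<in> el (V i) c" "ap (cc i) c u' = u" using cc_ex[OF ij(1) c u] by blast
  obtain v' where v': "v' \<in> el (V j) c" "ap (cc j) c v' = v" using cc_ex[OF ij(2) c v] by blast
  let ?F = "{tup E [a, b] | Z a b. is_action_span E \<gamma> I \<zeta> R \<sigma> i j Z a b}"
  note x = tp2(1)[OF Vo[OF ij(1)] Vo[OF ij(2)] c u'(1) v'(1)]
  have ef: "epimorphic_family E (VV i j) ?F" using cov N1I[OF c ij u'(1) v'(1)] by simp
  show ?thesis
  proof (rule loc_mono[OF epimorphic_loc[OF ef V2o[OF ij] c x]])
    fix d h assume h: "h \<in> st d c" and "\<exists>f\<in>?F. \<exists>y\<in>el (Dom E f) d. ap f d y = rs (VV i j) h (tp [V i, V j] c [u', v'])"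
    then obtain Z a b y where sp: "is_action_span E \<gamma> I \<zeta> R \<sigma> i j Z a b" and y: "y \<in> el (Dom E (tup E [a, b])) d"
      and eq: "ap (tup E [a, b]) d y = rs (VV i j) h (tp [V i, V j] c [u', v'])" by blast
    note d = st_inh[OF h]
    have a: "a \<in> hom E Z (V i)" and b: "b \<in> hom E Z (V j)" using sp by (auto simp: is_action_span_def)
    have y': "y \<in> el Z d" using y tup2(1)[OF a b] by (simp add: in_hom)
    have "tp [V i, V j] d [ap a d y, ap b d y] = tp [V i, V j] d [rs (V i) h u', rs (V j) h v']"
      using eq tup2(2)[OF a b d y'] rs_tp2[OF Vo[OF ij(1)] Vo[OF ij(2)] h u'(1) v'(1)] by simp
    then have "ap a d y = rs (V i) h u'" "ap b d y = rs (V j) h v'"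
      using tp2(2,3)[OF Vo[OF ij(1)] Vo[OF ij(2)] d ap_el[OF a d y'] ap_el[OF b d y']]
        tp2(2,3)[OF Vo[OF ij(1)] Vo[OF ij(2)] d rs_el[OF Vo[OF ij(1)] h u'(1)] rs_el[OF Vo[OF ij(2)] h v'(1)]] by simp_all
    then have 1: "ap (cc i) d (ap a d y) = rs U h u" "ap (cc j) d (ap b d y) = rs U h v"
      using ap_rs[OF cc_hom[OF ij(1)] h u'(1)] ap_rs[OF cc_hom[OF ij(2)] h v'(1)] u' v' by simp_all
    show "\<exists>b. set_bijection (R i) (R j) b \<and> agr i j b d (rs U h u) (rs U h v)"
      by (rule span_agr[OF ij sp d y']) (use 1 in auto)
  qed
qed

text \<open>Constant sections over a single inhabited stage already separate the elements of a set,
  so one stage is enough to distinguish maps.\<close>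

lemma \<gamma>_faithful:
  assumes s: "s \<in> hom SET P Q" and t: "t \<in> hom SET P Q" and c: "inh c"
    and eq: "\<And>r. r \<in> el (on_obj \<gamma> P) c \<Longrightarrow> ap (on_arr \<gamma> s) c r = ap (on_arr \<gamma> t) c r"
  shows "s = t"
proof (rule SET_ext[OF s t])
  fix x assume x: "x \<in> P"
  have P: "small P" and Q: "small Q" using s by (auto simp: hom_SET)
  have "kap Q (sm_fun s x) c = kap Q (sm_fun t x) c"
    using kap_map[OF s x c] kap_map[OF t x c] eq[OF kap_el[OF P x c]] by simp
  then show "sm_fun s x = sm_fun t x" using kap_inj[OF Q SET_fun_in[OF s x] SET_fun_in[OF t x] c] by blast
qed

text \<open>Both bijections describe the same transition map at the stage \<open>c\<close> itself.
  The index hypotheses provide the points of the components there; without such points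
  \<open>agr\<close> would hold vacuously.\<close>

lemma agr_uniq:
  assumes ij: "i \<in> I" "j \<in> I" and c: "inh c" and u: "u \<in> el U c" "ap \<zeta> c u = kap I i c"
    and v: "v \<in> el U c" "ap \<zeta> c v = kap I j c"
    and s: "s \<in> hom SET (R i) (R j)" "agr i j s c u v" and t: "t \<in> hom SET (R i) (R j)" "agr i j t c u v"
  shows "s = t"
proof (rule \<gamma>_faithful[OF s(1) t(1) c])
  obtain u' where u': "u' \<in> el (V i) c" "ap (cc i) c u' = u" using cc_ex[OF ij(1) c u] by blast
  obtain v' where v': "v' \<in> el (V j) c" "ap (cc j) c v' = v" using cc_ex[OF ij(2) c v] by blast
  fix r assume r: "r \<in> el (A i) c"
  have "sg \<sigma> i j c r u' v' = ap (on_arr \<gamma> b) c r" if "agr i j b c u v" for b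
    using that[unfolded agr_def, THEN spec, THEN bspec, OF st_id[OF c], THEN bspec, OF u'(1), THEN bspec, OF v'(1)]
      rs_id[OF Uo c u(1)] rs_id[OF Uo c v(1)] u' v' r by simp
  then show "ap (on_arr \<gamma> s) c r = ap (on_arr \<gamma> t) c r" using s(2) t(2) by metis
qed

lemma agr_id:
  assumes i: "i \<in> I" and c: "inh c"
  shows "agr i i (Id SET (R i)) c u u"
  unfolding agr_def
proof (intro allI ballI impI)
  fix d h u' v' r assume h: "h \<in> st d c" and m: "u' \<in> el (V i) d" "v' \<in> el (V i) d"
    "ap (cc i) d u' = rs U h u" "ap (cc i) d v' = rs U h u" "r \<in> el (A i) d"
  have "v' = u'" using cc_inj[OF i st_inh[OF h] m(2,1)] m(3,4) by simp
  then show "sg \<sigma> i i d r u' v' = ap (on_arr \<gamma> (Id SET (R i))) d r"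
    using sg_id[OF ud i st_inh[OF h] m(5,1)] \<gamma>_id[OF R[OF i]] ap_id[OF Ao[OF i] st_inh[OF h] m(5)] by simp
qed

text \<open>The cocycle law of the descent datum. The index hypothesis on \<open>v\<close> lifts the
  middle point into the component of \<open>j\<close>, so that the two transition maps can be
  composed there.\<close>

lemma agr_comp:
  assumes ijk: "i \<in> I" "j \<in> I" "k \<in> I" and v: "v \<in> el U c" "ap \<zeta> c v = kap I j c"
    and s: "s \<in> hom SET (R i) (R j)" "agr i j s c u v" and t: "t \<in> hom SET (R j) (R k)" "agr j k t c v w"
  shows "agr i k (Comp SET t s) c u w"
  unfolding agr_def
proof (intro allI ballI impI)
  fix d h u' w' r assume h: "h \<in> st d c" and m: "u' \<in> el (V i) d" "w' \<in> el (V k) d"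
    "ap (cc i) d u' = rs U h u" "ap (cc k) d w' = rs U h w" "r \<in> el (A i) d"
  note d = st_inh[OF h] and hv = rs_el[OF Uo h v(1)]
  have "ap \<zeta> d (rs U h v) = kap I j d" using ap_rs[OF \<zeta> h v(1)] v(2) kap_rs[OF I ijk(2) h] by simp
  then obtain v' where v': "v' \<in> el (V j) d" "ap (cc j) d v' = rs U h v" using cc_ex[OF ijk(2) d hv] by blast
  have 1: "sg \<sigma> i j d r u' v' = ap (on_arr \<gamma> s) d r" using s(2) h m v' unfolding agr_def by blast
  have "sg \<sigma> j k d (ap (on_arr \<gamma> s) d r) v' w' = ap (on_arr \<gamma> t) d (ap (on_arr \<gamma> s) d r)"
    using t(2) h m v' ap_el[OF \<gamma>_hom[OF s(1)] d m(5)] unfolding agr_def by blast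
  then show "sg \<sigma> i k d r u' w' = ap (on_arr \<gamma> (Comp SET t s)) d r"
    using sg_comp[OF ud ijk d m(5,1) v'(1) m(2)] 1 \<gamma>_comp[OF s(1) t(1)]
      ap_comp[OF \<gamma>_hom[OF s(1)] \<gamma>_hom[OF t(1)] d m(5)] by simp
qed

end

section \<open>Tuples of vertices with marks\<close>

context cover_data
begin

definition B :: "'u set" where "B = {tt, ff}"

abbreviation T where "T \<equiv> on_obj \<gamma> B"

text \<open>The Kripke-Joyal form of an implication: if the mark is \<open>tt\<close>, then the
  points are equal. Quantifying over all later stages makes it stable under restriction.\<close>

definition frc :: "'u \<Rightarrow> 'u \<Rightarrow> 'u \<Rightarrow> 'u \<Rightarrow> bool" where
  "frc c t u v \<longleftrightarrow> (\<forall>d. \<forall>h \<in> st d c. rs T h t = kap B tt d \<longrightarrow> rs U h u = rs U h v)"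

text \<open>The names of the entries of an \<open>n\<close>-simplex: \<open>Inl k\<close> for the
  \<open>k\<close>-th vertex, \<open>Inr (k, l)\<close> for the mark on the ordered pair.\<close>

definition KK :: "nat \<Rightarrow> (nat + nat \<times> nat) set" where
  "KK n = {..n} <+> ({..n} \<times> {..n})"

definition XX :: "nat + nat \<times> nat \<Rightarrow> 'o" where
  "XX = case_sum (\<lambda>_. U) (\<lambda>_. T)"

text \<open>An \<open>n\<close>-simplex consists of vertices in \<open>U\<close> and of decidable marks on the pairs of vertices; a
  mark \<open>tt\<close> declares a pair degenerate, which forces its two vertices to be equal. The marks make
  the degenerate edge at a vertex a component of its own, as condition G requires.\<close>

definition QQ :: "nat \<Rightarrow> 'u \<Rightarrow> (nat + nat \<times> nat \<Rightarrow> 'u) \<Rightarrow> bool" where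
  "QQ n c x \<longleftrightarrow> (\<forall>k\<le>n. x (Inr (k, k)) = kap B tt c) \<and> (\<forall>k\<le>n. \<forall>l\<le>n. x (Inr (k, l)) = x (Inr (l, k))) \<and>
     (\<forall>k\<le>n. \<forall>l\<le>n. frc c (x (Inr (k, l))) (x (Inl k)) (x (Inl l)))"

lemma small_B: "small B"
  using sml_finite[of B] by (simp add: small_def B_def)

lemma B_in: "tt \<in> B" "ff \<in> B"
  by (simp_all add: B_def)

lemma To: "T \<in> Obj E"
  by (rule \<gamma>_obj[OF small_B])

lemma KK_simps: "Inl k \<in> KK n \<longleftrightarrow> k \<le> n" "Inr (k, l) \<in> KK n \<longleftrightarrow> k \<le> n \<and> l \<le> n"
  by (auto simp: KK_def)

lemma XX_simps: "XX (Inl k) = U" "XX (Inr q) = T"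
  by (simp_all add: XX_def)

lemma XX_obj: "XX q \<in> Obj E"
  using Uo To by (cases q) (simp_all add: XX_simps)

lemma frc_rs:
  assumes "h \<in> st d c" "t \<in> el T c" "u \<in> el U c" "v \<in> el U c" "frc c t u v"
  shows "frc d (rs T h t) (rs U h u) (rs U h v)"
  unfolding frc_def
proof (intro allI ballI impI)
  fix e g assume g: "g \<in> st e d" and "rs T g (rs T h t) = kap B tt e"
  then have "rs T (h \<odot> g) t = kap B tt e" using rs_comp[OF To assms(1) g assms(2)] by simp
  then have "rs U (h \<odot> g) u = rs U (h \<odot> g) v" using assms(5) st_comp[OF assms(1) g] unfolding frc_def by blast
  then show "rs U g (rs U h u) = rs U g (rs U h v)"
    using rs_comp[OF Uo assms(1) g] assms(3,4) by simp
qed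

lemma frc_loc:
  assumes c: "inh c" and t: "t \<in> el T c" and u: "u \<in> el U c" and v: "v \<in> el U c"
    and L: "loc c (\<lambda>d h. frc d (rs T h t) (rs U h u) (rs U h v))"
  shows "frc c t u v"
  unfolding frc_def
proof (intro allI ballI impI)
  fix d h assume h: "h \<in> st d c" and eq: "rs T h t = kap B tt d"
  note d = st_inh[OF h] and hu = rs_el[OF Uo h u] and hv = rs_el[OF Uo h v] and ht = rs_el[OF To h t]
  show "rs U h u = rs U h v"
  proof (rule sep[OF Uo d hu hv], rule loc_mono[OF loc_res[OF h L]])
    fix e g assume g: "g \<in> st e d" and F: "frc e (rs T (h \<odot> g) t) (rs U (h \<odot> g) u) (rs U (h \<odot> g) v)"
    note hg = st_comp[OF h g] and e = st_inh[OF g]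
    have "rs T (h \<odot> g) t = kap B tt e" using rs_comp[OF To h g t] eq kap_rs[OF small_B B_in(1) g] by simp
    then have "rs T (Id C e) (rs T (h \<odot> g) t) = kap B tt e" using rs_id[OF To e rs_el[OF To hg t]] by simp
    then have "rs U (Id C e) (rs U (h \<odot> g) u) = rs U (Id C e) (rs U (h \<odot> g) v)"
      using F st_id[OF e] unfolding frc_def by blast
    then show "rs U g (rs U h u) = rs U g (rs U h v)"
      using rs_id[OF Uo e rs_el[OF Uo hg u]] rs_id[OF Uo e rs_el[OF Uo hg v]] rs_comp[OF Uo h g u] rs_comp[OF Uo h g v] by simp
  qed
qed

lemma QQ_exists: "\<exists>M \<pi>. subproduct (KK n) XX (QQ n) M \<pi>"
proof (rule subproduct_exists[of "KK n" XX "QQ n"])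
  show "finite (KK n)" by (simp add: KK_def)
  show "XX k \<in> Obj E" for k by (rule XX_obj)
  show "QQ n d (\<lambda>k\<in>KK n. rs (XX k) h (x k))"
    if h: "h \<in> st d c" and x: "x \<in> (\<Pi>\<^sub>E k\<in>KK n. el (XX k) c)" and Q: "QQ n c x" for c d h x
  proof -
    have xm: "x (Inl k) \<in> el U c" "x (Inr (k, l)) \<in> el T c" if "k \<le> n" "l \<le> n" for k l
      using PiE_mem[OF x, of "Inl k"] PiE_mem[OF x, of "Inr (k, l)"] that by (simp_all add: KK_simps XX_simps)
    show ?thesis unfolding QQ_def
    proof (intro conjI allI impI)
      fix k assume k: "k \<le> n"
      then show "(\<lambda>k\<in>KK n. rs (XX k) h (x k)) (Inr (k, k)) = kap B tt d"
        using Q kap_rs[OF small_B B_in(1) h] by (simp add: KK_simps XX_simps QQ_def)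
    next
      fix k l assume k: "k \<le> n" and l: "l \<le> n"
      have "x (Inr (k, l)) = x (Inr (l, k))" using Q k l unfolding QQ_def by blast
      then show "(\<lambda>k\<in>KK n. rs (XX k) h (x k)) (Inr (k, l)) = (\<lambda>k\<in>KK n. rs (XX k) h (x k)) (Inr (l, k))"
        using k l by (simp add: KK_simps XX_simps)
      have "frc c (x (Inr (k, l))) (x (Inl k)) (x (Inl l))" using Q k l unfolding QQ_def by blast
      then show "frc d ((\<lambda>k\<in>KK n. rs (XX k) h (x k)) (Inr (k, l))) ((\<lambda>k\<in>KK n. rs (XX k) h (x k)) (Inl k)) ((\<lambda>k\<in>KK n. rs (XX k) h (x k)) (Inl l))"
        using frc_rs[OF h xm(2)[OF k l] xm(1)[OF k l] xm(1)[OF l k]] k l by (simp add: KK_simps XX_simps)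
    qed
  qed
  show "QQ n c x" if c: "inh c" and x: "x \<in> (\<Pi>\<^sub>E k\<in>KK n. el (XX k) c)"
    and L: "loc c (\<lambda>d h. QQ n d (\<lambda>k\<in>KK n. rs (XX k) h (x k)))" for c x
  proof -
    have xm: "x (Inl k) \<in> el U c" "x (Inr (k, l)) \<in> el T c" if "k \<le> n" "l \<le> n" for k l
      using PiE_mem[OF x, of "Inl k"] PiE_mem[OF x, of "Inr (k, l)"] that by (simp_all add: KK_simps XX_simps)
    show ?thesis unfolding QQ_def
    proof (intro conjI allI impI)
      fix k assume k: "k \<le> n"
      show "x (Inr (k, k)) = kap B tt c"
        by (rule sep[OF To c xm(2)[OF k k] kap_el[OF small_B B_in(1) c]], rule loc_mono[OF L])
          (use k kap_rs[OF small_B B_in(1)] in \<open>auto simp: QQ_def KK_simps XX_simps\<close>)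
    next
      fix k l assume k: "k \<le> n" and l: "l \<le> n"
      show "x (Inr (k, l)) = x (Inr (l, k))"
        by (rule sep[OF To c xm(2)[OF k l] xm(2)[OF l k]], rule loc_mono[OF L])
          (use k l in \<open>auto simp: QQ_def KK_simps XX_simps\<close>)
      show "frc c (x (Inr (k, l))) (x (Inl k)) (x (Inl l))"
        by (rule frc_loc[OF c xm(2)[OF k l] xm(1)[OF k l] xm(1)[OF l k]], rule loc_mono[OF L])
          (use k l in \<open>auto simp: QQ_def KK_simps XX_simps\<close>)
    qed
  qed
qed blast

text \<open>A refinement must have \<open>U\<close> itself at level 0, not merely an isomorphic
  object. The only mark there belongs to a pair \<open>(k, k)\<close> and is constantly
  \<open>tt\<close>, so \<open>U\<close> with its identity qualifies.\<close>

lemma QQ_0: "\<exists>\<pi>. subproduct (KK 0) XX (QQ 0) U \<pi> \<and> \<pi> (Inl 0) = Id E U"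
proof -
  obtain t where t: "t \<in> hom E U T" "\<And>c u. inh c \<Longrightarrow> u \<in> el U c \<Longrightarrow> ap t c u = kap B tt c"
    by (rule arrow_of_family[OF Uo To, of "\<lambda>c _. kap B tt c"])
      (use kap_el[OF small_B B_in(1)] kap_rs[OF small_B B_in(1)] in auto)
  define \<pi> where "\<pi> = case_sum (\<lambda>_::nat. Id E U) (\<lambda>_::nat \<times> nat. t)"
  have \<pi>: "\<pi> (Inl k) = Id E U" "\<pi> (Inr q) = t" for k q by (simp_all add: \<pi>_def)
  have KK0: "KK 0 = {Inl 0, Inr (0, 0)}" by (auto simp: KK_def)
  have "subproduct (KK 0) XX (QQ 0) U \<pi>"
    unfolding subproduct_def
  proof (intro conjI allI impI ballI Uo)
    fix k assume "k \<in> KK 0" then show "\<pi> k \<in> hom E U (XX k)"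
      using t(1) E_id[OF Uo] by (auto simp: KK0 \<pi> XX_simps)
  next
    fix c m n assume "inh c" "m \<in> el U c" "n \<in> el U c" "\<forall>k\<in>KK 0. ap (\<pi> k) c m = ap (\<pi> k) c n"
    then show "m = n" using ap_id[OF Uo] by (simp add: KK0 \<pi>)
  next
    fix c m assume "inh c" "m \<in> el U c"
    then show "QQ 0 c (\<lambda>k\<in>KK 0. ap (\<pi> k) c m)" using t(2) by (simp add: QQ_def KK0 \<pi> frc_def)
  next
    fix c x assume c: "inh c" and x: "x \<in> (\<Pi>\<^sub>E k\<in>KK 0. el (XX k) c)" and Q: "QQ 0 c x"
    have m: "x (Inl 0) \<in> el U c" using PiE_mem[OF x, of "Inl 0"] by (simp add: KK0 XX_simps)
    show "\<exists>m\<in>el U c. \<forall>k\<in>KK 0. ap (\<pi> k) c m = x k"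
      by (rule bexI[OF _ m]) (use Q ap_id[OF Uo c m] t(2)[OF c m] in \<open>simp add: QQ_def KK0 \<pi>\<close>)
  qed
  then show ?thesis using \<pi>(1) by blast
qed

end

locale hyper = cover_data ty E C J \<Phi> \<gamma> I U \<zeta> R \<sigma> tt ff
  for ty :: "'u itself" and E :: "('o, 'a) category" and C :: "('u, 'u) category" and J
    and \<Phi> :: "('o, 'a, 'u) sheaf_functor"
    and \<gamma> :: "('u set, 'u set_map, 'o, 'a) cfunctor"
    and I :: "'u set" and U :: 'o and \<zeta> :: 'a and R :: "'u \<Rightarrow> 'u set"
    and \<sigma> :: "'u list \<Rightarrow> 'a" and tt ff :: 'u +
  fixes M :: "nat \<Rightarrow> 'o" and \<pi> :: "nat \<Rightarrow> nat + nat \<times> nat \<Rightarrow> 'a"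
  assumes M: "\<And>n. subproduct (KK n) XX (QQ n) (M n) (\<pi> n)"
    and M0: "M 0 = U" and \<pi>0: "\<pi> 0 (Inl 0) = Id E U"
begin

section \<open>The levels of the hypercover and the action of maps of ordinals\<close>

abbreviation ver where "ver n k \<equiv> \<pi> n (Inl k)"
abbreviation edg where "edg n k l \<equiv> \<pi> n (Inr (k, l))"

lemma M_obj: "M n \<in> Obj E"
  using subproduct_obj[OF M] .

lemma ver_hom: "k \<le> n \<Longrightarrow> ver n k \<in> hom E (M n) U"
  using subproduct_pr[OF M, of "Inl k"] by (simp add: KK_simps XX_simps)

lemma edg_hom: "k \<le> n \<Longrightarrow> l \<le> n \<Longrightarrow> edg n k l \<in> hom E (M n) T"
  using subproduct_pr[OF M, of "Inr (k, l)"] by (simp add: KK_simps XX_simps)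

lemma ball_KK: "(\<forall>q\<in>KK n. P q) \<longleftrightarrow> (\<forall>k\<le>n. P (Inl k)) \<and> (\<forall>k\<le>n. \<forall>l\<le>n. P (Inr (k, l)))"
  by (auto simp: KK_def)

lemma M_inj:
  assumes "inh c" "x \<in> el (M n) c" "y \<in> el (M n) c"
    "\<And>k. k \<le> n \<Longrightarrow> ap (ver n k) c x = ap (ver n k) c y"
    "\<And>k l. k \<le> n \<Longrightarrow> l \<le> n \<Longrightarrow> ap (edg n k l) c x = ap (edg n k l) c y"
  shows "x = y"
  by (rule subproduct_inj[OF M assms(1-3)]) (use assms(4,5) in \<open>auto simp: KK_def\<close>)

lemma M_props:
  assumes c: "inh c" and x: "x \<in> el (M n) c"
  shows M_diag: "\<And>k. k \<le> n \<Longrightarrow> ap (edg n k k) c x = kap B tt c"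
    and M_sym: "\<And>k l. k \<le> n \<Longrightarrow> l \<le> n \<Longrightarrow> ap (edg n k l) c x = ap (edg n l k) c x"
    and M_frc: "\<And>k l. k \<le> n \<Longrightarrow> l \<le> n \<Longrightarrow> frc c (ap (edg n k l) c x) (ap (ver n k) c x) (ap (ver n l) c x)"
proof -
  have Q: "QQ n c (\<lambda>k\<in>KK n. ap (\<pi> n k) c x)" by (rule subproduct_Q[OF M c x])
  show "ap (edg n k k) c x = kap B tt c" if "k \<le> n" for k
    using Q that by (simp add: QQ_def KK_simps)
  show "ap (edg n k l) c x = ap (edg n l k) c x" if "k \<le> n" "l \<le> n" for k l
  proof -
    have "(\<lambda>k\<in>KK n. ap (\<pi> n k) c x) (Inr (k, l)) = (\<lambda>k\<in>KK n. ap (\<pi> n k) c x) (Inr (l, k))"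
      using Q that unfolding QQ_def by blast
    then show ?thesis using that by (simp add: KK_simps)
  qed
  show "frc c (ap (edg n k l) c x) (ap (ver n k) c x) (ap (ver n l) c x)" if "k \<le> n" "l \<le> n" for k l
    using Q that by (simp add: QQ_def KK_simps)
qed

lemma M_eq:
  assumes c: "inh c" and x: "x \<in> el (M n) c" and k: "k \<le> n" "l \<le> n" and e: "ap (edg n k l) c x = kap B tt c"
  shows "ap (ver n k) c x = ap (ver n l) c x"
proof -
  have "rs T (Id C c) (ap (edg n k l) c x) = kap B tt c"
    using rs_id[OF To c ap_el[OF edg_hom[OF k] c x]] e by simp
  then have "rs U (Id C c) (ap (ver n k) c x) = rs U (Id C c) (ap (ver n l) c x)"
    using M_frc[OF c x k] st_id[OF c] unfolding frc_def by blast
  then show ?thesis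
    using rs_id[OF Uo c ap_el[OF ver_hom[OF k(1)] c x]] rs_id[OF Uo c ap_el[OF ver_hom[OF k(2)] c x]] by simp
qed

lemma M_ex:
  assumes c: "inh c" and u: "\<And>k. k \<le> n \<Longrightarrow> u k \<in> el U c" and t: "\<And>k l. k \<le> n \<Longrightarrow> l \<le> n \<Longrightarrow> t k l \<in> el T c"
    and "\<And>k. k \<le> n \<Longrightarrow> t k k = kap B tt c" "\<And>k l. k \<le> n \<Longrightarrow> l \<le> n \<Longrightarrow> t k l = t l k"
    "\<And>k l. k \<le> n \<Longrightarrow> l \<le> n \<Longrightarrow> frc c (t k l) (u k) (u l)"
  obtains x where "x \<in> el (M n) c" "\<And>k. k \<le> n \<Longrightarrow> ap (ver n k) c x = u k"
    "\<And>k l. k \<le> n \<Longrightarrow> l \<le> n \<Longrightarrow> ap (edg n k l) c x = t k l"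
proof -
  define y where "y = restrict (case_sum u (\<lambda>(k, l). t k l)) (KK n)"
  have yP: "y \<in> (\<Pi>\<^sub>E k\<in>KK n. el (XX k) c)"
    using u t by (auto simp: y_def KK_def XX_simps)
  have "QQ n c y" unfolding QQ_def using assms(4-6) by (auto simp: y_def KK_simps)
  with subproduct_ex[OF M[of n] c yP] obtain x where x: "x \<in> el (M n) c" "\<forall>k\<in>KK n. ap (\<pi> n k) c x = y k" by blast
  show ?thesis by (rule that[OF x(1)]) (use x(2) in \<open>simp_all add: ball_KK y_def KK_simps\<close>)
qed

text \<open>The universal property of a level. Hypothesis \<open>e\<close> is asked one stage at a
  time; naturality supplies the later stages over which \<open>frc\<close> quantifies.\<close>

lemma M_arrow:
  assumes Z: "Z \<in> Obj E" and f: "\<And>k. k \<le> n \<Longrightarrow> f k \<in> hom E Z U" and g: "\<And>k l. k \<le> n \<Longrightarrow> l \<le> n \<Longrightarrow> g k l \<in> hom E Z T"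
    and d: "\<And>c z k. inh c \<Longrightarrow> z \<in> el Z c \<Longrightarrow> k \<le> n \<Longrightarrow> ap (g k k) c z = kap B tt c"
    and s: "\<And>c z k l. inh c \<Longrightarrow> z \<in> el Z c \<Longrightarrow> k \<le> n \<Longrightarrow> l \<le> n \<Longrightarrow> ap (g k l) c z = ap (g l k) c z"
    and e: "\<And>c z k l. inh c \<Longrightarrow> z \<in> el Z c \<Longrightarrow> k \<le> n \<Longrightarrow> l \<le> n \<Longrightarrow> ap (g k l) c z = kap B tt c \<Longrightarrow> ap (f k) c z = ap (f l) c z"
  shows "\<exists>!h. h \<in> hom E Z (M n) \<and> (\<forall>k\<le>n. ver n k \<bullet> h = f k) \<and> (\<forall>k\<le>n. \<forall>l\<le>n. edg n k l \<bullet> h = g k l)"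
proof -
  define y where "y = case_sum f (\<lambda>(k, l). g k l)"
  have "\<exists>!h. h \<in> hom E Z (M n) \<and> (\<forall>k\<in>KK n. \<pi> n k \<bullet> h = y k)"
  proof (rule subproduct_arrow[OF M Z])
    fix k assume "k \<in> KK n" then show "y k \<in> hom E Z (XX k)" using f g by (auto simp: KK_def XX_simps y_def)
  next
    fix c z assume c: "inh c" and z: "z \<in> el Z c"
    have "frc c (ap (g k l) c z) (ap (f k) c z) (ap (f l) c z)" if k: "k \<le> n" "l \<le> n" for k l
      unfolding frc_def
    proof (intro allI ballI impI)
      fix d h assume h: "h \<in> st d c" and eq: "rs T h (ap (g k l) c z) = kap B tt d"
      have "ap (g k l) d (rs Z h z) = kap B tt d" using ap_rs[OF g[OF k] h z] eq by simp
      then show "rs U h (ap (f k) c z) = rs U h (ap (f l) c z)"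
        using e[OF st_inh[OF h] rs_el[OF Z h z] k] ap_rs[OF f[OF k(1)] h z] ap_rs[OF f[OF k(2)] h z] by simp
    qed
    then show "QQ n c (\<lambda>k\<in>KK n. ap (y k) c z)"
      using d[OF c z] s[OF c z] by (simp add: QQ_def KK_simps y_def)
  qed
  then show ?thesis by (simp add: ball_KK y_def)
qed

text \<open>Reindexing along \<open>\<phi>\<close>: the new \<open>k\<close>-th vertex is the old
  one at \<open>\<phi> k\<close>, and marks follow their pairs. The conditions on marks survive for
  an arbitrary \<open>\<phi>\<close>, since a pair that is collapsed gets the mark of a diagonal
  pair.\<close>

definition Hm :: "nat \<Rightarrow> nat \<Rightarrow> (nat \<Rightarrow> nat) \<Rightarrow> 'a" where
  "Hm m n \<phi> = (THE h. h \<in> hom E (M n) (M m) \<and> (\<forall>k\<le>m. ver m k \<bullet> h = ver n (\<phi> k)) \<and>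
     (\<forall>k\<le>m. \<forall>l\<le>m. edg m k l \<bullet> h = edg n (\<phi> k) (\<phi> l)))"

lemma Hm:
  assumes \<phi>: "\<phi> ` {..m} \<subseteq> {..n}"
  shows "Hm m n \<phi> \<in> hom E (M n) (M m)" "\<And>k. k \<le> m \<Longrightarrow> ver m k \<bullet> Hm m n \<phi> = ver n (\<phi> k)"
    "\<And>k l. k \<le> m \<Longrightarrow> l \<le> m \<Longrightarrow> edg m k l \<bullet> Hm m n \<phi> = edg n (\<phi> k) (\<phi> l)"
proof -
  have p: "\<phi> k \<le> n" if "k \<le> m" for k using \<phi> that by auto
  have "\<exists>!h. h \<in> hom E (M n) (M m) \<and> (\<forall>k\<le>m. ver m k \<bullet> h = ver n (\<phi> k)) \<and> (\<forall>k\<le>m. \<forall>l\<le>m. edg m k l \<bullet> h = edg n (\<phi> k) (\<phi> l))"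
    by (rule M_arrow[OF M_obj])
      (use p ver_hom edg_hom M_diag M_sym M_eq in auto)
  from theI'[OF this] have "Hm m n \<phi> \<in> hom E (M n) (M m) \<and> (\<forall>k\<le>m. ver m k \<bullet> Hm m n \<phi> = ver n (\<phi> k)) \<and>
     (\<forall>k\<le>m. \<forall>l\<le>m. edg m k l \<bullet> Hm m n \<phi> = edg n (\<phi> k) (\<phi> l))" unfolding Hm_def .
  then show "Hm m n \<phi> \<in> hom E (M n) (M m)" "\<And>k. k \<le> m \<Longrightarrow> ver m k \<bullet> Hm m n \<phi> = ver n (\<phi> k)"
    "\<And>k l. k \<le> m \<Longrightarrow> l \<le> m \<Longrightarrow> edg m k l \<bullet> Hm m n \<phi> = edg n (\<phi> k) (\<phi> l)" by auto
qed

lemma ap_Hm: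
  assumes \<phi>: "\<phi> ` {..m} \<subseteq> {..n}" and c: "inh c" and x: "x \<in> el (M n) c"
  shows "\<And>k. k \<le> m \<Longrightarrow> ap (ver m k) c (ap (Hm m n \<phi>) c x) = ap (ver n (\<phi> k)) c x"
    "\<And>k l. k \<le> m \<Longrightarrow> l \<le> m \<Longrightarrow> ap (edg m k l) c (ap (Hm m n \<phi>) c x) = ap (edg n (\<phi> k) (\<phi> l)) c x"
  using ap_comp[OF Hm(1)[OF \<phi>] ver_hom c x] ap_comp[OF Hm(1)[OF \<phi>] edg_hom c x] Hm(2,3)[OF \<phi>] by simp_all

lemma M_arrow_ext:
  assumes f: "f \<in> hom E Z (M n)" and g: "g \<in> hom E Z (M n)"
    and v: "\<And>c z k. inh c \<Longrightarrow> z \<in> el Z c \<Longrightarrow> k \<le> n \<Longrightarrow> ap (ver n k) c (ap f c z) = ap (ver n k) c (ap g c z)"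
    and e: "\<And>c z k l. inh c \<Longrightarrow> z \<in> el Z c \<Longrightarrow> k \<le> n \<Longrightarrow> l \<le> n \<Longrightarrow> ap (edg n k l) c (ap f c z) = ap (edg n k l) c (ap g c z)"
  shows "f = g"
proof (rule ext_stage[OF f g])
  fix c z assume c: "inh c" and z: "z \<in> el Z c"
  show "ap f c z = ap g c z"
    by (rule M_inj[OF c ap_el[OF f c z] ap_el[OF g c z]]) (use v[OF c z] e[OF c z] in auto)
qed

sublocale HA: ordinal_action E M Hm
proof
  show "is_category E" by (rule E)
  show "Hm m n \<phi> \<in> hom E (M n) (M m)" if "\<phi> ` {..m} \<subseteq> {..n}" for m n \<phi> using Hm(1)[OF that] .
  show "Hm m n \<phi> = Hm m n \<psi>" if "\<And>k. k \<le> m \<Longrightarrow> \<phi> k = \<psi> k" for m n \<phi> \<psi>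
  proof -
    have "(\<forall>k\<le>m. ver m k \<bullet> h = ver n (\<phi> k)) \<longleftrightarrow> (\<forall>k\<le>m. ver m k \<bullet> h = ver n (\<psi> k))"
      "(\<forall>k\<le>m. \<forall>l\<le>m. edg m k l \<bullet> h = edg n (\<phi> k) (\<phi> l)) \<longleftrightarrow> (\<forall>k\<le>m. \<forall>l\<le>m. edg m k l \<bullet> h = edg n (\<psi> k) (\<psi> l))" for h
      using that by auto
    then show ?thesis unfolding Hm_def by simp
  qed
  show "Hm k m \<psi> \<bullet> Hm m n \<phi> = Hm k n (\<phi> \<circ> \<psi>)" if \<phi>: "\<phi> ` {..m} \<subseteq> {..n}" and \<psi>: "\<psi> ` {..k} \<subseteq> {..m}" for k m n \<phi> \<psi>
  proof -
    have \<phi>\<psi>: "(\<phi> \<circ> \<psi>) ` {..k} \<subseteq> {..n}" using \<phi> \<psi> by auto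
    have p: "\<psi> j \<le> m" if "j \<le> k" for j using \<psi> that by auto
    show ?thesis
      by (rule M_arrow_ext[OF E_comp[OF Hm(1)[OF \<phi>] Hm(1)[OF \<psi>]] Hm(1)[OF \<phi>\<psi>]])
        (use ap_comp[OF Hm(1)[OF \<phi>] Hm(1)[OF \<psi>]] ap_Hm[OF \<phi>\<psi>] ap_Hm[OF \<phi>] ap_Hm[OF \<psi> _ ap_el[OF Hm(1)[OF \<phi>]]] p in auto)
  qed
  show "Hm n n (\<lambda>k. k) = Id E (M n)" for n
  proof -
    have i: "(\<lambda>k. k) ` {..n} \<subseteq> {..n}" by auto
    show ?thesis
      by (rule M_arrow_ext[OF Hm(1)[OF i] E_id[OF M_obj]]) (use ap_Hm[OF i] ap_id[OF M_obj] in auto)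
  qed
  show "M n \<in> Obj E" for n by (rule M_obj)
qed

subsection \<open>The hypercover condition\<close>

abbreviation HH where "HH \<equiv> HA.X"

lemma HH_simps: "lev HH = M" "dd HH n i = Hm (n - 1) n (coface i)" "ss HH n i = Hm (Suc n) n (codeg i)"
  by (simp_all add: HA.X_def)

lemma ver0: "inh c \<Longrightarrow> x \<in> el U c \<Longrightarrow> ap (ver 0 0) c x = x"
  using ap_id[OF Uo] by (simp add: \<pi>0)

lemma omit_nth: "i \<le> m \<Longrightarrow> length x = Suc m \<Longrightarrow> j < m \<Longrightarrow> omit i x ! j = x ! coface i j"
  by (auto simp: omit_def coface_def nth_append min_def)

lemma double_nth: "i \<le> m \<Longrightarrow> length x = Suc m \<Longrightarrow> j \<le> Suc m \<Longrightarrow> double i x ! j = x ! codeg i j"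
  by (auto simp: double_def codeg_def nth_append min_def)

lemma omit_length: "i \<le> m \<Longrightarrow> length x = Suc m \<Longrightarrow> length (omit i x) = m"
  by (simp add: omit_def)

lemma double_length: "i \<le> m \<Longrightarrow> length x = Suc m \<Longrightarrow> length (double i x) = Suc (Suc m)"
  by (simp add: double_def)

lemma monotone_maps_iff:
  "x \<in> monotone_maps m k \<longleftrightarrow> length x = Suc m \<and> (\<forall>j\<le>m. x ! j \<le> k) \<and> (\<forall>a b. a \<le> b \<longrightarrow> b \<le> m \<longrightarrow> x ! a \<le> x ! b)"
proof -
  have "set x \<subseteq> {0..k} \<longleftrightarrow> (\<forall>j<length x. x ! j \<le> k)"
    using all_set_conv_all_nth[of x "\<lambda>t. t \<le> k"] by auto
  then show ?thesis by (auto simp: monotone_maps_def sorted_iff_nth_mono less_Suc_eq_le)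
qed

lemma omit_mono:
  assumes "x \<in> monotone_maps (Suc m) k" "i \<le> Suc m"
  shows "omit i x \<in> monotone_maps m k"
  using assms unfolding monotone_maps_iff
  by (auto simp: omit_length omit_nth coface_def less_Suc_eq_le)

lemma double_mono:
  assumes "x \<in> monotone_maps m k" "i \<le> m"
  shows "double i x \<in> monotone_maps (Suc m) k"
  using assms unfolding monotone_maps_iff
  by (auto simp: double_length double_nth codeg_def)

lemma upt_mono: "[0..<Suc k] \<in> monotone_maps k k"
  by (auto simp: monotone_maps_iff simp del: upt_Suc)

end

context hyper
begin

text \<open>At this level the marks are additional data. The coskeleton is the product of
  \<open>U\<close> with itself, and the canonical arrow forgets the mark of the edge.\<close>

lemma hypercover_1:
  "\<exists>Z q c. is_cosk E 0 HH (Suc 0) Z q \<and> c \<in> hom E (lev HH (Suc 0)) Z \<and>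
     (\<forall>i\<le>Suc 0. q (omit i [0..<Suc (Suc 0)]) \<bullet> c = dd HH (Suc 0) i) \<and> is_epi E c"
proof -
  define q where "q x = (if x = [0::nat] then pr E [U, U] 0 else pr E [U, U] (Suc 0))" for x
  define c where "c = tup E [ver (Suc 0) 0, ver (Suc 0) (Suc 0)]"
  note P = pr2_hom[OF Uo Uo]
  have v: "ver (Suc 0) 0 \<in> hom E (M (Suc 0)) U" "ver (Suc 0) (Suc 0) \<in> hom E (M (Suc 0)) U"
    using ver_hom by auto
  note t = tup2[OF v]
  have mm: "monotone_maps 0 (Suc 0) = {[0], [Suc 0]}"
  proof -
    have "x \<in> monotone_maps 0 (Suc 0) \<longleftrightarrow> x \<in> {[0], [Suc 0]}" for x
      by (cases x) (auto simp: monotone_maps_def)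
    then show ?thesis by blast
  qed
  have cone: "cosk_cone E 0 HH (Suc 0) (Prod E [U, U]) q"
    unfolding cosk_cone_def using P Prod2_obj[OF Uo Uo] by (simp add: mm q_def HH_simps M0)
  have "is_cosk E 0 HH (Suc 0) (Prod E [U, U]) q"
    unfolding is_cosk_def
  proof (intro conjI cone allI impI)
    fix Z r assume r: "cosk_cone E 0 HH (Suc 0) Z r"
    then have Z: "Z \<in> Obj E" and r1: "r [0] \<in> hom E Z U" "r [Suc 0] \<in> hom E Z U"
      unfolding cosk_cone_def by (auto simp: mm HH_simps M0)
    have "\<exists>!h. h \<in> hom E Z (Prod E [U, U]) \<and> (\<forall>k<length [U, U]. pr E [U, U] k \<bullet> h = r [k])"
    proof (rule product_univ[OF Prod_product Z])
      show "set [U, U] \<subseteq> Obj E" using Uo by simp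
      fix k assume "k < length [U, U]"
      then have "k = 0 \<or> k = Suc 0" by auto
      then show "r [k] \<in> hom E Z ([U, U] ! k)" using r1 by auto
    qed
    moreover have "(\<forall>k<length [U, U]. pr E [U, U] k \<bullet> h = r [k]) \<longleftrightarrow>
      (\<forall>m\<le>0. \<forall>x\<in>monotone_maps m (Suc 0). q x \<bullet> h = r x)" for h
      by (auto simp: mm q_def less_Suc_eq)
    ultimately show "\<exists>!h. h \<in> hom E Z (Prod E [U, U]) \<and> (\<forall>m\<le>0. \<forall>x\<in>monotone_maps m (Suc 0). q x \<bullet> h = r x)"
      by simp
  qed
  moreover have "c \<in> hom E (lev HH (Suc 0)) (Prod E [U, U])" using t(1) by (simp add: c_def HH_simps)
  moreover have "q (omit i [0..<Suc (Suc 0)]) \<bullet> c = dd HH (Suc 0) i" if i: "i \<le> Suc 0" for i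
  proof -
    have h: "Hm 0 (Suc 0) (coface i) \<in> hom E (M (Suc 0)) U"
      using Hm(1)[OF HA.coface_im[OF i]] by (simp add: M0)
    \<comment> \<open>The face \<open>i\<close> omits vertex \<open>i\<close>, so vertex
      \<open>1 - i\<close> remains.\<close>
    have "pr E [U, U] (1 - i) \<bullet> c = Hm 0 (Suc 0) (coface i)"
    proof (rule ext_stage)
      show "pr E [U, U] (1 - i) \<bullet> c \<in> hom E (M (Suc 0)) U"
        using E_comp[OF t(1) P(1)] E_comp[OF t(1) P(3)] i by (cases i) (auto simp: c_def)
      show "Hm 0 (Suc 0) (coface i) \<in> hom E (M (Suc 0)) U" by (rule h)
      fix d x assume d: "inh d" and x: "x \<in> el (M (Suc 0)) d"
      have "ap (Hm 0 (Suc 0) (coface i)) d x = ap (ver (Suc 0) (coface i 0)) d x"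
        using ap_Hm(1)[OF HA.coface_im[OF i] d x, of 0] ver0[OF d] ap_el[OF h d x] by simp
      moreover have "ap (pr E [U, U] (1 - i) \<bullet> c) d x = ap (ver (Suc 0) (coface i 0)) d x"
        using ap_comp[OF t(1) P(1) d x] ap_comp[OF t(1) P(3) d x] t(2)[OF d x]
          tp2[OF Uo Uo d ap_el[OF v(1) d x] ap_el[OF v(2) d x]] i
        by (cases i) (auto simp: c_def coface_def)
      ultimately show "ap (pr E [U, U] (1 - i) \<bullet> c) d x = ap (Hm 0 (Suc 0) (coface i)) d x" by simp
    qed
    moreover have "q (omit i [0..<Suc (Suc 0)]) = pr E [U, U] (1 - i)"
      using i by (cases i) (auto simp: q_def omit_def)
    ultimately show ?thesis by (simp add: HH_simps)
  qed
  moreover have "is_epi E c"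
    unfolding c_def
  proof (rule loc_epi[OF t(1)])
    fix d z assume d: "inh d" and z: "z \<in> el (Prod E [U, U]) d"
    show "loc d (\<lambda>e h. \<exists>y\<in>el (M (Suc 0)) e. ap (tup E [ver (Suc 0) 0, ver (Suc 0) (Suc 0)]) e y = rs (Prod E [U, U]) h z)"
    proof (rule loc_triv[OF d])
      fix e h assume h: "h \<in> st e d"
      note e = st_inh[OF h]
      obtain u v where uv: "u \<in> el U e" "v \<in> el U e" "rs (Prod E [U, U]) h z = tp [U, U] e [u, v]"
        using tp2_cases[OF Uo Uo e rs_el[OF Prod2_obj[OF Uo Uo] h z]] .
      define f where "f k = (if k = 0 then u else v)" for k :: nat
      \<comment> \<open>The mark \<open>ff\<close> forces nothing, so it puts an edge over any two
        points, equal or not. Pairs \<open>(k, k)\<close> must carry \<open>tt\<close>.\<close>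
      define g where "g k l = (if k = l then kap B tt e else kap B ff e)" for k l :: nat
      have ne: "kap B ff b \<noteq> kap B tt b" if "inh b" for b
        using kap_inj[OF small_B B_in(2,1) that] tf by auto
      obtain x where x: "x \<in> el (M (Suc 0)) e" "\<And>k. k \<le> Suc 0 \<Longrightarrow> ap (ver (Suc 0) k) e x = f k"
      proof (rule M_ex[OF e, of "Suc 0" f g])
        show "frc e (g k l) (f k) (f l)" if "k \<le> Suc 0" "l \<le> Suc 0" for k l
          using ne[OF st_inh] kap_rs[OF small_B B_in(2)] by (auto simp: frc_def g_def)
      qed (use uv kap_el[OF small_B _ e] B_in in \<open>auto simp: f_def g_def\<close>)
      have "ap (tup E [ver (Suc 0) 0, ver (Suc 0) (Suc 0)]) e x = rs (Prod E [U, U]) h z"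
        using t(2)[OF e x(1)] x(2)[of 0] x(2)[of "Suc 0"] uv(3) by (simp add: f_def)
      then show "\<exists>y\<in>el (M (Suc 0)) e. ap (tup E [ver (Suc 0) 0, ver (Suc 0) (Suc 0)]) e y = rs (Prod E [U, U]) h z"
        using x(1) by blast
    qed
  qed
  ultimately show ?thesis by blast
qed

definition cq :: "nat \<Rightarrow> nat list \<Rightarrow> 'a" where
  "cq k x = Hm (length x - 1) k (\<lambda>j. x ! j)"

lemma mono_im: "x \<in> monotone_maps m k \<Longrightarrow> (\<lambda>j. x ! j) ` {..m} \<subseteq> {..k}"
  by (auto simp: monotone_maps_iff)

lemma cq_eq: "x \<in> monotone_maps m k \<Longrightarrow> cq k x = Hm m k (\<lambda>j. x ! j)"
  by (simp add: cq_def monotone_maps_iff)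

lemma cq_cone: "cosk_cone E n HH k (M k) (cq k)"
  unfolding cosk_cone_def
proof (intro conjI allI impI ballI M_obj)
  fix m x assume "x \<in> monotone_maps m k"
  then show "cq k x \<in> hom E (M k) (lev HH m)" using Hm(1)[OF mono_im] by (simp add: cq_eq HH_simps)
next
  fix m x i assume x: "x \<in> monotone_maps (Suc m) k" and i: "i \<le> Suc m"
  have "Hm m (Suc m) (coface i) \<bullet> Hm (Suc m) k (\<lambda>j. x ! j) = Hm m k ((\<lambda>j. x ! j) \<circ> coface i)"
    by (rule HA.a_comp[OF mono_im[OF x] HA.coface_im[OF i]])
  also have "\<dots> = Hm m k (\<lambda>j. omit i x ! j)"
    by (rule HA.a_cong) (use x i omit_nth[of i "Suc m" x] in \<open>auto simp: monotone_maps_iff\<close>)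
  finally show "cq k (omit i x) = dd HH (Suc m) i \<bullet> cq k x"
    using cq_eq[OF x] cq_eq[OF omit_mono[OF x i]] by (simp add: HH_simps)
next
  fix m x i assume x: "x \<in> monotone_maps m k" and i: "i \<le> m"
  have "Hm (Suc m) m (codeg i) \<bullet> Hm m k (\<lambda>j. x ! j) = Hm (Suc m) k ((\<lambda>j. x ! j) \<circ> codeg i)"
    by (rule HA.a_comp[OF mono_im[OF x] HA.codeg_im[OF i]])
  also have "\<dots> = Hm (Suc m) k (\<lambda>j. double i x ! j)"
    by (rule HA.a_cong) (use x i double_nth[of i m x] in \<open>auto simp: monotone_maps_iff\<close>)
  finally show "cq k (double i x) = ss HH m i \<bullet> cq k x"
    using cq_eq[OF x] cq_eq[OF double_mono[OF x i]] by (simp add: HH_simps)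
qed

section \<open>Cones over the truncated simplicial object\<close>

context
  fixes n k Z p
  assumes cone: "cosk_cone E n HH k Z p"
begin

lemma cone_hom: "m \<le> n \<Longrightarrow> x \<in> monotone_maps m k \<Longrightarrow> p x \<in> hom E Z (M m)"
  using cone unfolding cosk_cone_def by (simp add: HH_simps)

lemma cone_omit: "Suc m \<le> n \<Longrightarrow> x \<in> monotone_maps (Suc m) k \<Longrightarrow> i \<le> Suc m \<Longrightarrow> p (omit i x) = Hm m (Suc m) (coface i) \<bullet> p x"
  using cone unfolding cosk_cone_def by (simp add: HH_simps)

lemma cone_double: "Suc m \<le> n \<Longrightarrow> x \<in> monotone_maps m k \<Longrightarrow> i \<le> m \<Longrightarrow> p (double i x) = Hm (Suc m) m (codeg i) \<bullet> p x"
  using cone unfolding cosk_cone_def by (simp add: HH_simps)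

text \<open>A cone is compatible with faces, so its value at a longer list has the vertices
  prescribed at the lists of length one. The induction deletes entries other than the one in
  question.\<close>

lemma cone_vertex:
  assumes "inh c" "z \<in> el Z c"
  shows "m \<le> n \<Longrightarrow> x \<in> monotone_maps m k \<Longrightarrow> j \<le> m \<Longrightarrow> ap (ver m j) c (ap (p x) c z) = ap (p [x ! j]) c z"
proof (induction m arbitrary: x j)
  case 0
  then have x: "x = [x ! 0]" by (cases x) (auto simp: monotone_maps_iff)
  show ?case using ver0[OF assms(1)] ap_el[OF cone_hom[OF 0(1,2)] assms] x 0 by (simp add: M0)
next
  case (Suc m)
  \<comment> \<open>An entry different from \<open>j\<close> is deleted: the first one, or the
    second one if \<open>j\<close> is the first. Then \<open>j'\<close> is the position of
    \<open>j\<close> after the deletion.\<close>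
  define i where "i = (if j = 0 then 1 else 0 :: nat)"
  define j' where "j' = j - 1"
  have i: "i \<le> Suc m" "j' \<le> m" "coface i j' = j" using Suc.prems(3) by (auto simp: i_def j'_def coface_def)
  note o = omit_mono[OF Suc.prems(2) i(1)]
  have len: "length x = Suc (Suc m)" using Suc.prems(2) by (simp add: monotone_maps_iff)
  have "ap (ver m j') c (ap (p (omit i x)) c z) = ap (p [omit i x ! j']) c z"
    using Suc.IH[OF _ o i(2)] Suc.prems(1) by simp
  moreover have "omit i x ! j' = x ! j" using omit_nth[OF i(1) len, of j'] i by simp
  moreover have "ap (p (omit i x)) c z = ap (Hm m (Suc m) (coface i)) c (ap (p x) c z)"
    using cone_omit[OF Suc.prems(1,2) i(1)] ap_comp[OF cone_hom[OF Suc.prems(1,2)] Hm(1)[OF HA.coface_im[OF i(1)]] assms] by simp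
  ultimately show ?case
    using ap_Hm(1)[OF HA.coface_im[OF i(1)] assms(1) ap_el[OF cone_hom[OF Suc.prems(1,2)] assms] i(2)] i(3) by simp
qed

text \<open>The same induction for marks: deleting entries other than \<open>a\<close> and
  \<open>b\<close> leads down to the lists of length two.\<close>

lemma cone_edge:
  assumes "inh c" "z \<in> el Z c"
  shows "m \<le> n \<Longrightarrow> x \<in> monotone_maps m k \<Longrightarrow> a < b \<Longrightarrow> b \<le> m \<Longrightarrow>
    ap (edg m a b) c (ap (p x) c z) = ap (edg (Suc 0) 0 (Suc 0)) c (ap (p [x ! a, x ! b]) c z)"
proof (induction m arbitrary: x a b)
  case 0
  then show ?case by simp
next
  case (Suc m)
  have len: "length x = Suc (Suc m)" using Suc.prems(2) by (simp add: monotone_maps_iff)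
  show ?case
  proof (cases "m = 0")
    case True
    have "x = [x ! 0, x ! 1]" using len True by (auto simp: length_Suc_conv)
    moreover have "a = 0" "b = 1" using Suc.prems True by auto
    ultimately show ?thesis using True by simp
  next
    case False
    \<comment> \<open>The smallest position different from \<open>a\<close> and \<open>b\<close>.
      When these are 0 and 1 it is 2, which exists because \<open>m\<close> is not 0 here.\<close>
    define i where "i = (if 0 < a then 0 else if b = 1 then 2 else 1 :: nat)"
    define a' where "a' = a - 1"
    define b' where "b' = (if i = 2 then b else b - 1)"
    have i: "i \<le> Suc m" "a' \<le> m" "b' \<le> m" "a' < b'" "coface i a' = a" "coface i b' = b"
      using Suc.prems(3,4) False by (auto simp: i_def a'_def b'_def coface_def)
    note o = omit_mono[OF Suc.prems(2) i(1)]
    have "ap (edg m a' b') c (ap (p (omit i x)) c z) =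
      ap (edg (Suc 0) 0 (Suc 0)) c (ap (p [omit i x ! a', omit i x ! b']) c z)"
      using Suc.IH[OF _ o i(4,3)] Suc.prems(1) by simp
    moreover have "omit i x ! a' = x ! a" "omit i x ! b' = x ! b"
      using omit_nth[OF i(1) len, of a'] omit_nth[OF i(1) len, of b'] i by simp_all
    moreover have "ap (p (omit i x)) c z = ap (Hm m (Suc m) (coface i)) c (ap (p x) c z)"
      using cone_omit[OF Suc.prems(1,2) i(1)] ap_comp[OF cone_hom[OF Suc.prems(1,2)] Hm(1)[OF HA.coface_im[OF i(1)]] assms] by simp
    ultimately show ?thesis
      using ap_Hm(2)[OF HA.coface_im[OF i(1)] assms(1) ap_el[OF cone_hom[OF Suc.prems(1,2)] assms] i(2,3)] i(5,6) by simp
  qed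
qed

text \<open>A simplex is determined by its vertices and by the marks on pairs, and the conditions on
  these involve edges only. For \<open>n\<close> at least 1 the cone contains all vertices and
  edges, hence determines exactly one arrow into level \<open>k\<close>.\<close>

lemma cone_universal:
  assumes n: "1 \<le> n" "n \<le> k"
  shows "\<exists>!h. h \<in> hom E Z (M k) \<and> (\<forall>m\<le>n. \<forall>x\<in>monotone_maps m k. cq k x \<bullet> h = p x)"
proof -
  have Z: "Z \<in> Obj E" using cone by (simp add: cosk_cone_def)
  have m1: "[j] \<in> monotone_maps 0 k" if "j \<le> k" for j using that by (simp add: monotone_maps_iff)
  have m2: "[a, b] \<in> monotone_maps (Suc 0) k" if "a \<le> b" "b \<le> k" for a b
    using that by (simp add: monotone_maps_def)
  define f where "f j = p [j]" for j
  \<comment> \<open>A cone has values at monotone lists only. The mark of an arbitrary pair is read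
    off the increasing edge; this is consistent because marks are symmetric.\<close>
  define g where "g a b = edg (Suc 0) 0 (Suc 0) \<bullet> p [min a b, max a b]" for a b
  have f: "f j \<in> hom E Z U" if "j \<le> k" for j using cone_hom[OF _ m1[OF that]] by (simp add: f_def M0)
  have p2: "p [a, b] \<in> hom E Z (M (Suc 0))" if "a \<le> b" "b \<le> k" for a b using cone_hom[OF _ m2[OF that]] n by simp
  have e1: "edg (Suc 0) 0 (Suc 0) \<in> hom E (M (Suc 0)) T" using edg_hom by simp
  have g: "g a b \<in> hom E Z T" if "a \<le> k" "b \<le> k" for a b
    unfolding g_def using E_comp[OF p2 e1] that by simp
  have apg: "ap (g a b) c z = ap (edg (Suc 0) 0 (Suc 0)) c (ap (p [min a b, max a b]) c z)"
    if "inh c" "z \<in> el Z c" "a \<le> k" "b \<le> k" for a b c z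
    unfolding g_def using ap_comp[OF p2 e1 that(1,2)] that(3,4) by simp
  have "\<exists>!h. h \<in> hom E Z (M k) \<and> (\<forall>j\<le>k. ver k j \<bullet> h = f j) \<and> (\<forall>a\<le>k. \<forall>b\<le>k. edg k a b \<bullet> h = g a b)"
  proof (rule M_arrow[OF Z f g])
    fix c z a assume c: "inh c" and z: "z \<in> el Z c" and a: "a \<le> k"
    have im: "codeg 0 ` {..Suc 0} \<subseteq> {..0}" using HA.codeg_im[of 0 0] by simp
    \<comment> \<open>The value of a cone at a constant list is a degenerate edge, and there the
      mark is that of a diagonal pair, hence \<open>tt\<close>.\<close>
    have "p [a, a] = Hm (Suc 0) 0 (codeg 0) \<bullet> p [a]"
      using cone_double[OF _ m1[OF a], of 0] n by (simp add: double_def)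
    then have "ap (p [a, a]) c z = ap (Hm (Suc 0) 0 (codeg 0)) c (ap (p [a]) c z)"
      using ap_comp[OF cone_hom[OF _ m1[OF a]] Hm(1)[OF im] c z] by simp
    moreover have pa: "ap (p [a]) c z \<in> el (M 0) c" using ap_el[OF cone_hom[OF _ m1[OF a]] c z] by simp
    ultimately show "ap (g a a) c z = kap B tt c"
      using apg[OF c z a a] ap_Hm(2)[OF im c pa, of 0 "Suc 0"] M_diag[OF c pa, of 0] by (simp add: codeg_def)
  next
    fix c z a b assume "a \<le> k" "b \<le> k"
    show "ap (g a b) c z = ap (g b a) c z" by (simp add: g_def min.commute max.commute)
  next
    fix c z a b assume c: "inh c" and z: "z \<in> el Z c" and ab: "a \<le> k" "b \<le> k" and eq: "ap (g a b) c z = kap B tt c"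
    have mm: "[min a b, max a b] \<in> monotone_maps (Suc 0) k" using m2 ab by simp
    note y = ap_el[OF cone_hom[OF n(1)[folded One_nat_def[symmetric], simplified] mm] c z]
    have "ap (ver (Suc 0) 0) c (ap (p [min a b, max a b]) c z) = ap (ver (Suc 0) (Suc 0)) c (ap (p [min a b, max a b]) c z)"
      using M_eq[OF c y, of 0 "Suc 0"] apg[OF c z ab] eq by simp
    then have "ap (p [min a b]) c z = ap (p [max a b]) c z"
      using cone_vertex[OF c z _ mm, of 0] cone_vertex[OF c z _ mm, of "Suc 0"] n by simp
    then show "ap (f a) c z = ap (f b) c z" by (auto simp: f_def min_def max_def split: if_splits)
  qed
  then obtain h where h: "h \<in> hom E Z (M k)" "\<And>j. j \<le> k \<Longrightarrow> ver k j \<bullet> h = f j" "\<And>a b. a \<le> k \<Longrightarrow> b \<le> k \<Longrightarrow> edg k a b \<bullet> h = g a b"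
    by blast
  have hv: "ap (ver k j) c (ap h c z) = ap (f j) c z" if "inh c" "z \<in> el Z c" "j \<le> k" for c z j
    using ap_comp[OF h(1) ver_hom[OF that(3)] that(1,2)] h(2)[OF that(3)] by simp
  have he: "ap (edg k a b) c (ap h c z) = ap (g a b) c z" if "inh c" "z \<in> el Z c" "a \<le> k" "b \<le> k" for c z a b
    using ap_comp[OF h(1) edg_hom[OF that(3,4)] that(1,2)] h(3)[OF that(3,4)] by simp
  have hq: "cq k x \<bullet> h = p x" if m: "m \<le> n" and x: "x \<in> monotone_maps m k" for m x
  proof -
    note q = Hm(1)[OF mono_im[OF x]]
    have xle: "x ! j \<le> k" if "j \<le> m" for j using x that by (simp add: monotone_maps_iff)
    show ?thesis unfolding cq_eq[OF x]
    proof (rule M_arrow_ext[OF E_comp[OF h(1) q] cone_hom[OF m x]])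
      fix c z j assume c: "inh c" and z: "z \<in> el Z c" and j: "j \<le> m"
      show "ap (ver m j) c (ap (Hm m k ((!) x) \<bullet> h) c z) = ap (ver m j) c (ap (p x) c z)"
        using ap_comp[OF h(1) q c z] ap_Hm(1)[OF mono_im[OF x] c ap_el[OF h(1) c z] j] hv[OF c z xle[OF j]]
          cone_vertex[OF c z m x j] by (simp add: f_def)
    next
      fix c z a b assume c: "inh c" and z: "z \<in> el Z c" and ab: "a \<le> m" "b \<le> m"
      note px = ap_el[OF cone_hom[OF m x] c z]
      have l: "ap (edg m a b) c (ap (Hm m k ((!) x) \<bullet> h) c z) = ap (edg k (x ! a) (x ! b)) c (ap h c z)"
        using ap_comp[OF h(1) q c z] ap_Hm(2)[OF mono_im[OF x] c ap_el[OF h(1) c z] ab] by simp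
      have mono: "x ! a \<le> x ! b" if "a \<le> b" "b \<le> m" for a b using x that by (simp add: monotone_maps_iff)
      have lt: "ap (edg k (x ! a) (x ! b)) c (ap h c z) = ap (edg m a b) c (ap (p x) c z)" if "a < b" "b \<le> m" for a b
      proof -
        have "a \<le> m" using that by simp
        then show ?thesis
          using he[OF c z xle[OF \<open>a \<le> m\<close>] xle[OF that(2)]] apg[OF c z xle[OF \<open>a \<le> m\<close>] xle[OF that(2)]]
            cone_edge[OF c z m x that] mono[of a b] that by (simp add: min_def max_def)
      qed
      note hz = ap_el[OF h(1) c z]
      consider "a < b" | "a = b" | "b < a" by linarith
      then show "ap (edg m a b) c (ap (Hm m k ((!) x) \<bullet> h) c z) = ap (edg m a b) c (ap (p x) c z)"
      proof cases
        case 1 then show ?thesis using l lt ab by simp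
      next
        case 2 then show ?thesis using l M_diag[OF c px ab(1)] M_diag[OF c hz xle[OF ab(1)]] by simp
      next
        case 3
        then show ?thesis using l lt[of b a] ab M_sym[OF c px ab] M_sym[OF c hz xle[OF ab(1)] xle[OF ab(2)]] by simp
      qed
    qed
  qed
  have "h' = h" if h': "h' \<in> hom E Z (M k)" "\<forall>m\<le>n. \<forall>x\<in>monotone_maps m k. cq k x \<bullet> h' = p x" for h'
  proof (rule M_arrow_ext[OF h'(1) h(1)])
    fix c z j assume c: "inh c" and z: "z \<in> el Z c" and j: "j \<le> k"
    note q = Hm(1)[OF mono_im[OF m1[OF j]]] and h'z = ap_el[OF h'(1) c z]
    have "cq k [j] \<bullet> h' = p [j]" using h'(2) m1[OF j] by blast
    then have "ap (p [j]) c z = ap (Hm 0 k ((!) [j])) c (ap h' c z)"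
      using cq_eq[OF m1[OF j]] ap_comp[OF h'(1) q c z] by simp
    moreover have "ap (ver 0 0) c (ap (Hm 0 k ((!) [j])) c (ap h' c z)) = ap (ver k j) c (ap h' c z)"
      using ap_Hm(1)[OF mono_im[OF m1[OF j]] c h'z, of 0] by simp
    moreover have "ap (Hm 0 k ((!) [j])) c (ap h' c z) \<in> el U c" using ap_el[OF q c h'z] by (simp add: M0)
    ultimately show "ap (ver k j) c (ap h' c z) = ap (ver k j) c (ap h c z)"
      using ver0[OF c] hv[OF c z j] by (simp add: f_def)
  next
    fix c z a b assume c: "inh c" and z: "z \<in> el Z c" and ab: "a \<le> k" "b \<le> k"
    note h'z = ap_el[OF h'(1) c z] and hz = ap_el[OF h(1) c z]
    have le: "ap (edg k a b) c (ap h' c z) = ap (edg k a b) c (ap h c z)" if ab: "a \<le> b" "b \<le> k" for a b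
    proof -
      have a: "a \<le> k" using ab by simp
      note q = Hm(1)[OF mono_im[OF m2[OF ab]]]
      have "cq k [a, b] \<bullet> h' = p [a, b]" using h'(2) m2[OF ab] n(1) by auto
      then have "ap (p [a, b]) c z = ap (Hm (Suc 0) k ((!) [a, b])) c (ap h' c z)"
        using cq_eq[OF m2[OF ab]] ap_comp[OF h'(1) q c z] by simp
      moreover have "ap (edg (Suc 0) 0 (Suc 0)) c (ap (Hm (Suc 0) k ((!) [a, b])) c (ap h' c z)) = ap (edg k a b) c (ap h' c z)"
        using ap_Hm(2)[OF mono_im[OF m2[OF ab]] c h'z, of 0 "Suc 0"] by simp
      ultimately show ?thesis
        using he[OF c z a ab(2)] apg[OF c z a ab(2)] ab by (simp add: min_def max_def)
    qed
    show "ap (edg k a b) c (ap h' c z) = ap (edg k a b) c (ap h c z)"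
    proof (cases "a \<le> b")
      case True then show ?thesis using le ab by simp
    next
      case False
      then show ?thesis using le[of b a] ab M_sym[OF c h'z ab] M_sym[OF c hz ab] by simp
    qed
  qed
  then show ?thesis using h(1) hq by blast
qed

end

lemma hypercover: "is_hypercover E HH"
  unfolding is_hypercover_def
proof (intro allI impI)
  fix k :: nat assume k: "1 \<le> k"
  show "\<exists>M q c. is_cosk E (k - 1) HH k M q \<and> c \<in> hom E (lev HH k) M \<and>
     (\<forall>i\<le>k. q (omit i [0..<Suc k]) \<bullet> c = dd HH k i) \<and> is_epi E c"
  proof (cases "k = 1")
    case True
    then show ?thesis using hypercover_1 by simp
  next
    case False
    \<comment> \<open>From level 2 on the level is its own coskeleton, so the canonical arrow is the
      identity and trivially epimorphic.\<close>
    have "is_cosk E (k - 1) HH k (M k) (cq k)"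
      unfolding is_cosk_def using cq_cone cone_universal k False by simp
    moreover have "Id E (M k) \<in> hom E (lev HH k) (M k)" using E_id[OF M_obj] by (simp add: HH_simps)
    moreover have "is_epi E (Id E (M k))"
      by (rule loc_epi[OF E_id[OF M_obj]], rule loc_triv) (use ap_id[OF M_obj st_inh] rs_el[OF M_obj] in blast)+
    moreover have "cq k (omit i [0..<Suc k]) \<bullet> Id E (M k) = dd HH k i" if i: "i \<le> k" for i
    proof -
      obtain k' where k': "k = Suc k'" using k by (cases k) auto
      have om: "omit i [0..<Suc k] \<in> monotone_maps k' k" using omit_mono[of "[0..<Suc k]" k' k i] upt_mono[of k] i k' by simp
      have "Hm k' k ((!) (omit i [0..<Suc k])) = Hm k' k (coface i)"
      proof (rule HA.a_cong)
        fix j assume j: "j \<le> k'"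
        then have "coface i j < Suc k" using k' by (auto simp: coface_def)
        then show "omit i [0..<Suc k] ! j = coface i j"
          using omit_nth[OF i, of "[0..<Suc k]" j] j k' by (simp del: upt_Suc)
      qed
      then show ?thesis
        using cq_eq[OF om] E_comp_id(1)[OF Hm(1)[OF mono_im[OF om]]] k' by (simp add: HH_simps)
    qed
    ultimately show ?thesis by blast
  qed
qed

end

context hyper
begin

subsection \<open>The index sets\<close>

type_synonym 'v idx = "(nat \<Rightarrow> 'v) \<times> (nat \<times> nat \<Rightarrow> 'v set_map) \<times> (nat \<times> nat \<Rightarrow> 'v)"

abbreviation vi where "vi w \<equiv> fst w"
abbreviation vb where "vb w \<equiv> fst (snd w)"
abbreviation ve where "ve w \<equiv> snd (snd w)"

abbreviation sq :: "nat \<Rightarrow> (nat \<times> nat) set" where "sq n \<equiv> {..n} \<times> {..n}"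

text \<open>\<open>W n c x w\<close> says that the simplex \<open>x\<close> has the index
  \<open>w\<close> throughout the stage \<open>c\<close>. The entries of an index are extensional
  functions, so that finitely many values determine it.\<close>

definition W :: "nat \<Rightarrow> 'u \<Rightarrow> 'u \<Rightarrow> 'u idx \<Rightarrow> bool" where
  "W n c x w \<longleftrightarrow> vi w \<in> {..n} \<rightarrow>\<^sub>E I \<and> vb w \<in> (\<Pi>\<^sub>E (k, l) \<in> sq n. {b. set_bijection (R (vi w k)) (R (vi w l)) b}) \<and>
     ve w \<in> sq n \<rightarrow>\<^sub>E B \<and>
     (\<forall>k\<le>n. ap \<zeta> c (ap (ver n k) c x) = kap I (vi w k) c) \<and>
     (\<forall>k\<le>n. \<forall>l\<le>n. agr (vi w k) (vi w l) (vb w (k, l)) c (ap (ver n k) c x) (ap (ver n l) c x)) \<and>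
     (\<forall>k\<le>n. \<forall>l\<le>n. ap (edg n k l) c x = kap B (ve w (k, l)) c)"

lemma W_in:
  assumes "W n c x w"
  shows W_I: "k \<le> n \<Longrightarrow> vi w k \<in> I"
    and W_bij: "k \<le> n \<Longrightarrow> l \<le> n \<Longrightarrow> set_bijection (R (vi w k)) (R (vi w l)) (vb w (k, l))"
    and W_B: "k \<le> n \<Longrightarrow> l \<le> n \<Longrightarrow> ve w (k, l) \<in> B"
    and W_\<zeta>: "k \<le> n \<Longrightarrow> ap \<zeta> c (ap (ver n k) c x) = kap I (vi w k) c"
    and W_agr: "k \<le> n \<Longrightarrow> l \<le> n \<Longrightarrow> agr (vi w k) (vi w l) (vb w (k, l)) c (ap (ver n k) c x) (ap (ver n l) c x)"
    and W_edg: "k \<le> n \<Longrightarrow> l \<le> n \<Longrightarrow> ap (edg n k l) c x = kap B (ve w (k, l)) c"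
  using assms by (auto simp: W_def PiE_iff)

lemma W_ext:
  assumes "W n c x w" "W n d y w'"
    and "\<And>k. k \<le> n \<Longrightarrow> vi w k = vi w' k" "\<And>k l. k \<le> n \<Longrightarrow> l \<le> n \<Longrightarrow> vb w (k, l) = vb w' (k, l)"
    "\<And>k l. k \<le> n \<Longrightarrow> l \<le> n \<Longrightarrow> ve w (k, l) = ve w' (k, l)"
  shows "w = w'"
proof (intro prod_eqI)
  show "vi w = vi w'" by (rule PiE_ext[of _ "{..n}" "\<lambda>_. I"]) (use assms in \<open>auto simp: W_def\<close>)
  show "vb w = vb w'"
  proof
    fix q show "vb w q = vb w' q"
      using assms(1,2,4) by (cases q; cases "q \<in> sq n") (auto simp: W_def PiE_iff extensional_def)
  qed
  show "ve w = ve w'" by (rule PiE_ext[of _ "sq n" "\<lambda>_. B"]) (use assms in \<open>auto simp: W_def\<close>)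
qed

lemma W_rs:
  assumes h: "h \<in> st d c" and x: "x \<in> el (M n) c" and W: "W n c x w"
  shows "W n d (rs (M n) h x) w"
proof -
  note c = st_inh'[OF h]
  have v: "ap (ver n k) d (rs (M n) h x) = rs U h (ap (ver n k) c x)" "ap (ver n k) c x \<in> el U c" if "k \<le> n" for k
    using ap_rs[OF ver_hom[OF that] h x] ap_el[OF ver_hom[OF that] c x] by auto
  have e: "ap (edg n k l) d (rs (M n) h x) = rs T h (ap (edg n k l) c x)" if "k \<le> n" "l \<le> n" for k l
    using ap_rs[OF edg_hom[OF that] h x] .
  show ?thesis
    using W v e agr_rs[OF h] ap_rs[OF \<zeta> h] kap_rs[OF I _ h] kap_rs[OF small_B _ h]
    unfolding W_def by (auto simp: PiE_iff)
qed

lemma W_uniq: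
  assumes c: "inh c" and x: "x \<in> el (M n) c" and W: "W n c x w" "W n c x w'"
  shows "w = w'"
proof (rule W_ext[OF W])
  show vi: "vi w k = vi w' k" if "k \<le> n" for k
    using kap_inj[OF I W_I[OF W(1) that] W_I[OF W(2) that] c] W_\<zeta>[OF W(1) that] W_\<zeta>[OF W(2) that] by simp
  show "ve w (k, l) = ve w' (k, l)" if "k \<le> n" "l \<le> n" for k l
    using kap_inj[OF small_B W_B[OF W(1) that] W_B[OF W(2) that] c] W_edg[OF W(1) that] W_edg[OF W(2) that] by simp
  show "vb w (k, l) = vb w' (k, l)" if kl: "k \<le> n" "l \<le> n" for k l
  proof -
    have s: "vb w (k, l) \<in> hom SET (R (vi w k)) (R (vi w l))" "vb w' (k, l) \<in> hom SET (R (vi w k)) (R (vi w l))"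
      using W_bij[OF W(1) kl] W_bij[OF W(2) kl] vi[OF kl(1)] vi[OF kl(2)] by (auto simp: set_bijection_def)
    show ?thesis
      by (rule agr_uniq[OF W_I[OF W(1) kl(1)] W_I[OF W(1) kl(2)] c ap_el[OF ver_hom[OF kl(1)] c x] W_\<zeta>[OF W(1) kl(1)]
            ap_el[OF ver_hom[OF kl(2)] c x] W_\<zeta>[OF W(1) kl(2)] s(1) W_agr[OF W(1) kl] s(2)])
        (use W_agr[OF W(2) kl] vi[OF kl(1)] vi[OF kl(2)] in simp)
  qed
qed

text \<open>Finitely many local choices over a common cover. Vertex indices and marks come first, as
  sections of constant objects; only then can \<open>agr_total\<close> provide the bijections, on a
  finer cover.\<close>

lemma W_total:
  assumes c: "inh c" and x: "x \<in> el (M n) c"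
  shows "loc c (\<lambda>d h. \<exists>w. W n d (rs (M n) h x) w)"
proof (rule loc_trans[OF c])
  let ?v = "\<lambda>d k x. ap (ver n k) d x" and ?e = "\<lambda>d q x. ap (edg n (fst q) (snd q)) d x"
  have 1: "loc c (\<lambda>d h. \<forall>k\<in>{..n}. \<exists>i\<in>I. rs (on_obj \<gamma> I) h (ap \<zeta> c (?v c k x)) = kap I i d)"
    by (rule loc_ball[OF _ c], simp, rule kap_loc[OF I c ap_el[OF \<zeta> c ap_el[OF ver_hom c x]]]) simp
  have 2: "loc c (\<lambda>d h. \<forall>q\<in>sq n. \<exists>i\<in>B. rs T h (?e c q x) = kap B i d)"
    by (rule loc_ball[OF _ c], simp, rule kap_loc[OF small_B c ap_el[OF edg_hom c x]]) auto
  show "loc c (\<lambda>d h. loc d (\<lambda>e g. \<exists>w. W n e (rs (M n) (h \<odot> g) x) w))"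
  proof (rule loc_mono[OF loc_conj[OF c 1 2]])
    fix d h assume h: "h \<in> st d c" and
      P: "(\<forall>k\<in>{..n}. \<exists>i\<in>I. rs (on_obj \<gamma> I) h (ap \<zeta> c (?v c k x)) = kap I i d) \<and> (\<forall>q\<in>sq n. \<exists>i\<in>B. rs T h (?e c q x) = kap B i d)"
    note d = st_inh[OF h]
    define y where "y = rs (M n) h x"
    have y: "y \<in> el (M n) d" using rs_el[OF M_obj h x] by (simp add: y_def)
    have vy: "?v d k y = rs U h (?v c k x)" "?v d k y \<in> el U d" if "k \<le> n" for k
      using ap_rs[OF ver_hom[OF that] h x] ap_el[OF ver_hom[OF that] d y] by (simp_all add: y_def)
    have "\<exists>i\<in>I. ap \<zeta> d (?v d k y) = kap I i d" if "k \<le> n" for k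
      using P that vy[OF that] ap_rs[OF \<zeta> h ap_el[OF ver_hom[OF that] c x]] by auto
    then obtain i where i: "\<And>k. k \<le> n \<Longrightarrow> i k \<in> I" "\<And>k. k \<le> n \<Longrightarrow> ap \<zeta> d (?v d k y) = kap I (i k) d" by metis
    have "\<exists>j\<in>B. ?e d q y = kap B j d" if "q \<in> sq n" for q
      using P that ap_rs[OF edg_hom h x] unfolding y_def by fastforce
    then obtain \<epsilon> where \<epsilon>: "\<And>q. q \<in> sq n \<Longrightarrow> \<epsilon> q \<in> B" "\<And>q. q \<in> sq n \<Longrightarrow> ?e d q y = kap B (\<epsilon> q) d" by metis
    have L: "loc d (\<lambda>e g. \<forall>q\<in>sq n. \<exists>b. set_bijection (R (i (fst q))) (R (i (snd q))) b \<and>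
        agr (i (fst q)) (i (snd q)) b e (rs U g (?v d (fst q) y)) (rs U g (?v d (snd q) y)))"
    proof (rule loc_ball[OF _ d])
      fix q assume "q \<in> sq n"
      then have q: "fst q \<le> n" "snd q \<le> n" by auto
      show "loc d (\<lambda>e g. \<exists>b. set_bijection (R (i (fst q))) (R (i (snd q))) b \<and>
        agr (i (fst q)) (i (snd q)) b e (rs U g (?v d (fst q) y)) (rs U g (?v d (snd q) y)))"
        by (rule agr_total[OF i(1)[OF q(1)] i(1)[OF q(2)] d vy(2)[OF q(1)] i(2)[OF q(1)] vy(2)[OF q(2)] i(2)[OF q(2)]])
    qed simp
    show "loc d (\<lambda>e g. \<exists>w. W n e (rs (M n) (h \<odot> g) x) w)"
    proof (rule loc_mono[OF L])
      fix e g assume g: "g \<in> st e d" and Q: "\<forall>q\<in>sq n. \<exists>b. set_bijection (R (i (fst q))) (R (i (snd q))) b \<and>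
        agr (i (fst q)) (i (snd q)) b e (rs U g (?v d (fst q) y)) (rs U g (?v d (snd q) y))"
      from Q[THEN bchoice] obtain b where b: "\<forall>q\<in>sq n. set_bijection (R (i (fst q))) (R (i (snd q))) (b q) \<and>
        agr (i (fst q)) (i (snd q)) (b q) e (rs U g (?v d (fst q) y)) (rs U g (?v d (snd q) y))" by blast
      define w where "w = (restrict i {..n}, restrict b (sq n), restrict \<epsilon> (sq n))"
      have z: "rs (M n) (h \<odot> g) x = rs (M n) g y" using rs_comp[OF M_obj h g x] by (simp add: y_def)
      have "W n e (rs (M n) g y) w"
        unfolding W_def
      proof (intro conjI allI impI)
        show "vi w \<in> {..n} \<rightarrow>\<^sub>E I" "ve w \<in> sq n \<rightarrow>\<^sub>E B" using i(1) \<epsilon>(1) by (auto simp: w_def)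
        show "vb w \<in> (\<Pi>\<^sub>E (k, l) \<in> sq n. {b. set_bijection (R (vi w k)) (R (vi w l)) b})"
          using b by (auto simp: w_def)
        fix k assume k: "k \<le> n"
        show "ap \<zeta> e (ap (ver n k) e (rs (M n) g y)) = kap I (vi w k) e"
          using ap_rs[OF ver_hom[OF k] g y] ap_rs[OF \<zeta> g vy(2)[OF k]] i(2)[OF k] kap_rs[OF I i(1)[OF k] g] k by (simp add: w_def)
        fix l assume l: "l \<le> n"
        show "agr (vi w k) (vi w l) (vb w (k, l)) e (ap (ver n k) e (rs (M n) g y)) (ap (ver n l) e (rs (M n) g y))"
          using b k l ap_rs[OF ver_hom[OF k] g y] ap_rs[OF ver_hom[OF l] g y] by (auto simp: w_def)
        show "ap (edg n k l) e (rs (M n) g y) = kap B (ve w (k, l)) e"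
          using ap_rs[OF edg_hom[OF k l] g y] \<epsilon>(2)[of "(k, l)"] kap_rs[OF small_B \<epsilon>(1) g, of "(k, l)"] k l by (simp add: w_def)
      qed
      then show "\<exists>w. W n e (rs (M n) (h \<odot> g) x) w" using z by metis
    qed
  qed
qed

definition rst :: "nat \<Rightarrow> (nat \<Rightarrow> nat) \<Rightarrow> 'u idx \<Rightarrow> 'u idx" where
  "rst m \<phi> w = (\<lambda>k\<in>{..m}. vi w (\<phi> k), \<lambda>(k, l)\<in>sq m. vb w (\<phi> k, \<phi> l), \<lambda>(k, l)\<in>sq m. ve w (\<phi> k, \<phi> l))"

lemma rst_simps:
  "k \<le> m \<Longrightarrow> vi (rst m \<phi> w) k = vi w (\<phi> k)"
  "k \<le> m \<Longrightarrow> l \<le> m \<Longrightarrow> vb (rst m \<phi> w) (k, l) = vb w (\<phi> k, \<phi> l)"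
  "k \<le> m \<Longrightarrow> l \<le> m \<Longrightarrow> ve (rst m \<phi> w) (k, l) = ve w (\<phi> k, \<phi> l)"
  by (simp_all add: rst_def)

lemma W_Hm:
  assumes \<phi>: "\<phi> ` {..m} \<subseteq> {..n}" and c: "inh c" and x: "x \<in> el (M n) c" and W: "W n c x w"
  shows "W m c (ap (Hm m n \<phi>) c x) (rst m \<phi> w)"
proof -
  have p: "\<phi> k \<le> n" if "k \<le> m" for k using \<phi> that by auto
  show ?thesis
    unfolding W_def
  proof (intro conjI allI impI)
    show "vi (rst m \<phi> w) \<in> {..m} \<rightarrow>\<^sub>E I" using W_I[OF W] p by (auto simp: rst_def)
    show "ve (rst m \<phi> w) \<in> sq m \<rightarrow>\<^sub>E B" using W_B[OF W] p by (auto simp: rst_def)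
    show "vb (rst m \<phi> w) \<in> (\<Pi>\<^sub>E (k, l) \<in> sq m. {b. set_bijection (R (vi (rst m \<phi> w) k)) (R (vi (rst m \<phi> w) l)) b})"
      using W_bij[OF W] p by (auto simp: rst_def)
  qed (use ap_Hm[OF \<phi> c x] W_\<zeta>[OF W] W_agr[OF W] W_edg[OF W] p in \<open>auto simp: rst_simps\<close>)
qed

definition Ws :: "nat \<Rightarrow> 'u idx set" where
  "Ws n = {w. \<exists>c x. inh c \<and> x \<in> el (M n) c \<and> W n c x w}"

lemma WsI: "inh c \<Longrightarrow> x \<in> el (M n) c \<Longrightarrow> W n c x w \<Longrightarrow> w \<in> Ws n"
  unfolding Ws_def by blast

lemma rst_Ws: "\<phi> ` {..m} \<subseteq> {..n} \<Longrightarrow> w \<in> Ws n \<Longrightarrow> rst m \<phi> w \<in> Ws m"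
proof -
  assume \<phi>: "\<phi> ` {..m} \<subseteq> {..n}" and "w \<in> Ws n"
  then obtain c x where W: "inh c" "x \<in> el (M n) c" "W n c x w" unfolding Ws_def by blast
  show ?thesis by (rule WsI[OF W(1) ap_el[OF Hm(1)[OF \<phi>] W(1,2)] W_Hm[OF \<phi> W]])
qed

lemma Ws_ext:
  assumes "w \<in> Ws n" "w' \<in> Ws n"
    and "\<And>k. k \<le> n \<Longrightarrow> vi w k = vi w' k" "\<And>k l. k \<le> n \<Longrightarrow> l \<le> n \<Longrightarrow> vb w (k, l) = vb w' (k, l)"
    "\<And>k l. k \<le> n \<Longrightarrow> l \<le> n \<Longrightarrow> ve w (k, l) = ve w' (k, l)"
  shows "w = w'"
  using assms(1,2) W_ext[OF _ _ assms(3-5)] unfolding Ws_def by blast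

section \<open>Smallness of the index sets and relations between the entries of an index\<close>

lemma sml_hom: "small P \<Longrightarrow> small Q \<Longrightarrow> sml ty (hom SET P (Q :: 'u set))"
proof -
  assume P: "small P" "small Q"
  have "inj_on sm_fun (hom SET P Q)" by (rule inj_onI) (simp add: hom_SET)
  moreover have "sm_fun ` hom SET P Q \<subseteq> P \<rightarrow>\<^sub>E Q" by (auto simp: hom_SET)
  moreover have "sml ty (P \<rightarrow>\<^sub>E Q)" using P by (intro sml_PiE) (simp_all add: small_def)
  ultimately show ?thesis by (rule sml_inj)
qed

lemma sml_Ws: "sml ty (Ws n)"
proof (rule sml_subset)
  let ?b = "\<Union>i\<in>I. \<Union>j\<in>I. hom SET (R i) (R j)"
  show "Ws n \<subseteq> ({..n} \<rightarrow>\<^sub>E I) \<times> (sq n \<rightarrow>\<^sub>E ?b) \<times> (sq n \<rightarrow>\<^sub>E B)"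
  proof
    fix w assume "w \<in> Ws n"
    then obtain c x where W: "W n c x w" unfolding Ws_def by blast
    have "vb w \<in> sq n \<rightarrow>\<^sub>E ?b"
    proof (rule PiE_I)
      fix q assume "q \<in> sq n"
      then obtain k l where q: "q = (k, l)" "k \<le> n" "l \<le> n" by auto
      show "vb w q \<in> ?b" using W_bij[OF W q(2,3)] W_I[OF W q(2)] W_I[OF W q(3)] q(1) by (auto simp: set_bijection_def)
    next
      fix q assume "q \<notin> sq n" then show "vb w q = undefined" using W by (cases q) (auto simp: W_def PiE_iff extensional_def)
    qed
    then show "w \<in> ({..n} \<rightarrow>\<^sub>E I) \<times> (sq n \<rightarrow>\<^sub>E ?b) \<times> (sq n \<rightarrow>\<^sub>E B)" using W by (auto simp: W_def mem_Times_iff)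
  qed
  show "sml ty (({..n} \<rightarrow>\<^sub>E I) \<times> (sq n \<rightarrow>\<^sub>E ?b) \<times> (sq n \<rightarrow>\<^sub>E B))"
  proof -
    have "sml ty I" "sml ty B" using I small_B by (simp_all add: small_def)
    moreover have "sml ty ?b" using I R sml_hom by (intro sml_UNION) (auto simp: small_def)
    moreover have "sml ty {..n}" "sml ty (sq n)" by (simp_all add: sml_finite)
    ultimately show ?thesis by (intro sml_Times sml_PiE)
  qed
qed

text \<open>The mark \<open>tt\<close> forces the two vertices to be equal, hence so are their
  indices. The transition map from a point to itself is the identity, and \<open>agr_uniq\<close>
  identifies the bijection with it.\<close>

lemma degenerate:
  assumes c: "inh c" and x: "x \<in> el (M n) c" and W: "W n c x w" and kl: "k \<le> n" "l \<le> n" and e: "ve w (k, l) = tt"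
  shows "vi w k = vi w l" "vb w (k, l) = Id SET (R (vi w k))" "ap (ver n k) c x = ap (ver n l) c x"
proof -
  show eq: "ap (ver n k) c x = ap (ver n l) c x"
    using M_eq[OF c x kl] W_edg[OF W kl] e by simp
  show vi: "vi w k = vi w l"
    using kap_inj[OF I W_I[OF W kl(1)] W_I[OF W kl(2)] c] W_\<zeta>[OF W kl(1)] W_\<zeta>[OF W kl(2)] eq by simp
  have s: "vb w (k, l) \<in> hom SET (R (vi w k)) (R (vi w k))"
    using W_bij[OF W kl] vi by (simp add: set_bijection_def)
  show "vb w (k, l) = Id SET (R (vi w k))"
    by (rule agr_uniq[OF W_I[OF W kl(1)] W_I[OF W kl(1)] c ap_el[OF ver_hom[OF kl(1)] c x] W_\<zeta>[OF W kl(1)]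
          ap_el[OF ver_hom[OF kl(1)] c x] W_\<zeta>[OF W kl(1)] s _ SET_id_hom[OF R[OF W_I[OF W kl(1)]]] agr_id[OF W_I[OF W kl(1)] c]])
      (use W_agr[OF W kl] vi eq in simp)
qed

lemma diagonal:
  assumes "w \<in> Ws n" "k \<le> n"
  shows "ve w (k, k) = tt" "vb w (k, k) = Id SET (R (vi w k))"
proof -
  obtain c x where W: "inh c" "x \<in> el (M n) c" "W n c x w" using assms(1) unfolding Ws_def by blast
  show e: "ve w (k, k) = tt"
    using kap_inj[OF small_B W_B[OF W(3) assms(2,2)] B_in(1) W(1)] W_edg[OF W(3) assms(2,2)] M_diag[OF W(1,2) assms(2)] by simp
  show "vb w (k, k) = Id SET (R (vi w k))" using degenerate(2)[OF W assms(2,2) e] .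
qed

text \<open>Both sides describe the transition map over the outer pair of vertices: the left one by
  definition of an index, the right one by \<open>agr_comp\<close>.\<close>

lemma cocycle:
  assumes "w \<in> Ws n" "k \<le> n" "l \<le> n" "m \<le> n"
  shows "vb w (k, m) = Comp SET (vb w (l, m)) (vb w (k, l))"
proof -
  obtain c x where W: "inh c" "x \<in> el (M n) c" "W n c x w" using assms(1) unfolding Ws_def by blast
  note i = W_I[OF W(3)] and z = W_\<zeta>[OF W(3)] and a = W_agr[OF W(3)]
  have s: "vb w (k, l) \<in> hom SET (R (vi w k)) (R (vi w l))" if "k \<le> n" "l \<le> n" for k l
    using W_bij[OF W(3) that] by (simp add: set_bijection_def)
  have v: "ap (ver n k) c x \<in> el U c" if "k \<le> n" for k using ap_el[OF ver_hom[OF that] W(1,2)] .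
  show ?thesis
    by (rule agr_uniq[OF i[OF assms(2)] i[OF assms(4)] W(1) v[OF assms(2)] z[OF assms(2)] v[OF assms(4)] z[OF assms(4)]
          s[OF assms(2,4)] a[OF assms(2,4)] SET_comp_hom[OF s[OF assms(2,3)] s[OF assms(3,4)]]
          agr_comp[OF i[OF assms(2)] i[OF assms(3)] i[OF assms(4)] v[OF assms(3)] z[OF assms(3)]
            s[OF assms(2,3)] a[OF assms(2,3)] s[OF assms(3,4)] a[OF assms(3,4)]]])
qed

text \<open>The index sets must consist of elements of \<open>'u\<close>. At level 0 the code is not
  free: it has to be the vertex index, since a refinement has exactly \<open>I\<close>
  there.\<close>

definition enc :: "nat \<Rightarrow> 'u idx \<Rightarrow> 'u" where
  "enc n = (if n = 0 then (\<lambda>w. vi w 0) else (SOME e. inj_on e (Ws n) \<and> small (e ` Ws n)))"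

definition Sn :: "nat \<Rightarrow> 'u set" where
  "Sn n = enc n ` Ws n"

definition dec :: "nat \<Rightarrow> 'u \<Rightarrow> 'u idx" where
  "dec n = inv_into (Ws n) (enc n)"

lemma enc_props: "inj_on (enc n) (Ws n)" "small (Sn n)"
proof -
  have "inj_on (enc n) (Ws n) \<and> small (enc n ` Ws n)"
  proof (cases "n = 0")
    case True
    \<comment> \<open>At level 0 the one bijection and the one mark sit on the diagonal, so the
      vertex index determines the rest.\<close>
    have "w = w'" if "w \<in> Ws 0" "w' \<in> Ws 0" "vi w 0 = vi w' 0" for w w'
      by (rule Ws_ext[OF that(1,2)]) (use that diagonal[OF that(1)] diagonal[OF that(2)] in auto)
    moreover have "sml ty (enc n ` Ws n)" by (rule sml_image[OF sml_Ws])
    ultimately show ?thesis using True by (auto simp: enc_def inj_on_def small_def)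
  next
    case False
    have "\<exists>e :: 'u idx \<Rightarrow> 'u. inj_on e (Ws n) \<and> small (e ` Ws n)" using sml_encode[OF sml_Ws] by metis
    from someI_ex[OF this] show ?thesis using False by (simp add: enc_def)
  qed
  then show "inj_on (enc n) (Ws n)" "small (Sn n)" by (simp_all add: Sn_def)
qed

lemma dec_enc: "w \<in> Ws n \<Longrightarrow> dec n (enc n w) = w"
  using enc_props(1) by (simp add: dec_def)

lemma enc_in: "w \<in> Ws n \<Longrightarrow> enc n w \<in> Sn n"
  by (simp add: Sn_def)

lemma dec_in: "t \<in> Sn n \<Longrightarrow> dec n t \<in> Ws n"
  using dec_enc by (auto simp: Sn_def)

text \<open>Each \<open>i\<close> in \<open>I\<close> occurs because its component is nonempty: a
  section there acquires an index after restriction, and the vertex entry of that index can only be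
  \<open>i\<close>.\<close>

lemma Sn0: "Sn 0 = I"
proof (intro equalityI subsetI)
  fix i assume "i \<in> Sn 0"
  then show "i \<in> I" using W_I by (auto simp: Sn_def enc_def Ws_def)
next
  fix i assume i: "i \<in> I"
  obtain c u where u: "inh c" "u \<in> el U c" "ap \<zeta> c u = kap I i c"
    using nonempty_V[OF i] nonempty_component[OF I \<zeta> i] by blast
  have "u \<in> el (M 0) c" using u by (simp add: M0)
  from W_total[OF u(1) this] obtain d h w where h: "h \<in> st d c" "W 0 d (rs (M 0) h u) w"
    using loc_ex[OF u(1)] by blast
  have hu: "rs U h u \<in> el U d" using rs_el[OF Uo h(1) u(2)] .
  have "kap I (vi w 0) d = kap I i d"
    using W_\<zeta>[OF h(2), of 0] ver0[OF st_inh[OF h(1)] hu] ap_rs[OF \<zeta> h(1) u(2)] u(3) kap_rs[OF I i h(1)] by (simp add: M0)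
  then have "vi w 0 = i" using kap_inj[OF I W_I[OF h(2)] i st_inh[OF h(1)]] by simp
  moreover have "w \<in> Ws 0" by (rule WsI[OF st_inh[OF h(1)] _ h(2)]) (use hu in \<open>simp add: M0\<close>)
  ultimately show "i \<in> Sn 0" by (force simp: Sn_def enc_def)
qed

definition Tm :: "nat \<Rightarrow> nat \<Rightarrow> (nat \<Rightarrow> nat) \<Rightarrow> 'u set_map" where
  "Tm m n \<phi> = \<lparr>sm_dom = Sn n, sm_cod = Sn m, sm_fun = restrict (\<lambda>t. enc m (rst m \<phi> (dec n t))) (Sn n)\<rparr>"

lemma Tm: "\<phi> ` {..m} \<subseteq> {..n} \<Longrightarrow> Tm m n \<phi> \<in> hom SET (Sn n) (Sn m)"
  unfolding Tm_def by (rule SET_homI[OF enc_props(2) enc_props(2)]) (rule enc_in[OF rst_Ws[OF _ dec_in]])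

lemma Tm_fun: "w \<in> Ws n \<Longrightarrow> sm_fun (Tm m n \<phi>) (enc n w) = enc m (rst m \<phi> w)"
  using enc_in dec_enc by (simp add: Tm_def)

lemma rst_comp: "\<psi> ` {..k} \<subseteq> {..m} \<Longrightarrow> rst k \<psi> (rst m \<phi> w) = rst k (\<phi> \<circ> \<psi>) w"
  unfolding rst_def by (auto intro!: restrict_ext simp: image_subset_iff)

sublocale SA: ordinal_action SET Sn Tm
proof
  show "is_category SET" by (rule SET_category)
  show "Tm m n \<phi> \<in> hom SET (Sn n) (Sn m)" if "\<phi> ` {..m} \<subseteq> {..n}" for m n \<phi> by (rule Tm[OF that])
  show "Tm m n \<phi> = Tm m n \<psi>" if "\<And>k. k \<le> m \<Longrightarrow> \<phi> k = \<psi> k" for m n \<phi> \<psi>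
  proof -
    have "rst m \<phi> w = rst m \<psi> w" for w unfolding rst_def using that by (auto intro!: restrict_ext)
    then show ?thesis by (simp add: Tm_def)
  qed
  show "Comp SET (Tm k m \<psi>) (Tm m n \<phi>) = Tm k n (\<phi> \<circ> \<psi>)" if \<phi>: "\<phi> ` {..m} \<subseteq> {..n}" and \<psi>: "\<psi> ` {..k} \<subseteq> {..m}" for k m n \<phi> \<psi>
  proof (rule SET_ext[OF SET_comp_hom[OF Tm[OF \<phi>] Tm[OF \<psi>]] Tm])
    show "(\<phi> \<circ> \<psi>) ` {..k} \<subseteq> {..n}" using \<phi> \<psi> by auto
    fix t assume "t \<in> Sn n"
    then obtain w where w: "w \<in> Ws n" "t = enc n w" by (auto simp: Sn_def)
    show "sm_fun (Comp SET (Tm k m \<psi>) (Tm m n \<phi>)) t = sm_fun (Tm k n (\<phi> \<circ> \<psi>)) t"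
      using SET_comp_fun[OF Tm[OF \<phi>] enc_in[OF w(1)]] Tm_fun[OF w(1)] Tm_fun[OF rst_Ws[OF \<phi> w(1)]] rst_comp[OF \<psi>] w(2) by simp
  qed
  show "Tm n n (\<lambda>k. k) = Id SET (Sn n)" for n
  proof (rule SET_ext[OF Tm SET_id_hom[OF enc_props(2)]])
    fix t assume "t \<in> Sn n"
    then obtain w where w: "w \<in> Ws n" "t = enc n w" by (auto simp: Sn_def)
    have "(\<lambda>k. k) ` {..n} \<subseteq> {..n}" by auto
    then have "rst n (\<lambda>k. k) w = w" by (intro Ws_ext[OF rst_Ws w(1)]) (use w(1) in \<open>auto simp: rst_simps\<close>)
    then show "sm_fun (Tm n n (\<lambda>k. k)) t = sm_fun (Id SET (Sn n)) t"
      using w Tm_fun[OF w(1)] SET_id_fun[OF enc_in[OF w(1)]] by simp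
  qed auto
  show "Sn n \<in> Obj SET" for n using enc_props(2) by (simp add: SET_obj)
qed

section \<open>The structure maps and the assembled simplicial family\<close>

definition index_map :: "nat \<Rightarrow> 'a \<Rightarrow> bool" where
  "index_map n q \<longleftrightarrow> q \<in> hom E (M n) (on_obj \<gamma> (Sn n)) \<and>
     (\<forall>c x w. inh c \<longrightarrow> x \<in> el (M n) c \<longrightarrow> W n c x w \<longrightarrow> ap q c x = kap (Sn n) (enc n w) c)"

lemma index_map_exists: "\<exists>q. index_map n q"
proof -
  obtain q where "q \<in> hom E (M n) (on_obj \<gamma> (Sn n))"
    "\<And>c x t. inh c \<Longrightarrow> x \<in> el (M n) c \<Longrightarrow> (\<exists>w. W n c x w \<and> t = enc n w) \<Longrightarrow> ap q c x = kap (Sn n) t c"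
  proof (rule index_arrow[OF M_obj enc_props(2), of _ "\<lambda>c x t. \<exists>w. W n c x w \<and> t = enc n w"])
    show "t \<in> Sn n" if "inh c" "x \<in> el (M n) c" "\<exists>w. W n c x w \<and> t = enc n w" for c x t
      using that WsI enc_in by blast
    show "\<exists>w. W n d (rs (M n) h x) w \<and> t = enc n w" if "h \<in> st d c" "x \<in> el (M n) c" "\<exists>w. W n c x w \<and> t = enc n w" for c d h x t
      using that W_rs by blast
    show "t = t'" if "inh c" "x \<in> el (M n) c" "\<exists>w. W n c x w \<and> t = enc n w" "\<exists>w. W n c x w \<and> t' = enc n w" for c x t t'
      using that W_uniq by blast
    show "loc c (\<lambda>d h. \<exists>t w. W n d (rs (M n) h x) w \<and> t = enc n w)" if "inh c" "x \<in> el (M n) c" for c x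
      by (rule loc_mono[OF W_total[OF that]]) blast
  qed blast
  then show ?thesis unfolding index_map_def by blast
qed

lemma index_map_\<zeta>: "index_map 0 \<zeta>"
  unfolding index_map_def
proof (intro conjI allI impI)
  show "\<zeta> \<in> hom E (M 0) (on_obj \<gamma> (Sn 0))" using \<zeta> by (simp add: M0 Sn0)
  fix c x w assume c: "inh c" and x: "x \<in> el (M 0) c" and W: "W 0 c x w"
  then show "ap \<zeta> c x = kap (Sn 0) (enc 0 w) c"
    using W_\<zeta>[OF W, of 0] ver0[OF c, of x] by (simp add: M0 Sn0 enc_def)
qed

text \<open>A refinement must have \<open>\<zeta>\<close> itself as structure map at level 0, so a
  choice is made at higher levels only.\<close>

definition pp :: "nat \<Rightarrow> 'a" where
  "pp n = (if n = 0 then \<zeta> else SOME q. index_map n q)"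

lemma pp: "index_map n (pp n)"
  using index_map_\<zeta> someI_ex[OF index_map_exists] by (simp add: pp_def)

lemma pp_hom: "pp n \<in> hom E (M n) (on_obj \<gamma> (Sn n))"
  and pp_W: "inh c \<Longrightarrow> x \<in> el (M n) c \<Longrightarrow> W n c x w \<Longrightarrow> ap (pp n) c x = kap (Sn n) (enc n w) c"
  using pp[of n] unfolding index_map_def by blast+

text \<open>A section of a component has its index only locally. It does have some index on a cover,
  and the structure map together with the injectivity of codes tells which one.\<close>

lemma W_pp:
  assumes c: "inh c" and x: "x \<in> el (M n) c" and w: "w \<in> Ws n" and eq: "ap (pp n) c x = kap (Sn n) (enc n w) c"
  shows "loc c (\<lambda>d h. W n d (rs (M n) h x) w)"
proof (rule loc_mono[OF W_total[OF c x]])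
  fix d h assume h: "h \<in> st d c" and "\<exists>v. W n d (rs (M n) h x) v"
  then obtain v where v: "W n d (rs (M n) h x) v" by blast
  note d = st_inh[OF h] and hx = rs_el[OF M_obj h x]
  note vW = WsI[OF d hx v]
  have "kap (Sn n) (enc n v) d = kap (Sn n) (enc n w) d"
    using pp_W[OF d hx v] ap_rs[OF pp_hom h x] eq kap_rs[OF enc_props(2) enc_in[OF w] h] by simp
  then have "enc n v = enc n w" using kap_inj[OF enc_props(2) enc_in[OF vW] enc_in[OF w] d] by blast
  then have "v = w" using inj_onD[OF enc_props(1)] vW w by blast
  then show "W n d (rs (M n) h x) w" using v by simp
qed

text \<open>It is enough to compare on a cover where the simplex has an index. There the claim is
  that reindexing a simplex reindexes its index, which is \<open>W_Hm\<close>.\<close>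

lemma pp_nat:
  assumes \<phi>: "\<phi> ` {..m} \<subseteq> {..n}"
  shows "on_arr \<gamma> (Tm m n \<phi>) \<bullet> pp n = pp m \<bullet> Hm m n \<phi>"
proof (rule ext_loc[OF E_comp[OF pp_hom \<gamma>_hom[OF Tm[OF \<phi>]]] E_comp[OF Hm(1)[OF \<phi>] pp_hom]])
  fix c x assume c: "inh c" and x: "x \<in> el (M n) c"
  show "loc c (\<lambda>d h. ap (on_arr \<gamma> (Tm m n \<phi>) \<bullet> pp n) d (rs (M n) h x) = ap (pp m \<bullet> Hm m n \<phi>) d (rs (M n) h x))"
  proof (rule loc_mono[OF W_total[OF c x]])
    fix d h assume h: "h \<in> st d c" and "\<exists>w. W n d (rs (M n) h x) w"
    then obtain w where w: "W n d (rs (M n) h x) w" by blast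
    note d = st_inh[OF h] and hx = rs_el[OF M_obj h x]
    note wW = WsI[OF d hx w]
    show "ap (on_arr \<gamma> (Tm m n \<phi>) \<bullet> pp n) d (rs (M n) h x) = ap (pp m \<bullet> Hm m n \<phi>) d (rs (M n) h x)"
      using ap_comp[OF pp_hom \<gamma>_hom[OF Tm[OF \<phi>]] d hx] pp_W[OF d hx w] kap_map[OF Tm[OF \<phi>] enc_in[OF wW] d]
        Tm_fun[OF wW] ap_comp[OF Hm(1)[OF \<phi>] pp_hom d hx] pp_W[OF d ap_el[OF Hm(1)[OF \<phi>] d hx] W_Hm[OF \<phi> d hx w]] by simp
  qed
qed

definition FF :: "('o, 'a, 'u) simplicial_family" where
  "FF = \<lparr>fam_H = HA.X, fam_S = SA.X, fam_p = pp, fam_tau = (\<lambda>n. Hm n n (\<lambda>k. n - k)), fam_tauS = (\<lambda>n. Tm n n (\<lambda>k. n - k))\<rparr>"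

lemma SS_simps: "lev SA.X = Sn" "dd SA.X n i = Tm (n - 1) n (coface i)" "ss SA.X n i = Tm (Suc n) n (codeg i)"
  by (simp_all add: SA.X_def)

lemma FF_simps: "fam_H FF = HH" "fam_S FF = SA.X" "fam_p FF = pp" "fam_tau FF n = Hm n n (\<lambda>k. n - k)"
  "fam_tauS FF n = Tm n n (\<lambda>k. n - k)"
  by (simp_all add: FF_def)

lemma FF_family: "is_simplicial_family E \<gamma> FF"
  unfolding is_simplicial_family_def FF_simps
proof (intro conjI allI HA.simplicial SA.simplicial)
  show "is_simplicial_map E HH (map_simplicial \<gamma> SA.X) pp"
    unfolding is_simplicial_map_def map_simplicial_def
    using pp_hom pp_nat[OF HA.coface_im] pp_nat[OF HA.codeg_im] by (simp add: HH_simps SS_simps)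
  fix n
  show "is_family E \<gamma> (lev SA.X n) (lev HH n) (pp n)"
    unfolding is_family_def HH_simps SS_simps
  proof (intro conjI ballI enc_props(2) pp_hom)
    fix t assume t: "t \<in> Sn n"
    then obtain w where w: "w \<in> Ws n" "t = enc n w" by (auto simp: Sn_def)
    then obtain c x where "inh c" "x \<in> el (M n) c" "W n c x w" unfolding Ws_def by blast
    then show "nonempty E (component E \<gamma> (Sn n) (pp n) t)"
      using nonempty_component[OF enc_props(2) pp_hom t] pp_W w(2) by blast
  qed
qed

lemma FF_self_dual: "is_self_dual E \<gamma> FF"
  unfolding is_self_dual_def FF_simps
  using HA.duality SA.duality pp_nat[OF HA.rev_im] by simp

lemma FF_refinement: "hypercover_refinement E \<gamma> I U \<zeta> FF"
  unfolding hypercover_refinement_def using FF_family hypercover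
  by (simp add: FF_simps HH_simps SS_simps Sn0 M0 pp_def)

sublocale SF: simplicial_fam ty E C J \<Phi> \<gamma> FF
  by unfold_locales (rule FF_family FF_self_dual)+

end

section \<open>Refinements of the Cech family\<close>

locale refinement = simplicial_fam ty E C J \<Phi> \<gamma> F + cech_fam ty E C J \<Phi> \<gamma> I U \<zeta> R
  for ty :: "'u itself" and E :: "('o, 'a) category" and C :: "('u, 'u) category" and J
    and \<Phi> :: "('o, 'a, 'u) sheaf_functor"
    and \<gamma> :: "('u set, 'u set_map, 'o, 'a) cfunctor"
    and F :: "('o, 'a, 'u) simplicial_family"
    and I :: "'u set" and U :: 'o and \<zeta> :: 'a and R :: "'u \<Rightarrow> 'u set" +
  assumes ref: "hypercover_refinement E \<gamma> I U \<zeta> F"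
begin

lemma lev0: "lev S 0 = I" "lev H 0 = U" "p 0 = \<zeta>"
  using ref by (simp_all add: hypercover_refinement_def)

lemma co0: "co K 0 i = V i"
  by (simp add: K_simps lev0)

abbreviation du where "du l \<equiv> co_d K (Suc 0) (Suc 0) l"
abbreviation dv where "dv l \<equiv> co_d K (Suc 0) 0 l"

lemma src_in: "l \<in> lev S (Suc 0) \<Longrightarrow> src l \<in> I"
  and trg_in: "l \<in> lev S (Suc 0) \<Longrightarrow> trg l \<in> I"
  using S_d_in[of _ 0] by (simp_all add: lev0)

lemma du: "l \<in> lev S (Suc 0) \<Longrightarrow> du l \<in> hom E (K1 l) (V (src l))"
    "l \<in> lev S (Suc 0) \<Longrightarrow> inh c \<Longrightarrow> m \<in> el (K1 l) c \<Longrightarrow>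
      ap (cc (src l)) c (ap (du l) c m) = ap (dd H (Suc 0) (Suc 0)) c (ap (inc (Suc 0) l) c m)"
  using co_d(1)[of "Suc 0" 0 l] co_d(2)[of "Suc 0" 0 l c m] by (simp_all add: co0 lev0)

lemma dv: "l \<in> lev S (Suc 0) \<Longrightarrow> dv l \<in> hom E (K1 l) (V (trg l))"
    "l \<in> lev S (Suc 0) \<Longrightarrow> inh c \<Longrightarrow> m \<in> el (K1 l) c \<Longrightarrow>
      ap (cc (trg l)) c (ap (dv l) c m) = ap (dd H (Suc 0) 0) c (ap (inc (Suc 0) l) c m)"
  using co_d(1)[of 0 0 l] co_d(2)[of 0 0 l c m] by (simp_all add: co0 lev0)

text \<open>In terms of sections the correspondence says that over the two ends of a point of the
  component of \<open>l\<close> the transition map is the constant bijection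
  \<open>s l\<close>.\<close>

lemma corresponding_iff:
  assumes sd: "S_descent_datum E \<gamma> F R s" and ud: "U_descent_datum E \<gamma> I \<zeta> R \<sigma>"
  shows "corresponding E \<gamma> I \<zeta> F R \<sigma> (induced s) \<longleftrightarrow>
    (\<forall>l \<in> lev S (Suc 0). \<forall>c r m. inh c \<longrightarrow> r \<in> el (A (src l)) c \<longrightarrow> m \<in> el (K1 l) c \<longrightarrow>
      ap (on_arr \<gamma> (s l)) c r = sg \<sigma> (src l) (trg l) c r (ap (du l) c m) (ap (dv l) c m))"
proof -
  have "(hat E \<gamma> K R (induced s) l = hc \<sigma> (src l) (trg l) \<bullet> arr_prod E (Id E (A (src l))) (tup E [du l, dv l])) \<longleftrightarrow>
    (\<forall>c r m. inh c \<longrightarrow> r \<in> el (A (src l)) c \<longrightarrow> m \<in> el (K1 l) c \<longrightarrow>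
      ap (on_arr \<gamma> (s l)) c r = sg \<sigma> (src l) (trg l) c r (ap (du l) c m) (ap (dv l) c m))" (is "?L \<longleftrightarrow> ?R")
    if l: "l \<in> lev S (Suc 0)" for l
  proof -
    note i = src_in[OF l] and j = trg_in[OF l]
    obtain c0 m0 where "inh c0" "m0 \<in> el (K1 l) c0" using co_nonempty[OF l] nonempty_iff by blast
    then have N: "[src l, trg l] \<in> ix NN (Suc 0)"
      using N1I[OF _ i j] ap_el[OF du(1)[OF l]] ap_el[OF dv(1)[OF l]] by blast
    note h = hat_induced[OF sd l] and t = tup2[OF du(1)[OF l] dv(1)[OF l]]
    note q = arr_prod[OF E_id[OF Ao[OF i]] t(1)]
    note hr = hc_hom(1)[OF ud N]
    have eq: "ap (hc \<sigma> (src l) (trg l) \<bullet> arr_prod E (Id E (A (src l))) (tup E [du l, dv l])) c (tp [A (src l), K1 l] c [r, m]) =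
      sg \<sigma> (src l) (trg l) c r (ap (du l) c m) (ap (dv l) c m)"
      if "inh c" "r \<in> el (A (src l)) c" "m \<in> el (K1 l) c" for c r m
      unfolding sg_def
      using ap_comp[OF q(1) hr that(1) tp2(1)[OF Ao[OF i] co_obj[OF l] that]] q(2)[OF that] ap_id[OF Ao[OF i] that(1,2)] t(2)[OF that(1,3)] by simp
    show ?thesis
    proof
      assume L: ?L
      show ?R
      proof (intro allI impI)
        fix c r m assume m: "inh c" "r \<in> el (A (src l)) c" "m \<in> el (K1 l) c"
        show "ap (on_arr \<gamma> (s l)) c r = sg \<sigma> (src l) (trg l) c r (ap (du l) c m) (ap (dv l) c m)"
          using eq[OF m] h(2)[OF m] L by simp
      qed
    next
      assume R: ?R
      show ?L
      proof (rule ext_stage[OF h(1) E_comp[OF q(1) hr]])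
        fix c x assume c: "inh c" and x: "x \<in> el (Prod E [A (src l), K1 l]) c"
        obtain r m where m: "r \<in> el (A (src l)) c" "m \<in> el (K1 l) c" "x = tp [A (src l), K1 l] c [r, m]"
          using tp2_cases[OF Ao[OF i] co_obj[OF l] c x] .
        have "ap (on_arr \<gamma> (s l)) c r = sg \<sigma> (src l) (trg l) c r (ap (du l) c m) (ap (dv l) c m)"
          using R c m(1,2) by blast
        then show "ap (hat E \<gamma> K R (induced s) l) c x =
          ap (hc \<sigma> (src l) (trg l) \<bullet> arr_prod E (Id E (A (src l))) (tup E [du l, dv l])) c x"
          using eq[OF c m(1,2)] h(2)[OF c m(1,2)] m(3) by simp
      qed
    qed
  qed
  then show ?thesis unfolding corresponding_def Let_def K_simps(1-2) One_nat_def by simp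
qed

end

section \<open>The descent datum on the hypercover\<close>

context hyper
begin

sublocale RF: refinement ty E C J \<Phi> \<gamma> FF I U \<zeta> R
  by unfold_locales (rule FF_refinement)

definition ss1 :: "'u \<Rightarrow> 'u set_map" where
  "ss1 t = vb (dec (Suc 0) t) (0, Suc 0)"

lemma ss1: "w \<in> Ws (Suc 0) \<Longrightarrow> ss1 (enc (Suc 0) w) = vb w (0, Suc 0)"
  by (simp add: ss1_def dec_enc)

lemma enc_0: "enc 0 w = vi w 0"
  by (simp add: enc_def)

lemma S_face: "i \<le> Suc n \<Longrightarrow> w \<in> Ws (Suc n) \<Longrightarrow> sm_fun (dd SA.X (Suc n) i) (enc (Suc n) w) = enc n (rst n (coface i) w)"
  by (simp add: SS_simps Tm_fun)

lemma S_deg: "i \<le> n \<Longrightarrow> w \<in> Ws n \<Longrightarrow> sm_fun (ss SA.X n i) (enc n w) = enc (Suc n) (rst (Suc n) (codeg i) w)"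
  by (simp add: SS_simps Tm_fun)

lemma face_in: "i \<le> Suc n \<Longrightarrow> w \<in> Ws (Suc n) \<Longrightarrow> rst n (coface i) w \<in> Ws n"
  by (rule rst_Ws[OF HA.coface_im])

lemma deg_in: "i \<le> n \<Longrightarrow> w \<in> Ws n \<Longrightarrow> rst (Suc n) (codeg i) w \<in> Ws (Suc n)"
  by (rule rst_Ws[OF HA.codeg_im])

lemma src_enc: "w \<in> Ws (Suc 0) \<Longrightarrow> sm_fun (dd SA.X (Suc 0) (Suc 0)) (enc (Suc 0) w) = vi w 0"
  and trg_enc: "w \<in> Ws (Suc 0) \<Longrightarrow> sm_fun (dd SA.X (Suc 0) 0) (enc (Suc 0) w) = vi w (Suc 0)"
  by (simp_all add: S_face enc_0 rst_simps coface_def)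

lemma lev_cases: "t \<in> lev SA.X n \<Longrightarrow> \<exists>w\<in>Ws n. t = enc n w"
  by (auto simp: Sn_def SS_simps)

lemma Ws_bij: "w \<in> Ws n \<Longrightarrow> k \<le> n \<Longrightarrow> l \<le> n \<Longrightarrow> set_bijection (R (vi w k)) (R (vi w l)) (vb w (k, l))"
  unfolding Ws_def using W_bij by blast

text \<open>All three conditions are read off an index: the bijection of a degenerate edge sits at
  the pair \<open>(0, 0)\<close> and is the identity by \<open>diagonal\<close>, and the composition
  law of a 2-simplex is \<open>cocycle\<close> for its three vertices.\<close>

lemma FF_S_descent: "S_descent_datum E \<gamma> FF R ss1"
  unfolding S_descent_datum_def Let_def SF.K_simps One_nat_def numeral_2_eq_2 FF_simps
proof (intro conjI ballI)
  fix l assume "l \<in> lev SA.X (Suc 0)"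
  then obtain w where w: "w \<in> Ws (Suc 0)" "l = enc (Suc 0) w" using lev_cases by blast
  show "set_bijection (R (sm_fun (dd SA.X (Suc 0) (Suc 0)) l)) (R (sm_fun (dd SA.X (Suc 0) 0) l)) (ss1 l)"
    using Ws_bij[OF w(1), of 0 "Suc 0"] by (simp add: w(2) src_enc[OF w(1)] trg_enc[OF w(1)] ss1[OF w(1)])
next
  fix i assume "i \<in> lev SA.X 0"
  then obtain w where w: "w \<in> Ws 0" "i = enc 0 w" using lev_cases by blast
  have "ss1 (sm_fun (ss SA.X 0 0) i) = vb w (0, 0)"
    using S_deg[OF le0 w(1)] ss1[OF deg_in[OF le0 w(1)]] by (simp add: w(2) rst_simps codeg_def)
  then show "ss1 (sm_fun (ss SA.X 0 0) i) = Id SET (R i)"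
    using diagonal(2)[OF w(1), of 0] by (simp add: w(2) enc_0)
next
  fix t assume "t \<in> lev SA.X (Suc (Suc 0))"
  then obtain w where w: "w \<in> Ws (Suc (Suc 0))" "t = enc (Suc (Suc 0)) w" using lev_cases by blast
  have *: "ss1 (sm_fun (dd SA.X (Suc (Suc 0)) i) t) = vb w (coface i 0, coface i (Suc 0))" if "i \<le> Suc (Suc 0)" for i
    using S_face[OF that w(1)] ss1[OF face_in[OF that w(1)]] by (simp add: w(2) rst_simps)
  show "ss1 (sm_fun (dd SA.X (Suc (Suc 0)) (Suc 0)) t) =
    Comp SET (ss1 (sm_fun (dd SA.X (Suc (Suc 0)) 0) t)) (ss1 (sm_fun (dd SA.X (Suc (Suc 0)) (Suc (Suc 0))) t))"
    using cocycle[OF w(1), of 0 "Suc 0" "Suc (Suc 0)"] *[of 0] *[of "Suc 0"] *[of "Suc (Suc 0)"] by (simp add: coface_def)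
qed

section \<open>Consistency, correspondence and condition G for the constructed hypercover\<close>

lemma inc_W:
  assumes w: "w \<in> Ws (Suc 0)" and c: "inh c" and m: "m \<in> el (co SF.K (Suc 0) (enc (Suc 0) w)) c"
  shows "ap (SF.inc (Suc 0) (enc (Suc 0) w)) c m \<in> el (M (Suc 0)) c"
    "loc c (\<lambda>d h. W (Suc 0) d (rs (M (Suc 0)) h (ap (SF.inc (Suc 0) (enc (Suc 0) w)) c m)) w)"
proof -
  have t: "enc (Suc 0) w \<in> lev SF.S (Suc 0)" using enc_in[OF w] by (simp add: FF_simps SS_simps)
  show x: "ap (SF.inc (Suc 0) (enc (Suc 0) w)) c m \<in> el (M (Suc 0)) c"
    using ap_el[OF SF.inc_hom[OF t] c m] by (simp add: FF_simps HH_simps)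
  show "loc c (\<lambda>d h. W (Suc 0) d (rs (M (Suc 0)) h (ap (SF.inc (Suc 0) (enc (Suc 0) w)) c m)) w)"
    by (rule W_pp[OF c x w]) (use SF.inc_kap[OF t c m] in \<open>simp add: FF_simps SS_simps\<close>)
qed

lemma face_ver:
  assumes c: "inh c" and x: "x \<in> el (M (Suc 0)) c"
  shows "ap (dd SF.H (Suc 0) (Suc 0)) c x = ap (ver (Suc 0) 0) c x" "ap (dd SF.H (Suc 0) 0) c x = ap (ver (Suc 0) (Suc 0)) c x"
proof -
  have "ap (Hm 0 (Suc 0) (coface i)) c x = ap (ver (Suc 0) (coface i 0)) c x" if i: "i \<le> Suc 0" for i
    using ap_Hm(1)[OF HA.coface_im[OF i] c x, of 0] ver0[OF c] ap_el[OF Hm(1)[OF HA.coface_im[OF i]] c x] by (simp add: M0)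
  from this[of 0] this[of "Suc 0"]
  show "ap (dd SF.H (Suc 0) (Suc 0)) c x = ap (ver (Suc 0) 0) c x" "ap (dd SF.H (Suc 0) 0) c x = ap (ver (Suc 0) (Suc 0)) c x"
    by (simp_all add: FF_simps HH_simps coface_def)
qed

text \<open>The arrow \<open>f\<close> carries an edge over \<open>l\<close> to an edge over
  \<open>t\<close> with the same vertices. Where both have their indices, both bijections describe
  the transition map over the same pair of points, so \<open>agr_uniq\<close> applies. The marks of
  the two edges may differ, the bijections cannot.\<close>

lemma FF_consistent: "consistent E \<gamma> FF ss1"
  unfolding consistent_def Let_def SF.K_simps(1-2) One_nat_def
proof (intro ballI impI)
  fix l t assume l: "l \<in> lev SF.S (Suc 0)" and t: "t \<in> lev SF.S (Suc 0)"
    and P: "SF.src l = SF.src t \<and> SF.trg l = SF.trg t \<and>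
      (\<exists>f\<in>hom E (co SF.K (Suc 0) l) (co SF.K (Suc 0) t). RF.du t \<bullet> f = RF.du l \<and> RF.dv t \<bullet> f = RF.dv l)"
  obtain w where w: "w \<in> Ws (Suc 0)" "l = enc (Suc 0) w" using lev_cases l unfolding FF_simps by blast
  obtain w' where w': "w' \<in> Ws (Suc 0)" "t = enc (Suc 0) w'" using lev_cases t unfolding FF_simps by blast
  obtain f where f: "f \<in> hom E (co SF.K (Suc 0) l) (co SF.K (Suc 0) t)" "RF.du t \<bullet> f = RF.du l" "RF.dv t \<bullet> f = RF.dv l"
    using P by blast
  obtain c m where c: "inh c" and m: "m \<in> el (co SF.K (Suc 0) l) c" using SF.co_nonempty[OF l] nonempty_iff by blast
  define x x' where "x = ap (SF.inc (Suc 0) l) c m" and "x' = ap (SF.inc (Suc 0) t) c (ap f c m)"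
  note m' = ap_el[OF f(1) c m]
  note x = inc_W[OF w(1) c m[unfolded w(2)], folded w(2), folded x_def]
    and x' = inc_W[OF w'(1) c m'[unfolded w'(2)], folded w'(2), folded x'_def]
  have v: "ap (ver (Suc 0) 0) c x = ap (ver (Suc 0) 0) c x'" "ap (ver (Suc 0) (Suc 0)) c x = ap (ver (Suc 0) (Suc 0)) c x'"
    using RF.du(2)[OF l c m] RF.du(2)[OF t c m'] RF.dv(2)[OF l c m] RF.dv(2)[OF t c m'] P
      ap_comp[OF f(1) RF.du(1)[OF t] c m] ap_comp[OF f(1) RF.dv(1)[OF t] c m] f(2,3)
      face_ver[OF c x(1)] face_ver[OF c x'(1)] unfolding x_def[symmetric] x'_def[symmetric] by simp_all
  obtain d h where h: "h \<in> st d c" "W (Suc 0) d (rs (M (Suc 0)) h x) w \<and> W (Suc 0) d (rs (M (Suc 0)) h x') w'"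
    using loc_ex[OF c loc_conj[OF c x(2) x'(2)]] by blast
  let ?y = "rs (M (Suc 0)) h x" and ?y' = "rs (M (Suc 0)) h x'"
  note d = st_inh[OF h(1)] and W = h(2)[THEN conjunct1] and W' = h(2)[THEN conjunct2]
  have y: "?y \<in> el (M (Suc 0)) d" by (rule rs_el[OF M_obj h(1) x(1)])
  have v': "ap (ver (Suc 0) k) d ?y' = ap (ver (Suc 0) k) d ?y" if "k \<le> Suc 0" for k
  proof -
    have "k = 0 \<or> k = Suc 0" using that by auto
    then show ?thesis using ap_rs[OF ver_hom[OF that] h(1) x(1)] ap_rs[OF ver_hom[OF that] h(1) x'(1)] v by auto
  qed
  have vi: "vi w' 0 = vi w 0" "vi w' (Suc 0) = vi w (Suc 0)"
    using P src_enc[OF w(1)] src_enc[OF w'(1)] trg_enc[OF w(1)] trg_enc[OF w'(1)] by (simp_all add: w(2) w'(2) FF_simps)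
  have s: "vb w (0, Suc 0) \<in> hom SET (R (vi w 0)) (R (vi w (Suc 0)))" "vb w' (0, Suc 0) \<in> hom SET (R (vi w 0)) (R (vi w (Suc 0)))"
    using W_bij[OF W, of 0 "Suc 0"] W_bij[OF W', of 0 "Suc 0"] vi by (simp_all add: set_bijection_def)
  have "vb w (0, Suc 0) = vb w' (0, Suc 0)"
    by (rule agr_uniq[OF W_I[OF W] W_I[OF W] d ap_el[OF ver_hom d y] W_\<zeta>[OF W] ap_el[OF ver_hom d y] W_\<zeta>[OF W] s(1) W_agr[OF W] s(2)])
      (use W_agr[OF W', of 0 "Suc 0"] vi v' in auto)
  then show "ss1 l = ss1 t" using ss1[OF w(1)] ss1[OF w'(1)] by (simp add: w(2) w'(2))
qed

text \<open>The index of an edge contains the bijection through which the descent datum acts over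
  its ends. As the index is attained only locally, the equation of sections is verified on a
  cover.\<close>

lemma FF_corresponding: "corresponding E \<gamma> I \<zeta> FF R \<sigma> (induced_datum E \<gamma> FF ss1)"
  unfolding RF.corresponding_iff[OF FF_S_descent ud]
proof (intro ballI allI impI)
  fix l c r m assume l: "l \<in> lev SF.S (Suc 0)" and c: "inh c" and r: "r \<in> el (A (SF.src l)) c"
    and m: "m \<in> el (co SF.K (Suc 0) l) c"
  obtain w where w: "w \<in> Ws (Suc 0)" "l = enc (Suc 0) w" using lev_cases l unfolding FF_simps by blast
  have st: "SF.src l = vi w 0" "SF.trg l = vi w (Suc 0)" using src_enc[OF w(1)] trg_enc[OF w(1)] by (simp_all add: w(2) FF_simps)
  note i = RF.src_in[OF l] and j = RF.trg_in[OF l]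
  define x where "x = ap (SF.inc (Suc 0) l) c m"
  note x = inc_W[OF w(1) c m[unfolded w(2)], folded w(2), folded x_def]
  note u = ap_el[OF RF.du(1)[OF l] c m] and v = ap_el[OF RF.dv(1)[OF l] c m]
  have cu: "ap (cc (SF.src l)) c (ap (RF.du l) c m) = ap (ver (Suc 0) 0) c x"
    and cv: "ap (cc (SF.trg l)) c (ap (RF.dv l) c m) = ap (ver (Suc 0) (Suc 0)) c x"
    using RF.du(2)[OF l c m] RF.dv(2)[OF l c m] face_ver[OF c x(1)] unfolding x_def[symmetric] by simp_all
  have sh: "ss1 l \<in> hom SET (R (SF.src l)) (R (SF.trg l))" using SF.s_hom[OF FF_S_descent l] .
  note gs = \<gamma>_hom[OF sh]
  show "ap (on_arr \<gamma> (ss1 l)) c r = sg \<sigma> (SF.src l) (SF.trg l) c r (ap (RF.du l) c m) (ap (RF.dv l) c m)"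
  proof (rule sep[OF Ao[OF j] c ap_el[OF gs c r] sg_el[OF ud i j c r u v]], rule loc_mono[OF x(2)])
    fix d h assume h: "h \<in> st d c" and W: "W (Suc 0) d (rs (M (Suc 0)) h x) w"
    note d = st_inh[OF h]
    have "agr (SF.src l) (SF.trg l) (ss1 l) d (rs U h (ap (ver (Suc 0) 0) c x)) (rs U h (ap (ver (Suc 0) (Suc 0)) c x))"
      using W_agr[OF W, of 0 "Suc 0"] ap_rs[OF ver_hom h x(1), of 0] ap_rs[OF ver_hom h x(1), of "Suc 0"] st ss1[OF w(1)]
      by (simp add: w(2))
    then have a: "agr (SF.src l) (SF.trg l) (ss1 l) d (ap (cc (SF.src l)) d (rs (V (SF.src l)) h (ap (RF.du l) c m)))
       (ap (cc (SF.trg l)) d (rs (V (SF.trg l)) h (ap (RF.dv l) c m)))"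
      using ap_rs[OF cc_hom[OF i] h u] ap_rs[OF cc_hom[OF j] h v] cu cv by simp
    note hu = rs_el[OF Vo[OF i] h u] and hv = rs_el[OF Vo[OF j] h v] and hr = rs_el[OF Ao[OF i] h r]
    have "sg \<sigma> (SF.src l) (SF.trg l) d (rs (A (SF.src l)) h r) (rs (V (SF.src l)) h (ap (RF.du l) c m)) (rs (V (SF.trg l)) h (ap (RF.dv l) c m)) =
      ap (on_arr \<gamma> (ss1 l)) d (rs (A (SF.src l)) h r)"
      using a[unfolded agr_def, THEN spec, THEN bspec, OF st_id[OF d], THEN bspec, OF hu, THEN bspec, OF hv]
        rs_id[OF Uo d ap_el[OF cc_hom[OF i] d hu]] rs_id[OF Uo d ap_el[OF cc_hom[OF j] d hv]] hr by simp
    then show "rs (A (SF.trg l)) h (ap (on_arr \<gamma> (ss1 l)) c r) =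
      rs (A (SF.trg l)) h (sg \<sigma> (SF.src l) (SF.trg l) c r (ap (RF.du l) c m) (ap (RF.dv l) c m))"
      using sg_rs[OF ud i j h r u v] ap_rs[OF gs h r] by simp
  qed
qed

text \<open>The required triangle runs along the edge and back again. Its middle edge joins two
  copies of the first vertex and is marked \<open>tt\<close>; every point of that component has
  equal ends.\<close>

lemma FF_condition_G: "condition_G E \<gamma> FF"
  unfolding condition_G_def Let_def SF.K_simps(1-2,4) One_nat_def numeral_2_eq_2
proof (intro ballI)
  fix l assume l: "l \<in> lev SF.S (Suc 0)"
  obtain w where w: "w \<in> Ws (Suc 0)" "l = enc (Suc 0) w" using lev_cases l unfolding FF_simps by blast
  \<comment> \<open>The map \<open>0, 1, 0\<close> from three vertices to two. Composed with the
    cofaces 2, 0 and 1 it becomes the identity, the reversal and the constant map at 0.\<close>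
  define \<phi> where "\<phi> k = (if k = Suc 0 then Suc 0 else 0)" for k :: nat
  have \<phi>: "\<phi> ` {..Suc (Suc 0)} \<subseteq> {..Suc 0}" by (auto simp: \<phi>_def)
  define w2 where "w2 = rst (Suc (Suc 0)) \<phi> w"
  have w2: "w2 \<in> Ws (Suc (Suc 0))" unfolding w2_def by (rule rst_Ws[OF \<phi> w(1)])
  define t where "t = enc (Suc (Suc 0)) w2"
  have face: "sm_fun (dd SF.S (Suc (Suc 0)) i) t = enc (Suc 0) (rst (Suc 0) (\<phi> \<circ> coface i) w)" if "i \<le> Suc (Suc 0)" for i
    using S_face[OF that w2] rst_comp[OF HA.coface_im[OF that]] by (simp add: t_def w2_def FF_simps)
  have rin: "rst (Suc 0) \<psi> w \<in> Ws (Suc 0)" if "\<psi> ` {..Suc 0} \<subseteq> {..Suc 0}" for \<psi> using rst_Ws[OF that w(1)] .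
  have im: "(\<phi> \<circ> coface i) ` {..Suc 0} \<subseteq> {..Suc 0}" for i by (auto simp: \<phi>_def)
  have 2: "rst (Suc 0) (\<phi> \<circ> coface (Suc (Suc 0))) w = w"
    by (rule Ws_ext[OF rin[OF im] w(1)]) (auto simp: rst_simps \<phi>_def coface_def le_Suc_eq)
  have 0: "rst (Suc 0) (\<phi> \<circ> coface 0) w = rst (Suc 0) (\<lambda>k. Suc 0 - k) w"
    by (rule Ws_ext[OF rin[OF im] rin[OF HA.rev_im]]) (auto simp: rst_simps \<phi>_def coface_def le_Suc_eq)
  let ?l1 = "sm_fun (dd SF.S (Suc (Suc 0)) (Suc 0)) t"
  let ?w1 = "rst (Suc 0) (\<phi> \<circ> coface (Suc 0)) w"
  have l1: "?l1 = enc (Suc 0) ?w1" using face[of "Suc 0"] by simp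
  note w1 = rin[OF im[of "Suc 0"]]
  have l1S: "?l1 \<in> lev SF.S (Suc 0)" using enc_in[OF w1] unfolding l1 by (simp add: FF_simps SS_simps)
  \<comment> \<open>Both ends of the middle edge come from vertex 0, so its mark is that of a
    diagonal pair.\<close>
  have e1: "ve ?w1 (0, Suc 0) = tt"
    using diagonal(1)[OF w(1), of 0] by (simp add: rst_simps \<phi>_def coface_def)
  have st: "SF.src ?l1 = SF.trg ?l1"
    using src_enc[OF w1] trg_enc[OF w1] unfolding l1 by (simp add: FF_simps rst_simps \<phi>_def coface_def)
  have "RF.du ?l1 = RF.dv ?l1"
  proof (rule ext_stage)
    show "RF.du ?l1 \<in> hom E (co SF.K (Suc 0) ?l1) (V (SF.src ?l1))" by (rule RF.du(1)[OF l1S])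
    show "RF.dv ?l1 \<in> hom E (co SF.K (Suc 0) ?l1) (V (SF.src ?l1))" using RF.dv(1)[OF l1S] st by simp
    fix c m assume c: "inh c" and m: "m \<in> el (co SF.K (Suc 0) ?l1) c"
    define x where "x = ap (SF.inc (Suc 0) ?l1) c m"
    note x = inc_W[OF w1 c m[unfolded l1], folded l1, folded x_def]
    have "ap (ver (Suc 0) 0) c x = ap (ver (Suc 0) (Suc 0)) c x"
    proof (rule sep[OF Uo c ap_el[OF ver_hom c x(1)] ap_el[OF ver_hom c x(1)]])
      show "loc c (\<lambda>d f. rs U f (ap (ver (Suc 0) 0) c x) = rs U f (ap (ver (Suc 0) (Suc 0)) c x))"
      proof (rule loc_mono[OF x(2)])
        fix d h assume h: "h \<in> st d c" and W: "W (Suc 0) d (rs (M (Suc 0)) h x) ?w1"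
        show "rs U h (ap (ver (Suc 0) 0) c x) = rs U h (ap (ver (Suc 0) (Suc 0)) c x)"
          using degenerate(3)[OF st_inh[OF h] rs_el[OF M_obj h x(1)] W _ _ e1]
            ap_rs[OF ver_hom h x(1), of 0] ap_rs[OF ver_hom h x(1), of "Suc 0"] by simp
      qed
    qed auto
    then have "ap (cc (SF.src ?l1)) c (ap (RF.du ?l1) c m) = ap (cc (SF.src ?l1)) c (ap (RF.dv ?l1) c m)"
      using RF.du(2)[OF l1S c m] RF.dv(2)[OF l1S c m] face_ver[OF c x(1)] st unfolding x_def[symmetric] by simp
    then show "ap (RF.du ?l1) c m = ap (RF.dv ?l1) c m"
      using cc_inj[OF RF.src_in[OF l1S] c ap_el[OF RF.du(1)[OF l1S] c m]] ap_el[OF RF.dv(1)[OF l1S] c m] st by simp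
  qed
  moreover have "sm_fun (dd SF.S (Suc (Suc 0)) (Suc (Suc 0))) t = l"
    using face[of "Suc (Suc 0)"] 2 w(2) by simp
  moreover have "sm_fun (dd SF.S (Suc (Suc 0)) 0) t = sm_fun (fam_tauS FF (Suc 0)) l"
    using face[of 0] 0 Tm_fun[OF w(1)] w(2) by (simp add: FF_simps)
  moreover have "t \<in> lev SF.S (Suc (Suc 0))" using enc_in[OF w2] by (simp add: t_def FF_simps SS_simps)
  ultimately show "\<exists>w\<in>lev SF.S (Suc (Suc 0)). sm_fun (dd SF.S (Suc (Suc 0)) (Suc (Suc 0))) w = l \<and>
      sm_fun (dd SF.S (Suc (Suc 0)) 0) w = sm_fun (fam_tauS FF (Suc 0)) l \<and>
      RF.du (sm_fun (dd SF.S (Suc (Suc 0)) (Suc 0)) w) = RF.dv (sm_fun (dd SF.S (Suc (Suc 0)) (Suc 0)) w)"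
    by blast
qed

end

section \<open>Descent\<close>

context topos
begin

lemma times_obj:
  assumes o: "A \<in> Obj E" "B \<in> Obj E" "P \<in> Obj E" "Q \<in> Obj E" and f: "f \<in> hom E (Prod E [A, P]) (Prod E [B, P])"
  shows "times_obj E A B P Q f \<in> hom E (Prod E [A, Prod E [P, Q]]) (Prod E [B, Prod E [P, Q]])"
    "\<And>c a p q b p'. inh c \<Longrightarrow> a \<in> el A c \<Longrightarrow> p \<in> el P c \<Longrightarrow> q \<in> el Q c \<Longrightarrow> b \<in> el B c \<Longrightarrow> p' \<in> el P c \<Longrightarrow>
       ap f c (tp [A, P] c [a, p]) = tp [B, P] c [b, p'] \<Longrightarrow>
       ap (times_obj E A B P Q f) c (tp [A, Prod E [P, Q]] c [a, tp [P, Q] c [p, q]]) =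
       tp [B, Prod E [P, Q]] c [b, tp [P, Q] c [p', q]]"
proof -
  note PQ = Prod2_obj[OF o(3,4)]
  let ?\<pi> = "pr E [A, Prod E [P, Q]]"
  note \<pi> = pr2_hom[OF o(1) PQ] and \<rho> = pr2_hom[OF o(3,4)] and \<beta> = pr2_hom[OF o(2,3)]
  note t = tup2[OF \<pi>(1) E_comp[OF \<pi>(3) \<rho>(1)]]
  define g where "g = f \<bullet> tup E [?\<pi> 0, pr E [P, Q] 0 \<bullet> ?\<pi> 1]"
  have g: "g \<in> hom E (Prod E [A, Prod E [P, Q]]) (Prod E [B, P])" unfolding g_def using E_comp[OF t(1) f] by simp
  note t1 = tup2[OF E_comp[OF g \<beta>(3)] E_comp[OF \<pi>(3) \<rho>(3)]]
  note t2 = tup2[OF E_comp[OF g \<beta>(1)] t1(1)]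
  have eq: "times_obj E A B P Q f = tup E [pr E [B, P] 0 \<bullet> g, tup E [pr E [B, P] (Suc 0) \<bullet> g, pr E [P, Q] (Suc 0) \<bullet> ?\<pi> (Suc 0)]]"
    by (simp add: times_obj_def Let_def g_def)
  show "times_obj E A B P Q f \<in> hom E (Prod E [A, Prod E [P, Q]]) (Prod E [B, Prod E [P, Q]])"
    unfolding eq by (rule t2(1))
  fix c a p q b p' assume c: "inh c" and m: "a \<in> el A c" "p \<in> el P c" "q \<in> el Q c" "b \<in> el B c" "p' \<in> el P c"
    and fe: "ap f c (tp [A, P] c [a, p]) = tp [B, P] c [b, p']"
  note pq = tp2[OF o(3,4) c m(2,3)]
  let ?z = "tp [A, Prod E [P, Q]] c [a, tp [P, Q] c [p, q]]"
  note z = tp2[OF o(1) PQ c m(1) pq(1)]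
  have gz: "ap g c ?z = tp [B, P] c [b, p']"
    unfolding g_def using ap_comp[OF t(1) f c z(1)] t(2)[OF c z(1)] ap_comp[OF \<pi>(3) \<rho>(1) c z(1)] z pq fe by simp
  show "ap (times_obj E A B P Q f) c ?z = tp [B, Prod E [P, Q]] c [b, tp [P, Q] c [p', q]]"
    unfolding eq
    using t2(2)[OF c z(1)] t1(2)[OF c z(1)] ap_comp[OF g \<beta>(1) c z(1)] ap_comp[OF g \<beta>(3) c z(1)] gz
      tp2[OF o(2,3) c m(4,5)] ap_comp[OF \<pi>(3) \<rho>(3) c z(1)] z(4) pq(4) by simp
qed

end

section \<open>The locally constant object glued from a descent datum\<close>

context cech_fam
begin

context
  fixes \<sigma>
  assumes ud: "U_descent_datum E \<gamma> I \<zeta> R \<sigma>"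
begin

text \<open>The places where a section of the glued object over \<open>c\<close> has to be
  described: each point \<open>u\<close> of a component, over each stage below \<open>c\<close>, is
  a local trivialization and asks for one element of the fibre.\<close>

definition KX :: "'u \<Rightarrow> ('u \<times> 'u \<times> 'u \<times> 'u) set" where
  "KX c = {(d, f, i, u). f \<in> st d c \<and> i \<in> I \<and> u \<in> el (V i) d}"

text \<open>The object glued from the descent datum is constructed as the sheaf of compatible families of
  sections of the constant objects, not as a quotient.\<close>

definition PX :: "'u \<Rightarrow> ('u \<times> 'u \<times> 'u \<times> 'u \<Rightarrow> 'u) set" where
  "PX c = {r \<in> (\<Pi>\<^sub>E (d, f, i, u) \<in> KX c. el (A i) d).
     (\<forall>d f i u e g. (d, f, i, u) \<in> KX c \<longrightarrow> g \<in> st e d \<longrightarrow> rs (A i) g (r (d, f, i, u)) = r (e, f \<odot> g, i, rs (V i) g u)) \<and>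
     (\<forall>d f i u j v. (d, f, i, u) \<in> KX c \<longrightarrow> (d, f, j, v) \<in> KX c \<longrightarrow> sg \<sigma> i j d (r (d, f, i, u)) u v = r (d, f, j, v))}"

definition rX :: "'u \<Rightarrow> ('u \<times> 'u \<times> 'u \<times> 'u \<Rightarrow> 'u) \<Rightarrow> 'u \<times> 'u \<times> 'u \<times> 'u \<Rightarrow> 'u" where
  "rX h r = (\<lambda>(e, g, i, u) \<in> KX (Dom C h). r (e, h \<odot> g, i, u))"

lemma KX_iff: "(d, f, i, u) \<in> KX c \<longleftrightarrow> f \<in> st d c \<and> i \<in> I \<and> u \<in> el (V i) d"
  by (simp add: KX_def)

lemma rX: "h \<in> st d c \<Longrightarrow> (e, g, i, u) \<in> KX d \<Longrightarrow> rX h r (e, g, i, u) = r (e, h \<odot> g, i, u)"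
  using st_dom[of h d c] by (simp add: rX_def)

lemma PX_el: "r \<in> PX c \<Longrightarrow> (d, f, i, u) \<in> KX c \<Longrightarrow> r (d, f, i, u) \<in> el (A i) d"
  by (auto simp: PX_def PiE_iff)

lemma PX_nat: "r \<in> PX c \<Longrightarrow> (d, f, i, u) \<in> KX c \<Longrightarrow> g \<in> st e d \<Longrightarrow>
    rs (A i) g (r (d, f, i, u)) = r (e, f \<odot> g, i, rs (V i) g u)"
  unfolding PX_def by blast

lemma PX_compat: "r \<in> PX c \<Longrightarrow> (d, f, i, u) \<in> KX c \<Longrightarrow> (d, f, j, v) \<in> KX c \<Longrightarrow>
    sg \<sigma> i j d (r (d, f, i, u)) u v = r (d, f, j, v)"
  unfolding PX_def by blast

lemma PX_I:
  assumes "r \<in> extensional (KX c)"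
    and "\<And>d f i u. (d, f, i, u) \<in> KX c \<Longrightarrow> r (d, f, i, u) \<in> el (A i) d"
    and "\<And>d f i u e g. (d, f, i, u) \<in> KX c \<Longrightarrow> g \<in> st e d \<Longrightarrow> rs (A i) g (r (d, f, i, u)) = r (e, f \<odot> g, i, rs (V i) g u)"
    and "\<And>d f i u j v. (d, f, i, u) \<in> KX c \<Longrightarrow> (d, f, j, v) \<in> KX c \<Longrightarrow> sg \<sigma> i j d (r (d, f, i, u)) u v = r (d, f, j, v)"
  shows "r \<in> PX c"
  using assms unfolding PX_def by (auto simp: PiE_iff)

lemma PX_ext:
  assumes "r \<in> PX c" "r' \<in> PX c" "\<And>d f i u. (d, f, i, u) \<in> KX c \<Longrightarrow> r (d, f, i, u) = r' (d, f, i, u)"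
  shows "r = r'"
proof
  fix q :: "'u \<times> 'u \<times> 'u \<times> 'u"
  obtain d f i u where q: "q = (d, f, i, u)" by (cases q)
  have "r \<in> extensional (KX c)" "r' \<in> extensional (KX c)" using assms(1,2) by (auto simp: PX_def PiE_def)
  then show "r q = r' q" using assms(3)[of d f i u] unfolding q extensional_def by (cases "(d, f, i, u) \<in> KX c") auto
qed

lemma KX_res: "(d, f, i, u) \<in> KX c \<Longrightarrow> g \<in> st e d \<Longrightarrow> (e, f \<odot> g, i, rs (V i) g u) \<in> KX c"
  using st_comp rs_el[OF Vo] by (auto simp: KX_iff)

lemma KX_comp: "h \<in> st d c \<Longrightarrow> (e, g, i, u) \<in> KX d \<Longrightarrow> (e, h \<odot> g, i, u) \<in> KX c"
  using st_comp by (auto simp: KX_iff)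

lemma rX_PX:
  assumes h: "h \<in> st d c" and r: "r \<in> PX c"
  shows "rX h r \<in> PX d"
proof (rule PX_I)
  show "rX h r \<in> extensional (KX d)" using st_dom[OF h] by (simp add: rX_def)
  fix e g i u assume k: "(e, g, i, u) \<in> KX d"
  note hk = KX_comp[OF h k]
  show "rX h r (e, g, i, u) \<in> el (A i) e" using rX[OF h k] PX_el[OF r hk] by simp
  have gs: "g \<in> st e d" using k by (simp add: KX_iff)
  show "rs (A i) k' (rX h r (e, g, i, u)) = rX h r (b, g \<odot> k', i, rs (V i) k' u)" if k': "k' \<in> st b e" for b k'
    using rX[OF h k] PX_nat[OF r hk k'] rX[OF h KX_res[OF k k']] st_assoc[OF h gs k'] by simp
  show "sg \<sigma> i j e (rX h r (e, g, i, u)) u v = rX h r (e, g, j, v)" if "(e, g, j, v) \<in> KX d" for j v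
    using rX[OF h k] rX[OF h that] PX_compat[OF r hk KX_comp[OF h that]] by simp
qed

lemma sml_PX: "inh c \<Longrightarrow> sml ty (PX c)"
proof -
  \<comment> \<open>Smallness of sections is known at inhabited stages, and \<open>KX\<close>
    contains no others; the empty set stands for the remaining ones.\<close>
  have "KX c \<subseteq> Sigma (Obj C) (\<lambda>d. Arr C \<times> Sigma I (\<lambda>i. if inh d then el (V i) d else {}))"
    using hom_obj[OF C st_hom] st_hom st_inh by (auto simp: KX_iff in_hom)
  moreover have "sml ty (Sigma (Obj C) (\<lambda>d. Arr C \<times> Sigma I (\<lambda>i. if inh d then el (V i) d else {})))"
    using small_C I sml_el[OF Vo] sml_finite[of "{}"]
    by (intro sml_Sigma sml_Times) (auto simp: small_def)
  ultimately have "sml ty (KX c)" by (rule sml_subset)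
  then have "sml ty (\<Pi>\<^sub>E q \<in> KX c. case q of (d, f, i, u) \<Rightarrow> el (A i) d)"
    by (rule sml_PiE) (use sml_el[OF Ao] st_inh in \<open>auto simp: KX_iff\<close>)
  then show ?thesis by (rule sml_subset[rotated]) (auto simp: PX_def)
qed

lemma descent_object:
  obtains X en where "X \<in> Obj E" "\<And>c. inh c \<Longrightarrow> bij_betw (en c) (PX c) (el X c)"
    "\<And>c d h x. h \<in> st d c \<Longrightarrow> x \<in> PX c \<Longrightarrow> rs X h (en c x) = en d (rX h x)"
proof (rule represent[of PX rX])
  show "sml ty (PX c)" if "inh c" for c by (rule sml_PX[OF that])
  show "rX h r \<in> PX d" if "h \<in> st d c" "r \<in> PX c" for c d h r by (rule rX_PX[OF that])
  show "rX (Id C c) r = r" if c: "inh c" and r: "r \<in> PX c" for c r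
    by (rule PX_ext[OF rX_PX[OF st_id[OF c] r] r]) (use rX[OF st_id[OF c]] st_comp_id(2) in \<open>auto simp: KX_iff\<close>)
  show "rX (h \<odot> g) r = rX g (rX h r)" if h: "h \<in> st d c" and g: "g \<in> st e d" and r: "r \<in> PX c" for c d e h g r
  proof (rule PX_ext[OF rX_PX[OF st_comp[OF h g] r] rX_PX[OF g rX_PX[OF h r]]])
    fix b f i u assume k: "(b, f, i, u) \<in> KX e"
    then have f: "f \<in> st b e" by (simp add: KX_iff)
    show "rX (h \<odot> g) r (b, f, i, u) = rX g (rX h r) (b, f, i, u)"
      using rX[OF st_comp[OF h g] k] rX[OF g k] rX[OF h KX_comp[OF g k]] st_assoc[OF h g f] by simp
  qed
  show "r = r'" if c: "inh c" and r: "r \<in> PX c" and r': "r' \<in> PX c" and L: "loc c (\<lambda>d f. rX f r = rX f r')" for c r r'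
  proof (rule PX_ext[OF r r'])
    fix d f i u assume k: "(d, f, i, u) \<in> KX c"
    then have f: "f \<in> st d c" and i: "i \<in> I" and u: "u \<in> el (V i) d" by (simp_all add: KX_iff)
    show "r (d, f, i, u) = r' (d, f, i, u)"
    proof (rule sep[OF Ao[OF i] st_inh[OF f] PX_el[OF r k] PX_el[OF r' k]], rule loc_mono[OF loc_res[OF f L]])
      fix e g assume g: "g \<in> st e d" and eq: "rX (f \<odot> g) r = rX (f \<odot> g) r'"
      note fg = st_comp[OF f g]
      have k': "(e, Id C e, i, rs (V i) g u) \<in> KX e" using st_id[OF st_inh[OF g]] i rs_el[OF Vo[OF i] g u] by (simp add: KX_iff)
      have "r (e, f \<odot> g, i, rs (V i) g u) = r' (e, f \<odot> g, i, rs (V i) g u)"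
        using fun_cong[OF eq, of "(e, Id C e, i, rs (V i) g u)"] rX[OF fg k'] st_comp_id(1)[OF fg] by simp
      then show "rs (A i) g (r (d, f, i, u)) = rs (A i) g (r' (d, f, i, u))"
        using PX_nat[OF r k g] PX_nat[OF r' k g] by simp
    qed
  qed
  show "\<exists>y\<in>PX c. \<forall>d. \<forall>f\<in>st d c. f \<in> S \<longrightarrow> rX f y = x f"
    if c: "inh c" and S: "S \<in> J c" and x: "\<And>d f. f \<in> st d c \<Longrightarrow> f \<in> S \<Longrightarrow> x f \<in> PX d"
      and xr: "\<And>d f e g. f \<in> st d c \<Longrightarrow> f \<in> S \<Longrightarrow> g \<in> st e d \<Longrightarrow> rX g (x f) = x (f \<odot> g)" for c S x
  proof -
    have Scomp: "f \<odot> g \<in> S" if "f \<in> st d c" "f \<in> S" "g \<in> st e d" for d e f g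
      using sieve_comp[OF S c that(2)] that st_hom by blast
    \<comment> \<open>Compatibility of the given families under restriction allows each value to be
      read at an identity arrow of a smaller stage.\<close>
    have key: "x (f \<odot> g) (e, Id C e, i, u) = x f (e, g, i, u)"
      if f: "f \<in> st d c" "f \<in> S" and g: "g \<in> st e d" and iu: "i \<in> I" "u \<in> el (V i) e" for d e f g i u
    proof -
      have k: "(e, Id C e, i, u) \<in> KX e" using st_id[OF st_inh[OF g]] iu by (simp add: KX_iff)
      show ?thesis using xr[OF f g] rX[OF g k, of "x f"] st_comp_id(1)[OF g] by simp
    qed
    \<comment> \<open>The value of the amalgamation at one place is itself glued, from the values
      prescribed along those arrows \<open>g\<close> for which \<open>f \<odot> g\<close> belongs to
      the covering sieve.\<close>
    have ex: "\<exists>y. y \<in> el (A i) d \<and> (\<forall>e g. g \<in> st e d \<longrightarrow> f \<odot> g \<in> S \<longrightarrow> rs (A i) g y = x (f \<odot> g) (e, Id C e, i, rs (V i) g u))"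
      if k: "(d, f, i, u) \<in> KX c" for d f i u
    proof -
      have f: "f \<in> st d c" and i: "i \<in> I" and u: "u \<in> el (V i) d" using k by (simp_all add: KX_iff)
      note d = st_inh[OF f]
      define W where "W e g z \<longleftrightarrow> f \<odot> g \<in> S \<and> z = x (f \<odot> g) (e, Id C e, i, rs (V i) g u)" for e g z
      have kI: "(e, Id C e, i, rs (V i) g u) \<in> KX e" if "g \<in> st e d" for e g
        using st_id[OF st_inh[OF that]] i rs_el[OF Vo[OF i] that u] by (simp add: KX_iff)
      obtain y where y: "y \<in> el (A i) d" "\<And>e g z. g \<in> st e d \<Longrightarrow> W e g z \<Longrightarrow> rs (A i) g y = z"
      proof (rule glue[OF Ao[OF i] d, of W])
        show "z \<in> el (A i) e" if "g \<in> st e d" "W e g z" for e g z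
          using that PX_el[OF x[OF st_comp[OF f that(1)]] kI[OF that(1)]] by (simp add: W_def)
        show "W b (g \<odot> k) (rs (A i) k z)" if g: "g \<in> st e d" and k: "k \<in> st b e" and W: "W e g z" for e b g k z
        proof -
          note fg = st_comp[OF f g]
          have fgS: "f \<odot> g \<in> S" using W by (simp add: W_def)
          have "rs (A i) k z = x (f \<odot> g) (b, Id C e \<odot> k, i, rs (V i) k (rs (V i) g u))"
            using W PX_nat[OF x[OF fg fgS] kI[OF g] k] by (simp add: W_def)
          also have "\<dots> = x (f \<odot> g) (b, k, i, rs (V i) (g \<odot> k) u)"
            using st_comp_id(2)[OF k] rs_comp[OF Vo[OF i] g k u] by simp
          also have "\<dots> = x ((f \<odot> g) \<odot> k) (b, Id C b, i, rs (V i) (g \<odot> k) u)"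
            using key[OF fg fgS k i rs_el[OF Vo[OF i] st_comp[OF g k] u]] by simp
          finally show ?thesis using st_assoc[OF f g k] Scomp[OF fg fgS k] by (simp add: W_def)
        qed
        show "y = z" if "W e g y" "W e g z" for e g y z using that by (simp add: W_def)
        show "loc d (\<lambda>e g. \<exists>z. W e g z)"
          by (rule loc_mono[OF loc_res[OF f loc_J[OF S]]]) (simp add: W_def)
      qed blast
      then show ?thesis by (auto simp: W_def)
    qed
    define y where "y = (\<lambda>(d, f, i, u) \<in> KX c. SOME y. y \<in> el (A i) d \<and>
       (\<forall>e g. g \<in> st e d \<longrightarrow> f \<odot> g \<in> S \<longrightarrow> rs (A i) g y = x (f \<odot> g) (e, Id C e, i, rs (V i) g u)))"
    have y12: "y (d, f, i, u) \<in> el (A i) d \<and>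
       (\<forall>e g. g \<in> st e d \<longrightarrow> f \<odot> g \<in> S \<longrightarrow> rs (A i) g (y (d, f, i, u)) = x (f \<odot> g) (e, Id C e, i, rs (V i) g u))"
      if "(d, f, i, u) \<in> KX c" for d f i u
      using someI_ex[OF ex[OF that]] that by (simp add: y_def)
    have y1: "y (d, f, i, u) \<in> el (A i) d" if "(d, f, i, u) \<in> KX c" for d f i u using y12[OF that] by (rule conjunct1)
    have y2: "rs (A i) g (y (d, f, i, u)) = x (f \<odot> g) (e, Id C e, i, rs (V i) g u)"
      if "(d, f, i, u) \<in> KX c" "g \<in> st e d" "f \<odot> g \<in> S" for d f i u e g using y12[OF that(1)] that(2,3) by blast
    have LS: "loc d (\<lambda>e g. f \<odot> g \<in> S)" if "f \<in> st d c" for d f using loc_res[OF that loc_J[OF S]] .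
    have "y \<in> PX c"
    proof (rule PX_I)
      show "y \<in> extensional (KX c)" by (simp add: y_def)
      fix d f i u assume k: "(d, f, i, u) \<in> KX c"
      then have f: "f \<in> st d c" and i: "i \<in> I" and u: "u \<in> el (V i) d" by (simp_all add: KX_iff)
      show "y (d, f, i, u) \<in> el (A i) d" by (rule y1[OF k])
      show "rs (A i) g (y (d, f, i, u)) = y (e, f \<odot> g, i, rs (V i) g u)" if g: "g \<in> st e d" for e g
      proof (rule sep[OF Ao[OF i] st_inh[OF g] rs_el[OF Ao[OF i] g y1[OF k]] y1[OF KX_res[OF k g]]],
          rule loc_mono[OF LS[OF st_comp[OF f g]]])
        fix b k' assume k': "k' \<in> st b e" and S': "(f \<odot> g) \<odot> k' \<in> S"
        show "rs (A i) k' (rs (A i) g (y (d, f, i, u))) = rs (A i) k' (y (e, f \<odot> g, i, rs (V i) g u))"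
          using y2[OF KX_res[OF k g] k' S'] y2[OF k st_comp[OF g k']] S' st_assoc[OF f g k']
            rs_comp[OF Ao[OF i] g k' y1[OF k]] rs_comp[OF Vo[OF i] g k' u] by simp
      qed
      show "sg \<sigma> i j d (y (d, f, i, u)) u v = y (d, f, j, v)" if kj: "(d, f, j, v) \<in> KX c" for j v
      proof -
        have j: "j \<in> I" and v: "v \<in> el (V j) d" using kj by (simp_all add: KX_iff)
        note d = st_inh[OF f]
        show ?thesis
        proof (rule sep[OF Ao[OF j] d sg_el[OF ud i j d y1[OF k] u v] y1[OF kj]], rule loc_mono[OF LS[OF f]])
          fix e g assume g: "g \<in> st e d" and S': "f \<odot> g \<in> S"
          note e = st_inh[OF g]
          have ki: "(e, Id C e, i, rs (V i) g u) \<in> KX e" "(e, Id C e, j, rs (V j) g v) \<in> KX e"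
            using st_id[OF e] i j rs_el[OF Vo[OF i] g u] rs_el[OF Vo[OF j] g v] by (simp_all add: KX_iff)
          show "rs (A j) g (sg \<sigma> i j d (y (d, f, i, u)) u v) = rs (A j) g (y (d, f, j, v))"
            using sg_rs[OF ud i j g y1[OF k] u v] y2[OF k g S'] y2[OF kj g S'] PX_compat[OF x[OF st_comp[OF f g] S'] ki] by simp
        qed
      qed
    qed
    moreover have "rX f y = x f" if f: "f \<in> st d c" "f \<in> S" for d f
    proof (rule PX_ext[OF rX_PX[OF f(1) \<open>y \<in> PX c\<close>] x[OF f]])
      fix e g i u assume k: "(e, g, i, u) \<in> KX d"
      then have g: "g \<in> st e d" and i: "i \<in> I" and u: "u \<in> el (V i) e" by (simp_all add: KX_iff)
      note fg = st_comp[OF f(1) g] and e = st_inh[OF g]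
      have kc: "(e, f \<odot> g, i, u) \<in> KX c" using KX_comp[OF f(1) k] .
      have "rs (A i) (Id C e) (y (e, f \<odot> g, i, u)) = x (f \<odot> g) (e, Id C e, i, rs (V i) (Id C e) u)"
        using y2[OF kc st_id[OF e]] Scomp[OF f g] st_comp_id(1)[OF fg] by simp
      then have "y (e, f \<odot> g, i, u) = x (f \<odot> g) (e, Id C e, i, u)"
        using rs_id[OF Ao[OF i] e y1[OF kc]] rs_id[OF Vo[OF i] e u] by simp
      then show "rX f y (e, g, i, u) = x f (e, g, i, u)" using rX[OF f(1) k] key[OF f g i u] by simp
    qed
    ultimately show ?thesis by blast
  qed
qed (rule that)

text \<open>Once a point \<open>u\<close> of a component is given, a compatible family is determined
  by its value at \<open>u\<close>, and every value occurs. This is the trivialization; it respects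
  the descent datum because transport along a transition map does not change the family.\<close>

lemma locally_constant_exists: "\<exists>X \<theta>. locally_constant E \<gamma> I \<zeta> R \<sigma> X \<theta>"
proof -
  obtain X en where X: "X \<in> Obj E" and en: "\<And>c. inh c \<Longrightarrow> bij_betw (en c) (PX c) (el X c)"
    and rsX: "\<And>c d h x. h \<in> st d c \<Longrightarrow> x \<in> PX c \<Longrightarrow> rs X h (en c x) = en d (rX h x)"
    by (rule descent_object) blast
  have enX: "en c x \<in> el X c" if "inh c" "x \<in> PX c" for c x using bij_betwE[OF en[OF that(1)]] that(2) by blast
  \<comment> \<open>The family generated by the value \<open>r\<close> at the point
    \<open>u\<close>: at any other point \<open>v\<close> it is \<open>r\<close> transported from
    \<open>u\<close> to \<open>v\<close>.\<close>
  define fam where "fam i c r u = (\<lambda>(d, f, j, v) \<in> KX c. sg \<sigma> i j d (rs (A i) f r) (rs (V i) f u) v)" for i c r u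
  have famk: "fam i c r u (d, f, j, v) = sg \<sigma> i j d (rs (A i) f r) (rs (V i) f u) v" if "(d, f, j, v) \<in> KX c" for i c r u d f j v
    using that by (simp add: fam_def)
  have fam: "fam i c r u \<in> PX c" if i: "i \<in> I" and r: "r \<in> el (A i) c" and u: "u \<in> el (V i) c" for i c r u
  proof (rule PX_I)
    show "fam i c r u \<in> extensional (KX c)" by (simp add: fam_def)
    fix d f j v assume k: "(d, f, j, v) \<in> KX c"
    then have f: "f \<in> st d c" and j: "j \<in> I" and v: "v \<in> el (V j) d" by (simp_all add: KX_iff)
    note d = st_inh[OF f] and fr = rs_el[OF Ao[OF i] f r] and fu = rs_el[OF Vo[OF i] f u]
    show "fam i c r u (d, f, j, v) \<in> el (A j) d" using famk[OF k] sg_el[OF ud i j d fr fu v] by simp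
    show "rs (A j) g (fam i c r u (d, f, j, v)) = fam i c r u (e, f \<odot> g, j, rs (V j) g v)" if g: "g \<in> st e d" for e g
      using famk[OF k] famk[OF KX_res[OF k g]] sg_rs[OF ud i j g fr fu v] rs_comp[OF Ao[OF i] f g r] rs_comp[OF Vo[OF i] f g u] by simp
    show "sg \<sigma> j l d (fam i c r u (d, f, j, v)) v w = fam i c r u (d, f, l, w)" if k': "(d, f, l, w) \<in> KX c" for l w
      using famk[OF k] famk[OF k'] sg_comp[OF ud i j _ d fr fu v] k' by (simp add: KX_iff)
  qed
  have fam_rs: "rX h (fam i c r u) = fam i d (rs (A i) h r) (rs (V i) h u)"
    if i: "i \<in> I" and h: "h \<in> st d c" and r: "r \<in> el (A i) c" and u: "u \<in> el (V i) c" for i c d h r u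
  proof (rule PX_ext[OF rX_PX[OF h fam[OF i r u]] fam[OF i rs_el[OF Ao[OF i] h r] rs_el[OF Vo[OF i] h u]]])
    fix e g j v assume k: "(e, g, j, v) \<in> KX d"
    then have g: "g \<in> st e d" by (simp add: KX_iff)
    show "rX h (fam i c r u) (e, g, j, v) = fam i d (rs (A i) h r) (rs (V i) h u) (e, g, j, v)"
      using rX[OF h k] famk[OF k] famk[OF KX_comp[OF h k]] rs_comp[OF Ao[OF i] h g r] rs_comp[OF Vo[OF i] h g u] by simp
  qed
  \<comment> \<open>This and \<open>fam_of\<close> make the trivialization invertible: the unit law
    recovers \<open>r\<close> from the generated family, and compatibility recovers a family from
    its value at \<open>u\<close>.\<close>
  have fam_at: "fam i c r u (c, Id C c, i, u) = r" if i: "i \<in> I" and c: "inh c" and r: "r \<in> el (A i) c" and u: "u \<in> el (V i) c" for i c r u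
  proof -
    have "(c, Id C c, i, u) \<in> KX c" using st_id[OF c] i u by (simp add: KX_iff)
    then show ?thesis using famk rs_id[OF Ao[OF i] c r] rs_id[OF Vo[OF i] c u] sg_id[OF ud i c r u] by simp
  qed
  have fam_of: "fam i c (x (c, Id C c, i, u)) u = x" if i: "i \<in> I" and c: "inh c" and x: "x \<in> PX c" and u: "u \<in> el (V i) c" for i c x u
  proof -
    have k0: "(c, Id C c, i, u) \<in> KX c" using st_id[OF c] i u by (simp add: KX_iff)
    note r = PX_el[OF x k0]
    show ?thesis
    proof (rule PX_ext[OF fam[OF i r u] x])
      fix d f j v assume k: "(d, f, j, v) \<in> KX c"
      then have f: "f \<in> st d c" by (simp add: KX_iff)
      have k1: "(d, f, i, rs (V i) f u) \<in> KX c" using f i rs_el[OF Vo[OF i] f u] by (simp add: KX_iff)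
      have "rs (A i) f (x (c, Id C c, i, u)) = x (d, f, i, rs (V i) f u)"
        using PX_nat[OF x k0 f] st_comp_id(2)[OF f] by simp
      then show "fam i c (x (c, Id C c, i, u)) u (d, f, j, v) = x (d, f, j, v)"
        using famk[OF k] PX_compat[OF x k1 k] by simp
    qed
  qed
  have "\<exists>t \<in> hom E (Prod E [A i, V i]) (Prod E [X, V i]). is_iso E t \<and>
      (\<forall>c r u. inh c \<longrightarrow> r \<in> el (A i) c \<longrightarrow> u \<in> el (V i) c \<longrightarrow> ap t c (tp [A i, V i] c [r, u]) = tp [X, V i] c [en c (fam i c r u), u])"
    if i: "i \<in> I" for i
  proof -
    note o = Ao[OF i] Vo[OF i]
    obtain k where k: "k \<in> hom E (Prod E [A i, V i]) X"
      "\<And>c z. inh c \<Longrightarrow> z \<in> el (Prod E [A i, V i]) c \<Longrightarrow> ap k c z = en c (fam i c (ap (pr E [A i, V i] 0) c z) (ap (pr E [A i, V i] (Suc 0)) c z))"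
    proof (rule arrow_of_family[OF Prod2_obj[OF o] X, of "\<lambda>c z. en c (fam i c (ap (pr E [A i, V i] 0) c z) (ap (pr E [A i, V i] (Suc 0)) c z))"])
      fix c z assume cz: "inh c" "z \<in> el (Prod E [A i, V i]) c"
      show "en c (fam i c (ap (pr E [A i, V i] 0) c z) (ap (pr E [A i, V i] (Suc 0)) c z)) \<in> el X c"
        by (rule enX[OF cz(1) fam[OF i ap_el[OF pr2_hom(1)[OF o] cz] ap_el[OF pr2_hom(3)[OF o] cz]]])
    next
      fix d c h z assume h: "h \<in> st d c" and z: "z \<in> el (Prod E [A i, V i]) c"
      note c = st_inh'[OF h]
      note r = ap_el[OF pr2_hom(1)[OF o] c z] and u = ap_el[OF pr2_hom(3)[OF o] c z]
      show "en d (fam i d (ap (pr E [A i, V i] 0) d (rs (Prod E [A i, V i]) h z)) (ap (pr E [A i, V i] (Suc 0)) d (rs (Prod E [A i, V i]) h z))) =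
        rs X h (en c (fam i c (ap (pr E [A i, V i] 0) c z) (ap (pr E [A i, V i] (Suc 0)) c z)))"
        using ap_rs[OF pr2_hom(1)[OF o] h z] ap_rs[OF pr2_hom(3)[OF o] h z] rsX[OF h fam[OF i r u]] fam_rs[OF i h r u] by simp
    qed blast
    note t = tup2[OF k(1) pr2_hom(3)[OF o]]
    let ?t = "tup E [k, pr E [A i, V i] (Suc 0)]"
    have tap: "ap ?t c (tp [A i, V i] c [r, u]) = tp [X, V i] c [en c (fam i c r u), u]"
      if c: "inh c" and r: "r \<in> el (A i) c" and u: "u \<in> el (V i) c" for c r u
      using t(2)[OF c tp2(1)[OF o c r u]] k(2)[OF c tp2(1)[OF o c r u]] tp2(2,4)[OF o c r u] by simp
    have "is_iso E ?t"
    proof (rule iso_bij[OF t(1)], unfold bij_betw_def, intro conjI inj_onI equalityI subsetI)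
      fix c y z assume c: "inh c" and y: "y \<in> el (Prod E [A i, V i]) c" and z: "z \<in> el (Prod E [A i, V i]) c"
        and eq: "ap ?t c y = ap ?t c z"
      obtain r u where y': "r \<in> el (A i) c" "u \<in> el (V i) c" "y = tp [A i, V i] c [r, u]" using tp2_cases[OF o c y] .
      obtain r' u' where z': "r' \<in> el (A i) c" "u' \<in> el (V i) c" "z = tp [A i, V i] c [r', u']" using tp2_cases[OF o c z] .
      note e = enX[OF c fam[OF i y'(1,2)]] and e' = enX[OF c fam[OF i z'(1,2)]]
      have eq': "tp [X, V i] c [en c (fam i c r u), u] = tp [X, V i] c [en c (fam i c r' u'), u']"
        using eq tap[OF c y'(1,2)] tap[OF c z'(1,2)] y'(3) z'(3) by simp
      have enq: "en c (fam i c r u) = en c (fam i c r' u')" and "u = u'"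
        using tp2(2,3)[OF X o(2) c e y'(2)] tp2(2,3)[OF X o(2) c e' z'(2)] eq' by simp_all
      have feq: "fam i c r u = fam i c r' u'"
        by (rule inj_onD[OF bij_betw_imp_inj_on[OF en[OF c]] enq fam[OF i y'(1,2)] fam[OF i z'(1,2)]])
      have "r = fam i c r u (c, Id C c, i, u)" by (rule fam_at[OF i c y'(1,2), symmetric])
      also have "\<dots> = fam i c r' u' (c, Id C c, i, u')" by (subst feq) (simp only: \<open>u = u'\<close>)
      also have "\<dots> = r'" by (rule fam_at[OF i c z'(1,2)])
      finally have "r = r'" .
      then show "y = z" using y'(3) z'(3) \<open>u = u'\<close> by simp
    next
      fix c z assume "inh c" "z \<in> ap ?t c ` el (Prod E [A i, V i]) c"
      then show "z \<in> el (Prod E [X, V i]) c" using ap_el[OF t(1)] by blast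
    next
      fix c z assume c: "inh c" and z: "z \<in> el (Prod E [X, V i]) c"
      obtain m u where z': "m \<in> el X c" "u \<in> el (V i) c" "z = tp [X, V i] c [m, u]" using tp2_cases[OF X o(2) c z] .
      obtain x where x: "x \<in> PX c" "m = en c x" using z'(1) bij_betw_imp_surj_on[OF en[OF c]] by blast
      have k0: "(c, Id C c, i, u) \<in> KX c" using st_id[OF c] i z'(2) by (simp add: KX_iff)
      note r = PX_el[OF x(1) k0]
      have "z = ap ?t c (tp [A i, V i] c [x (c, Id C c, i, u), u])"
        using tap[OF c r z'(2)] fam_of[OF i c x(1) z'(2)] x(2) z'(3) by simp
      then show "z \<in> ap ?t c ` el (Prod E [A i, V i]) c" using tp2(1)[OF o c r z'(2)] by blast
    qed
    then show ?thesis using t(1) tap by blast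
  qed
  then obtain \<theta> where \<theta>: "\<And>i. i \<in> I \<Longrightarrow> \<theta> i \<in> hom E (Prod E [A i, V i]) (Prod E [X, V i])" "\<And>i. i \<in> I \<Longrightarrow> is_iso E (\<theta> i)"
    "\<And>i c r u. i \<in> I \<Longrightarrow> inh c \<Longrightarrow> r \<in> el (A i) c \<Longrightarrow> u \<in> el (V i) c \<Longrightarrow> ap (\<theta> i) c (tp [A i, V i] c [r, u]) = tp [X, V i] c [en c (fam i c r u), u]"
    by metis
  have "pr E [X, V i] (Suc 0) \<bullet> \<theta> i = pr E [A i, V i] (Suc 0)" if i: "i \<in> I" for i
  proof (rule ext_stage[OF E_comp[OF \<theta>(1)[OF i] pr2_hom(3)[OF X Vo[OF i]]] pr2_hom(3)[OF Ao[OF i] Vo[OF i]]])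
    fix c z assume c: "inh c" and z: "z \<in> el (Prod E [A i, V i]) c"
    obtain r u where z': "r \<in> el (A i) c" "u \<in> el (V i) c" "z = tp [A i, V i] c [r, u]" using tp2_cases[OF Ao[OF i] Vo[OF i] c z] .
    show "ap (pr E [X, V i] (Suc 0) \<bullet> \<theta> i) c z = ap (pr E [A i, V i] (Suc 0)) c z"
      using ap_comp[OF \<theta>(1)[OF i] pr2_hom(3)[OF X Vo[OF i]] c z] \<theta>(3)[OF i c z'(1,2)] z'
        tp2(4)[OF X Vo[OF i] c enX[OF c fam[OF i z'(1,2)]] z'(2)] tp2(4)[OF Ao[OF i] Vo[OF i] c z'(1,2)] by simp
  qed
  then have tr: "trivialized E \<gamma> I \<zeta> R X \<theta>"
    unfolding trivialized_def set_family_def Let_def using \<theta>(1,2) X R by simp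
  have "times_obj E (A j) X (V j) (V i) (\<theta> j) \<bullet> \<sigma> [i, j] = arr_prod E (Id E X) (swap i j) \<bullet> times_obj E (A i) X (V i) (V j) (\<theta> i)"
    if N: "[i, j] \<in> ix NN (Suc 0)" for i j
  proof -
    have i: "i \<in> I" and j: "j \<in> I" using N by (auto simp: N1)
    note tj = times_obj[OF Ao[OF j] X Vo[OF j] Vo[OF i] \<theta>(1)[OF j]]
      and ti = times_obj[OF Ao[OF i] X Vo[OF i] Vo[OF j] \<theta>(1)[OF i]]
    note sw = swap[OF i j]
    note q = arr_prod[OF E_id[OF X] sw(1)]
    note \<sigma>h = \<sigma>_hom[OF ud N]
    show ?thesis
    proof (rule ext_stage[OF E_comp[OF \<sigma>h tj(1)] E_comp[OF ti(1) q(1)]])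
      fix c z assume c: "inh c" and z: "z \<in> el (AV i j) c"
      obtain r u v where m: "r \<in> el (A i) c" "u \<in> el (V i) c" "v \<in> el (V j) c" "z = tq i j c r u v" using tq_cases[OF i j c z] .
      let ?s = "sg \<sigma> i j c r u v"
      have s: "?s \<in> el (A j) c" using sg_el[OF ud i j c m(1-3)] .
      \<comment> \<open>The cocycle law: transporting from \<open>u\<close> to \<open>v\<close> and
        then onwards equals transporting directly, so \<open>(r, u)\<close> and its transport at
        \<open>v\<close> generate the same family.\<close>
      have feq: "fam j c ?s v = fam i c r u"
      proof (rule PX_ext[OF fam[OF j s m(3)] fam[OF i m(1,2)]])
        fix d f l w assume k: "(d, f, l, w) \<in> KX c"
        then have f: "f \<in> st d c" and l: "l \<in> I" and w: "w \<in> el (V l) d" by (simp_all add: KX_iff)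
        show "fam j c ?s v (d, f, l, w) = fam i c r u (d, f, l, w)"
          using famk[OF k] sg_rs[OF ud i j f m(1-3)]
            sg_comp[OF ud i j l st_inh[OF f] rs_el[OF Ao[OF i] f m(1)] rs_el[OF Vo[OF i] f m(2)] rs_el[OF Vo[OF j] f m(3)] w] by simp
      qed
      note e = enX[OF c fam[OF i m(1,2)]]
      have "ap (times_obj E (A j) X (V j) (V i) (\<theta> j) \<bullet> \<sigma> [i, j]) c z = tp [X, VV j i] c [en c (fam i c r u), tp [V j, V i] c [v, u]]"
        using ap_comp[OF \<sigma>h tj(1) c z] ap_\<sigma>[OF ud i j c m(1-3)] m(4)
          tj(2)[OF c s m(3,2) e m(3)] \<theta>(3)[OF j c s m(3)] feq by simp
      moreover have "ap (arr_prod E (Id E X) (swap i j) \<bullet> times_obj E (A i) X (V i) (V j) (\<theta> i)) c z =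
        tp [X, VV j i] c [en c (fam i c r u), tp [V j, V i] c [v, u]]"
        using ap_comp[OF ti(1) q(1) c z] ti(2)[OF c m(1-3) e m(2)] \<theta>(3)[OF i c m(1,2)] m(4)
          q(2)[OF c e tp2(1)[OF Vo[OF i] Vo[OF j] c m(2,3)]] ap_id[OF X c e] sw(2)[OF c m(2,3)] by simp
      ultimately show "ap (times_obj E (A j) X (V j) (V i) (\<theta> j) \<bullet> \<sigma> [i, j]) c z =
        ap (arr_prod E (Id E X) (swap i j) \<bullet> times_obj E (A i) X (V i) (V j) (\<theta> i)) c z" by simp
    qed
  qed
  then have "locally_constant E \<gamma> I \<zeta> R \<sigma> X \<theta>"
    unfolding locally_constant_def Let_def One_nat_def using tr ud by (simp add: swap_def)
  then show ?thesis by blast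
qed

end

end

section \<open>Lifting edges and triangles through the hypercover\<close>

context refinement
begin

abbreviation H1 where "H1 \<equiv> lev H (Suc 0)"
abbreviation H2 where "H2 \<equiv> lev H (Suc (Suc 0))"
abbreviation b0 where "b0 \<equiv> dd H (Suc 0) 0"
abbreviation b1 where "b1 \<equiv> dd H (Suc 0) (Suc 0)"
abbreviation f0 where "f0 \<equiv> dd H (Suc (Suc 0)) 0"
abbreviation f1 where "f1 \<equiv> dd H (Suc (Suc 0)) (Suc 0)"
abbreviation f2 where "f2 \<equiv> dd H (Suc (Suc 0)) (Suc (Suc 0))"

lemma Uo: "U \<in> Obj E"
  using E_obj(1)[OF \<zeta>] .

lemma b_hom: "b0 \<in> hom E H1 U" "b1 \<in> hom E H1 U"
  using H_d[of 0 0] H_d[of "Suc 0" 0] by (simp_all add: lev0)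

lemma s0_hom: "ss H 0 0 \<in> hom E U H1"
  using H_s[of 0 0] by (simp add: lev0)

lemma hyp: "is_hypercover E H"
  using ref by (simp add: hypercover_refinement_def)

text \<open>The coskeleton is known only by its universal property. The projections make the product
  of \<open>U\<close> with itself a cone over it, so a pair of points gives a section of the
  coskeleton, and the epimorphism from level 1 lifts that section locally.\<close>

lemma lift1:
  assumes c: "inh c" and u: "u \<in> el U c" and v: "v \<in> el U c"
  shows "loc c (\<lambda>d h. \<exists>x \<in> el H1 d. ap b1 d x = rs U h u \<and> ap b0 d x = rs U h v)"
proof -
  obtain M q e where M: "is_cosk E 0 H (Suc 0) M q" and e: "e \<in> hom E H1 M"
    and qe: "\<And>i. i \<le> Suc 0 \<Longrightarrow> q (omit i [0..<Suc (Suc 0)]) \<bullet> e = dd H (Suc 0) i" and epi: "is_epi E e"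
    using hyp[unfolded is_hypercover_def, THEN spec, of "Suc 0"] by auto
  have mm: "monotone_maps 0 (Suc 0) = {[0], [Suc 0]}"
  proof -
    have "x \<in> monotone_maps 0 (Suc 0) \<longleftrightarrow> x \<in> {[0], [Suc 0]}" for x
      by (cases x) (auto simp: monotone_maps_def)
    then show ?thesis by blast
  qed
  define p' where "p' x = (if x = [0::nat] then pr E [U, U] 0 else pr E [U, U] (Suc 0))" for x
  note P = pr2_hom[OF Uo Uo]
  have "cosk_cone E 0 H (Suc 0) (Prod E [U, U]) p'"
    unfolding cosk_cone_def using P Prod2_obj[OF Uo Uo] by (simp add: mm p'_def lev0)
  then obtain h where h: "h \<in> hom E (Prod E [U, U]) M" "\<forall>m\<le>0. \<forall>x\<in>monotone_maps m (Suc 0). q x \<bullet> h = p' x"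
    using M unfolding is_cosk_def by blast
  have q: "q [0] \<in> hom E M U" "q [Suc 0] \<in> hom E M U"
    using M unfolding is_cosk_def cosk_cone_def by (auto simp: mm lev0)
  have qh: "q [0] \<bullet> h = pr E [U, U] 0" "q [Suc 0] \<bullet> h = pr E [U, U] (Suc 0)" using h(2) by (auto simp: mm p'_def)
  have qe': "q [Suc 0] \<bullet> e = b0" "q [0] \<bullet> e = b1" using qe[of 0] qe[of "Suc 0"] by (simp_all add: omit_def)
  note z = tp2[OF Uo Uo c u v]
  let ?m = "ap h c (tp [U, U] c [u, v])"
  have m: "?m \<in> el M c" by (rule ap_el[OF h(1) c z(1)])
  have qm: "ap (q [0]) c ?m = u" "ap (q [Suc 0]) c ?m = v"
    using ap_comp[OF h(1) q(1) c z(1)] ap_comp[OF h(1) q(2) c z(1)] qh z by simp_all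
  show ?thesis
  proof (rule loc_mono[OF epi_loc[OF epi e c m]])
    fix d k assume k: "k \<in> st d c" and "\<exists>x\<in>el H1 d. ap e d x = rs M k ?m"
    then obtain x where x: "x \<in> el H1 d" "ap e d x = rs M k ?m" by blast
    note d = st_inh[OF k]
    have "ap b1 d x = rs U k u" "ap b0 d x = rs U k v"
      using ap_comp[OF e q(1) d x(1)] ap_comp[OF e q(2) d x(1)] qe' x(2) ap_rs[OF q(1) k m] ap_rs[OF q(2) k m] qm by simp_all
    then show "\<exists>x\<in>el H1 d. ap b1 d x = rs U k u \<and> ap b0 d x = rs U k v" using x(1) by blast
  qed
qed

text \<open>Three edges with matching ends should be a section of the coskeleton at level 2. To
  obtain it, the object of all such triples is made a cone, and then the epimorphism from level 2 is
  used.\<close>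

lemma lift2:
  assumes c: "inh c" and x: "x \<in> el H1 c" and y: "y \<in> el H1 c" and w: "w \<in> el H1 c"
    and xy: "ap b0 c x = ap b1 c y" and xw: "ap b1 c x = ap b1 c w" and yw: "ap b0 c y = ap b0 c w"
  shows "loc c (\<lambda>d h. \<exists>z \<in> el H2 d. ap f2 d z = rs H1 h x \<and>
    ap f0 d z = rs H1 h y \<and> ap f1 d z = rs H1 h w)"
proof -
  let ?H1 = "H1"
  obtain M q e where M: "is_cosk E (Suc 0) H (Suc (Suc 0)) M q" and e: "e \<in> hom E H2 M"
    and qe: "\<And>i. i \<le> Suc (Suc 0) \<Longrightarrow> q (omit i [0..<Suc (Suc (Suc 0))]) \<bullet> e = dd H (Suc (Suc 0)) i" and epi: "is_epi E e"
    using hyp[unfolded is_hypercover_def, THEN spec, of "Suc (Suc 0)"] by auto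
  define K' where "K' = {0, 1, 2 :: nat}"
  \<comment> \<open>Entry \<open>k\<close> of \<open>t\<close> is to be the \<open>k\<close>-th face
    of a triangle: entries 2, 0 and 1 are the edges from 0 to 1, from 1 to 2 and from 0 to 2. The
    equations say that they meet at the three vertices.\<close>
  define Q where "Q c t \<longleftrightarrow> ap b0 c (t 2) = ap b1 c (t 0) \<and> ap b1 c (t 2) = ap b1 c (t 1) \<and> ap b0 c (t 0) = ap b0 c (t (1::nat))" for c and t :: "nat \<Rightarrow> 'u"
  obtain Z \<pi> where Z: "subproduct K' (\<lambda>_. ?H1) Q Z \<pi>"
  proof (rule subproduct_exists[of K' "\<lambda>_. ?H1" Q])
    show "finite K'" by (simp add: K'_def)
    show "?H1 \<in> Obj E" by (rule H_obj)
    fix c d h t assume h: "h \<in> st d c" and t: "t \<in> (\<Pi>\<^sub>E k\<in>K'. el ?H1 c)" and Q: "Q c t"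
    have tm: "t 0 \<in> el ?H1 c" "t 1 \<in> el ?H1 c" "t 2 \<in> el ?H1 c" using t by (auto simp: K'_def PiE_iff)
    then show "Q d (\<lambda>k\<in>K'. rs ?H1 h (t k))"
      using Q ap_rs[OF b_hom(1) h] ap_rs[OF b_hom(2) h] by (simp add: Q_def K'_def)
  next
    fix c t assume c: "inh c" and t: "t \<in> (\<Pi>\<^sub>E k\<in>K'. el ?H1 c)" and L: "loc c (\<lambda>d h. Q d (\<lambda>k\<in>K'. rs ?H1 h (t k)))"
    have tm: "t 0 \<in> el ?H1 c" "t 1 \<in> el ?H1 c" "t 2 \<in> el ?H1 c" using t by (auto simp: K'_def PiE_iff)
    have s: "ap g c a = ap g' c b" if g: "g \<in> hom E ?H1 U" "g' \<in> hom E ?H1 U" and ab: "a \<in> el ?H1 c" "b \<in> el ?H1 c"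
      and e: "\<And>d h. Q d (\<lambda>k\<in>K'. rs ?H1 h (t k)) \<Longrightarrow> ap g d (rs ?H1 h a) = ap g' d (rs ?H1 h b)" for g g' a b
    proof (rule sep[OF Uo c ap_el[OF g(1) c ab(1)] ap_el[OF g(2) c ab(2)]], rule loc_mono[OF L])
      fix d h assume h: "h \<in> st d c" and "Q d (\<lambda>k\<in>K'. rs ?H1 h (t k))"
      then show "rs U h (ap g c a) = rs U h (ap g' c b)"
        using e ap_rs[OF g(1) h ab(1)] ap_rs[OF g(2) h ab(2)] by simp
    qed
    show "Q c t" unfolding Q_def
      by (intro conjI s b_hom tm) (simp_all add: Q_def K'_def)
  qed
  note Zo = subproduct_obj[OF Z]
  have \<pi>: "\<pi> 0 \<in> hom E Z ?H1" "\<pi> (Suc 0) \<in> hom E Z ?H1" "\<pi> 2 \<in> hom E Z ?H1"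
    using subproduct_pr[OF Z] by (auto simp: K'_def)
  have Zb: "ap b0 c (ap (\<pi> 2) c m) = ap b1 c (ap (\<pi> 0) c m)" "ap b1 c (ap (\<pi> 2) c m) = ap b1 c (ap (\<pi> (Suc 0)) c m)"
    "ap b0 c (ap (\<pi> 0) c m) = ap b0 c (ap (\<pi> (Suc 0)) c m)" if "inh c" "m \<in> el Z c" for c m
    using subproduct_Q[OF Z that] by (simp_all add: Q_def K'_def)
  \<comment> \<open>The cone carried by the universal triangle: \<open>vt a\<close> is its vertex
    \<open>a\<close>, and \<open>ed a b\<close> its edge from \<open>a\<close> to \<open>b\<close>,
    taken degenerate if \<open>a = b\<close>. A cone also has values at the constant lists of length
    two, hence the degenerate edges.\<close>
  define vt where "vt a = (if a = 0 then b1 \<bullet> \<pi> 2 else if a = Suc 0 then b0 \<bullet> \<pi> 2 else b0 \<bullet> \<pi> 0)" for a :: nat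
  define ed where "ed a b = (if a = b then ss H 0 0 \<bullet> vt a else if (a, b) = (0, Suc 0) then \<pi> 2 else if a = 0 then \<pi> (Suc 0) else \<pi> 0)" for a b :: nat
  define r where "r x = (if length x = Suc 0 then vt (x ! 0) else ed (x ! 0) (x ! 1))" for x :: "nat list"
  have vt: "vt a \<in> hom E Z U" for a
    using E_comp[OF \<pi>(3) b_hom(2)] E_comp[OF \<pi>(3) b_hom(1)] E_comp[OF \<pi>(1) b_hom(1)] by (simp add: vt_def)
  have ed: "ed a b \<in> hom E Z ?H1" for a b
    using E_comp[OF vt s0_hom] \<pi> by (simp add: ed_def)
  have bb: "b1 \<bullet> ed a b = vt a \<and> b0 \<bullet> ed a b = vt b" if ab: "a \<le> b" "b \<le> Suc (Suc 0)" for a b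
  proof -
    consider "a = b" | "a = 0 \<and> b = Suc 0" | "a = 0 \<and> b = Suc (Suc 0)" | "a = Suc 0 \<and> b = Suc (Suc 0)"
      using ab by linarith
    then have "ap b1 c (ap (ed a b) c m) = ap (vt a) c m \<and> ap b0 c (ap (ed a b) c m) = ap (vt b) c m"
      if c: "inh c" and m: "m \<in> el Z c" for c m
    proof cases
      case 1
      then show ?thesis
        using ap_comp[OF vt s0_hom c m] H_ds[of _ c "ap (vt a) c m"] c ap_el[OF vt c m] by (simp add: ed_def lev0)
    qed (use Zb[OF c m] ap_comp[OF \<pi>(3) b_hom(1) c m] ap_comp[OF \<pi>(3) b_hom(2) c m] ap_comp[OF \<pi>(1) b_hom(1) c m] in \<open>auto simp: ed_def vt_def\<close>)
    then show ?thesis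
      using ap_comp[OF ed b_hom(1)] ap_comp[OF ed b_hom(2)]
      by (intro conjI ext_stage[OF E_comp[OF ed b_hom(2)] vt] ext_stage[OF E_comp[OF ed b_hom(1)] vt]) auto
  qed
  have mm1: "\<exists>a b. x = [a, b] \<and> a \<le> b \<and> b \<le> k" if "x \<in> monotone_maps (Suc 0) k" for x k
    using that by (auto simp: monotone_maps_def length_Suc_conv)
  have mm0: "\<exists>a. x = [a] \<and> a \<le> k" if "x \<in> monotone_maps 0 k" for x k
    using that by (auto simp: monotone_maps_def length_Suc_conv)
  have "cosk_cone E (Suc 0) H (Suc (Suc 0)) Z r"
    unfolding cosk_cone_def
  proof (intro conjI allI impI ballI Zo)
    fix m x assume m: "m \<le> Suc 0" and x: "x \<in> monotone_maps m (Suc (Suc 0))"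
    have "m = 0 \<or> m = Suc 0" using m by linarith
    then show "r x \<in> hom E Z (lev H m)"
      using mm0[of x "Suc (Suc 0)"] mm1[of x "Suc (Suc 0)"] x vt ed by (auto simp: r_def lev0)
  next
    fix m x i assume m: "Suc m \<le> Suc 0" and x: "x \<in> monotone_maps (Suc m) (Suc (Suc 0))" and i: "i \<le> Suc m"
    then have m0: "m = 0" by simp
    then obtain a b where x': "x = [a, b]" "a \<le> b" "b \<le> Suc (Suc 0)" using mm1 x by blast
    have "i = 0 \<or> i = Suc 0" using i m0 by auto
    then show "r (omit i x) = dd H (Suc m) i \<bullet> r x"
      using bb[OF x'(2,3)] by (auto simp: r_def x'(1) omit_def m0)
  next
    fix m x i assume m: "Suc m \<le> Suc 0" and x: "x \<in> monotone_maps m (Suc (Suc 0))" and i: "i \<le> m"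
    then have m0: "m = 0" "i = 0" by auto
    then obtain a where "x = [a]" using mm0 x by blast
    then show "r (double i x) = ss H m i \<bullet> r x" by (simp add: r_def double_def m0 ed_def)
  qed
  then obtain h where h: "h \<in> hom E Z M" "\<forall>m\<le>Suc 0. \<forall>x\<in>monotone_maps m (Suc (Suc 0)). q x \<bullet> h = r x"
    using M unfolding is_cosk_def by blast
  have e2: "[a, b] \<in> monotone_maps (Suc 0) (Suc (Suc 0))" if "a \<le> b" "b \<le> Suc (Suc 0)" for a b
    using that by (simp add: monotone_maps_def)
  have q: "q [a, b] \<in> hom E M ?H1" if "a \<le> b" "b \<le> Suc (Suc 0)" for a b
    using M[unfolded is_cosk_def, THEN conjunct1, unfolded cosk_cone_def, THEN conjunct2, THEN conjunct1, rule_format, OF le_refl e2[OF that]] .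
  have qh: "q [a, b] \<bullet> h = ed a b" if "a \<le> b" "b \<le> Suc (Suc 0)" for a b
    using h(2) e2[OF that] by (auto simp: r_def)
  note q01 = q[of 0 "Suc 0", simplified] and q02 = q[of 0 "Suc (Suc 0)", simplified] and q12 = q[of "Suc 0" "Suc (Suc 0)", simplified]
  have qe': "q [Suc 0, Suc (Suc 0)] \<bullet> e = f0" "q [0, Suc (Suc 0)] \<bullet> e = f1" "q [0, Suc 0] \<bullet> e = f2"
    using qe[of 0] qe[of "Suc 0"] qe[of "Suc (Suc 0)"] by (simp_all add: omit_def)
  define t where "t = (\<lambda>k\<in>K'. if k = 0 then y else if k = 1 then w else x)"
  have tP: "t \<in> (\<Pi>\<^sub>E k\<in>K'. el ?H1 c)" using x y w by (auto simp: t_def K'_def)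
  have "Q c t" using xy xw yw by (simp add: Q_def t_def K'_def)
  with subproduct_ex[OF Z c tP] obtain z0 where z0: "z0 \<in> el Z c" "\<forall>k\<in>K'. ap (\<pi> k) c z0 = t k" by blast
  have \<pi>z: "ap (\<pi> 0) c z0 = y" "ap (\<pi> (Suc 0)) c z0 = w" "ap (\<pi> 2) c z0 = x" using z0(2) by (auto simp: K'_def t_def)
  define m where "m = ap h c z0"
  have m: "m \<in> el M c" unfolding m_def by (rule ap_el[OF h(1) c z0(1)])
  have qm: "ap (q [0, Suc 0]) c m = x" "ap (q [0, Suc (Suc 0)]) c m = w" "ap (q [Suc 0, Suc (Suc 0)]) c m = y"
    using ap_comp[OF h(1) q01 c z0(1)] ap_comp[OF h(1) q02 c z0(1)] ap_comp[OF h(1) q12 c z0(1)] \<pi>z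
      qh[of 0 "Suc 0"] qh[of 0 "Suc (Suc 0)"] qh[of "Suc 0" "Suc (Suc 0)"] by (simp_all add: m_def ed_def)
  show ?thesis
  proof (rule loc_mono[OF epi_loc[OF epi e c m]])
    fix d k assume k: "k \<in> st d c" and "\<exists>z\<in>el H2 d. ap e d z = rs M k m"
    then obtain z where z: "z \<in> el H2 d" "ap e d z = rs M k m" by blast
    note d = st_inh[OF k]
    have "ap f2 d z = rs ?H1 k x" "ap f0 d z = rs ?H1 k y" "ap f1 d z = rs ?H1 k w"
      using ap_comp[OF e q01 d z(1)] ap_comp[OF e q02 d z(1)] ap_comp[OF e q12 d z(1)] qe' z(2)
        ap_rs[OF q01 k m] ap_rs[OF q02 k m] ap_rs[OF q12 k m] qm by simp_all
    then show "\<exists>z\<in>el H2 d. ap f2 d z = rs ?H1 k x \<and> ap f0 d z = rs ?H1 k y \<and> ap f1 d z = rs ?H1 k w"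
      using z(1) by blast
  qed
qed

text \<open>\<open>x\<close> is a section of level \<open>n\<close> whose index is constantly
  \<open>w\<close>; in other words it comes from the component of \<open>w\<close>. It is kept in
  the whole level, where the faces of different simplices can be compared.\<close>

definition at :: "nat \<Rightarrow> 'u \<Rightarrow> 'u \<Rightarrow> 'u \<Rightarrow> bool" where
  "at n c x w \<longleftrightarrow> x \<in> el (lev H n) c \<and> w \<in> lev S n \<and> ap (p n) c x = kap (lev S n) w c"

lemma at_rs: "at n c x w \<Longrightarrow> h \<in> st d c \<Longrightarrow> at n d (rs (lev H n) h x) w"
  unfolding at_def using rs_el[OF H_obj] ap_rs[OF p_hom] kap_rs[OF S_small] by simp

lemma at_uniq: "at n c x w \<Longrightarrow> at n c x w' \<Longrightarrow> inh c \<Longrightarrow> w = w'"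
  unfolding at_def using kap_inj[OF S_small] by metis

lemma at_total: "inh c \<Longrightarrow> x \<in> el (lev H n) c \<Longrightarrow> loc c (\<lambda>d h. \<exists>w. at n d (rs (lev H n) h x) w)"
  by (rule loc_mono[OF kap_loc[OF S_small _ ap_el[OF p_hom]]])
    (use rs_el[OF H_obj] ap_rs[OF p_hom] in \<open>auto simp: at_def\<close>)

lemma at_d: "at (Suc n) c x w \<Longrightarrow> inh c \<Longrightarrow> i \<le> Suc n \<Longrightarrow> at n c (ap (dd H (Suc n) i) c x) (sm_fun (dd S (Suc n) i) w)"
  unfolding at_def using ap_el[OF H_d] S_d_in pd by blast

lemma at_s: "at n c x w \<Longrightarrow> inh c \<Longrightarrow> i \<le> n \<Longrightarrow> at (Suc n) c (ap (ss H n i) c x) (sm_fun (ss S n i) w)"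
  unfolding at_def using ap_el[OF H_s] S_s_in ps by blast

section \<open>The descent datum determined by bijections on the edges\<close>

context
  fixes s
  assumes sd: "S_descent_datum E \<gamma> F R s"
begin

text \<open>Locally the three edges are the faces of a 2-simplex with some index, and the
  composition law of \<open>s\<close> holds for that index. The conclusion is about maps of sets, so
  a single stage below \<open>c\<close> suffices.\<close>

lemma triangle:
  assumes c: "inh c" and x: "at (Suc 0) c x l" and y: "at (Suc 0) c y t" and w: "at (Suc 0) c w k"
    and xy: "ap b0 c x = ap b1 c y" and xw: "ap b1 c x = ap b1 c w" and yw: "ap b0 c y = ap b0 c w"
  shows "s k = Comp SET (s t) (s l)"
proof -
  note el = x[unfolded at_def, THEN conjunct1] y[unfolded at_def, THEN conjunct1] w[unfolded at_def, THEN conjunct1]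
  obtain d h where h: "h \<in> st d c" and "\<exists>z\<in>el H2 d. ap f2 d z = rs H1 h x \<and>
    ap f0 d z = rs H1 h y \<and> ap f1 d z = rs H1 h w"
    using loc_ex[OF c lift2[OF c el xy xw yw]] by blast
  then obtain z where z: "z \<in> el H2 d" "ap f2 d z = rs H1 h x"
    "ap f0 d z = rs H1 h y" "ap f1 d z = rs H1 h w" by blast
  obtain e g v where g: "g \<in> st e d" and v: "at (Suc (Suc 0)) e (rs H2 g z) v"
    using loc_ex[OF st_inh[OF h] at_total[OF st_inh[OF h] z(1)]] by blast
  note ei = st_inh[OF g]
  have face: "sm_fun (dd S (Suc (Suc 0)) i) v = l'"
    if "i \<le> Suc (Suc 0)" "ap (dd H (Suc (Suc 0)) i) d z = rs H1 h x'" "at (Suc 0) c x' l'" for i x' l'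
  proof -
    have "ap (dd H (Suc (Suc 0)) i) e (rs H2 g z) = rs H1 g (rs H1 h x')"
      using ap_rs[OF H_d[OF that(1)] g z(1)] that(2) by simp
    then show ?thesis using at_uniq[OF at_d[OF v ei that(1)] _ ei] at_rs[OF at_rs[OF that(3) h] g] by simp
  qed
  have "v \<in> lev S (Suc (Suc 0))" using v by (simp add: at_def)
  from s_comp[OF sd this] show ?thesis
    using face[OF _ z(2) x] face[OF _ z(3) y] face[OF _ z(4) w] by simp
qed

lemma s_degenerate:
  assumes c: "inh c" and u: "at 0 c u i"
  shows "at (Suc 0) c (ap (ss H 0 0) c u) (sm_fun (ss S 0 0) i)" "s (sm_fun (ss S 0 0) i) = Id SET (R i)"
    "ap b0 c (ap (ss H 0 0) c u) = u" "ap b1 c (ap (ss H 0 0) c u) = u"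
  using at_s[OF u c le0] s_id[OF sd] H_ds[OF _ c] u by (auto simp: at_def)

text \<open>Two edges with the same ends close up to a triangle whose remaining side is the
  degenerate edge at the common target; the bijection of that side is the identity. This makes the
  transition maps independent of the chosen lifts.\<close>

lemma s_parallel:
  assumes c: "inh c" and x: "at (Suc 0) c x l" and y: "at (Suc 0) c y t"
    and "ap b1 c x = ap b1 c y" "ap b0 c x = ap b0 c y"
  shows "s l = s t"
proof -
  note v = at_d[OF x c, of 0, simplified]
  note g = s_degenerate[OF c v]
  have l: "l \<in> lev S (Suc 0)" using x by (simp add: at_def)
  have "s t = Comp SET (s (sm_fun (ss S 0 0) (trg l))) (s l)"
    by (rule triangle[OF c x g(1) y]) (use g assms(4,5) in auto)
  then show ?thesis using g(2) comp_id(2)[OF SET_category s_hom[OF sd l]] by simp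
qed

text \<open>The graph of the transition map that \<open>s\<close> prescribes: \<open>r'\<close> is
  the image of \<open>r\<close> under the bijection of some edge from \<open>u\<close> to
  \<open>v\<close>.\<close>

definition G :: "'u \<Rightarrow> 'u \<Rightarrow> 'u \<Rightarrow> 'u \<Rightarrow> 'u \<Rightarrow> 'u \<Rightarrow> 'u \<Rightarrow> bool" where
  "G i j c r u v r' \<longleftrightarrow> (\<exists>l x. at (Suc 0) c x l \<and> src l = i \<and> trg l = j \<and> ap b1 c x = ap (cc i) c u \<and> ap b0 c x = ap (cc j) c v \<and>
     r' = ap (on_arr \<gamma> (s l)) c r)"

lemma at_cc: "i \<in> I \<Longrightarrow> inh c \<Longrightarrow> u \<in> el (V i) c \<Longrightarrow> at 0 c (ap (cc i) c u) i"
  using cc_kap ap_el[OF cc_hom] by (simp add: at_def lev0)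

text \<open>The ends of an edge have the ends of its index as indices, and constant sections are
  distinct for distinct indices. Hence an edge over \<open>u\<close> and \<open>v\<close>
  automatically runs from \<open>i\<close> to \<open>j\<close>.\<close>

lemma G_I:
  assumes ij: "i \<in> I" "j \<in> I" and c: "inh c" and u: "u \<in> el (V i) c" and v: "v \<in> el (V j) c"
    and x: "at (Suc 0) c x l" "ap b1 c x = ap (cc i) c u" "ap b0 c x = ap (cc j) c v"
  shows "src l = i" "trg l = j" "G i j c r u v (ap (on_arr \<gamma> (s l)) c r)"
proof -
  show 1: "src l = i" using at_uniq[OF at_d[OF x(1) c, of "Suc 0"] _ c] at_cc[OF ij(1) c u] x(2) by simp
  show 2: "trg l = j" using at_uniq[OF at_d[OF x(1) c, of 0] _ c] at_cc[OF ij(2) c v] x(3) by simp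
  show "G i j c r u v (ap (on_arr \<gamma> (s l)) c r)" unfolding G_def using x 1 2 by blast
qed

lemma G_el:
  assumes "G i j c r u v r'" "inh c" "r \<in> el (A i) c"
  shows "r' \<in> el (A j) c"
proof -
  obtain l x where l: "at (Suc 0) c x l" "src l = i" "trg l = j" "r' = ap (on_arr \<gamma> (s l)) c r" using assms(1) unfolding G_def by blast
  have "l \<in> lev S (Suc 0)" using l(1) by (simp add: at_def)
  then show ?thesis using ap_el[OF \<gamma>_hom[OF s_hom[OF sd]] assms(2)] assms(3) l by blast
qed

lemma G_rs:
  assumes h: "h \<in> st d c" and ij: "i \<in> I" "j \<in> I" and m: "r \<in> el (A i) c" "u \<in> el (V i) c" "v \<in> el (V j) c" and G: "G i j c r u v r'"
  shows "G i j d (rs (A i) h r) (rs (V i) h u) (rs (V j) h v) (rs (A j) h r')"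
proof -
  obtain l x where l: "at (Suc 0) c x l" "src l = i" "trg l = j" "ap b1 c x = ap (cc i) c u" "ap b0 c x = ap (cc j) c v"
    "r' = ap (on_arr \<gamma> (s l)) c r" using G unfolding G_def by blast
  have lS: "l \<in> lev S (Suc 0)" and x: "x \<in> el H1 c" using l(1) by (simp_all add: at_def)
  have "s l \<in> hom SET (R i) (R j)" using s_hom[OF sd lS] l(2,3) by simp
  note gs = \<gamma>_hom[OF this]
  have "rs (A j) h r' = ap (on_arr \<gamma> (s l)) d (rs (A i) h r)" using ap_rs[OF gs h m(1)] l(6) by simp
  moreover have "ap b1 d (rs H1 h x) = ap (cc i) d (rs (V i) h u)"
    using ap_rs[OF b_hom(2) h x] ap_rs[OF cc_hom[OF ij(1)] h m(2)] l(4) by simp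
  moreover have "ap b0 d (rs H1 h x) = ap (cc j) d (rs (V j) h v)"
    using ap_rs[OF b_hom(1) h x] ap_rs[OF cc_hom[OF ij(2)] h m(3)] l(5) by simp
  ultimately show ?thesis unfolding G_def using at_rs[OF l(1) h] l(2,3) by blast
qed

lemma G_uniq:
  assumes "inh c" "G i j c r u v r'" "G i j c r u v r''"
  shows "r' = r''"
proof -
  obtain l x where l: "at (Suc 0) c x l" "ap b1 c x = ap (cc i) c u" "ap b0 c x = ap (cc j) c v"
    "r' = ap (on_arr \<gamma> (s l)) c r" using assms(2) unfolding G_def by blast
  obtain t y where t: "at (Suc 0) c y t" "ap b1 c y = ap (cc i) c u" "ap b0 c y = ap (cc j) c v"
    "r'' = ap (on_arr \<gamma> (s t)) c r" using assms(3) unfolding G_def by blast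
  have "s l = s t" by (rule s_parallel[OF assms(1) l(1) t(1)]) (use l t in auto)
  then show ?thesis using l t by simp
qed

text \<open>Two successive localizations: one to lift the pair of points to an edge, one to give
  that edge a constant index.\<close>

lemma edge_exists:
  assumes ij: "i \<in> I" "j \<in> I" and c: "inh c" and u: "u \<in> el (V i) c" and v: "v \<in> el (V j) c"
  shows "loc c (\<lambda>d h. \<exists>x l. at (Suc 0) d x l \<and> ap b1 d x = ap (cc i) d (rs (V i) h u) \<and> ap b0 d x = ap (cc j) d (rs (V j) h v))"
proof (rule loc_trans[OF c], rule loc_mono[OF lift1[OF c ap_el[OF cc_hom[OF ij(1)] c u] ap_el[OF cc_hom[OF ij(2)] c v]]])
  fix d h assume h: "h \<in> st d c" and "\<exists>x\<in>el H1 d. ap b1 d x = rs U h (ap (cc i) c u) \<and> ap b0 d x = rs U h (ap (cc j) c v)"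
  then obtain x where x: "x \<in> el H1 d" "ap b1 d x = rs U h (ap (cc i) c u)" "ap b0 d x = rs U h (ap (cc j) c v)" by blast
  show "loc d (\<lambda>e g. \<exists>x l. at (Suc 0) e x l \<and> ap b1 e x = ap (cc i) e (rs (V i) (h \<odot> g) u) \<and> ap b0 e x = ap (cc j) e (rs (V j) (h \<odot> g) v))"
  proof (rule loc_mono[OF at_total[OF st_inh[OF h] x(1)]])
    fix e g assume g: "g \<in> st e d" and "\<exists>w. at (Suc 0) e (rs H1 g x) w"
    then obtain l where l: "at (Suc 0) e (rs H1 g x) l" by blast
    note hg = st_comp[OF h g]
    have "ap b1 e (rs H1 g x) = ap (cc i) e (rs (V i) (h \<odot> g) u)"
      using ap_rs[OF b_hom(2) g x(1)] x(2) ap_rs[OF cc_hom[OF ij(1)] hg u] rs_comp[OF Uo h g ap_el[OF cc_hom[OF ij(1)] c u]] by simp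
    moreover have "ap b0 e (rs H1 g x) = ap (cc j) e (rs (V j) (h \<odot> g) v)"
      using ap_rs[OF b_hom(1) g x(1)] x(3) ap_rs[OF cc_hom[OF ij(2)] hg v] rs_comp[OF Uo h g ap_el[OF cc_hom[OF ij(2)] c v]] by simp
    ultimately show "\<exists>x l. at (Suc 0) e x l \<and> ap b1 e x = ap (cc i) e (rs (V i) (h \<odot> g) u) \<and> ap b0 e x = ap (cc j) e (rs (V j) (h \<odot> g) v)"
      using l by blast
  qed
qed

lemma G_total:
  assumes ij: "i \<in> I" "j \<in> I" and c: "inh c" and m: "r \<in> el (A i) c" "u \<in> el (V i) c" "v \<in> el (V j) c"
  shows "loc c (\<lambda>d h. \<exists>r'. G i j d (rs (A i) h r) (rs (V i) h u) (rs (V j) h v) r')"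
proof (rule loc_mono[OF edge_exists[OF ij c m(2,3)]])
  fix d h assume h: "h \<in> st d c" and "\<exists>x l. at (Suc 0) d x l \<and> ap b1 d x = ap (cc i) d (rs (V i) h u) \<and> ap b0 d x = ap (cc j) d (rs (V j) h v)"
  then show "\<exists>r'. G i j d (rs (A i) h r) (rs (V i) h u) (rs (V j) h v) r'"
    using G_I(3)[OF ij st_inh[OF h] rs_el[OF Vo[OF ij(1)] h m(2)] rs_el[OF Vo[OF ij(2)] h m(3)]] by blast
qed

text \<open>\<open>G\<close> is single-valued by \<open>s_parallel\<close> and locally total by
  \<open>edge_exists\<close>, so it defines transition maps. The unit law is seen on a degenerate
  edge, the cocycle law on three edges forming a triangle. The correspondence holds because a point
  of the component of \<open>l\<close> is itself an edge over its two ends.\<close>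

lemma U_descent_exists:
  obtains \<sigma> where "U_descent_datum E \<gamma> I \<zeta> R \<sigma>" "corresponding E \<gamma> I \<zeta> F R \<sigma> (induced s)"
proof -
  have "\<exists>t \<in> hom E (AV i j) (A j). \<forall>c r u v r'. inh c \<longrightarrow> r \<in> el (A i) c \<longrightarrow> u \<in> el (V i) c \<longrightarrow> v \<in> el (V j) c \<longrightarrow>
      G i j c r u v r' \<longrightarrow> ap t c (tq i j c r u v) = r'" if ij: "i \<in> I" "j \<in> I" for i j
  proof -
    note o = Prod2_obj[OF Ao[OF ij(1)] V2o[OF ij]]
    define W where "W c z r' \<longleftrightarrow> (\<exists>r u v. r \<in> el (A i) c \<and> u \<in> el (V i) c \<and> v \<in> el (V j) c \<and> z = tq i j c r u v \<and> G i j c r u v r')" for c z r'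
    obtain t where t: "t \<in> hom E (AV i j) (A j)"
      "\<And>c z r'. inh c \<Longrightarrow> z \<in> el (AV i j) c \<Longrightarrow> W c z r' \<Longrightarrow> ap t c z = r'"
    proof (rule arrow_of_graph[OF o Ao[OF ij(2)], of W])
      show "r' \<in> el (A j) c" if "inh c" "W c z r'" for c z r' using that G_el unfolding W_def by blast
      show "W d (rs (AV i j) h z) (rs (A j) h r')" if h: "h \<in> st d c" and W: "W c z r'" for c d h z r'
      proof -
        obtain r u v where m: "r \<in> el (A i) c" "u \<in> el (V i) c" "v \<in> el (V j) c" "z = tq i j c r u v" "G i j c r u v r'"
          using W unfolding W_def by blast
        show ?thesis unfolding W_def
          using tq_rs[OF ij h m(1-3)] G_rs[OF h ij m(1-3,5)] m(4) rs_el[OF Ao[OF ij(1)] h m(1)] rs_el[OF Vo[OF ij(1)] h m(2)] rs_el[OF Vo[OF ij(2)] h m(3)]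
          by blast
      qed
      show "x = y" if c: "inh c" and xy: "W c z x" "W c z y" for c z x y
      proof -
        obtain r u v where m: "r \<in> el (A i) c" "u \<in> el (V i) c" "v \<in> el (V j) c" "z = tq i j c r u v" "G i j c r u v x"
          using xy(1) unfolding W_def by blast
        obtain r' u' v' where m': "r' \<in> el (A i) c" "u' \<in> el (V i) c" "v' \<in> el (V j) c" "z = tq i j c r' u' v'" "G i j c r' u' v' y"
          using xy(2) unfolding W_def by blast
        have "r = r'" "u = u'" "v = v'" using tq_inj[OF ij c m(1-3) m'(1-3)] m(4) m'(4) by auto
        then show ?thesis using G_uniq[OF c m(5)] m'(5) by simp
      qed
      show "loc c (\<lambda>d h. \<exists>y. W d (rs (AV i j) h z) y)"
        if c: "inh c" and z: "z \<in> el (AV i j) c" for c z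
      proof -
        obtain r u v where m: "r \<in> el (A i) c" "u \<in> el (V i) c" "v \<in> el (V j) c" "z = tq i j c r u v" using tq_cases[OF ij c z] .
        show ?thesis
        proof (rule loc_mono[OF G_total[OF ij c m(1-3)]])
          fix d h assume h: "h \<in> st d c" and "\<exists>r'. G i j d (rs (A i) h r) (rs (V i) h u) (rs (V j) h v) r'"
          then show "\<exists>y. W d (rs (AV i j) h z) y"
            unfolding W_def using tq_rs[OF ij h m(1-3)] m(4) rs_el[OF Ao[OF ij(1)] h m(1)] rs_el[OF Vo[OF ij(1)] h m(2)] rs_el[OF Vo[OF ij(2)] h m(3)] by blast
        qed
      qed
    qed blast
    have "ap t c (tq i j c r u v) = r'" if "inh c" "r \<in> el (A i) c" "u \<in> el (V i) c" "v \<in> el (V j) c" "G i j c r u v r'" for c r u v r'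
      by (rule t(2)[OF that(1) tq[OF ij that(1-4)]]) (use that in \<open>unfold W_def, blast\<close>)
    then show ?thesis using t(1) by blast
  qed
  then obtain t where t: "\<And>i j. i \<in> I \<Longrightarrow> j \<in> I \<Longrightarrow> t i j \<in> hom E (AV i j) (A j)"
    "\<And>i j c r u v r'. i \<in> I \<Longrightarrow> j \<in> I \<Longrightarrow> inh c \<Longrightarrow> r \<in> el (A i) c \<Longrightarrow> u \<in> el (V i) c \<Longrightarrow> v \<in> el (V j) c \<Longrightarrow>
      G i j c r u v r' \<Longrightarrow> ap (t i j) c (tq i j c r u v) = r'" by metis
  define g where "g i j c r u v = ap (t i j) c (tq i j c r u v)" for i j c r u v
  have g_el: "g i j c r u v \<in> el (A j) c" if "i \<in> I" "j \<in> I" "inh c" "r \<in> el (A i) c" "u \<in> el (V i) c" "v \<in> el (V j) c" for i j c r u v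
    unfolding g_def by (rule ap_el[OF t(1)[OF that(1,2)] that(3) tq[OF that]])
  have g_rs: "rs (A j) h (g i j c r u v) = g i j d (rs (A i) h r) (rs (V i) h u) (rs (V j) h v)"
    if "i \<in> I" "j \<in> I" "h \<in> st d c" "r \<in> el (A i) c" "u \<in> el (V i) c" "v \<in> el (V j) c" for i j h d c r u v
    unfolding g_def
    using ap_rs[OF t(1)[OF that(1,2)] that(3) tq[OF that(1,2) st_inh'[OF that(3)] that(4-6)]] tq_rs[OF that] by simp
  have gG: "g i j c r u v = r'" if "i \<in> I" "j \<in> I" "inh c" "r \<in> el (A i) c" "u \<in> el (V i) c" "v \<in> el (V j) c" "G i j c r u v r'" for i j c r u v r'
    unfolding g_def using t(2)[OF that] .
  obtain \<sigma> where \<sigma>: "U_descent_datum E \<gamma> I \<zeta> R \<sigma>"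
    "\<And>i j c r u v. i \<in> I \<Longrightarrow> j \<in> I \<Longrightarrow> inh c \<Longrightarrow> r \<in> el (A i) c \<Longrightarrow> u \<in> el (V i) c \<Longrightarrow> v \<in> el (V j) c \<Longrightarrow> sg \<sigma> i j c r u v = g i j c r u v"
  proof (rule U_descent_construct[OF g_el g_rs])
    fix i c r u assume i: "i \<in> I" and c: "inh c" and r: "r \<in> el (A i) c" and u: "u \<in> el (V i) c"
    note d = s_degenerate[OF c at_cc[OF i c u]]
    have "G i i c r u u r"
      using G_I(3)[OF i i c u u d(1,4,3), of r] d(2) \<gamma>_id[OF R[OF i]] ap_id[OF Ao[OF i] c r] by simp
    then show "g i i c r u u = r" using gG[OF i i c r u u] by blast
  next
    fix i j k c r u v w assume i: "i \<in> I" and j: "j \<in> I" and k: "k \<in> I" and c: "inh c" and r: "r \<in> el (A i) c"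
      and u: "u \<in> el (V i) c" and v: "v \<in> el (V j) c" and w: "w \<in> el (V k) c"
    note gij = g_el[OF i j c r u v]
    show "g j k c (g i j c r u v) v w = g i k c r u w"
    proof (rule sep[OF Ao[OF k] c g_el[OF j k c gij v w] g_el[OF i k c r u w]],
        rule loc_mono[OF loc_conj[OF c edge_exists[OF i j c u v] loc_conj[OF c edge_exists[OF j k c v w] edge_exists[OF i k c u w]]]])
      fix d h assume h: "h \<in> st d c" and
        "(\<exists>x l. at (Suc 0) d x l \<and> ap b1 d x = ap (cc i) d (rs (V i) h u) \<and> ap b0 d x = ap (cc j) d (rs (V j) h v)) \<and>
         (\<exists>x l. at (Suc 0) d x l \<and> ap b1 d x = ap (cc j) d (rs (V j) h v) \<and> ap b0 d x = ap (cc k) d (rs (V k) h w)) \<and>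
         (\<exists>x l. at (Suc 0) d x l \<and> ap b1 d x = ap (cc i) d (rs (V i) h u) \<and> ap b0 d x = ap (cc k) d (rs (V k) h w))"
      then obtain x l y t' z q where x: "at (Suc 0) d x l" "ap b1 d x = ap (cc i) d (rs (V i) h u)" "ap b0 d x = ap (cc j) d (rs (V j) h v)"
        and y: "at (Suc 0) d y t'" "ap b1 d y = ap (cc j) d (rs (V j) h v)" "ap b0 d y = ap (cc k) d (rs (V k) h w)"
        and z: "at (Suc 0) d z q" "ap b1 d z = ap (cc i) d (rs (V i) h u)" "ap b0 d z = ap (cc k) d (rs (V k) h w)" by blast
      note d = st_inh[OF h]
      define r' u' v' w' where "r' = rs (A i) h r" and "u' = rs (V i) h u" and "v' = rs (V j) h v" and "w' = rs (V k) h w"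
      have m: "r' \<in> el (A i) d" "u' \<in> el (V i) d" "v' \<in> el (V j) d" "w' \<in> el (V k) d"
        using rs_el[OF Ao[OF i] h r] rs_el[OF Vo[OF i] h u] rs_el[OF Vo[OF j] h v] rs_el[OF Vo[OF k] h w]
        by (simp_all add: r'_def u'_def v'_def w'_def)
      note x' = x[folded u'_def v'_def] and y' = y[folded v'_def w'_def] and z' = z[folded u'_def w'_def]
      \<comment> \<open>Edges over the three pairs of points share their vertices, so they form a
        triangle even though they were lifted independently.\<close>
      have comp: "s q = Comp SET (s t') (s l)" by (rule triangle[OF d x(1) y(1) z(1)]) (use x y z in auto)
      note Gx = G_I[OF i j d m(2,3) x'] and Gy = G_I[OF j k d m(3,4) y'] and Gz = G_I[OF i k d m(2,4) z']
      have lS: "l \<in> lev S (Suc 0)" "t' \<in> lev S (Suc 0)" using x(1) y(1) by (simp_all add: at_def)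
      have sl: "s l \<in> hom SET (R i) (R j)" using s_hom[OF sd lS(1)] Gx(1,2) by simp
      have st': "s t' \<in> hom SET (R j) (R k)" using s_hom[OF sd lS(2)] Gy(1,2) by simp
      have e1: "g i j d r' u' v' = ap (on_arr \<gamma> (s l)) d r'" by (rule gG[OF i j d m(1-3) Gx(3)])
      have e2: "g j k d (ap (on_arr \<gamma> (s l)) d r') v' w' = ap (on_arr \<gamma> (s t')) d (ap (on_arr \<gamma> (s l)) d r')"
        by (rule gG[OF j k d ap_el[OF \<gamma>_hom[OF sl] d m(1)] m(3,4) Gy(3)])
      have e3: "g i k d r' u' w' = ap (on_arr \<gamma> (s q)) d r'" by (rule gG[OF i k d m(1,2,4) Gz(3)])
      have "g j k d (g i j d r' u' v') v' w' = g i k d r' u' w'"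
        using e1 e2 e3 comp \<gamma>_comp[OF sl st'] ap_comp[OF \<gamma>_hom[OF sl] \<gamma>_hom[OF st'] d m(1)] by simp
      then show "rs (A k) h (g j k c (g i j c r u v) v w) = rs (A k) h (g i k c r u w)"
        using g_rs[OF j k h gij v w] g_rs[OF i j h r u v] g_rs[OF i k h r u w] by (simp add: r'_def u'_def v'_def w'_def)
    qed
  next
    fix \<tau> assume "U_descent_datum E \<gamma> I \<zeta> R \<tau>" and
      "\<And>i j c r u v. i \<in> I \<Longrightarrow> j \<in> I \<Longrightarrow> inh c \<Longrightarrow> r \<in> el (A i) c \<Longrightarrow> u \<in> el (V i) c \<Longrightarrow> v \<in> el (V j) c \<Longrightarrow> sg \<tau> i j c r u v = g i j c r u v"
    then show thesis by (rule that)
  qed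
  have "corresponding E \<gamma> I \<zeta> F R \<sigma> (induced s)"
    unfolding corresponding_iff[OF sd \<sigma>(1)]
  proof (intro ballI allI impI)
    fix l c r m assume l: "l \<in> lev S (Suc 0)" and c: "inh c" and r: "r \<in> el (A (src l)) c" and m: "m \<in> el (K1 l) c"
    note i = src_in[OF l] and j = trg_in[OF l] and u = ap_el[OF du(1)[OF l] c m] and v = ap_el[OF dv(1)[OF l] c m]
    have x: "at (Suc 0) c (ap (inc (Suc 0) l) c m) l"
      using ap_el[OF inc_hom[OF l] c m] l inc_kap[OF l c m] by (simp add: at_def)
    have "G (src l) (trg l) c r (ap (du l) c m) (ap (dv l) c m) (ap (on_arr \<gamma> (s l)) c r)"
      by (rule G_I(3)[OF i j c u v x du(2)[OF l c m, symmetric] dv(2)[OF l c m, symmetric]])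
    then show "ap (on_arr \<gamma> (s l)) c r = sg \<sigma> (src l) (trg l) c r (ap (du l) c m) (ap (dv l) c m)"
      using gG[OF i j c r u v] \<sigma>(2)[OF i j c r u v] by simp
  qed
  with \<sigma>(1) show ?thesis by (rule that)
qed

text \<open>The correspondence says that the datum acts over the component of \<open>l\<close> as
  the constant bijection \<open>s l\<close>. This is the equation of an action span whose apex is
  that component and whose legs are its two faces.\<close>

lemma component_span:
  assumes ud: "U_descent_datum E \<gamma> I \<zeta> R \<sigma>" and cor: "corresponding E \<gamma> I \<zeta> F R \<sigma> (induced s)"
    and l: "l \<in> lev S (Suc 0)"
  shows "is_action_span E \<gamma> I \<zeta> R \<sigma> (src l) (trg l) (K1 l) (du l) (dv l)"
  unfolding is_action_span_def
proof (intro conjI exI)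
  show "nonempty E (K1 l)" by (rule co_nonempty[OF l])
  note i = src_in[OF l] and j = trg_in[OF l] and Z = co_obj[OF l]
  show u: "du l \<in> hom E (K1 l) (V (src l))" and v: "dv l \<in> hom E (K1 l) (V (trg l))"
    by (rule du(1)[OF l], rule dv(1)[OF l])
  show "set_bijection (R (src l)) (R (trg l)) (s l)" by (rule s_bij[OF sd l])
  obtain c0 m0 where "inh c0" "m0 \<in> el (K1 l) c0" using co_nonempty[OF l] nonempty_iff by blast
  then have N: "[src l, trg l] \<in> ix NN (Suc 0)"
    using N1I[OF _ i j] ap_el[OF u] ap_el[OF v] by blast
  note gs = \<gamma>_hom[OF s_hom[OF sd l]]
  note ta = tup2[OF u v] and tb = tup2[OF v u]
  note p1 = arr_prod[OF E_id[OF Ao[OF i]] ta(1)] and p2 = arr_prod[OF E_id[OF Ao[OF j]] tb(1)]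
    and p3 = arr_prod[OF gs E_id[OF Z]]
  note \<sigma>h = \<sigma>_hom[OF ud N]
  show "\<sigma> [src l, trg l] \<bullet> arr_prod E (Id E (A (src l))) (tup E [du l, dv l]) =
       arr_prod E (Id E (A (trg l))) (tup E [dv l, du l]) \<bullet> arr_prod E (on_arr \<gamma> (s l)) (Id E (K1 l))"
  proof (rule ext_stage[OF E_comp[OF p1(1) \<sigma>h] E_comp[OF p3(1) p2(1)]])
    fix c z assume c: "inh c" and z: "z \<in> el (Prod E [A (src l), K1 l]) c"
    obtain r m where m: "r \<in> el (A (src l)) c" "m \<in> el (K1 l) c" "z = tp [A (src l), K1 l] c [r, m]"
      using tp2_cases[OF Ao[OF i] Z c z] .
    note ya = ap_el[OF u c m(2)] and yb = ap_el[OF v c m(2)]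
    have sge: "sg \<sigma> (src l) (trg l) c r (ap (du l) c m) (ap (dv l) c m) = ap (on_arr \<gamma> (s l)) c r"
      using cor[unfolded corresponding_iff[OF sd ud]] l c m by auto
    have "ap (\<sigma> [src l, trg l] \<bullet> arr_prod E (Id E (A (src l))) (tup E [du l, dv l])) c z =
      tq (trg l) (src l) c (ap (on_arr \<gamma> (s l)) c r) (ap (dv l) c m) (ap (du l) c m)"
      using ap_comp[OF p1(1) \<sigma>h c z] p1(2)[OF c m(1,2)] ap_id[OF Ao[OF i] c m(1)] ta(2)[OF c m(2)]
        ap_\<sigma>[OF ud i j c m(1) ya yb] m(3) sge by simp
    moreover have "ap (arr_prod E (Id E (A (trg l))) (tup E [dv l, du l]) \<bullet> arr_prod E (on_arr \<gamma> (s l)) (Id E (K1 l))) c z =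
      tq (trg l) (src l) c (ap (on_arr \<gamma> (s l)) c r) (ap (dv l) c m) (ap (du l) c m)"
      using ap_comp[OF p3(1) p2(1) c z] p3(2)[OF c m(1,2)] ap_id[OF Z c m(2)] p2(2)[OF c ap_el[OF gs c m(1)] m(2)]
        ap_id[OF Ao[OF j] c ap_el[OF gs c m(1)]] tb(2)[OF c m(2)] m(3) by simp
    ultimately show "ap (\<sigma> [src l, trg l] \<bullet> arr_prod E (Id E (A (src l))) (tup E [du l, dv l])) c z =
      ap (arr_prod E (Id E (A (trg l))) (tup E [dv l, du l]) \<bullet> arr_prod E (on_arr \<gamma> (s l)) (Id E (K1 l))) c z" by simp
  qed
qed

text \<open>Locally every pair of points is the pair of ends of an edge with constant index, that
  is, of a point of some component; by \<open>component_span\<close> that component is an action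
  span between the right objects.\<close>

lemma spans_epimorphic:
  assumes ud: "U_descent_datum E \<gamma> I \<zeta> R \<sigma>" and cor: "corresponding E \<gamma> I \<zeta> F R \<sigma> (induced s)"
    and ij: "i \<in> I" "j \<in> I"
  shows "epimorphic_family E (VV i j) {tup E [u, v] | Z u v. is_action_span E \<gamma> I \<zeta> R \<sigma> i j Z u v}"
proof (rule loc_epimorphic)
  fix f assume "f \<in> {tup E [u, v] | Z u v. is_action_span E \<gamma> I \<zeta> R \<sigma> i j Z u v}"
  then obtain Z u v where f: "f = tup E [u, v]" and sp: "is_action_span E \<gamma> I \<zeta> R \<sigma> i j Z u v" by blast
  have "tup E [u, v] \<in> hom E Z (VV i j)" using sp tup2(1) by (auto simp: is_action_span_def)
  then show "f \<in> hom E (Dom E f) (VV i j)" unfolding f by (simp add: in_hom)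
next
  fix c z assume c: "inh c" and z: "z \<in> el (VV i j) c"
  note o = Vo[OF ij(1)] Vo[OF ij(2)]
  obtain u v where uv: "u \<in> el (V i) c" "v \<in> el (V j) c" "z = tp [V i, V j] c [u, v]" using tp2_cases[OF o c z] .
  show "loc c (\<lambda>d h. \<exists>f\<in>{tup E [u, v] | Z u v. is_action_span E \<gamma> I \<zeta> R \<sigma> i j Z u v}. \<exists>y\<in>el (Dom E f) d. ap f d y = rs (VV i j) h z)"
  proof (rule loc_mono[OF edge_exists[OF ij c uv(1,2)]])
    fix d h assume h: "h \<in> st d c"
      and "\<exists>x l. at (Suc 0) d x l \<and> ap b1 d x = ap (cc i) d (rs (V i) h u) \<and> ap b0 d x = ap (cc j) d (rs (V j) h v)"
    then obtain x l where x: "at (Suc 0) d x l" "ap b1 d x = ap (cc i) d (rs (V i) h u)" "ap b0 d x = ap (cc j) d (rs (V j) h v)" by blast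
    note d = st_inh[OF h] and hu = rs_el[OF o(1) h uv(1)] and hv = rs_el[OF o(2) h uv(2)]
    have l: "l \<in> lev S (Suc 0)" using x(1) by (simp add: at_def)
    have st: "src l = i" "trg l = j" using G_I(1,2)[OF ij d hu hv x] by auto
    obtain m where m: "m \<in> el (K1 l) d" "ap (inc (Suc 0) l) d m = x"
      using inc_ex[OF l d] x(1) unfolding at_def by blast
    note U' = du(1)[OF l, unfolded st(1)] and V' = dv(1)[OF l, unfolded st(2)]
    have "ap (du l) d m = rs (V i) h u"
      by (rule cc_inj[OF ij(1) d ap_el[OF U' d m(1)] hu]) (use du(2)[OF l d m(1)] m(2) x(2) st in simp)
    moreover have "ap (dv l) d m = rs (V j) h v"
      by (rule cc_inj[OF ij(2) d ap_el[OF V' d m(1)] hv]) (use dv(2)[OF l d m(1)] m(2) x(3) st in simp)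
    ultimately have "ap (tup E [du l, dv l]) d m = rs (VV i j) h z"
      using tup2(2)[OF U' V' d m(1)] rs_tp2[OF o h uv(1,2)] uv(3) by simp
    moreover have "m \<in> el (Dom E (tup E [du l, dv l])) d" using tup2(1)[OF U' V'] m(1) by (simp add: in_hom)
    moreover have "is_action_span E \<gamma> I \<zeta> R \<sigma> i j (K1 l) (du l) (dv l)"
      using component_span[OF ud cor l] st by simp
    ultimately show "\<exists>f\<in>{tup E [u, v] | Z u v. is_action_span E \<gamma> I \<zeta> R \<sigma> i j Z u v}. \<exists>y\<in>el (Dom E f) d. ap f d y = rs (VV i j) h z"
      by blast
  qed
qed

end

end

section \<open>Assembling the two directions\<close>

lemma (in cover_data) refinement_exists:
  "\<exists>(F :: ('o, 'a, 'u) simplicial_family) s. hypercover_refinement E \<gamma> I U \<zeta> F \<and> is_self_dual E \<gamma> F \<and> condition_G E \<gamma> F \<and>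
     S_descent_datum E \<gamma> F R s \<and> consistent E \<gamma> F s \<and> H_descent_datum E \<gamma> F R (induced_datum E \<gamma> F s) \<and>
     corresponding E \<gamma> I \<zeta> F R \<sigma> (induced_datum E \<gamma> F s)"
proof -
  obtain \<pi>0 where \<pi>0: "subproduct (KK 0) XX (QQ 0) U \<pi>0" "\<pi>0 (Inl 0) = Id E U" using QQ_0 by blast
  \<comment> \<open>Each level is chosen up to isomorphism, except level 0, which is prescribed to
    be \<open>U\<close> with the identity as its vertex.\<close>
  have "\<exists>M \<pi>. subproduct (KK n) XX (QQ n) M \<pi> \<and> (n = 0 \<longrightarrow> M = U \<and> \<pi> (Inl 0) = Id E U)" for n
    using \<pi>0 QQ_exists[of n] by (cases "n = 0") auto
  then obtain M \<pi> where M: "\<And>n. subproduct (KK n) XX (QQ n) (M n) (\<pi> n) \<and> (n = 0 \<longrightarrow> M n = U \<and> \<pi> n (Inl 0) = Id E U)"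
    by metis
  interpret hyper ty E C J \<Phi> \<gamma> I U \<zeta> R \<sigma> tt ff M \<pi> by unfold_locales (use M in auto)
  show ?thesis
    by (intro exI[of _ FF] exI[of _ ss1] conjI FF_refinement FF_self_dual FF_condition_G FF_S_descent FF_consistent
        FF_corresponding SF.H_descent[OF FF_S_descent])
qed

theorem theorem7p7:
  fixes E :: "('o, 'a) category"
    and \<gamma> :: "('u set, 'u set_map, 'o, 'a) cfunctor"
    and I :: "'u set" and U :: 'o and \<zeta> :: 'a
  assumes "grothendieck_universe TYPE('u)"
    and "grothendieck_topos TYPE('u) E"
    and "inverse_image E \<gamma>"
    and "is_cover E \<gamma> I U \<zeta>"
  shows
    "(\<forall>R \<sigma> X \<theta>. covering_projection E \<gamma> I \<zeta> R \<sigma> X \<theta> \<longrightarrow>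
       (\<exists>F s.
          hypercover_refinement E \<gamma> I U \<zeta> F \<and> is_self_dual E \<gamma> F \<and> condition_G E \<gamma> F \<and>
          S_descent_datum E \<gamma> F R s \<and> consistent E \<gamma> F s \<and>
          H_descent_datum E \<gamma> F R (induced_datum E \<gamma> F s) \<and>
          corresponding E \<gamma> I \<zeta> F R \<sigma> (induced_datum E \<gamma> F s)))
     \<and>
     (\<forall>R F s.
        set_family I R \<and>
        hypercover_refinement E \<gamma> I U \<zeta> F \<and> is_self_dual E \<gamma> F \<and> condition_G E \<gamma> F \<and>
        S_descent_datum E \<gamma> F R s \<and> consistent E \<gamma> F s \<longrightarrow>
        H_descent_datum E \<gamma> F R (induced_datum E \<gamma> F s) \<and>
        (\<exists>\<sigma>. U_descent_datum E \<gamma> I \<zeta> R \<sigma> \<and>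
           corresponding E \<gamma> I \<zeta> F R \<sigma> (induced_datum E \<gamma> F s)) \<and>
        (\<forall>\<sigma>. U_descent_datum E \<gamma> I \<zeta> R \<sigma> \<and>
           corresponding E \<gamma> I \<zeta> F R \<sigma> (induced_datum E \<gamma> F s) \<longrightarrow>
           (\<exists>X \<theta>. locally_constant E \<gamma> I \<zeta> R \<sigma> X \<theta>) \<and>
           (\<forall>X \<theta>. locally_constant E \<gamma> I \<zeta> R \<sigma> X \<theta> \<longrightarrow>
              covering_projection E \<gamma> I \<zeta> R \<sigma> X \<theta>)))"
proof -
  obtain C :: "('u, 'u) category" and J where C: "is_category C" "small (Obj C)" "small (Arr C)" "grothendieck_topology C J"
    "equivalent E (sheaves C J)" using assms(2) unfolding grothendieck_topos_def by blast
  obtain \<Phi> :: "('o, 'a, 'u) sheaf_functor" where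
    \<Phi>: "is_functor E (sheaves C J) \<Phi>"
    "\<And>X Y. X \<in> Obj E \<Longrightarrow> Y \<in> Obj E \<Longrightarrow> bij_betw (on_arr \<Phi>) (hom E X Y) (hom (sheaves C J) (on_obj \<Phi> X) (on_obj \<Phi> Y))"
    "\<And>Z. Z \<in> Obj (sheaves C J) \<Longrightarrow> \<exists>X \<in> Obj E. \<exists>f \<in> hom (sheaves C J) (on_obj \<Phi> X) Z. is_iso (sheaves C J) f"
    using C(5) unfolding equivalent_def by blast
  interpret topos_over_Set "TYPE('u)" E C J \<Phi> \<gamma>
    by unfold_locales (rule assms C \<Phi>; assumption?)+
  have cf: "cech_fam E C J \<Phi> \<gamma> I U \<zeta> R" if "set_family I R" for R
    by unfold_locales (use assms(4) that in \<open>simp_all add: is_cover_def is_family_def set_family_def\<close>)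
  show ?thesis
  proof (intro conjI allI impI)
    fix R \<sigma> X \<theta> assume cp: "covering_projection E \<gamma> I \<zeta> R \<sigma> X \<theta>"
    then have lc: "locally_constant E \<gamma> I \<zeta> R \<sigma> X \<theta>" by (simp add: covering_projection_def)
    then have sf: "set_family I R" and ud: "U_descent_datum E \<gamma> I \<zeta> R \<sigma>" by (simp_all add: locally_constant_def trivialized_def)
    \<comment> \<open>The two values of the marks; the universe is infinite, so it has two different
      elements.\<close>
    obtain tt ff :: 'u where tf: "tt \<noteq> ff"
      using infinite_universe by (metis finite.emptyI finite_insert finite_subset insertI1 subsetI)
    interpret cech_fam "TYPE('u)" E C J \<Phi> \<gamma> I U \<zeta> R by (rule cf[OF sf])
    interpret cover_data "TYPE('u)" E C J \<Phi> \<gamma> I U \<zeta> R \<sigma> tt ff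
      by unfold_locales (use ud tf cp in \<open>auto simp: covering_projection_def\<close>)
    show "\<exists>F s. hypercover_refinement E \<gamma> I U \<zeta> F \<and> is_self_dual E \<gamma> F \<and> condition_G E \<gamma> F \<and>
          S_descent_datum E \<gamma> F R s \<and> consistent E \<gamma> F s \<and> H_descent_datum E \<gamma> F R (induced_datum E \<gamma> F s) \<and>
          corresponding E \<gamma> I \<zeta> F R \<sigma> (induced_datum E \<gamma> F s)"
      by (rule refinement_exists)
  next
    fix R F s assume a: "set_family I R \<and>
        hypercover_refinement E \<gamma> I U \<zeta> F \<and> is_self_dual E \<gamma> F \<and> condition_G E \<gamma> F \<and>
        S_descent_datum E \<gamma> F R s \<and> consistent E \<gamma> F s"
    then have sf: "set_family I R" and ref: "hypercover_refinement E \<gamma> I U \<zeta> F" and dual: "is_self_dual E \<gamma> F"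
      and sd: "S_descent_datum E \<gamma> F R s" by simp_all
    interpret cech_fam "TYPE('u)" E C J \<Phi> \<gamma> I U \<zeta> R by (rule cf[OF sf])
    interpret refinement "TYPE('u)" E C J \<Phi> \<gamma> F I U \<zeta> R
      by unfold_locales (use ref dual in \<open>simp_all add: hypercover_refinement_def\<close>)
    show "H_descent_datum E \<gamma> F R (induced_datum E \<gamma> F s)" by (rule H_descent[OF sd])
    show "\<exists>\<sigma>. U_descent_datum E \<gamma> I \<zeta> R \<sigma> \<and> corresponding E \<gamma> I \<zeta> F R \<sigma> (induced_datum E \<gamma> F s)"
      using U_descent_exists[OF sd] by blast
    fix \<sigma> assume \<sigma>: "U_descent_datum E \<gamma> I \<zeta> R \<sigma> \<and> corresponding E \<gamma> I \<zeta> F R \<sigma> (induced_datum E \<gamma> F s)"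
    then show "\<exists>X \<theta>. locally_constant E \<gamma> I \<zeta> R \<sigma> X \<theta>" using locally_constant_exists by blast
    fix X \<theta> assume lc: "locally_constant E \<gamma> I \<zeta> R \<sigma> X \<theta>"
    show "covering_projection E \<gamma> I \<zeta> R \<sigma> X \<theta>" unfolding covering_projection_def
    proof (intro conjI lc allI impI)
      fix i j assume "[i, j] \<in> ix (cech E \<gamma> I \<zeta>) 1"
      then have "i \<in> I" "j \<in> I" by (simp_all add: cech_def Let_def)
      then show "epimorphic_family E (Prod E [component E \<gamma> I \<zeta> i, component E \<gamma> I \<zeta> j])
          {tup E [u, v] | V u v. is_action_span E \<gamma> I \<zeta> R \<sigma> i j V u v}"
        using spans_epimorphic[OF sd] \<sigma> by blast
    qed
  qed
qed

end
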